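(* Let $a\in C^\infty(\mathbb S)$ be a positive function satisfying $\frac1{2\pi}\int_0^{2\pi}a(\theta)^{-1}\,d\theta=1$. Then $\zeta_a(s)-2\zeta_R(s)\ge0$ for every real $s$. Moreover, equality $\zeta_a(s)-2\zeta_R(s)=0$ holds for some real $s\neq0$ if and only if $a$ is conformally equivalent to the constant function $\mathbf 1$.
   Context: $\mathbb S=\{e^{i\theta}\}$ is the unit circle; functions on $\mathbb S$ are identified with $2\pi$-periodic functions of $\theta$ and with the corresponding multiplication operators. $\Lambda$ is the operator on $C^\infty(\mathbb S)$ with $\Lambda e^{in\theta}=|n|e^{in\theta}$ ($n\in\mathbb Z$). For positive $a\in C^\infty(\mathbb S)$, $\Lambda_a=a^{1/2}\Lambda a^{1/2}$; it is nonnegative self-adjoint on $L^2(\mathbb S)$ with discrete spectrum $0=\lambda_0(a)<\lambda_1(a)\le\lambda_2(a)\le\dots$ (with multiplicity), the Steklov spectrum of $a$. For $a$ satisfying $\int_0^{2\pi}a^{-1}d\theta=2\pi$, $\zeta_a(s)=\sum_{k\ge1}\lambda_k(a)^{-s}$ converges for $\Re s>1$, extends meromorphically to $\mathbb C$ with a unique simple pole at $s=1$, and $\zeta_a-2\zeta_R$ is entire ($\zeta_R$ the Riemann zeta function); at $s=1$, $\zeta_a(s)-2\zeta_R(s)$ means the value of this entire function. Two functions $a,b\in C^\infty(\mathbb S)$ are conformally equivalent if there is a conformal or anticonformal automorphism $\Psi$ of the closed unit disk such that $b=|d\psi/d\theta|^{-1}\,a\circ\psi$, where $e^{i\psi(\theta)}=\Psi(e^{i\theta})$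 ($\Psi$ anticonformal means $\bar\Psi$ conformal). *)

theory Defs
  imports "HOL-Analysis.Analysis" "HOL-Library.Function_Algebras"
begin

text \<open>Functions on the unit circle are identified with 2pi-periodic functions of theta.\<close>

definition periodic2pi :: "(real \<Rightarrow> 'b) \<Rightarrow> bool" where
  "periodic2pi f \<longleftrightarrow> (\<forall>\<theta>. f (\<theta> + 2 * pi) = f \<theta>)"

definition smooth_fun :: "(real \<Rightarrow> 'b::real_normed_vector) \<Rightarrow> bool" where
  "smooth_fun f \<longleftrightarrow> (\<exists>D :: nat \<Rightarrow> real \<Rightarrow> 'b. D 0 = f \<and>
      (\<forall>n x. (D n has_vector_derivative D (Suc n) x) (at x)))"

definition smooth_circle :: "(real \<Rightarrow> 'b::real_normed_vector) \<Rightarrow> bool" where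
  "smooth_circle f \<longleftrightarrow> smooth_fun f \<and> periodic2pi f"

definition fourier_coeff :: "(real \<Rightarrow> complex) \<Rightarrow> int \<Rightarrow> complex" where
  "fourier_coeff u n = integral {0..2*pi} (\<lambda>\<theta>. u \<theta> * exp (- \<i> * of_int n * of_real \<theta>)) / (2 * pi)"

definition Lambda_op :: "(real \<Rightarrow> complex) \<Rightarrow> real \<Rightarrow> complex" where
  "Lambda_op u \<theta> = (\<Sum>\<^sub>\<infinity>n\<in>(UNIV::int set). of_int \<bar>n\<bar> * fourier_coeff u n * exp (\<i> * of_int n * of_real \<theta>))"

definition Lambda_a :: "(real \<Rightarrow> real) \<Rightarrow> (real \<Rightarrow> complex) \<Rightarrow> real \<Rightarrow> complex" where
  "Lambda_a a u \<theta> = of_real (sqrt (a \<theta>)) * Lambda_op (\<lambda>t. of_real (sqrt (a t)) * u t) \<theta>"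

text \<open>Eigenspace of Lambda_a for the eigenvalue lam (smooth eigenfunctions, by elliptic regularity).\<close>
definition steklov_eigenspace :: "(real \<Rightarrow> real) \<Rightarrow> real \<Rightarrow> (real \<Rightarrow> complex) set" where
  "steklov_eigenspace a lam =
     {u. smooth_circle u \<and> (\<forall>\<theta>. Lambda_a a u \<theta> = of_real lam * u \<theta>)}"

definition steklov_mult :: "(real \<Rightarrow> real) \<Rightarrow> real \<Rightarrow> nat" where
  "steklov_mult a lam =
     vector_space.dim (\<lambda>(c::complex) (f::real \<Rightarrow> complex). (\<lambda>x. c * f x)) (steklov_eigenspace a lam)"

definition steklov_pos_eigs :: "(real \<Rightarrow> real) \<Rightarrow> real set" where
  "steklov_pos_eigs a = {lam. lam > 0 \<and> (\<exists>u\<in>steklov_eigenspace a lam. u \<noteq> (\<lambda>_. 0))}"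

definition zeta_a_series :: "(real \<Rightarrow> real) \<Rightarrow> complex \<Rightarrow> complex" where
  "zeta_a_series a s = (\<Sum>\<^sub>\<infinity>lam\<in>steklov_pos_eigs a. of_nat (steklov_mult a lam) * (of_real lam) powr (- s))"

definition zeta_R_series :: "complex \<Rightarrow> complex" where
  "zeta_R_series s = (\<Sum>\<^sub>\<infinity>n\<in>{1::nat..}. (of_nat n) powr (- s))"

definition zeta_diff :: "(real \<Rightarrow> real) \<Rightarrow> complex \<Rightarrow> complex" where
  "zeta_diff a = (THE f. f holomorphic_on UNIV \<and>
      (\<forall>s. Re s > 1 \<longrightarrow> f s = zeta_a_series a s - 2 * zeta_R_series s))"

definition conformal_aut_disk :: "(complex \<Rightarrow> complex) \<Rightarrow> bool" where
  "conformal_aut_disk \<Psi> \<longleftrightarrow> \<Psi> ` cball 0 1 = cball 0 1 \<and> inj_on \<Psi> (cball 0 1) \<and>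
      continuous_on (cball 0 1) \<Psi> \<and> \<Psi> holomorphic_on ball 0 1"

definition conf_equiv :: "(real \<Rightarrow> real) \<Rightarrow> (real \<Rightarrow> real) \<Rightarrow> bool" where
  "conf_equiv a b \<longleftrightarrow> (\<exists>\<Psi> \<psi> \<psi>'.
      (conformal_aut_disk \<Psi> \<or> conformal_aut_disk (cnj \<circ> \<Psi>)) \<and>
      (\<forall>\<theta>. exp (\<i> * of_real (\<psi> \<theta>)) = \<Psi> (exp (\<i> * of_real \<theta>))) \<and>
      (\<forall>\<theta>. (\<psi> has_real_derivative \<psi>' \<theta>) (at \<theta>)) \<and>
      (\<forall>\<theta>. b \<theta> = a (\<psi> \<theta>) / \<bar>\<psi>' \<theta>\<bar>))"

end

theory Submission
  imports Defs "HOL-Complex_Analysis.Complex_Analysis" "HOL-Real_Asymp.Real_Asymp" "Jordan_Normal_Form.Determinant"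
begin

text \<open>In the arc-length parameter \<open>\<phi>\<close> of the weight, \<open>d\<phi> = a\<inverse> d\<theta>\<close>, the operator \<open>a \<Lambda>\<close>, which has
  the spectrum of \<open>\<Lambda>\<^sub>a\<close>, is the Hilbert transform \<open>H\<close> of the circle followed by \<open>d/d\<phi>\<close>. Its matrix \<open>A\<close> in
  the basis of cosines and sines of \<open>\<phi>\<close> differs from the diagonal matrix \<open>D\<close> with entries 1, 1, 2, 2, ...
  by a rapidly decreasing matrix, and the relation \<open>H\<^sup>2 = -1\<close> becomes a symplectic symmetry: up to a signed
  permutation, the inverse of \<open>A\<close> is \<open>D\<inverse> A D\<inverse>\<close>. Comparing a section of the inverse with the inverse of the
  section shows that the even sections of \<open>A\<close> have at least the determinant of those of \<open>D\<close>; by the symmetry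
  again and interlacing, the product of the first \<open>2M\<close> eigenvalues \<open>\<lambda>\<^sub>k\<close> is at most that of the first \<open>2M\<close>
  entries \<open>d\<^sub>k\<close> of \<open>D\<close>, with equality in the limit. Since \<open>\<lambda>\<^sub>k - d\<^sub>k\<close> decreases rapidly, the difference of
  the zeta functions is a series of entire functions; with \<open>x\<^sub>k = ln (\<lambda>\<^sub>k / d\<^sub>k)\<close>, convexity of the exponential
  bounds it below by the sum of \<open>- s x\<^sub>k d\<^sub>k powr (-s)\<close>, which is nonnegative by summation by parts.

  If the difference vanishes at some \<open>s \<noteq> 0\<close>, then \<open>\<lambda>\<^sub>k = d\<^sub>k\<close> for all \<open>k\<close>. The resulting equality in the
  Dirichlet energy of \<open>exp (\<i>\<phi>)\<close>, as a function of \<open>\<theta>\<close>, rules out negative frequencies, so this function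
  extends holomorphically to the disk. A Moebius transformation makes the extension vanish at the origin;
  comparing its energy with its mean square then leaves the single frequency 1, so that \<open>exp (\<i>\<phi>)\<close> is a
  Moebius transform of \<open>exp (\<i>\<theta>)\<close>.\<close>
section \<open>Compact positive operators\<close>

text \<open>The decrease of A - D has one source: \<Lambda> agrees with -i d/d\<theta> on
  nonnegative frequencies, so its error on exp (i n \<phi>) comes from the negative
  \<theta>-frequencies of that function. Their coefficients are integrals with phase n \<phi> + m
  \<theta>, n, m > 0, and such a phase has no stationary point. A is unbounded; the spectral theory
  is that of its Hilbert--Schmidt inverse T, which the symmetry provides explicitly, and A itself
  enters as a relation. In the determinant step, with P and \<Delta> the determinants of an even
  section of A and of D, the symmetry gives P / \<Delta>^2 for the section of T, while the inverse
  of the section of A has 1 / P; domination then reads 1 / P \<le> P / \<Delta>^2. The length must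
  be even because the symmetry exchanges cosine and sine of each frequency. The equality in the
  limit is what makes negative s accessible: there the weights in the summation by parts grow, and
  the boundary term is harmless only because the logarithms x_k have sum 0.\<close>

definition compact_psd :: "('a::real_inner \<Rightarrow> 'a) \<Rightarrow> bool" where
  "compact_psd T \<longleftrightarrow> bounded_linear T \<and> (\<forall>x y. inner (T x) y = inner x (T y)) \<and> (\<forall>x. 0 \<le> inner (T x) x) \<and>
     (\<forall>X::nat \<Rightarrow> 'a. (\<forall>n. norm (X n) \<le> 1) \<longrightarrow> (\<exists>l r. strict_mono r \<and> (\<lambda>n. T (X (r n))) \<longlonglongrightarrow> l))"

text \<open>The form of x + t y is a nonnegative quadratic polynomial in t, so its discriminant is
  not positive.\<close>

lemma psd_Cauchy_Schwarz:
  fixes T :: "'a::real_inner \<Rightarrow> 'a"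
  assumes "linear T" "\<And>x y. inner (T x) y = inner x (T y)" "\<And>x. 0 \<le> inner (T x) x"
  shows "(inner (T x) y)\<^sup>2 \<le> inner (T x) x * inner (T y) y"
proof -
  have quad: "0 \<le> inner (T x) x + 2 * t * inner (T x) y + t\<^sup>2 * inner (T y) y" for t
  proof -
    have "inner (T (x + t *\<^sub>R y)) (x + t *\<^sub>R y) = inner (T x) x + 2 * t * inner (T x) y + t\<^sup>2 * inner (T y) y"
      using assms(2)[of y x]
      by (simp add: linear_add[OF assms(1)] linear_scale[OF assms(1)] inner_add algebra_simps
          inner_commute power2_eq_square)
    then show ?thesis using assms(3)[of "x + t *\<^sub>R y"] by simp
  qed
  show ?thesis
  proof (cases "inner (T y) y = 0")
    case True
    have "inner (T x) y = 0"
    proof (rule ccontr)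
      assume ne: "inner (T x) y \<noteq> 0"
      \<comment> \<open>This value of t makes the polynomial equal to -1.\<close>
      show False
        using quad[of "- (inner (T x) x + 1) / (2 * inner (T x) y)"] ne True by (simp add: field_simps)
    qed
    then show ?thesis using True by simp
  next
    case False
    then have p: "inner (T y) y > 0" using assms(3)[of y] by linarith
    show ?thesis
      using quad[of "- inner (T x) y / inner (T y) y"] p
      by (simp add: field_simps power2_eq_square)
  qed
qed

text \<open>The supremum s of the Rayleigh quotient on S is attained: a maximizing sequence consists
  of approximate eigenvectors, and compactness extracts a limit.\<close>

lemma compact_psd_maximizer:
  fixes T :: "'a::real_inner \<Rightarrow> 'a"
  assumes T: "compact_psd T" and S: "subspace S" "closed S" "\<And>x. x \<in> S \<Longrightarrow> T x \<in> S"
    and ne: "\<exists>x\<in>S. x \<noteq> 0"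
  shows "\<exists>x\<in>S. norm x = 1 \<and> T x = inner (T x) x *\<^sub>R x \<and> (\<forall>y\<in>S. inner (T y) y \<le> inner (T x) x * inner y y)"
proof -
  have bl: "bounded_linear T" and sa: "\<And>x y. inner (T x) y = inner x (T y)"
    and pos: "\<And>x. 0 \<le> inner (T x) x"
    and cpt: "\<And>X. (\<And>n::nat. norm (X n) \<le> 1) \<Longrightarrow> \<exists>l r. strict_mono r \<and> (\<lambda>n. T (X (r n))) \<longlonglongrightarrow> l"
    using T unfolding compact_psd_def by blast+
  have lin: "linear T" using bl bounded_linear.linear by blast
  obtain K where K: "\<And>x. norm (T x) \<le> norm x * K" using bounded_linear.bounded[OF bl] by blast
  define V where "V = {inner (T y) y |y. y \<in> S \<and> norm y = 1}"
  have Vne: "V \<noteq> {}"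
  proof -
    obtain x where x: "x \<in> S" "x \<noteq> 0" using ne by blast
    have "(1 / norm x) *\<^sub>R x \<in> S" "norm ((1 / norm x) *\<^sub>R x) = 1"
      using x S(1) by (auto simp: subspace_def)
    then show ?thesis unfolding V_def by blast
  qed
  have Vb: "bdd_above V"
  proof (rule bdd_aboveI[of _ K])
    fix v assume "v \<in> V"
    then obtain y where y: "norm y = 1" "v = inner (T y) y" unfolding V_def by blast
    have "v \<le> norm (T y) * norm y" using y norm_cauchy_schwarz by blast
    then show "v \<le> K" using y K[of y] by simp
  qed
  define s where "s = Sup V"
  have s_ub: "inner (T y) y \<le> s * inner y y" if "y \<in> S" for y
  proof (cases "y = 0")
    case True then show ?thesis by (simp add: linear_0[OF lin])
  next
    case False
    define z where "z = (1 / norm y) *\<^sub>R y"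
    have "z \<in> S" "norm z = 1" using False that S(1) by (auto simp: z_def subspace_def)
    then have "inner (T z) z \<le> s" unfolding s_def by (intro cSup_upper[OF _ Vb]) (auto simp: V_def)
    moreover have "inner (T z) z = inner (T y) y / (norm y)\<^sup>2"
      by (simp add: z_def linear_scale[OF lin] power2_eq_square)
    ultimately show ?thesis using False by (simp add: field_simps dot_square_norm)
  qed
  obtain v0 where "v0 \<in> V" using Vne by blast
  then have "0 \<le> v0" "v0 \<le> s" using cSup_upper[OF _ Vb, of v0] pos by (auto simp: s_def V_def)
  then have s0: "0 \<le> s" by simp
  \<comment> \<open>Cauchy--Schwarz for the form of T, applied to y and T y. It turns a nearly
    maximal quotient into a nearly vanishing T y - s y.\<close>
  have T2: "(norm (T y))\<^sup>2 \<le> s * inner (T y) y" if y: "y \<in> S" for y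
  proof -
    have "((norm (T y))\<^sup>2)\<^sup>2 \<le> inner (T y) y * inner (T (T y)) (T y)"
      using psd_Cauchy_Schwarz[OF lin sa pos, of y "T y"] by (simp add: dot_square_norm)
    also have "\<dots> \<le> inner (T y) y * (s * (norm (T y))\<^sup>2)"
      using s_ub[OF S(3)[OF y]] pos[of y] by (intro mult_left_mono) (auto simp: dot_square_norm)
    finally have *: "(norm (T y))\<^sup>2 * (norm (T y))\<^sup>2 \<le> (s * inner (T y) y) * (norm (T y))\<^sup>2"
      by (simp add: power2_eq_square algebra_simps)
    show ?thesis
    proof (cases "T y = 0")
      case True then show ?thesis using s0 pos[of y] by simp
    next
      case False
      then have "(norm (T y))\<^sup>2 > 0" by simp
      then show ?thesis using * by (rule mult_right_le_imp_le[rotated])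
    qed
  qed
  have "\<exists>x\<in>S. norm x = 1 \<and> T x = s *\<^sub>R x"
  \<comment> \<open>For s = 0, T vanishes on S by \<open>T2\<close>. For s > 0 the limit of the
    vectors is recovered from that of their images by dividing by s.\<close>
  proof (cases "s = 0")
    case True
    obtain y where y: "y \<in> S" "norm y = 1" using Vne unfolding V_def by blast
    then have "T y = 0" using T2[OF y(1)] True by simp
    then show ?thesis using y True by auto
  next
    case False
    then have sp: "s > 0" using s0 by simp
    have "\<exists>y\<in>S. norm y = 1 \<and> s - 1 / Suc n < inner (T y) y" for n
    proof -
      have "\<exists>v\<in>V. s - 1 / Suc n < v" by (subst less_cSup_iff[OF Vne Vb, symmetric]) (simp add: s_def)
      then show ?thesis by (auto simp: V_def)
    qed
    then obtain X where X: "\<And>n. X n \<in> S" "\<And>n. norm (X n) = 1" "\<And>n. s - 1 / Suc n < inner (T (X n)) (X n)"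
      by metis
    obtain l r where r: "strict_mono r" "(\<lambda>n. T (X (r n))) \<longlonglongrightarrow> l" using cpt[of X] X(2) by auto
    have diff: "(norm (T (X n) - s *\<^sub>R X n))\<^sup>2 \<le> s * (1 / Suc n)" for n
    proof -
      have "(norm (T (X n) - s *\<^sub>R X n))\<^sup>2 = (norm (T (X n)))\<^sup>2 - 2 * s * inner (T (X n)) (X n) + s\<^sup>2"
      proof -
        have "inner (X n) (X n) = 1" using X(2)[of n] by (simp add: norm_eq_1)
        then show ?thesis
          unfolding power2_norm_eq_inner
          by (simp add: inner_diff_left inner_diff_right inner_commute[of "X n" "T (X n)"] power2_eq_square algebra_simps)
      qed
      also have "\<dots> \<le> s * (s - inner (T (X n)) (X n))"
        using T2[OF X(1), of n] by (simp add: algebra_simps power2_eq_square)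
      also have "\<dots> \<le> s * (1 / Suc n)" using X(3)[of n] sp by (intro mult_left_mono) auto
      finally show ?thesis .
    qed
    have lim: "(\<lambda>n. s * (1 / real (Suc n))) \<longlonglongrightarrow> 0"
      using tendsto_mult_right_zero[OF LIMSEQ_Suc[OF lim_1_over_n], of s] by simp
    have "(\<lambda>n. (norm (T (X n) - s *\<^sub>R X n))\<^sup>2) \<longlonglongrightarrow> 0"
      by (rule Lim_null_comparison[OF always_eventually lim]) (use diff in simp)
    from tendsto_real_sqrt[OF this] have "(\<lambda>n. T (X n) - s *\<^sub>R X n) \<longlonglongrightarrow> 0"
      by (simp add: tendsto_norm_zero_iff)
    then have "(\<lambda>n. T (X (r n)) - s *\<^sub>R X (r n)) \<longlonglongrightarrow> 0"
      using LIMSEQ_subseq_LIMSEQ[OF _ r(1)] by (auto simp: o_def)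
    then have "(\<lambda>n. (1/s) *\<^sub>R (T (X (r n)) - (T (X (r n)) - s *\<^sub>R X (r n)))) \<longlonglongrightarrow> (1/s) *\<^sub>R (l - 0)"
      by (intro tendsto_intros r(2))
    then have Xl: "(\<lambda>n. X (r n)) \<longlonglongrightarrow> (1/s) *\<^sub>R l" using sp by simp
    define x where "x = (1/s) *\<^sub>R l"
    have "(\<lambda>n. T (X (r n))) \<longlonglongrightarrow> T x" unfolding x_def using bounded_linear.tendsto[OF bl Xl] .
    then have "T x = l" using r(2) LIMSEQ_unique by blast
    then have "T x = s *\<^sub>R x" using sp by (simp add: x_def)
    moreover have "norm x = 1" using tendsto_norm[OF Xl] X(2) LIMSEQ_unique[OF tendsto_const] unfolding x_def by fastforce
    moreover have "x \<in> S" using closed_sequentially[OF S(2), of "\<lambda>n. X (r n)"] X(1) Xl by (auto simp: x_def)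
    ultimately show ?thesis by blast
  qed
  then obtain x where x: "x \<in> S" "norm x = 1" "T x = s *\<^sub>R x" by blast
  then have "inner (T x) x = s" by (simp add: norm_eq_1)
  then show ?thesis using x s_ub by auto
qed

text \<open>Each \<open>w n\<close> maximizes the quotient on the orthogonal complement of its
  predecessors, which T maps to itself; \<open>inf\<close> keeps that complement nonzero. The
  maximum property in the last conclusion is what the min-max arguments use.\<close>

lemma compact_psd_spectral:
  fixes T :: "'a::real_inner \<Rightarrow> 'a"
  assumes T: "compact_psd T" and inf: "\<And>(f::nat \<Rightarrow> 'a) n. \<exists>x. x \<noteq> 0 \<and> (\<forall>i<n. inner x (f i) = 0)"
  obtains w t where "\<And>i j. inner (w i) (w j) = (if i = j then 1 else 0)"
    and "\<And>i::nat. T (w i) = t i *\<^sub>R w i" and "\<And>i. 0 \<le> t i" and "antimono t"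
    and "\<And>n y. \<forall>i<n. inner y (w i) = 0 \<Longrightarrow> inner (T y) y \<le> t n * inner y y"
proof -
  have bl: "bounded_linear T" and sa: "\<And>x y. inner (T x) y = inner x (T y)"
    and pos: "\<And>x. 0 \<le> inner (T x) x"
    using T unfolding compact_psd_def by blast+
  \<comment> \<open>P depends on f only below n, as well-founded dependent choice requires.\<close>
  define P where "P f n r \<longleftrightarrow> norm r = 1 \<and> (\<forall>i<n. inner r (f i) = 0) \<and> T r = inner (T r) r *\<^sub>R r \<and>
     (\<forall>y. (\<forall>i<n. inner y (f i) = 0) \<longrightarrow> inner (T y) y \<le> inner (T r) r * inner y y)"
    for f :: "nat \<Rightarrow> 'a" and n r
  have "\<exists>f. \<forall>n. P f n (f n)"
  proof (rule dependent_wf_choice[of "{(x, y). x < y}"])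
    show "wf {(x::nat, y). x < y}" by (rule wf_less)
    show "P f x r = P g x r" if "\<And>z. (z, x) \<in> {(x::nat, y). x < y} \<Longrightarrow> f z = g z" for f g x r
      using that unfolding P_def by auto
    fix n f assume H: "\<And>y. (y, n) \<in> {(x::nat, y). x < y} \<Longrightarrow> P f y (f y)"
    define S where "S = {x. \<forall>i<n. inner x (f i) = 0}"
    have "S = (\<Inter>i\<in>{..<n}. {x. inner x (f i) = 0})" by (auto simp: S_def)
    moreover have "closed {x. inner x (f i) = 0}" for i
      by (intro closed_Collect_eq continuous_intros)
    ultimately have "closed S" by auto
    moreover have "subspace S" by (auto simp: S_def subspace_def inner_add)
    moreover have "T x \<in> S" if "x \<in> S" for x
    proof -
      have "inner (T x) (f i) = 0" if i: "i < n" for i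
      proof -
        obtain k where k: "T (f i) = k *\<^sub>R f i" using H[of i] i unfolding P_def by blast
        have "inner (T x) (f i) = k * inner x (f i)" unfolding sa k by simp
        then show ?thesis using \<open>x \<in> S\<close> i by (auto simp: S_def)
      qed
      then show ?thesis by (simp add: S_def)
    qed
    moreover have "\<exists>x\<in>S. x \<noteq> 0" using inf[of n f] by (auto simp: S_def)
    ultimately obtain x where "x \<in> S" "norm x = 1" "T x = inner (T x) x *\<^sub>R x"
      "\<forall>y\<in>S. inner (T y) y \<le> inner (T x) x * inner y y"
      using compact_psd_maximizer[OF T] by blast
    then show "\<exists>r. P f n r" unfolding P_def S_def by blast
  qed
  then obtain w where w: "\<And>n. P w n (w n)" by blast
  define t where "t n = inner (T (w n)) (w n)" for n
  have n1: "inner (w i) (w i) = 1" for i using w[of i] by (simp add: P_def norm_eq_1)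
  have o: "inner (w i) (w j) = 0" if "j < i" for i j using w[of i] that by (simp add: P_def)
  show thesis
  proof
    show "inner (w i) (w j) = (if i = j then 1 else 0)" for i j
      using n1 o[of i j] o[of j i] by (cases i j rule: linorder_cases) (auto simp: inner_commute)
    show "T (w i) = t i *\<^sub>R w i" for i using w[of i] by (simp add: P_def t_def)
    show "0 \<le> t i" for i by (simp add: t_def pos)
    show max: "inner (T y) y \<le> t n * inner y y" if "\<forall>i<n. inner y (w i) = 0" for n y
      using w[of n] that by (simp add: P_def t_def)
    show "antimono t"
    proof (rule antimonoI)
      fix m n :: nat assume "m \<le> n"
      then have "\<forall>i<m. inner (w n) (w i) = 0" using o by simp
      from max[OF this] show "t n \<le> t m" by (simp add: t_def n1)
    qed
  qed
qed

text \<open>Elimination for n equations in n + 1 unknowns; it is behind every dimension count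
  below.\<close>

lemma homogeneous_system_nontrivial:
  fixes M :: "nat \<Rightarrow> nat \<Rightarrow> real"
  shows "\<exists>c. (\<exists>i\<le>n. c i \<noteq> 0) \<and> (\<forall>j<n. (\<Sum>i\<le>n. c i * M j i) = 0)"
proof (induction n arbitrary: M)
  case 0
  then show ?case by (intro exI[of _ "\<lambda>_. 1"]) auto
next
  case (Suc n)
  show ?case
  proof (cases "\<forall>i\<le>Suc n. M n i = 0")
    case True
    obtain c where c: "\<exists>i\<le>n. c i \<noteq> 0" "\<forall>j<n. (\<Sum>i\<le>n. c i * M j i) = 0" using Suc.IH by blast
    let ?c = "c(Suc n := 0)"
    have "(\<Sum>i\<le>Suc n. ?c i * M j i) = 0" if "j < Suc n" for j
    proof (cases "j = n")
      case True
      then show ?thesis using \<open>\<forall>i\<le>Suc n. M n i = 0\<close> by (intro sum.neutral) auto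
    next
      case False
      then have "j < n" using that by simp
      have "(\<Sum>i\<le>n. ?c i * M j i) = (\<Sum>i\<le>n. c i * M j i)" by (intro sum.cong) auto
      then show ?thesis using c(2) \<open>j < n\<close> by simp
    qed
    moreover have "\<exists>i\<le>Suc n. ?c i \<noteq> 0" using c(1) by (metis fun_upd_apply le_SucI not_less_eq_eq)
    ultimately show ?thesis by blast
  next
    case False
    then obtain p where p: "p \<le> Suc n" "M n p \<noteq> 0" by blast
    \<comment> \<open>solve the last equation for the unknown p; the other unknowns are enumerated by q'\<close>
    define q' where "q' i = (if i < p then i else Suc i)" for i
    define M' where "M' j i = M j (q' i) - M j p * M n (q' i) / M n p" for j i
    obtain c where c: "\<exists>i\<le>n. c i \<noteq> 0" "\<forall>j<n. (\<Sum>i\<le>n. c i * M' j i) = 0" using Suc.IH by blast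
    have bij: "bij_betw q' {..n} ({..Suc n} - {p})"
      using p(1) by (intro bij_betwI[of _ _ _ "\<lambda>i. if i < p then i else i - 1"]) (auto simp: q'_def split: if_splits)
    define g where "g i = (if i < p then i else i - 1)" for i
    have gq: "g (q' i) = i" for i by (auto simp: g_def q'_def)
    define e where "e i = (if i = p then - (\<Sum>i\<le>n. c i * M n (q' i)) / M n p else c (g i))" for i
    have qp: "q' i \<noteq> p" for i by (auto simp: q'_def)
    have sume: "(\<Sum>i\<le>Suc n. e i * M j i) = (\<Sum>i\<le>n. c i * M' j i)" for j
    proof -
      have "(\<Sum>i\<le>Suc n. e i * M j i) = e p * M j p + (\<Sum>i\<in>{..Suc n} - {p}. e i * M j i)"
        using p(1) by (subst sum.remove[of _ p]) auto
      also have "(\<Sum>i\<in>{..Suc n} - {p}. e i * M j i) = (\<Sum>i\<le>n. e (q' i) * M j (q' i))"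
        using sum.reindex_bij_betw[OF bij, of "\<lambda>i. e i * M j i"] by simp
      also have "\<dots> = (\<Sum>i\<le>n. c i * M j (q' i))" by (simp add: e_def gq qp)
      also have "e p * M j p + \<dots> = (\<Sum>i\<le>n. c i * M' j i)"
        by (simp add: e_def M'_def right_diff_distrib sum_subtractf sum_distrib_left sum_divide_distrib
            sum_distrib_right algebra_simps)
      finally show ?thesis .
    qed
    have "(\<Sum>i\<le>Suc n. e i * M j i) = 0" if "j < Suc n" for j
    proof (cases "j = n")
      case True
      then show ?thesis using p(2) by (simp only: sume) (simp add: M'_def)
    next
      case False
      then show ?thesis using that c(2) sume by simp
    qed
    moreover obtain i where i: "i \<le> n" "c i \<noteq> 0" using c(1) by blast
    then have "e (q' i) \<noteq> 0" "q' i \<le> Suc n" using gq[of i] qp[of i] by (auto simp: e_def) (auto simp: q'_def)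
    ultimately show ?thesis by blast
  qed
qed

section \<open>Square-summable sequences and Hilbert--Schmidt matrices\<close>

lemma summable_mult_of_squares:
  fixes f g :: "nat \<Rightarrow> real"
  assumes "summable (\<lambda>n. (f n)\<^sup>2)" "summable (\<lambda>n. (g n)\<^sup>2)"
  shows "summable (\<lambda>n. \<bar>f n * g n\<bar>)" "summable (\<lambda>n. f n * g n)"
proof -
  have "\<bar>x * y\<bar> \<le> x\<^sup>2 + y\<^sup>2" for x y :: real
  proof -
    have "0 \<le> (\<bar>x\<bar> - \<bar>y\<bar>)\<^sup>2" by simp
    then have "2 * (\<bar>x\<bar> * \<bar>y\<bar>) \<le> x\<^sup>2 + y\<^sup>2" by (simp add: power2_diff)
    moreover have "0 \<le> \<bar>x\<bar> * \<bar>y\<bar>" by simp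
    ultimately show ?thesis unfolding abs_mult by linarith
  qed
  then show "summable (\<lambda>n. \<bar>f n * g n\<bar>)"
    by (intro summable_comparison_test'[OF summable_add[OF assms]]) auto
  then show "summable (\<lambda>n. f n * g n)" by (rule summable_rabs_cancel)
qed

section \<open>The inner product space of square-summable sequences\<close>

typedef ell2 = "{f :: nat \<Rightarrow> real. summable (\<lambda>n. (f n)\<^sup>2)}" morphisms crd of_seq
  by (intro exI[of _ "\<lambda>_. 0"]) simp

lemma crd_of_seq: "summable (\<lambda>n. (f n)\<^sup>2) \<Longrightarrow> crd (of_seq f) = f"
  by (simp add: of_seq_inverse)

lemma summable_crd: "summable (\<lambda>n. (crd x n)\<^sup>2)"
  using crd[of x] by simp

lemmas summable_crd_mult = summable_mult_of_squares(2)[OF summable_crd summable_crd]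

lemma ell2_eqI: "(\<And>k. crd x k = crd y k) \<Longrightarrow> x = y"
  by (metis crd_inverse ext)

lemma summable_square_add:
  fixes f g :: "nat \<Rightarrow> real"
  assumes "summable (\<lambda>n. (f n)\<^sup>2)" "summable (\<lambda>n. (g n)\<^sup>2)"
  shows "summable (\<lambda>n. (f n + g n)\<^sup>2)"
  unfolding power2_sum
  by (intro summable_add assms) (use summable_mult[OF summable_mult_of_squares(2)[OF assms], of 2] in \<open>simp add: mult.assoc\<close>)

instantiation ell2 :: real_inner
begin

definition "0 = of_seq (\<lambda>_. 0)"
definition "x + y = of_seq (\<lambda>k. crd x k + crd y k)"
definition "- x = of_seq (\<lambda>k. - crd x k)"
definition "x - y = of_seq (\<lambda>k. crd x k - crd y k)"
definition "c *\<^sub>R x = of_seq (\<lambda>k. c * crd x k)"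
definition "inner x y = (\<Sum>k. crd x k * crd y k)"
definition "norm (x::ell2) = sqrt (inner x x)"
definition "sgn (x::ell2) = inverse (norm x) *\<^sub>R x"
definition "dist (x::ell2) y = norm (x - y)"
definition "(uniformity :: (ell2 \<times> ell2) filter) = (INF e\<in>{0 <..}. principal {(x, y). dist x y < e})"
definition "open (U :: ell2 set) \<longleftrightarrow> (\<forall>x\<in>U. eventually (\<lambda>(x', y). x' = x \<longrightarrow> y \<in> U) uniformity)"

lemma crd_zero: "crd 0 k = 0"
  by (simp add: zero_ell2_def crd_of_seq)

lemma crd_add: "crd (x + y) k = crd x k + crd y k"
  by (simp add: plus_ell2_def crd_of_seq summable_square_add summable_crd)

lemma crd_uminus: "crd (- x) k = - crd x k"
  by (simp add: uminus_ell2_def crd_of_seq summable_crd)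

lemma crd_diff: "crd (x - y) k = crd x k - crd y k"
  using summable_square_add[OF summable_crd[of x], of "\<lambda>k. - crd y k"] summable_crd[of y]
  by (simp add: minus_ell2_def crd_of_seq)

lemma crd_scaleR: "crd (c *\<^sub>R x) k = c * crd x k"
  by (simp add: scaleR_ell2_def crd_of_seq power_mult_distrib summable_crd summable_mult)

instance
proof
  fix x y z :: ell2 and a b :: real
  show "x + y + z = x + (y + z)" "x + y = y + x" "0 + x = x" "- x + x = 0" "x - y = x + - y"
    "a *\<^sub>R (x + y) = a *\<^sub>R x + a *\<^sub>R y" "(a + b) *\<^sub>R x = a *\<^sub>R x + b *\<^sub>R x"
    "a *\<^sub>R b *\<^sub>R x = (a * b) *\<^sub>R x" "1 *\<^sub>R x = x"
    by (rule ell2_eqI; simp add: crd_add crd_zero crd_uminus crd_diff crd_scaleR algebra_simps)+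
  show "dist x y = norm (x - y)" by (fact dist_ell2_def)
  show "sgn x = inverse (norm x) *\<^sub>R x" by (fact sgn_ell2_def)
  show "uniformity = (INF e\<in>{0 <..}. principal {(x, y :: ell2). dist x y < e})" by (fact uniformity_ell2_def)
  show "open U \<longleftrightarrow> (\<forall>x\<in>U. eventually (\<lambda>(x', y). x' = x \<longrightarrow> y \<in> U) uniformity)" for U :: "ell2 set"
    by (fact open_ell2_def)
  show "inner x y = inner y x" by (simp add: inner_ell2_def mult.commute)
  show "inner (x + y) z = inner x z + inner y z"
    by (simp add: inner_ell2_def crd_add distrib_right suminf_add summable_crd_mult)
  show "inner (a *\<^sub>R x) y = a * inner x y"
    by (simp add: inner_ell2_def crd_scaleR mult.assoc suminf_mult summable_crd_mult)
  show "0 \<le> inner x x" unfolding inner_ell2_def by (intro suminf_nonneg summable_crd_mult) auto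
  show "inner x x = 0 \<longleftrightarrow> x = 0"
  proof
    assume "inner x x = 0"
    then have "crd x k * crd x k = 0" for k
      unfolding inner_ell2_def by (subst (asm) suminf_eq_zero_iff) (auto intro: summable_crd_mult)
    then show "x = 0" by (intro ell2_eqI) (simp add: crd_zero)
  qed (simp add: inner_ell2_def crd_zero)
  show "norm x = sqrt (inner x x)" by (fact norm_ell2_def)
qed

end

lemmas crd_simps = crd_zero crd_add crd_uminus crd_diff crd_scaleR

lemma crd_sum: "crd (sum f S) k = (\<Sum>i\<in>S. crd (f i) k)"
  by (induction S rule: infinite_finite_induct) (auto simp: crd_simps)

lemma inner_sums: "(\<lambda>k. crd x k * crd y k) sums inner x y"
  unfolding inner_ell2_def by (rule summable_sums[OF summable_crd_mult])

definition unit_seq :: "nat \<Rightarrow> ell2" where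
  "unit_seq k = of_seq (\<lambda>i. if i = k then 1 else 0)"

lemma crd_unit_seq: "crd (unit_seq k) i = (if i = k then 1 else 0)"
proof -
  have "summable (\<lambda>n. (if n = k then 1 else 0 :: real)\<^sup>2)"
    by (rule summable_finite[of "{k}"]) auto
  then show ?thesis by (simp add: unit_seq_def crd_of_seq)
qed

lemma inner_unit_seq: "inner x (unit_seq k) = crd x k" "inner (unit_seq k) x = crd x k"
proof -
  have "(\<lambda>i. crd x i * crd (unit_seq k) i) sums (crd x k * 1)"
    using sums_If_finite_set[of "{k}" "\<lambda>i. crd x i"] by (simp add: crd_unit_seq if_distrib[of "times _"] cong: if_cong)
  then show "inner x (unit_seq k) = crd x k" using sums_unique2[OF inner_sums] by simp
  then show "inner (unit_seq k) x = crd x k" by (simp add: inner_commute)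
qed

text \<open>Orthogonal projection onto the first n coordinates. The equation
  \<open>trunc K x = x\<close> later expresses that x is supported below K.\<close>

definition trunc :: "nat \<Rightarrow> ell2 \<Rightarrow> ell2" where
  "trunc n x = (\<Sum>k<n. crd x k *\<^sub>R unit_seq k)"

lemma crd_trunc: "crd (trunc n x) k = (if k < n then crd x k else 0)"
proof -
  have "crd (trunc n x) k = (\<Sum>i<n. if i = k then crd x k else 0)"
    unfolding trunc_def crd_sum by (intro sum.cong) (auto simp: crd_simps crd_unit_seq)
  then show ?thesis by (simp)
qed

lemma norm_sums: "(\<lambda>k. (crd x k)\<^sup>2) sums (norm x)\<^sup>2"
  using inner_sums[of x x] by (simp add: power2_eq_square power2_norm_eq_inner[symmetric])

lemma crd_bound: "\<bar>crd x k\<bar> \<le> norm x"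
  using Cauchy_Schwarz_ineq2[of x "unit_seq k"] inner_unit_seq(1)[of "unit_seq k" k]
  by (simp add: inner_unit_seq norm_eq_sqrt_inner crd_unit_seq)

lemma trunc_tendsto: "(\<lambda>n. trunc n x) \<longlonglongrightarrow> x"
proof -
  have eq: "(norm (trunc n x - x))\<^sup>2 = (norm x)\<^sup>2 - (\<Sum>k<n. (crd x k)\<^sup>2)" for n
  proof -
    have "(\<lambda>k. (crd x k)\<^sup>2 - (if k \<in> {..<n} then (crd x k)\<^sup>2 else 0)) sums ((norm x)\<^sup>2 - (\<Sum>k<n. (crd x k)\<^sup>2))"
      by (intro sums_diff norm_sums sums_If_finite_set) auto
    moreover have "(\<lambda>k. (crd x k)\<^sup>2 - (if k \<in> {..<n} then (crd x k)\<^sup>2 else 0)) = (\<lambda>k. (crd (trunc n x - x) k)\<^sup>2)"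
      by (rule ext) (auto simp: crd_simps crd_trunc)
    ultimately show ?thesis using norm_sums[of "trunc n x - x"] sums_unique2 by fastforce
  qed
  have "(\<lambda>n. (norm x)\<^sup>2 - (\<Sum>k<n. (crd x k)\<^sup>2)) \<longlonglongrightarrow> (norm x)\<^sup>2 - (norm x)\<^sup>2"
    using norm_sums[of x] unfolding sums_def by (intro tendsto_intros)
  then have "(\<lambda>n. (norm (trunc n x - x))\<^sup>2) \<longlonglongrightarrow> 0" by (simp add: eq)
  from tendsto_real_sqrt[OF this] have "(\<lambda>n. trunc n x - x) \<longlonglongrightarrow> 0"
    by (simp add: tendsto_norm_zero_iff)
  then show ?thesis by (simp add: LIM_zero_iff)
qed

text \<open>Already the span of the first n + 1 unit sequences contains such a vector. This supplies
  the hypothesis \<open>inf\<close> of \<open>compact_psd_spectral\<close>.\<close>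

lemma ell2_infinite_dim:
  fixes f :: "nat \<Rightarrow> ell2" and n :: nat
  shows "\<exists>x. x \<noteq> 0 \<and> (\<forall>i<n. inner x (f i) = 0)"
proof -
  obtain c where c: "\<exists>i\<le>n. c i \<noteq> 0" "\<forall>j<n. (\<Sum>i\<le>n. c i * crd (f j) i) = 0"
    using homogeneous_system_nontrivial[of n "\<lambda>j i. crd (f j) i"] by blast
  define x where "x = (\<Sum>i\<le>n. c i *\<^sub>R unit_seq i)"
  have "crd x i = c i" if "i \<le> n" for i
  proof -
    have "crd x i = (\<Sum>j\<le>n. if j = i then c i else 0)"
      unfolding x_def crd_sum by (intro sum.cong) (auto simp: crd_simps crd_unit_seq)
    then show ?thesis using that by simp
  qed
  then have "x \<noteq> 0" using c(1) crd_zero by metis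
  moreover have "inner x (f j) = 0" if "j < n" for j
    using c(2) that by (simp add: x_def inner_sum_left inner_unit_seq)
  ultimately show ?thesis by blast
qed

section \<open>Hilbert--Schmidt matrices and their operators\<close>

definition hs_matrix :: "(nat \<Rightarrow> nat \<Rightarrow> real) \<Rightarrow> bool" where
  "hs_matrix M \<longleftrightarrow> (\<forall>k. summable (\<lambda>l. (M k l)\<^sup>2)) \<and> summable (\<lambda>k. \<Sum>l. (M k l)\<^sup>2)"

text \<open>\<open>of_seq\<close> is meaningful only on square-summable sequences; that the row
  products form one is the content of \<open>crd_mat_op\<close>.\<close>

definition mat_op :: "(nat \<Rightarrow> nat \<Rightarrow> real) \<Rightarrow> ell2 \<Rightarrow> ell2" where
  "mat_op M x = of_seq (\<lambda>k. inner (of_seq (M k)) x)"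

context
  fixes M :: "nat \<Rightarrow> nat \<Rightarrow> real"
  assumes hs: "hs_matrix M"
begin

lemma crd_row: "crd (of_seq (M k)) l = M k l"
  using hs by (simp add: hs_matrix_def crd_of_seq)

lemma norm_row: "(norm (of_seq (M k)))\<^sup>2 = (\<Sum>l. (M k l)\<^sup>2)"
  using norm_sums[of "of_seq (M k)"] by (simp add: crd_row sums_iff)

lemma summable_rows: "summable (\<lambda>k. (norm (of_seq (M k)))\<^sup>2)"
  using hs by (simp add: norm_row hs_matrix_def)

lemma crd_mat_op: "crd (mat_op M x) k = inner (of_seq (M k)) x"
proof -
  have "\<bar>(inner (of_seq (M k)) x)\<^sup>2\<bar> \<le> (norm (of_seq (M k)))\<^sup>2 * (norm x)\<^sup>2" for k
    using Cauchy_Schwarz_ineq[of "of_seq (M k)" x] by (simp add: power2_norm_eq_inner)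
  then have "summable (\<lambda>k. (inner (of_seq (M k)) x)\<^sup>2)"
    by (intro summable_comparison_test'[OF summable_mult2[OF summable_rows, of "(norm x)\<^sup>2"]]) auto
  then show ?thesis by (simp add: mat_op_def crd_of_seq)
qed

lemma mat_op_sums: "(\<lambda>l. M k l * crd x l) sums crd (mat_op M x) k"
  unfolding crd_mat_op using inner_sums[of "of_seq (M k)" x] by (simp add: crd_row)

lemma crd_mat_op_bound: "\<bar>crd (mat_op M x) k\<bar> \<le> norm (of_seq (M k)) * norm x"
  unfolding crd_mat_op by (rule Cauchy_Schwarz_ineq2)

lemma bounded_linear_mat_op: "bounded_linear (mat_op M)"
proof (rule bounded_linear_intro[where K = "sqrt (\<Sum>k. (norm (of_seq (M k)))\<^sup>2)"])
  show "mat_op M (x + y) = mat_op M x + mat_op M y" for x y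
    by (rule ell2_eqI) (simp add: crd_mat_op crd_simps inner_add_right)
  show "mat_op M (r *\<^sub>R x) = r *\<^sub>R mat_op M x" for r x
    by (rule ell2_eqI) (simp add: crd_mat_op crd_simps)
  show "norm (mat_op M x) \<le> norm x * sqrt (\<Sum>k. (norm (of_seq (M k)))\<^sup>2)" for x
  proof -
    have "(norm (mat_op M x))\<^sup>2 \<le> (\<Sum>k. (norm (of_seq (M k)))\<^sup>2 * (norm x)\<^sup>2)"
      unfolding sums_unique[OF norm_sums[of "mat_op M x"]]
    proof (intro suminf_le summable_mult2 summable_rows sums_summable[OF norm_sums])
      fix k
      have "\<bar>crd (mat_op M x) k\<bar>\<^sup>2 \<le> (norm (of_seq (M k)) * norm x)\<^sup>2"
        by (intro power_mono crd_mat_op_bound) auto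
      then show "(crd (mat_op M x) k)\<^sup>2 \<le> (norm (of_seq (M k)))\<^sup>2 * (norm x)\<^sup>2" by (simp add: power_mult_distrib)
    qed
    also have "\<dots> = (\<Sum>k. (norm (of_seq (M k)))\<^sup>2) * (norm x)\<^sup>2"
      by (rule suminf_mult2[OF summable_rows, symmetric])
    finally have "sqrt ((norm (mat_op M x))\<^sup>2) \<le> sqrt ((\<Sum>k. (norm (of_seq (M k)))\<^sup>2) * (norm x)\<^sup>2)"
      by (rule real_sqrt_le_mono)
    then show ?thesis by (simp add: real_sqrt_mult mult.commute)
  qed
qed

lemma linear_mat_op: "linear (mat_op M)"
  using bounded_linear_mat_op bounded_linear.linear by blast

text \<open>The row norms q bound the coordinates of all images, so a diagonal subsequence converges
  coordinatewise, and square-summability of q upgrades this to convergence in norm.\<close>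

lemma mat_op_compact:
  fixes X :: "nat \<Rightarrow> ell2"
  assumes "\<And>n. norm (X n) \<le> 1"
  shows "\<exists>l r. strict_mono r \<and> (\<lambda>n. mat_op M (X (r n))) \<longlonglongrightarrow> l"
proof -
  define q where "q k = norm (of_seq (M k))" for k
  have q0: "q k \<ge> 0" for k by (simp add: q_def)
  have qs: "summable (\<lambda>k. (q k)\<^sup>2)" using summable_rows by (simp add: q_def)
  have b: "\<bar>crd (mat_op M (X n)) k\<bar> \<le> q k" for n k
  proof -
    have "norm (of_seq (M k)) * norm (X n) \<le> norm (of_seq (M k)) * 1" by (intro mult_left_mono assms) auto
    then show ?thesis using crd_mat_op_bound[of "X n" k] by (simp add: q_def)
  qed
  have "(\<lambda>k. (q k)\<^sup>2) \<longlonglongrightarrow> 0" using summable_LIMSEQ_zero[OF qs] .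
  then have "Bseq (\<lambda>k. (q k)\<^sup>2)" using convergent_imp_Bseq convergentI by blast
  then obtain B where B: "\<And>k. (q k)\<^sup>2 \<le> B" unfolding Bseq_def by auto
  \<comment> \<open>A single bound for all coordinates, as the diagonal subsequence theorem
    requires; it comes from 2 q \<le> q^2 + 1.\<close>
  have qB: "q k \<le> B + 1" for k
  proof -
    have "0 \<le> (q k - 1)\<^sup>2" by simp
    then have "2 * q k \<le> (q k)\<^sup>2 + 1" by (simp add: power2_eq_square algebra_simps)
    then show ?thesis using B[of k] q0[of k] by linarith
  qed
  have "norm (crd (mat_op M (X n)) k) \<le> B + 1" for n k using b[of n k] qB[of k] by simp
  then obtain r where r: "strict_mono (r::nat \<Rightarrow> nat)" "\<And>k. \<exists>l. (\<lambda>n. crd (mat_op M (X (r n))) k) \<longlonglongrightarrow> l"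
    using function_convergent_subsequence[OF countableI_type[of "UNIV::nat set"], of "\<lambda>n. crd (mat_op M (X n))" "B + 1"]
    by (metis UNIV_I)
  then obtain l where l: "\<And>k. (\<lambda>n. crd (mat_op M (X (r n))) k) \<longlonglongrightarrow> l k" by metis
  have lq: "\<bar>l k\<bar> \<le> q k" for k
    using tendsto_rabs[OF l[of k]] b by (intro LIMSEQ_le_const2[of "\<lambda>n. \<bar>crd (mat_op M (X (r n))) k\<bar>"]) auto
  have "(l k)\<^sup>2 \<le> (q k)\<^sup>2" for k using lq q0 abs_le_square_iff by fastforce
  then have "summable (\<lambda>k. (l k)\<^sup>2)"
    by (intro summable_comparison_test'[OF qs]) auto
  then have cl: "crd (of_seq l) = l" by (rule crd_of_seq)
  \<comment> \<open>The coordinates and their limits are both bounded by q; this is the majorant for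
    Tannery's theorem.\<close>
  have tq: "norm ((crd (mat_op M (X (r n))) k - l k)\<^sup>2) \<le> 4 * (q k)\<^sup>2" for n k
  proof -
    have "\<bar>crd (mat_op M (X (r n))) k - l k\<bar> \<le> \<bar>2 * q k\<bar>" using b[of "r n" k] lq[of k] by linarith
    then have "(crd (mat_op M (X (r n))) k - l k)\<^sup>2 \<le> (2 * q k)\<^sup>2" by (simp only: abs_le_square_iff)
    then show ?thesis by (simp add: power_mult_distrib)
  qed
  have "(\<lambda>n. \<Sum>k. (crd (mat_op M (X (r n))) k - l k)\<^sup>2) \<longlonglongrightarrow> (\<Sum>k::nat. 0::real)"
  proof (rule conjunct2[OF conjunct2[OF tannerys_theorem[where M = "\<lambda>k. 4 * (q k)\<^sup>2"]]])
    show "(\<lambda>n. (crd (mat_op M (X (r n))) k - l k)\<^sup>2) \<longlonglongrightarrow> 0" for k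
      using tendsto_power[OF tendsto_diff[OF l[of k] tendsto_const[of "l k"]], of 2] by simp
    show "\<forall>\<^sub>F (k, n) in sequentially \<times>\<^sub>F sequentially. norm ((crd (mat_op M (X (r n))) k - l k)\<^sup>2) \<le> 4 * (q k)\<^sup>2"
      using tq by (auto intro!: always_eventually)
    show "summable (\<lambda>k. 4 * (q k)\<^sup>2)" using qs by (rule summable_mult)
  qed simp
  moreover have "(\<Sum>k. (crd (mat_op M (X (r n))) k - l k)\<^sup>2) = (norm (mat_op M (X (r n)) - of_seq l))\<^sup>2" for n
    using sums_unique[OF norm_sums[of "mat_op M (X (r n)) - of_seq l"]] by (simp add: crd_simps cl)
  ultimately have "(\<lambda>n. (norm (mat_op M (X (r n)) - of_seq l))\<^sup>2) \<longlonglongrightarrow> 0" by simp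
  from tendsto_real_sqrt[OF this] have "(\<lambda>n. mat_op M (X (r n)) - of_seq l) \<longlonglongrightarrow> 0"
    by (simp add: tendsto_norm_zero_iff)
  then have "(\<lambda>n. mat_op M (X (r n))) \<longlonglongrightarrow> of_seq l" by (simp add: LIM_zero_iff)
  then show ?thesis using r(1) by blast
qed

lemma mat_op_unit_seq: "crd (mat_op M (unit_seq l)) k = M k l"
  by (simp add: crd_mat_op inner_unit_seq crd_row)

text \<open>Checked on unit sequences, extended to truncations by linearity and to all y by
  continuity.\<close>

lemma mat_op_selfadjoint:
  assumes "\<And>k l. M k l = M l k"
  shows "inner (mat_op M x) y = inner x (mat_op M y)"
proof -
  have 1: "inner (mat_op M x) (unit_seq k) = inner x (mat_op M (unit_seq k))" for x k
  proof -
    have "mat_op M (unit_seq k) = of_seq (M k)"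
      by (rule ell2_eqI) (simp add: mat_op_unit_seq crd_row assms)
    then show ?thesis by (simp add: inner_unit_seq crd_mat_op inner_commute)
  qed
  have 2: "inner (mat_op M x) (trunc n y) = inner x (mat_op M (trunc n y))" for n
    by (simp add: trunc_def inner_sum_right linear_sum[OF linear_mat_op] linear_scale[OF linear_mat_op] 1)
  have "(\<lambda>n. inner (mat_op M x) (trunc n y)) \<longlonglongrightarrow> inner (mat_op M x) y"
    by (intro tendsto_intros trunc_tendsto)
  moreover have "(\<lambda>n. inner x (mat_op M (trunc n y))) \<longlonglongrightarrow> inner x (mat_op M y)"
    by (intro tendsto_intros bounded_linear.tendsto[OF bounded_linear_mat_op] trunc_tendsto)
  ultimately show ?thesis unfolding 2 using LIMSEQ_unique by blast
qed

lemma mat_op_trunc_inner: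
  "inner (mat_op M (trunc n x)) (trunc n x) = (\<Sum>k<n. \<Sum>l<n. M k l * crd x k * crd x l)"
proof -
  have "inner (mat_op M (trunc n x)) (trunc n x) = (\<Sum>k<n. crd x k * crd (mat_op M (trunc n x)) k)"
    by (simp add: trunc_def inner_sum_right inner_unit_seq)
  also have "\<dots> = (\<Sum>k<n. crd x k * (\<Sum>l<n. crd x l * M k l))"
    by (intro sum.cong refl arg_cong2[where f = "times"])
      (simp add: trunc_def linear_sum[OF linear_mat_op] linear_scale[OF linear_mat_op] crd_sum crd_simps mat_op_unit_seq)
  finally show ?thesis by (simp add: sum_distrib_left mult_ac)
qed

lemma mat_op_compact_psd:
  assumes sym: "\<And>k l. M k l = M l k"
    and pos: "\<And>n (x::nat \<Rightarrow> real). 0 \<le> (\<Sum>k<n. \<Sum>l<n. M k l * x k * x l)"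
  shows "compact_psd (mat_op M)"
proof -
  have "0 \<le> inner (mat_op M x) x" for x
  proof -
    have "(\<lambda>n. inner (mat_op M (trunc n x)) (trunc n x)) \<longlonglongrightarrow> inner (mat_op M x) x"
      by (intro tendsto_intros bounded_linear.tendsto[OF bounded_linear_mat_op] trunc_tendsto)
    then show ?thesis
      by (rule LIMSEQ_le_const) (use pos mat_op_trunc_inner in auto)
  qed
  then show ?thesis
    unfolding compact_psd_def
    using bounded_linear_mat_op mat_op_selfadjoint[OF sym] mat_op_compact by blast
qed

end

lemma hs_matrix_dominated:
  assumes "summable (\<lambda>k. (u k)\<^sup>2)" "\<And>k l. \<bar>M k l\<bar> \<le> u k * u l"
  shows "hs_matrix M"
proof -
  have b: "(M k l)\<^sup>2 \<le> (u k)\<^sup>2 * (u l)\<^sup>2" for k l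
    using power_mono[OF assms(2)[of k l], of 2] by (simp add: power_mult_distrib)
  have s1: "summable (\<lambda>l. (M k l)\<^sup>2)" for k
    using b by (intro summable_comparison_test'[OF summable_mult[OF assms(1), of "(u k)\<^sup>2"]]) auto
  have "\<bar>\<Sum>l. (M k l)\<^sup>2\<bar> \<le> (u k)\<^sup>2 * (\<Sum>l. (u l)\<^sup>2)" for k
  proof -
    have "0 \<le> (\<Sum>l. (M k l)\<^sup>2)" by (intro suminf_nonneg s1) auto
    moreover have "(\<Sum>l. (M k l)\<^sup>2) \<le> (\<Sum>l. (u k)\<^sup>2 * (u l)\<^sup>2)"
      by (intro suminf_le s1 summable_mult assms(1) b)
    ultimately show ?thesis by (simp add: suminf_mult assms(1))
  qed
  then have "summable (\<lambda>k. \<Sum>l. (M k l)\<^sup>2)"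
    by (intro summable_comparison_test'[OF summable_mult2[OF assms(1)]]) auto
  then show ?thesis using s1 by (simp add: hs_matrix_def)
qed

lemma hs_matrix_diag:
  assumes "summable (\<lambda>k. (u k)\<^sup>2)"
  shows "hs_matrix (\<lambda>k l. if k = l then u k else 0)"
proof -
  have s: "(\<lambda>l. (if k = l then u k else 0)\<^sup>2) sums (u k)\<^sup>2" for k
    using sums_If_finite_set[of "{k}" "\<lambda>l. (u k)\<^sup>2"] by (simp add: if_distrib[of "\<lambda>x. x\<^sup>2"] eq_commute cong: if_cong)
  show ?thesis unfolding hs_matrix_def using assms sums_summable[OF s] sums_unique[OF s, symmetric] by simp
qed

lemma hs_matrix_add:
  assumes "hs_matrix M" "hs_matrix N"
  shows "hs_matrix (\<lambda>k l. M k l + N k l)"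
proof -
  have b: "(x + y)\<^sup>2 \<le> 2 * x\<^sup>2 + 2 * y\<^sup>2" for x y :: real
    using zero_le_power2[of "x - y"] by (simp add: power2_eq_square algebra_simps)
  have s: "summable (\<lambda>l. (M k l)\<^sup>2)" "summable (\<lambda>l. (N k l)\<^sup>2)" for k using assms by (auto simp: hs_matrix_def)
  have s1: "summable (\<lambda>l. (M k l + N k l)\<^sup>2)" for k using summable_square_add[OF s] .
  have bound: "\<bar>\<Sum>l. (M k l + N k l)\<^sup>2\<bar> \<le> 2 * (\<Sum>l. (M k l)\<^sup>2) + 2 * (\<Sum>l. (N k l)\<^sup>2)" for k
  proof -
    have "0 \<le> (\<Sum>l. (M k l + N k l)\<^sup>2)" by (intro suminf_nonneg s1) auto
    moreover have "(\<Sum>l. (M k l + N k l)\<^sup>2) \<le> (\<Sum>l. 2 * (M k l)\<^sup>2 + 2 * (N k l)\<^sup>2)"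
      by (intro suminf_le s1 summable_add summable_mult s b)
    ultimately show ?thesis by (simp add: suminf_add[symmetric] suminf_mult s summable_mult)
  qed
  have "summable (\<lambda>k. 2 * (\<Sum>l. (M k l)\<^sup>2) + 2 * (\<Sum>l. (N k l)\<^sup>2))"
    using assms unfolding hs_matrix_def by (intro summable_add summable_mult) blast+
  then have "summable (\<lambda>k. \<Sum>l. (M k l + N k l)\<^sup>2)"
    by (rule summable_comparison_test') (use bound in simp)
  then show ?thesis using s1 by (simp add: hs_matrix_def)
qed

section \<open>Matrices of Steklov type\<close>

text \<open>The indices \<open>2m\<close> and \<open>2m + 1\<close> stand for the cosine and the sine of frequency \<open>m + 1\<close>: \<open>dd\<close> is the
  frequency, \<open>partner\<close> exchanges the two functions, and \<open>sg\<close> is the sign that differentiation introduces.\<close>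

definition dd :: "nat \<Rightarrow> real" where "dd k = real (k div 2 + 1)"

definition partner :: "nat \<Rightarrow> nat" where "partner k = (if even k then k + 1 else k - 1)"

definition sg :: "nat \<Rightarrow> real" where "sg k = (if even k then 1 else - 1)"

lemma partner_simps [simp]: "partner (partner k) = k" "dd (partner k) = dd k" "sg (partner k) = - sg k"
  "sg k * sg k = 1" "sg k \<noteq> 0" "\<bar>sg k\<bar> = 1"
  by (auto simp: partner_def dd_def sg_def elim!: oddE evenE)

lemma partner_less [simp]: "partner k < 2 * M \<longleftrightarrow> k < 2 * M"
  unfolding partner_def by (cases "even k") (auto elim!: evenE oddE)

text \<open>An initial segment is invariant under \<open>partner\<close> only if its length is even;
  hence the sections of length \<open>2 * M\<close> below.\<close>

lemma bij_partner: "bij_betw partner {..<2 * M} {..<2 * M}"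
  by (rule bij_betwI[of _ _ _ partner]) auto

lemma dd_ge1: "dd k \<ge> 1" by (simp add: dd_def)

lemma dd_pos [simp]: "dd k > 0" "dd k \<noteq> 0" using dd_ge1[of k] by linarith+

lemma dd_mono: "k \<le> l \<Longrightarrow> dd k \<le> dd l" by (simp add: dd_def div_le_mono)

lemma dd_lower: "real (Suc k) \<le> 2 * dd k"
proof -
  have "Suc k \<le> 2 * (k div 2 + 1)" by presburger
  then show ?thesis unfolding dd_def by linarith
qed

lemma dd_upper: "2 * dd k \<le> real k + 2"
proof -
  have "2 * (k div 2 + 1) \<le> k + 2" by presburger
  then show ?thesis unfolding dd_def by linarith
qed

lemma summable_inverse_squares: "summable (\<lambda>k. (1 / real (Suc k))\<^sup>2)"
  using inverse_power_summable[of 2, where 'a = real]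
  by (subst summable_Suc_iff[of "\<lambda>k. (1 / real k)\<^sup>2"]) (simp add: power_divide inverse_eq_divide)

text \<open>\<open>A_inverse\<close> states that A times the matrix \<open>Tm\<close> below is the
  identity. \<open>A_decay\<close> bounds entries in one index only; \<open>A_sym\<close> supplies
  the other.\<close>

locale steklov_matrix =
  fixes A :: "nat \<Rightarrow> nat \<Rightarrow> real"
  assumes A_sym: "A k l = A l k"
    and A_decay: "\<exists>C. \<forall>k l. \<bar>A k l - (if k = l then dd k else 0)\<bar> \<le> C / real (Suc l) ^ p"
    and A_inverse: "(\<lambda>j. A m j * (sg j * sg l * A (partner j) (partner l) / (dd j * dd l))) sums (if m = l then 1 else 0)"
    and A_psd: "0 \<le> (\<Sum>k<n. \<Sum>l<n. A k l * x k * x l)"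
begin

definition Rm :: "nat \<Rightarrow> nat \<Rightarrow> real" where "Rm k l = A k l - (if k = l then dd k else 0)"

definition Tm :: "nat \<Rightarrow> nat \<Rightarrow> real" where "Tm k l = sg k * sg l * A (partner k) (partner l) / (dd k * dd l)"

lemma Rm_sym: "Rm k l = Rm l k" by (simp add: Rm_def A_sym)

lemma Tm_sym: "Tm k l = Tm l k" by (simp add: Tm_def A_sym mult_ac)

text \<open>Decay of order 2 p in the larger index gives order p in both.\<close>

lemma Rm_decay: obtains C where "C \<ge> 0" "\<And>k l. \<bar>Rm k l\<bar> \<le> C / (real (Suc k) ^ p * real (Suc l) ^ p)"
proof -
  obtain C where C: "\<And>k l. \<bar>Rm k l\<bar> \<le> C / real (Suc l) ^ (2 * p)"
    using A_decay[of "2 * p"] by (auto simp: Rm_def)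
  have C0: "C \<ge> 0" using C[of 0 0] by simp
  have 1: "\<bar>Rm k l\<bar> \<le> C / (real (Suc k) ^ p * real (Suc l) ^ p)" if "k \<le> l" for k l
  proof -
    have "real (Suc k) ^ p * real (Suc l) ^ p \<le> real (Suc l) ^ p * real (Suc l) ^ p"
      using that by (intro mult_right_mono power_mono) auto
    also have "\<dots> = real (Suc l) ^ (2 * p)" by (simp add: mult_2 power_add)
    finally have "C / real (Suc l) ^ (2 * p) \<le> C / (real (Suc k) ^ p * real (Suc l) ^ p)"
      using C0 by (intro divide_left_mono) auto
    then show ?thesis using C[of k l] by linarith
  qed
  have "\<bar>Rm k l\<bar> \<le> C / (real (Suc k) ^ p * real (Suc l) ^ p)" for k l
    using 1[of k l] 1[of l k] Rm_sym[of k l] by (cases "k \<le> l") (auto simp: mult.commute)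
  then show thesis using that C0 by blast
qed

lemma hs_Rm: "hs_matrix Rm"
proof -
  obtain C where C: "C \<ge> 0" "\<And>k l. \<bar>Rm k l\<bar> \<le> C / (real (Suc k) ^ 1 * real (Suc l) ^ 1)"
    using Rm_decay[of 1] by metis
  show ?thesis
  proof (rule hs_matrix_dominated[of "\<lambda>k. sqrt C * (1 / real (Suc k))"])
    show "summable (\<lambda>k. (sqrt C * (1 / real (Suc k)))\<^sup>2)"
      unfolding power_mult_distrib by (intro summable_mult summable_inverse_squares)
    show "\<bar>Rm k l\<bar> \<le> sqrt C * (1 / real (Suc k)) * (sqrt C * (1 / real (Suc l)))" for k l
      using C(2)[of k l] C(1) by (simp add: field_simps)
  qed
qed

lemma Tm_eq: "Tm k l = (if k = l then 1 / dd k else 0) + sg k * sg l * Rm (partner k) (partner l) / (dd k * dd l)"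
proof -
  have "partner k = partner l \<longleftrightarrow> k = l" by (metis partner_simps(1))
  then show ?thesis by (simp add: Tm_def Rm_def field_simps)
qed

text \<open>The diagonal part has the square-summable entries 1 / d_k, and the bounded perturbation
  is dominated by a multiple of 1 / (d_k d_l).\<close>

lemma hs_Tm: "hs_matrix Tm"
proof -
  have u: "(1 / dd k)\<^sup>2 \<le> 4 * (1 / real (Suc k))\<^sup>2" for k
  proof -
    have "1 / dd k \<le> 2 * (1 / real (Suc k))" using dd_lower[of k] dd_pos[of k] by (simp add: field_simps)
    then have "(1 / dd k)\<^sup>2 \<le> (2 * (1 / real (Suc k)))\<^sup>2" using less_imp_le[OF dd_pos(1)[of k]] by (intro power_mono) auto
    then show ?thesis by (simp add: power_mult_distrib power_divide)
  qed
  have s: "summable (\<lambda>k. (1 / dd k)\<^sup>2)"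
    by (rule summable_comparison_test'[OF summable_mult[OF summable_inverse_squares, of 4]]) (use u in simp)
  obtain C where C: "C \<ge> 0" "\<And>k l. \<bar>Rm k l\<bar> \<le> C / (real (Suc k) ^ 0 * real (Suc l) ^ 0)"
    using Rm_decay[of 0] by metis
  have "hs_matrix (\<lambda>k l. sg k * sg l * Rm (partner k) (partner l) / (dd k * dd l))"
  proof (rule hs_matrix_dominated[of "\<lambda>k. sqrt C * (1 / dd k)"])
    show "summable (\<lambda>k. (sqrt C * (1 / dd k))\<^sup>2)"
      unfolding power_mult_distrib by (intro summable_mult s)
    show "\<bar>sg k * sg l * Rm (partner k) (partner l) / (dd k * dd l)\<bar> \<le> sqrt C * (1 / dd k) * (sqrt C * (1 / dd l))" for k l
    proof -
      have "\<bar>sg k * sg l * Rm (partner k) (partner l) / (dd k * dd l)\<bar> = \<bar>Rm (partner k) (partner l)\<bar> / (dd k * dd l)"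
        using less_imp_le[OF dd_pos(1)] by (simp add: abs_mult)
      also have "\<dots> \<le> C / (dd k * dd l)" using C(2)[of "partner k" "partner l"]
        by (intro divide_right_mono mult_nonneg_nonneg less_imp_le[OF dd_pos(1)]) simp
      finally show ?thesis using C(1) by simp
    qed
  qed
  from hs_matrix_add[OF hs_matrix_diag[OF s] this] show ?thesis by (simp add: Tm_eq[abs_def])
qed

section \<open>The unbounded operator A and its inverse\<close>

abbreviation Rop :: "ell2 \<Rightarrow> ell2" where "Rop \<equiv> mat_op Rm"
abbreviation Top :: "ell2 \<Rightarrow> ell2" where "Top \<equiv> mat_op Tm"

lemmas Rop_selfadjoint = mat_op_selfadjoint[OF hs_Rm Rm_sym]
lemmas Top_selfadjoint = mat_op_selfadjoint[OF hs_Tm Tm_sym]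

text \<open>The relation A x = y. It is a relation because A is unbounded: x lies in the domain
  exactly when some y in \<open>ell2\<close> satisfies it.\<close>

definition A_graph :: "ell2 \<Rightarrow> ell2 \<Rightarrow> bool" where
  "A_graph x y \<longleftrightarrow> (\<forall>k. crd y k = dd k * crd x k + crd (Rop x) k)"

definition A_col :: "nat \<Rightarrow> ell2" where "A_col k = dd k *\<^sub>R unit_seq k + of_seq (Rm k)"

lemma crd_A_col: "crd (A_col k) j = A k j"
  by (simp add: A_col_def crd_simps crd_unit_seq crd_row[OF hs_Rm] Rm_def)

lemma Top_A_col: "Top (A_col k) = unit_seq k"
proof (rule ell2_eqI)
  fix m
  have "(\<lambda>j. A k j * Tm j m) sums (if k = m then 1 else 0)" using A_inverse[of k m] by (simp add: Tm_def)
  moreover have "(\<lambda>j. A k j * Tm j m) = (\<lambda>l. Tm m l * crd (A_col k) l)"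
    by (simp add: crd_A_col Tm_sym mult.commute)
  ultimately show "crd (Top (A_col k)) m = crd (unit_seq k) m"
    using mat_op_sums[OF hs_Tm, of m "A_col k"] sums_unique2 by (fastforce simp: crd_unit_seq)
qed

text \<open>Row k of A is the vector \<open>A_col k\<close>; moving T across the inner product
  replaces it by T (\<open>A_col k\<close>), the k-th unit sequence.\<close>

lemma A_graph_Top: "A_graph (Top y) y"
  unfolding A_graph_def
proof
  fix k
  have "dd k * crd (Top y) k + crd (Rop (Top y)) k = inner (dd k *\<^sub>R unit_seq k + of_seq (Rm k)) (Top y)"
    by (simp add: inner_add_left inner_unit_seq crd_mat_op[OF hs_Rm])
  also have "\<dots> = inner (Top (A_col k)) y" by (simp add: A_col_def Top_selfadjoint)
  finally show "crd y k = dd k * crd (Top y) k + crd (Rop (Top y)) k" by (simp add: Top_A_col inner_unit_seq)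
qed

text \<open>Pairing with t = T e_m recovers the m-th coordinate of x, because A is symmetric on its
  graph.\<close>

lemma A_graph_iff: "A_graph x y \<longleftrightarrow> x = Top y"
proof
  assume g: "A_graph x y"
  show "x = Top y"
  proof (rule ell2_eqI)
    fix m
    define t where "t = Top (unit_seq m)"
    have gt: "crd (unit_seq m) k = dd k * crd t k + crd (Rop t) k" for k
      using A_graph_Top[of "unit_seq m"] by (simp add: A_graph_def t_def)
    \<comment> \<open>Both series have the terms d_k t_k x_k. Writing them as differences of inner
      products provides their convergence and their sums.\<close>
    have "(\<lambda>k. crd t k * crd y k - crd t k * crd (Rop x) k) sums (inner t y - inner t (Rop x))"
      by (intro sums_diff inner_sums)
    moreover have "(\<lambda>k. crd (unit_seq m) k * crd x k - crd (Rop t) k * crd x k) sums (inner (unit_seq m) x - inner (Rop t) x)"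
      by (intro sums_diff inner_sums)
    moreover have "crd t k * crd y k - crd t k * crd (Rop x) k = crd (unit_seq m) k * crd x k - crd (Rop t) k * crd x k" for k
      using g unfolding A_graph_def gt by (simp add: algebra_simps)
    ultimately have "inner t y - inner t (Rop x) = inner (unit_seq m) x - inner (Rop t) x"
      using sums_unique2 by simp
    then have "inner t y = crd x m" by (simp add: Rop_selfadjoint inner_unit_seq)
    then show "crd x m = crd (Top y) m" by (simp add: t_def Top_selfadjoint inner_unit_seq)
  qed
qed (simp add: A_graph_Top)

lemma Tm_psd: "0 \<le> (\<Sum>k<n. \<Sum>l<n. Tm k l * x k * x l)"
proof -
  \<comment> \<open>x is extended by zero to the even length 2 n, on which \<open>partner\<close> is
    a permutation; z then absorbs the signs and denominators of \<open>Tm\<close>.\<close>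
  define y where "y k = (if k < n then x k else 0)" for k
  define z where "z k = sg (partner k) * y (partner k) / dd k" for k
  have "(\<Sum>k<n. \<Sum>l<n. Tm k l * x k * x l) = (\<Sum>k<n. \<Sum>l<2*n. Tm k l * y k * y l)"
    by (intro sum.cong sum.mono_neutral_cong_left refl) (auto simp: y_def)
  also have "\<dots> = (\<Sum>k<2*n. \<Sum>l<2*n. Tm k l * y k * y l)"
    by (intro sum.mono_neutral_left) (auto simp: y_def)
  also have "\<dots> = (\<Sum>k<2*n. \<Sum>l<2*n. Tm (partner k) (partner l) * y (partner k) * y (partner l))"
    using sum.reindex_bij_betw[OF bij_partner, of "\<lambda>k. \<Sum>l<2*n. Tm k l * y k * y l" n]
      sum.reindex_bij_betw[OF bij_partner, of "\<lambda>l. Tm _ l * y _ * y l" n] by simp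
  also have "\<dots> = (\<Sum>k<2*n. \<Sum>l<2*n. A k l * z k * z l)"
    by (intro sum.cong refl) (simp add: Tm_def z_def)
  also have "\<dots> \<ge> 0" by (rule A_psd)
  finally show ?thesis .
qed

lemma Top_compact_psd: "compact_psd Top"
  by (rule mat_op_compact_psd[OF hs_Tm Tm_sym Tm_psd])

lemma Top_nonneg: "0 \<le> inner (Top x) x"
  using Top_compact_psd unfolding compact_psd_def by blast

lemmas Top_linear = linear_mat_op[OF hs_Tm]
lemmas Rop_linear = linear_mat_op[OF hs_Rm]

lemmas Top_Cauchy_Schwarz = psd_Cauchy_Schwarz[OF Top_linear Top_selfadjoint Top_nonneg]

lemma Top_inj: "Top y = 0 \<Longrightarrow> y = 0"
  using A_graph_Top[of y] by (intro ell2_eqI) (simp add: A_graph_def linear_0[OF Rop_linear] crd_zero)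

text \<open>Cauchy--Schwarz for y and T y gives T y = 0.\<close>

lemma Top_inner_zero: "inner (Top y) y = 0 \<Longrightarrow> y = 0"
  using Top_Cauchy_Schwarz[of y "Top y"] Top_inj by simp

section \<open>Eigenvalues and their variational characterization\<close>

definition spectral_pair :: "(nat \<Rightarrow> ell2) \<Rightarrow> (nat \<Rightarrow> real) \<Rightarrow> bool" where
  "spectral_pair w t \<longleftrightarrow> (\<forall>i j. inner (w i) (w j) = (if i = j then 1 else 0)) \<and>
     (\<forall>i. Top (w i) = t i *\<^sub>R w i) \<and> antimono t \<and>
     (\<forall>n y. (\<forall>i<n. inner y (w i) = 0) \<longrightarrow> inner (Top y) y \<le> t n * inner y y)"

lemma spectral_pair_exists: "\<exists>p. spectral_pair (fst p) (snd p)"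
proof -
  obtain w t where "\<And>i j. inner (w i) (w j) = (if i = j then 1 else 0)"
    "\<And>i::nat. Top (w i) = t i *\<^sub>R w i" "antimono t"
    "\<And>n y. \<forall>i<n. inner y (w i) = 0 \<Longrightarrow> inner (Top y) y \<le> t n * inner y y"
    by (rule compact_psd_spectral[OF Top_compact_psd ell2_infinite_dim]) blast
  then have "spectral_pair w t" unfolding spectral_pair_def by blast
  then show ?thesis by (intro exI[of _ "(w, t)"]) simp
qed

text \<open>Both components come from one choice of a pair, so that \<open>ev\<close> and
  \<open>tau\<close> belong to each other.\<close>

definition ev :: "nat \<Rightarrow> ell2" where "ev = fst (SOME p. spectral_pair (fst p) (snd p))"
definition tau :: "nat \<Rightarrow> real" where "tau = snd (SOME p. spectral_pair (fst p) (snd p))"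
definition lam :: "nat \<Rightarrow> real" where "lam i = 1 / tau i"

lemma spectral_pair_ev: "spectral_pair ev tau"
  unfolding ev_def tau_def by (rule someI_ex[OF spectral_pair_exists])

lemma ev_orthonormal: "inner (ev i) (ev j) = (if i = j then 1 else 0)"
  and Top_ev: "Top (ev i) = tau i *\<^sub>R ev i"
  and tau_antimono: "antimono tau"
  and Top_max: "(\<And>i. i < n \<Longrightarrow> inner y (ev i) = 0) \<Longrightarrow> inner (Top y) y \<le> tau n * inner y y"
  using spectral_pair_ev unfolding spectral_pair_def by blast+

lemma tau_pos: "tau i > 0"
proof -
  have "ev i \<noteq> 0" using ev_orthonormal[of i i] by auto
  then have "inner (Top (ev i)) (ev i) \<noteq> 0" using Top_inner_zero by blast
  moreover have "inner (Top (ev i)) (ev i) = tau i" by (simp add: Top_ev ev_orthonormal)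
  ultimately show ?thesis using Top_nonneg[of "ev i"] by simp
qed

lemma lam_pos: "lam i > 0" using tau_pos by (simp add: lam_def)

lemma lam_mono: "i \<le> j \<Longrightarrow> lam i \<le> lam j"
  using antimonoD[OF tau_antimono, of i j] tau_pos[of j] by (simp add: lam_def frac_le)

lemma A_graph_comb: "A_graph (\<Sum>i\<in>S. c i *\<^sub>R ev i) (\<Sum>i\<in>S. (lam i * c i) *\<^sub>R ev i)"
proof -
  have "(lam i * c i) *\<^sub>R Top (ev i) = c i *\<^sub>R ev i" for i using tau_pos[of i] by (simp add: lam_def Top_ev)
  then show ?thesis
    by (simp add: A_graph_iff linear_sum[OF Top_linear] linear_scale[OF Top_linear])
qed

lemma ev_eigen: "lam i * crd (ev i) k = dd k * crd (ev i) k + crd (Rop (ev i)) k"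
  using A_graph_comb[of "\<lambda>_. 1" "{i}"] by (simp add: A_graph_def crd_simps)

lemma A_form_sums:
  assumes "A_graph x y"
  shows "(\<lambda>k. dd k * (crd x k)\<^sup>2) sums (inner y x - inner (Rop x) x)"
proof -
  have "(\<lambda>k. crd y k * crd x k - crd (Rop x) k * crd x k) sums (inner y x - inner (Rop x) x)"
    by (intro sums_diff inner_sums)
  then show ?thesis using assms by (simp add: A_graph_def power2_eq_square algebra_simps)
qed

text \<open>With x = T y, Cauchy--Schwarz in the form of T bounds the square of <x, x> by <y, x> <T
  x, x>, and \<open>Top_max\<close> bounds the last factor.\<close>

lemma A_form_lower:
  assumes g: "A_graph x y" and o: "\<And>i. i < n \<Longrightarrow> inner x (ev i) = 0"
  shows "lam n * inner x x \<le> inner y x"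
proof -
  have x: "x = Top y" using g by (simp add: A_graph_iff)
  have "(inner x x)\<^sup>2 \<le> inner x y * inner (Top x) x" using Top_Cauchy_Schwarz[of y x] by (simp add: x)
  also have "\<dots> \<le> inner x y * (tau n * inner x x)"
    using Top_max[OF o] Top_nonneg[of y] by (intro mult_left_mono) (auto simp: x)
  finally have *: "inner x x * inner x x \<le> (tau n * inner y x) * inner x x"
    by (simp add: power2_eq_square inner_commute mult_ac)
  show ?thesis
  proof (cases "x = 0")
    case False
    then have "inner x x \<le> tau n * inner y x" using * by (metis inner_gt_zero_iff mult_right_le_imp_le)
    then show ?thesis using tau_pos[of n] by (simp add: lam_def field_simps)
  qed simp
qed

text \<open>The test vectors of all min-max arguments. The last conclusion evaluates the form of an
  operator that is diagonal on the \<open>u i\<close>, with eigenvalues \<open>e i\<close>.\<close>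

lemma orthogonal_combination:
  fixes u :: "nat \<Rightarrow> ell2"
  assumes "\<And>i j. i \<le> n \<Longrightarrow> j \<le> n \<Longrightarrow> inner (u i) (u j) = (if i = j then 1 else 0)"
  obtains c where "(\<Sum>i\<le>n. c i *\<^sub>R u i) \<noteq> 0" "\<And>j. j < n \<Longrightarrow> inner (\<Sum>i\<le>n. c i *\<^sub>R u i) (v j) = 0"
    "inner (\<Sum>i\<le>n. c i *\<^sub>R u i) (\<Sum>i\<le>n. c i *\<^sub>R u i) = (\<Sum>i\<le>n. (c i)\<^sup>2)"
    "\<And>e. inner (\<Sum>i\<le>n. (e i * c i) *\<^sub>R u i) (\<Sum>i\<le>n. c i *\<^sub>R u i) = (\<Sum>i\<le>n. e i * (c i)\<^sup>2)"
proof -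
  obtain c where c: "\<exists>i\<le>n. c i \<noteq> 0" "\<forall>j<n. (\<Sum>i\<le>n. c i * inner (u i) (v j)) = 0"
    using homogeneous_system_nontrivial[of n "\<lambda>j i. inner (u i) (v j)"] by blast
  have e: "inner (\<Sum>i\<le>n. (e i * c i) *\<^sub>R u i) (\<Sum>i\<le>n. c i *\<^sub>R u i) = (\<Sum>i\<le>n. e i * (c i)\<^sup>2)" for e
  proof -
    have "inner (\<Sum>i\<le>n. (e i * c i) *\<^sub>R u i) (\<Sum>i\<le>n. c i *\<^sub>R u i) = (\<Sum>i\<le>n. \<Sum>j\<le>n. e i * c i * (c j * inner (u i) (u j)))"
      by (simp only: inner_sum_left inner_sum_right sum_distrib_left inner_scaleR_left inner_scaleR_right)
        (subst sum.swap, simp add: mult_ac)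
    also have "\<dots> = (\<Sum>i\<le>n. \<Sum>j\<le>n. if j = i then e i * c i * c i else 0)"
      by (intro sum.cong refl) (auto simp: assms)
    finally show ?thesis by (simp add: power2_eq_square mult_ac)
  qed
  have 1: "inner (\<Sum>i\<le>n. c i *\<^sub>R u i) (\<Sum>i\<le>n. c i *\<^sub>R u i) = (\<Sum>i\<le>n. (c i)\<^sup>2)" using e[of "\<lambda>_. 1"] by simp
  have "(\<Sum>i\<le>n. (c i)\<^sup>2) \<noteq> 0" using c(1) by (subst sum_nonneg_eq_0_iff) auto
  then have "(\<Sum>i\<le>n. c i *\<^sub>R u i) \<noteq> 0" using 1 by auto
  then show thesis using that[of c] c(2) e 1 by (simp add: inner_sum_left)
qed

section \<open>Tails of the perturbation and asymptotics of the eigenvalues\<close>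

lemma Rop_tail:
  obtains C where "C \<ge> 0" "\<And>N x. norm (Rop x - trunc N (Rop x)) \<le> C / real (Suc N) ^ p * norm x"
proof -
  define Z where "Z = (\<Sum>k. (1 / real (Suc k))\<^sup>2)"
  have Z0: "Z \<ge> 0" unfolding Z_def by (intro suminf_nonneg summable_inverse_squares) auto
  \<comment> \<open>Order p + 1: p for the tail, and one more power in each index to sum the
    squares.\<close>
  obtain C where C: "C \<ge> 0" "\<And>k l. \<bar>Rm k l\<bar> \<le> C / (real (Suc k) ^ (p + 1) * real (Suc l) ^ (p + 1))"
    using Rm_decay by metis
  have row: "(norm (of_seq (Rm k)))\<^sup>2 \<le> (C / real (Suc k) ^ (p + 1))\<^sup>2 * Z" for k
  proof -
    have "(Rm k l)\<^sup>2 \<le> (C / real (Suc k) ^ (p + 1))\<^sup>2 * (1 / real (Suc l))\<^sup>2" for l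
    proof -
      have "real (Suc l) ^ 1 \<le> real (Suc l) ^ (p + 1)" by (intro power_increasing) auto
      then have "C / (real (Suc k) ^ (p + 1) * real (Suc l) ^ (p + 1)) \<le> C / (real (Suc k) ^ (p + 1) * real (Suc l))"
        using C(1) by (intro divide_left_mono mult_left_mono) auto
      then have "\<bar>Rm k l\<bar> \<le> C / real (Suc k) ^ (p + 1) * (1 / real (Suc l))" using C(2)[of k l] by simp
      then have "\<bar>Rm k l\<bar>\<^sup>2 \<le> (C / real (Suc k) ^ (p + 1) * (1 / real (Suc l)))\<^sup>2" by (intro power_mono) auto
      then show ?thesis by (simp only: power2_abs power_mult_distrib)
    qed
    then have "(\<Sum>l. (Rm k l)\<^sup>2) \<le> (\<Sum>l. (C / real (Suc k) ^ (p + 1))\<^sup>2 * (1 / real (Suc l))\<^sup>2)"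
      using hs_Rm by (intro suminf_le summable_mult summable_inverse_squares) (auto simp: hs_matrix_def)
    then show ?thesis
      by (simp only: norm_row[OF hs_Rm] suminf_mult[OF summable_inverse_squares] Z_def)
  qed
  have "norm (Rop x - trunc N (Rop x)) \<le> C * Z / real (Suc N) ^ p * norm x" for N x
  proof -
    have crdk: "(crd (Rop x - trunc N (Rop x)) k)\<^sup>2 \<le> (C * norm x / real (Suc N) ^ p)\<^sup>2 * Z * (1 / real (Suc k))\<^sup>2" for k
    proof (cases "k < N")
      case True
      then show ?thesis using Z0 by (simp add: crd_simps crd_trunc)
    next
      case False
      have "(crd (Rop x) k)\<^sup>2 \<le> (norm (of_seq (Rm k)) * norm x)\<^sup>2"
        using power_mono[OF crd_mat_op_bound[OF hs_Rm, of x k], of 2] by simp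
      also have "\<dots> \<le> (C / real (Suc k) ^ (p + 1))\<^sup>2 * Z * (norm x)\<^sup>2"
        unfolding power_mult_distrib by (intro mult_right_mono row) auto
      also have "\<dots> \<le> (C / (real (Suc N) ^ p * real (Suc k)))\<^sup>2 * Z * (norm x)\<^sup>2"
      proof (intro mult_right_mono power_mono)
        have "real (Suc N) ^ p * real (Suc k) \<le> real (Suc k) ^ p * real (Suc k)"
          using False by (intro mult_right_mono power_mono) auto
        then show "C / real (Suc k) ^ (p + 1) \<le> C / (real (Suc N) ^ p * real (Suc k))"
          using C(1) by (intro divide_left_mono) (auto simp: mult.commute)
      qed (use Z0 C in auto)
      also have "\<dots> = (C * norm x / real (Suc N) ^ p)\<^sup>2 * Z * (1 / real (Suc k))\<^sup>2"
        by (simp add: power_mult_distrib power_divide)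
      finally show ?thesis using False by (simp add: crd_simps crd_trunc)
    qed
    have "(norm (Rop x - trunc N (Rop x)))\<^sup>2 \<le> (\<Sum>k. (C * norm x / real (Suc N) ^ p)\<^sup>2 * Z * (1 / real (Suc k))\<^sup>2)"
      unfolding sums_unique[OF norm_sums]
      by (intro suminf_le crdk sums_summable[OF norm_sums] summable_mult summable_inverse_squares)
    also have "\<dots> = (C * norm x / real (Suc N) ^ p)\<^sup>2 * Z * Z"
      unfolding Z_def by (rule suminf_mult[OF summable_inverse_squares])
    also have "\<dots> = (C * Z / real (Suc N) ^ p * norm x)\<^sup>2" by (simp add: power_mult_distrib power_divide power2_eq_square)
    finally show ?thesis
      by (rule power2_le_imp_le) (use Z0 C(1) in \<open>simp add: zero_le_divide_iff del: of_nat_Suc\<close>)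
  qed
  then show thesis using that[of "C * Z"] Z0 C(1) by simp
qed

lemma Rop_crd_decay:
  obtains C where "C \<ge> 0" "\<And>k x. \<bar>crd (Rop x) k\<bar> \<le> C / real (Suc k) ^ p * norm x"
proof -
  obtain C where C: "C \<ge> 0" "\<And>N x. norm (Rop x - trunc N (Rop x)) \<le> C / real (Suc N) ^ p * norm x"
    using Rop_tail by metis
  have "\<bar>crd (Rop x) k\<bar> \<le> C / real (Suc k) ^ p * norm x" for k x
    using crd_bound[of "Rop x - trunc k (Rop x)" k] C(2)[of x k] by (simp add: crd_simps crd_trunc)
  then show thesis using that C(1) by blast
qed

text \<open>The eigenvalue equation reads (d_k - \<lambda>) x_k = - (R x)_k. Where d_k \<ge>
  \<lambda> + 1 the right side decides; the remaining k satisfy k + 1 \<le> L, and there |x_k| \<le>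
  1 suffices.\<close>

lemma ev_decay: obtains C where "\<And>k. \<bar>crd (ev i) k\<bar> \<le> C / real (Suc k) ^ p"
proof -
  obtain C where C: "C \<ge> 0" "\<And>k x. \<bar>crd (Rop x) k\<bar> \<le> C / real (Suc k) ^ p * norm x"
    using Rop_crd_decay by metis
  have n1: "norm (ev i) = 1" using ev_orthonormal[of i i] by (simp add: norm_eq_1)
  define L where "L = 2 * lam i + 2"
  have L: "L > 0" using lam_pos[of i] by (simp add: L_def)
  have "\<bar>crd (ev i) k\<bar> \<le> (C + L ^ p) / real (Suc k) ^ p" for k
  proof (cases "dd k \<ge> lam i + 1")
    case True
    have "\<bar>crd (Rop (ev i)) k\<bar> = (dd k - lam i) * \<bar>crd (ev i) k\<bar>"
    proof -
      have "crd (Rop (ev i)) k = - ((dd k - lam i) * crd (ev i) k)" using ev_eigen[of i k] by (simp add: algebra_simps)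
      then show ?thesis using True by (simp add: abs_mult)
    qed
    moreover have "1 * \<bar>crd (ev i) k\<bar> \<le> (dd k - lam i) * \<bar>crd (ev i) k\<bar>" using True by (intro mult_right_mono) auto
    ultimately have "\<bar>crd (ev i) k\<bar> \<le> C / real (Suc k) ^ p" using C(2)[of "ev i" k] n1 by simp
    also have "\<dots> \<le> (C + L ^ p) / real (Suc k) ^ p" using L by (intro divide_right_mono) auto
    finally show ?thesis .
  next
    case False
    then have "real (Suc k) ^ p \<le> L ^ p" using dd_lower[of k] by (intro power_mono) (auto simp: L_def)
    then have "1 \<le> L ^ p / real (Suc k) ^ p" by (simp add: field_simps)
    also have "\<dots> \<le> (C + L ^ p) / real (Suc k) ^ p" using C(1) by (intro divide_right_mono) auto
    finally show ?thesis using crd_bound[of "ev i" k] n1 by linarith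
  qed
  then show thesis using that by blast
qed

lemma norm_split: "(norm (trunc N x))\<^sup>2 + (norm (x - trunc N x))\<^sup>2 = (norm x)\<^sup>2"
proof -
  have "(\<lambda>k. (crd (trunc N x) k)\<^sup>2 + (crd (x - trunc N x) k)\<^sup>2) sums ((norm (trunc N x))\<^sup>2 + (norm (x - trunc N x))\<^sup>2)"
    by (intro sums_add norm_sums)
  moreover have "(\<lambda>k. (crd (trunc N x) k)\<^sup>2 + (crd (x - trunc N x) k)\<^sup>2) = (\<lambda>k. (crd x k)\<^sup>2)"
    by (rule ext) (simp add: crd_simps crd_trunc)
  ultimately show ?thesis using norm_sums[of x] sums_unique2 by metis
qed

text \<open>In the expansion of x = l + h, every term except <R l, l> pairs an image of R with h,
  and h sees only the tail of that image.\<close>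

lemma Rop_form_tail:
  assumes "\<And>N x. norm (Rop x - trunc N (Rop x)) \<le> e N * norm x" "\<And>N. e N \<ge> 0"
  shows "\<bar>inner (Rop x) x - inner (Rop (trunc N x)) (trunc N x)\<bar> \<le> 2 * e N * (norm x)\<^sup>2"
proof -
  define l h where "l = trunc N x" and "h = x - trunc N x"
  have x: "x = l + h" by (simp add: l_def h_def)
  have b: "\<bar>inner (Rop z) h\<bar> \<le> e N * norm z * norm h" for z
  proof -
    have "inner (trunc N (Rop z)) h = 0"
      by (simp add: trunc_def inner_sum_left inner_unit_seq) (simp add: h_def crd_simps crd_trunc)
    then have "\<bar>inner (Rop z) h\<bar> = \<bar>inner (Rop z - trunc N (Rop z)) h\<bar>" by (simp add: inner_diff_left)
    also have "\<dots> \<le> norm (Rop z - trunc N (Rop z)) * norm h" by (rule Cauchy_Schwarz_ineq2)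
    also have "\<dots> \<le> e N * norm z * norm h" by (intro mult_right_mono assms) auto
    finally show ?thesis .
  qed
  have "inner (Rop x) x - inner (Rop l) l = 2 * inner (Rop l) h + inner (Rop h) h"
    by (simp add: x linear_add[OF Rop_linear] inner_add_left inner_add_right Rop_selfadjoint[of h l] inner_commute[of h "Rop l"])
  then have "\<bar>inner (Rop x) x - inner (Rop l) l\<bar> \<le> e N * (2 * norm l * norm h + (norm h)\<^sup>2)"
    using b[of l] b[of h] by (simp add: algebra_simps power2_eq_square)
  also have "\<dots> \<le> e N * (2 * (norm x)\<^sup>2)"
  proof (intro mult_left_mono assms)
    have "2 * norm l * norm h \<le> (norm l)\<^sup>2 + (norm h)\<^sup>2"
      using zero_le_power2[of "norm l - norm h"] by (simp add: power2_diff)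
    then show "2 * norm l * norm h + (norm h)\<^sup>2 \<le> 2 * (norm x)\<^sup>2"
      using norm_split[of N x] unfolding l_def h_def by (smt (verit) zero_le_power2)
  qed
  finally show ?thesis by (simp add: l_def mult_ac)
qed

text \<open>Some combination of the first N + 1 eigenvectors vanishes in the first N coordinates.
  Its quotient is at most \<lambda>_N for A and at least d_N for the diagonal part.\<close>

lemma lam_lower_form:
  obtains x where "x \<noteq> 0" "\<And>k. k < N \<Longrightarrow> crd x k = 0"
    "dd N * inner x x + inner (Rop x) x \<le> lam N * inner x x"
proof -
  obtain c where c: "(\<Sum>i\<le>N. c i *\<^sub>R ev i) \<noteq> 0" "\<And>j. j < N \<Longrightarrow> inner (\<Sum>i\<le>N. c i *\<^sub>R ev i) (unit_seq j) = 0"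
    "inner (\<Sum>i\<le>N. c i *\<^sub>R ev i) (\<Sum>i\<le>N. c i *\<^sub>R ev i) = (\<Sum>i\<le>N. (c i)\<^sup>2)"
    "\<And>e. inner (\<Sum>i\<le>N. (e i * c i) *\<^sub>R ev i) (\<Sum>i\<le>N. c i *\<^sub>R ev i) = (\<Sum>i\<le>N. e i * (c i)\<^sup>2)"
    by (rule orthogonal_combination[of N ev unit_seq, OF ev_orthonormal]) blast
  define x where "x = (\<Sum>i\<le>N. c i *\<^sub>R ev i)"
  define y where "y = (\<Sum>i\<le>N. (lam i * c i) *\<^sub>R ev i)"
  have g: "A_graph x y" unfolding x_def y_def by (rule A_graph_comb)
  have z: "crd x k = 0" if "k < N" for k using c(2)[OF that] by (simp add: x_def inner_unit_seq)
  have "inner y x \<le> (\<Sum>i\<le>N. lam N * (c i)\<^sup>2)"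
    unfolding x_def y_def c(4) by (intro sum_mono mult_right_mono lam_mono) auto
  then have 1: "inner y x \<le> lam N * inner x x" by (simp add: x_def c(3) sum_distrib_left)
  have "dd N * (norm x)\<^sup>2 \<le> inner y x - inner (Rop x) x"
  proof (rule sums_le[OF _ sums_mult[OF norm_sums] A_form_sums[OF g]])
    fix k show "dd N * (crd x k)\<^sup>2 \<le> dd k * (crd x k)\<^sup>2"
      using z[of k] dd_mono[of N k] by (cases "k < N") (auto intro: mult_right_mono)
  qed
  then show thesis using that[of x] c(1) z 1 by (simp add: x_def[symmetric] power2_norm_eq_inner)
qed

lemma lam_ge_of_Rm_zero:
  assumes "\<And>k l. Rm k l = 0"
  shows "dd N \<le> lam N"
proof -
  have z: "Rop x = 0" for x
    by (rule ell2_eqI) (use mat_op_sums[OF hs_Rm, of _ x] in \<open>simp add: assms crd_zero sums_iff\<close>)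
  obtain x where "x \<noteq> 0" "dd N * inner x x + inner (Rop x) x \<le> lam N * inner x x" by (metis lam_lower_form)
  then show ?thesis by (simp add: z)
qed

definition A_fin :: "nat \<Rightarrow> ell2 \<Rightarrow> ell2" where "A_fin K x = (\<Sum>k<K. crd x k *\<^sub>R A_col k)"

lemma A_graph_fin: "trunc K x = x \<Longrightarrow> A_graph x (A_fin K x)"
  by (simp add: A_graph_iff A_fin_def linear_sum[OF Top_linear] linear_scale[OF Top_linear] Top_A_col trunc_def)

text \<open>On long initial segments the form of A is asymptotically bounded by that of the diagonal part:
  the perturbation is negligible beyond half the length, and swamped by the spectral gap before it.\<close>

lemma A_form_upper:
  assumes e: "\<And>N x. norm (Rop x - trunc N (Rop x)) \<le> e N * norm x" "\<And>N. e N \<ge> 0"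
  shows "\<exists>N0. \<forall>N\<ge>N0. \<forall>x y. trunc (Suc N) x = x \<longrightarrow> A_graph x y \<longrightarrow>
    inner y x \<le> (dd N + 2 * e (N div 2)) * (norm x)\<^sup>2"
proof -
  obtain B where B: "\<And>x. norm (Rop x) \<le> norm x * B" "B > 0"
    using bounded_linear.pos_bounded[OF bounded_linear_mat_op[OF hs_Rm]] by blast
  \<comment> \<open>Chosen so that the gap between d_N and d_{N div 2}, about N / 4, exceeds the
    operator bound B.\<close>
  obtain N0 :: nat where N0: "real N0 \<ge> 4 * B + 4" using real_arch_simple by blast
  have "inner y x \<le> (dd N + 2 * e (N div 2)) * (norm x)\<^sup>2"
    if N: "N \<ge> N0" and x: "trunc (Suc N) x = x" and g: "A_graph x y" for N x y
  proof -
    define M where "M = N div 2"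
    define l h where "l = trunc M x" and "h = x - trunc M x"
    have gap: "dd M + B \<le> dd N"
    proof -
      have "real M \<le> real N / 2" unfolding M_def by linarith
      moreover have "real N0 \<le> real N" using N by simp
      ultimately show ?thesis using dd_upper[of M] dd_lower[of N] N0 by simp
    qed
    have "inner y x - inner (Rop x) x \<le> dd M * (norm l)\<^sup>2 + dd N * (norm h)\<^sup>2"
    proof (rule sums_le[OF _ A_form_sums[OF g] sums_add[OF sums_mult[OF norm_sums] sums_mult[OF norm_sums]]])
      fix k
      have "crd x k = 0" if "k > N" using x that by (metis crd_trunc less_Suc_eq_le not_le)
      then show "dd k * (crd x k)\<^sup>2 \<le> dd M * (crd l k)\<^sup>2 + dd N * (crd h k)\<^sup>2"
        using dd_mono[of k M] dd_mono[of k N]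
        by (cases "k < M"; cases "k > N") (auto simp: l_def h_def crd_simps crd_trunc intro!: mult_right_mono)
    qed
    moreover have "\<bar>inner (Rop x) x - inner (Rop l) l\<bar> \<le> 2 * e M * (norm x)\<^sup>2"
      unfolding l_def by (rule Rop_form_tail[OF e])
    moreover have "inner (Rop l) l \<le> B * (norm l)\<^sup>2"
    proof -
      have "inner (Rop l) l \<le> norm (Rop l) * norm l" by (rule norm_cauchy_schwarz)
      also have "\<dots> \<le> norm l * B * norm l" by (intro mult_right_mono B) auto
      finally show ?thesis by (simp add: power2_eq_square mult_ac)
    qed
    ultimately have "inner y x \<le> (dd M + B) * (norm l)\<^sup>2 + dd N * (norm h)\<^sup>2 + 2 * e M * (norm x)\<^sup>2"
      by (simp add: algebra_simps)
    also have "\<dots> \<le> dd N * (norm l)\<^sup>2 + dd N * (norm h)\<^sup>2 + 2 * e M * (norm x)\<^sup>2"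
      using gap by (intro add_right_mono mult_right_mono) auto
    also have "\<dots> = (dd N + 2 * e M) * (norm x)\<^sup>2"
      using norm_split[of M x] unfolding l_def h_def by (metis distrib_left distrib_right)
    finally show ?thesis by (simp add: M_def)
  qed
  then show ?thesis by blast
qed

text \<open>Min-max from both sides. The vector of \<open>lam_lower_form\<close> lives beyond
  coordinate N, where R is of size e N; the upper bound tests with unit sequences and uses
  \<open>A_form_upper\<close>. The indices below N0 go into the constant through Q.\<close>

lemma lam_asymptotics: "\<exists>C. \<forall>k. \<bar>lam k - dd k\<bar> \<le> C / real (Suc k) ^ p"
proof -
  obtain C where C: "C \<ge> 0" "\<And>N x. norm (Rop x - trunc N (Rop x)) \<le> C / real (Suc N) ^ p * norm x"
    using Rop_tail by metis
  define e where "e N = C / real (Suc N) ^ p" for N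
  have e: "\<And>N x. norm (Rop x - trunc N (Rop x)) \<le> e N * norm x" "\<And>N. e N \<ge> 0" using C by (auto simp: e_def)
  obtain N0 where N0: "\<And>N x y. N \<ge> N0 \<Longrightarrow> trunc (Suc N) x = x \<Longrightarrow> A_graph x y \<Longrightarrow>
      inner y x \<le> (dd N + 2 * e (N div 2)) * (norm x)\<^sup>2"
    using A_form_upper[OF e] by blast
  have low: "lam N \<ge> dd N - 2 * e N" for N
  proof -
    obtain x where x: "x \<noteq> 0" "\<And>k. k < N \<Longrightarrow> crd x k = 0"
      "dd N * inner x x + inner (Rop x) x \<le> lam N * inner x x" by (metis lam_lower_form)
    have "trunc N x = 0" by (rule ell2_eqI) (simp add: crd_trunc x crd_zero)
    then have "\<bar>inner (Rop x) x\<bar> \<le> 2 * e N * inner x x"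
      using Rop_form_tail[OF e, of x N] by (simp add: power2_norm_eq_inner)
    then have "(dd N - 2 * e N) * inner x x \<le> lam N * inner x x" using x(3) by (simp add: algebra_simps)
    then show ?thesis using x(1) by simp
  qed
  have up: "lam N \<le> dd N + 2 * e (N div 2)" if N: "N \<ge> N0" for N
  proof -
    have on: "inner (unit_seq i) (unit_seq j) = (if i = j then 1 else 0)" for i j
      by (simp add: inner_unit_seq crd_unit_seq)
    obtain c where c: "(\<Sum>i\<le>N. c i *\<^sub>R unit_seq i) \<noteq> 0" "\<And>j. j < N \<Longrightarrow> inner (\<Sum>i\<le>N. c i *\<^sub>R unit_seq i) (ev j) = 0"
      using orthogonal_combination[of N unit_seq ev] on by metis
    define x where "x = (\<Sum>i\<le>N. c i *\<^sub>R unit_seq i)"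
    have tx: "trunc (Suc N) x = x"
    proof (rule ell2_eqI)
      fix k
      have "crd x k = (\<Sum>i\<le>N. if i = k then c i else 0)"
        unfolding x_def crd_sum by (intro sum.cong) (auto simp: crd_simps crd_unit_seq)
      then show "crd (trunc (Suc N) x) k = crd x k" by (auto simp: crd_trunc)
    qed
    have "lam N * inner x x \<le> inner (A_fin (Suc N) x) x"
      using c(2) by (intro A_form_lower A_graph_fin tx) (simp add: x_def)
    also have "\<dots> \<le> (dd N + 2 * e (N div 2)) * inner x x"
      using N0[OF N tx A_graph_fin[OF tx]] by (simp add: power2_norm_eq_inner)
    finally show ?thesis using c(1) by (simp add: x_def)
  qed
  define Q where "Q = lam N0 + dd N0"
  have Q0: "Q \<ge> 0" unfolding Q_def using lam_pos[of N0] dd_pos(1)[of N0] by linarith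
  have "\<bar>lam k - dd k\<bar> \<le> (2 * C * 2 ^ p + Q * real (Suc N0) ^ p) / real (Suc k) ^ p" for k
  proof (cases "k \<ge> N0")
    case True
    have "real (Suc k) \<le> 2 * real (Suc (k div 2))" using dd_lower[of k] by (simp add: dd_def)
    then have "real (Suc k) ^ p \<le> 2 ^ p * real (Suc (k div 2)) ^ p"
      by (metis power_mono power_mult_distrib of_nat_0_le_iff)
    then have eh: "e (k div 2) \<le> C * 2 ^ p / real (Suc k) ^ p"
      using C(1) by (simp add: e_def field_simps) (metis mult.assoc mult.commute mult_left_mono)
    have "real (Suc (k div 2)) ^ p \<le> real (Suc k) ^ p" by (intro power_mono) auto
    then have "e k \<le> e (k div 2)" unfolding e_def using C(1) by (intro divide_left_mono) auto
    then have "\<bar>lam k - dd k\<bar> \<le> 2 * (C * 2 ^ p / real (Suc k) ^ p)" using low[of k] up[OF True] eh by (simp add: abs_le_iff)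
    also have "\<dots> \<le> (2 * C * 2 ^ p + Q * real (Suc N0) ^ p) / real (Suc k) ^ p"
    proof -
      have "0 \<le> Q * real (Suc N0) ^ p / real (Suc k) ^ p" using Q0 by simp
      then show ?thesis unfolding add_divide_distrib by (simp add: mult.assoc)
    qed
    finally show ?thesis .
  next
    case False
    have "\<bar>lam k - dd k\<bar> \<le> Q"
      using lam_mono[of k N0] dd_mono[of k N0] lam_pos[of k] dd_pos(1)[of k] False unfolding Q_def by linarith
    also have "\<dots> \<le> Q * real (Suc N0) ^ p / real (Suc k) ^ p"
    proof -
      have "real (Suc k) ^ p \<le> real (Suc N0) ^ p" using False by (intro power_mono) auto
      then show ?thesis using Q0 by (simp add: field_simps mult_left_mono)
    qed
    also have "\<dots> \<le> (2 * C * 2 ^ p + Q * real (Suc N0) ^ p) / real (Suc k) ^ p"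
      using C(1) by (intro divide_right_mono) auto
    finally show ?thesis .
  qed
  then show ?thesis by blast
qed

lemma lam_at_top: "filterlim lam at_top sequentially"
proof -
  obtain C where C: "\<And>k. \<bar>lam k - dd k\<bar> \<le> C / real (Suc k) ^ 0" using lam_asymptotics[of 0] by blast
  have le: "real k / 2 - C \<le> lam k" for k using C[of k] dd_lower[of k] by (simp add: abs_le_iff)
  have "filterlim (\<lambda>k. real k / 2 - C) at_top sequentially" by real_asymp
  then show ?thesis by (rule filterlim_at_top_mono[OF _ always_eventually]) (use le in blast)
qed

text \<open>On the complement of all eigenvectors the form of T is bounded by \<open>tau n\<close>
  for every n, and \<open>tau\<close> tends to 0.\<close>

lemma ev_complete:
  assumes "\<And>i. inner x (ev i) = 0"
  shows "x = 0"
proof -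
  have "(\<lambda>n. tau n * inner x x) \<longlonglongrightarrow> 0 * inner x x"
  proof (intro tendsto_mult tendsto_const)
    have "(\<lambda>n. 1 / lam n) \<longlonglongrightarrow> 0"
      using tendsto_inverse_0_at_top[OF lam_at_top] by (simp add: inverse_eq_divide)
    then show "tau \<longlonglongrightarrow> 0" by (simp add: lam_def)
  qed
  moreover have "inner (Top x) x \<le> tau n * inner x x" for n using assms by (intro Top_max)
  ultimately have "inner (Top x) x \<le> 0" by (intro LIMSEQ_le_const[of "\<lambda>n. tau n * inner x x"]) auto
  then show ?thesis using Top_nonneg[of x] Top_inner_zero[of x] by simp
qed

text \<open>Since d_0 = d_1 = 1, the first two diagonal entries of T are \<open>A 1 1\<close> and
  \<open>A 0 0\<close>, and both are Rayleigh quotients of T. This bound on energies starts the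
  rigidity argument.\<close>

lemma A_diag_le: "A 0 0 \<le> 1 / lam 0" "A 1 1 \<le> 1 / lam 0"
proof -
  have "Tm k k \<le> tau 0" for k
    using Top_max[of 0 "unit_seq k"] by (simp add: inner_unit_seq mat_op_unit_seq[OF hs_Tm] crd_unit_seq)
  from this[of 0] this[of 1] show "A 0 0 \<le> 1 / lam 0" "A 1 1 \<le> 1 / lam 0"
    by (auto simp: Tm_def dd_def partner_def sg_def lam_def)
qed

end

section \<open>Finite sections and their determinants\<close>

lemma finite_spectral:
  fixes X :: "nat \<Rightarrow> nat \<Rightarrow> real"
  assumes sym: "\<And>k l. X k l = X l k"
    and pd: "\<And>x. (\<exists>k<K. x k \<noteq> 0) \<Longrightarrow> 0 < (\<Sum>k<K. \<Sum>l<K. X k l * x k * x l)"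
  obtains u t where "\<And>i j. inner (u i) (u j) = (if i = j then 1 else 0)" "\<And>i. i < K \<Longrightarrow> trunc K (u i) = u i"
    "\<And>i k. i < K \<Longrightarrow> k < K \<Longrightarrow> (\<Sum>l<K. X k l * crd (u i) l) = t i * crd (u i) k"
    "\<And>i. i < K \<Longrightarrow> 0 < t i" "antimono t"
    "\<And>n y. trunc K y = y \<Longrightarrow> \<forall>i<n. inner y (u i) = 0 \<Longrightarrow>
        (\<Sum>k<K. \<Sum>l<K. X k l * crd y k * crd y l) \<le> t n * inner y y"
proof -
  \<comment> \<open>Padding by zeros lets the spectral theorem for compact operators serve finite
    matrices. Positive definiteness makes the first K eigenvalues positive, which confines their
    eigenvectors to the section.\<close>
  define Y where "Y k l = (if k < K \<and> l < K then X k l else 0)" for k l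
  have ssum: "summable (\<lambda>l. (Y k l)\<^sup>2)" for k by (rule summable_finite[of "{..<K}"]) (auto simp: Y_def)
  have "summable (\<lambda>k. \<Sum>l. (Y k l)\<^sup>2)" by (rule summable_finite[of "{..<K}"]) (auto simp: Y_def)
  then have hs: "hs_matrix Y" using ssum by (simp add: hs_matrix_def)
  have Ysym: "Y k l = Y l k" for k l using sym by (auto simp: Y_def)
  have X0: "0 \<le> (\<Sum>k<K. \<Sum>l<K. X k l * x k * x l)" for x
  proof (cases "\<exists>k<K. x k \<noteq> 0")
    case False
    then show ?thesis by (intro sum_nonneg) auto
  qed (use pd[of x] in auto)
  have "0 \<le> (\<Sum>k<n. \<Sum>l<n. Y k l * x k * x l)" for n and x :: "nat \<Rightarrow> real"
  proof -
    define z where "z k = (if k < n then x k else 0)" for k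
    have "(\<Sum>k<n. \<Sum>l<n. Y k l * x k * x l) = (\<Sum>k<n. \<Sum>l<n. Y k l * z k * z l)"
      by (intro sum.cong) (auto simp: z_def)
    also have "\<dots> = (\<Sum>k<n. \<Sum>l<max n K. Y k l * z k * z l)"
      by (intro sum.cong sum.mono_neutral_left refl) (auto simp: z_def)
    also have "\<dots> = (\<Sum>k<max n K. \<Sum>l<max n K. Y k l * z k * z l)"
      by (intro sum.mono_neutral_left) (auto simp: z_def)
    also have "\<dots> = (\<Sum>k<max n K. \<Sum>l<K. Y k l * z k * z l)"
      by (intro sum.cong sum.mono_neutral_right refl) (auto simp: Y_def)
    also have "\<dots> = (\<Sum>k<K. \<Sum>l<K. Y k l * z k * z l)"
      by (intro sum.mono_neutral_right) (auto simp: Y_def)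
    also have "\<dots> = (\<Sum>k<K. \<Sum>l<K. X k l * z k * z l)"
      by (intro sum.cong) (auto simp: Y_def)
    finally show ?thesis using X0[of z] by simp
  qed
  then have psd: "compact_psd (mat_op Y)" by (rule mat_op_compact_psd[OF hs Ysym])
  obtain u t where u: "\<And>i j. inner (u i) (u j) = (if i = j then 1 else 0)"
    "\<And>i::nat. mat_op Y (u i) = t i *\<^sub>R u i" "\<And>i. 0 \<le> t i" "antimono t"
    "\<And>n y. \<forall>i<n. inner y (u i) = 0 \<Longrightarrow> inner (mat_op Y y) y \<le> t n * inner y y"
    by (rule compact_psd_spectral[OF psd ell2_infinite_dim]) blast
  have op: "crd (mat_op Y x) k = (\<Sum>l<K. Y k l * crd x l)" for x k
  proof -
    have "(\<lambda>l. Y k l * crd x l) sums (\<Sum>l<K. Y k l * crd x l)" by (rule sums_finite) (auto simp: Y_def)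
    then show ?thesis using mat_op_sums[OF hs, of k x] sums_unique2 by blast
  qed
  have form: "inner (mat_op Y y) y = (\<Sum>k<K. \<Sum>l<K. X k l * crd y k * crd y l)" if "trunc K y = y" for y
  proof -
    have "inner (mat_op Y y) y = (\<Sum>k<K. \<Sum>l<K. Y k l * crd y k * crd y l)"
      using mat_op_trunc_inner[OF hs, of K y] that by simp
    also have "\<dots> = (\<Sum>k<K. \<Sum>l<K. X k l * crd y k * crd y l)" by (intro sum.cong) (auto simp: Y_def)
    finally show ?thesis .
  qed
  have tpos: "0 < t i" if i: "i < K" for i
  proof -
    \<comment> \<open>A nonzero vector on the first i + 1 coordinates, orthogonal to the earlier
      eigenvectors, has positive form; the maximum property then gives \<open>t i\<close> >
      0.\<close>
    obtain c where c: "(\<exists>j\<le>i. c j \<noteq> 0)" "\<forall>j<i. (\<Sum>k\<le>i. c k * crd (u j) k) = 0"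
      using homogeneous_system_nontrivial[of i "\<lambda>j k. crd (u j) k"] by blast
    define x where "x = (\<Sum>k\<le>i. c k *\<^sub>R unit_seq k)"
    have xk: "crd x k = (if k \<le> i then c k else 0)" for k
    proof -
      have "crd x k = (\<Sum>j\<le>i. if j = k then c j else 0)"
        unfolding x_def crd_sum by (intro sum.cong) (auto simp: crd_simps crd_unit_seq)
      then show ?thesis by simp
    qed
    have tx: "trunc K x = x" by (rule ell2_eqI) (use i in \<open>auto simp: crd_trunc xk\<close>)
    have "\<forall>j<i. inner x (u j) = 0"
      using c(2) by (simp add: x_def inner_sum_left inner_unit_seq)
    then have "inner (mat_op Y x) x \<le> t i * inner x x" by (rule u(5))
    moreover have "0 < inner (mat_op Y x) x" unfolding form[OF tx]
      by (rule pd) (use c(1) i xk in \<open>metis le_less_trans\<close>)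
    ultimately show ?thesis using u(3)[of i] by (metis less_le_trans mult_zero_left order_le_less order_less_irrefl)
  qed
  show thesis
  proof
    show "inner (u i) (u j) = (if i = j then 1 else 0)" for i j by (rule u(1))
    show "0 < t i" if "i < K" for i using tpos that .
    show "antimono t" by (rule u(4))
    show "trunc K (u i) = u i" if i: "i < K" for i
    proof (rule ell2_eqI)
      fix k
      have "t i * crd (u i) k = 0" if "\<not> k < K"
        using op[of "u i" k] that by (simp add: u(2) crd_simps Y_def)
      then show "crd (trunc K (u i)) k = crd (u i) k" using tpos[OF i] by (auto simp: crd_trunc)
    qed
    show "(\<Sum>l<K. X k l * crd (u i) l) = t i * crd (u i) k" if "i < K" "k < K" for i k
    proof -
      have "(\<Sum>l<K. X k l * crd (u i) l) = (\<Sum>l<K. Y k l * crd (u i) l)" using that by (intro sum.cong) (auto simp: Y_def)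
      then show ?thesis using op[of "u i" k] by (simp add: u(2) crd_simps)
    qed
    show "(\<Sum>k<K. \<Sum>l<K. X k l * crd y k * crd y l) \<le> t n * inner y y"
      if "trunc K y = y" "\<forall>i<n. inner y (u i) = 0" for n y
      using u(5)[OF that(2)] form[OF that(1)] by simp
  qed
qed

lemma det_diagonal_mat:
  "Determinant.det (Matrix.mat K K (\<lambda>(i, j). if i = j then t i else 0)) = (\<Prod>i<K. t i :: real)"
proof -
  have *: "prod_list (map f [0..<K]) = (\<Prod>i<K. f i)" for f :: "nat \<Rightarrow> real" by (induction K) auto
  show ?thesis
    by (subst det_upper_triangular[of _ K]) (auto simp: diag_mat_def * upper_triangular_def intro!: prod.cong)
qed

text \<open>With Q orthogonal, X Q = Q diag(t), and the determinant of Q cancels.\<close>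

lemma det_eq_prod_eigenvalues:
  fixes X Q :: "nat \<Rightarrow> nat \<Rightarrow> real"
  assumes "\<And>i j. i < K \<Longrightarrow> j < K \<Longrightarrow> (\<Sum>k<K. Q i k * Q j k) = (if i = j then 1 else 0)"
    and "\<And>i k. i < K \<Longrightarrow> k < K \<Longrightarrow> (\<Sum>l<K. X k l * Q i l) = t i * Q i k"
  shows "Determinant.det (Matrix.mat K K (\<lambda>(k, l). X k l)) = (\<Prod>i<K. t i)"
proof -
  define XM where "XM = Matrix.mat K K (\<lambda>(k, l). X k l)"
  define QM where "QM = Matrix.mat K K (\<lambda>(k, i). Q i k)"
  define DM where "DM = Matrix.mat K K (\<lambda>(i, j). if i = j then t i else 0)"
  have car: "XM \<in> carrier_mat K K" "QM \<in> carrier_mat K K" "DM \<in> carrier_mat K K"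
    "transpose_mat QM \<in> carrier_mat K K" by (auto simp: XM_def QM_def DM_def)
  have 1: "XM * QM = QM * DM"
  proof (rule eq_matI)
    fix k i assume "k < dim_row (QM * DM)" "i < dim_col (QM * DM)"
    then have ki: "k < K" "i < K" using car by auto
    have "(XM * QM) $$ (k, i) = (\<Sum>l<K. X k l * Q i l)"
      using ki by (simp add: XM_def QM_def scalar_prod_def atLeast0LessThan)
    moreover have "(QM * DM) $$ (k, i) = (\<Sum>l<K. if l = i then Q l k * t l else 0)"
      using ki by (simp add: QM_def DM_def scalar_prod_def atLeast0LessThan if_distrib[of "times _"] cong: if_cong)
    ultimately show "(XM * QM) $$ (k, i) = (QM * DM) $$ (k, i)" using ki assms(2) by (simp add: mult.commute)
  qed (use car in auto)
  have 2: "transpose_mat QM * QM = 1\<^sub>m K"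
  proof (rule eq_matI)
    fix i j assume "i < dim_row (1\<^sub>m K :: real mat)" "j < dim_col (1\<^sub>m K :: real mat)"
    then show "(transpose_mat QM * QM) $$ (i, j) = 1\<^sub>m K $$ (i, j)"
      using assms(1)[of i j] by (simp add: QM_def scalar_prod_def atLeast0LessThan)
  qed (use car in auto)
  have "Determinant.det QM * Determinant.det QM = 1"
    using det_mult[OF car(4) car(2)] det_transpose[OF car(2)] unfolding 2 by simp
  then have "Determinant.det QM \<noteq> 0" by auto
  moreover have "Determinant.det XM * Determinant.det QM = Determinant.det QM * Determinant.det DM"
    using det_mult[OF car(1) car(2)] det_mult[OF car(2) car(3)] unfolding 1 by metis
  ultimately have "Determinant.det XM = Determinant.det DM" by auto
  then show ?thesis unfolding XM_def DM_def det_diagonal_mat .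
qed

context steklov_matrix
begin

text \<open>The section of T is N^T A N, where N is the signed permutation divided by the d_k. The
  sign of det N cancels, as N^T N is diagonal with entries 1 / d_k^2.\<close>

lemma det_Tm_block:
  "Determinant.det (Matrix.mat (2 * M) (2 * M) (\<lambda>(k, l). Tm k l)) =
    (\<Prod>k<2*M. 1 / (dd k)\<^sup>2) * Determinant.det (Matrix.mat (2 * M) (2 * M) (\<lambda>(k, l). A k l))"
proof -
  define K where "K = 2 * M"
  define AM where "AM = Matrix.mat K K (\<lambda>(k, l). A k l)"
  define TM where "TM = Matrix.mat K K (\<lambda>(k, l). Tm k l)"
  define NM where "NM = Matrix.mat K K (\<lambda>(a, k). if a = partner k then sg k / dd k else 0)"
  define DM where "DM = Matrix.mat K K (\<lambda>(i, j). if i = j then 1 / (dd i)\<^sup>2 else 0)"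
  have car: "AM \<in> carrier_mat K K" "TM \<in> carrier_mat K K" "NM \<in> carrier_mat K K"
    "transpose_mat NM \<in> carrier_mat K K" "AM * NM \<in> carrier_mat K K"
    by (auto simp: AM_def TM_def NM_def)
  have pK: "partner k < K" if "k < K" for k using that by (simp add: K_def)
  have AN: "(AM * NM) $$ (a, l) = A a (partner l) * (sg l / dd l)" if "a < K" "l < K" for a l
    using that pK[of l]
    by (simp add: AM_def NM_def scalar_prod_def atLeast0LessThan if_distrib[of "times _"] cong: if_cong)
  have NX: "(transpose_mat NM * Y) $$ (k, l) = (sg k / dd k) * Y $$ (partner k, l)"
    if "k < K" "l < K" "Y \<in> carrier_mat K K" for k l Y
    using that pK[of k]
    by (auto simp: NM_def scalar_prod_def atLeast0LessThan if_distrib[of "\<lambda>x. x * _"] cong: if_cong)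
  have 1: "transpose_mat NM * (AM * NM) = TM"
  proof (rule eq_matI)
    fix k l assume "k < dim_row TM" "l < dim_col TM"
    then have kl: "k < K" "l < K" using car by auto
    show "(transpose_mat NM * (AM * NM)) $$ (k, l) = TM $$ (k, l)"
      using kl pK by (simp add: NX[OF kl car(5)] AN) (simp add: TM_def Tm_def)
  qed (use car in auto)
  have 2: "transpose_mat NM * NM = DM"
  proof (rule eq_matI)
    fix k l assume "k < dim_row DM" "l < dim_col DM"
    then have kl: "k < K" "l < K" by (auto simp: DM_def)
    have "partner k = partner l \<longleftrightarrow> k = l" by (metis partner_simps(1))
    then show "(transpose_mat NM * NM) $$ (k, l) = DM $$ (k, l)"
      using kl pK by (simp add: NX[OF kl car(3)]) (simp add: NM_def DM_def power2_eq_square)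
  qed (use car in \<open>auto simp: DM_def\<close>)
  have "Determinant.det TM = Determinant.det NM * (Determinant.det AM * Determinant.det NM)"
    using det_mult[OF car(4) car(5)] det_mult[OF car(1) car(3)] det_transpose[OF car(3)] 1 by simp
  moreover have "Determinant.det NM * Determinant.det NM = (\<Prod>k<K. 1 / (dd k)\<^sup>2)"
    using det_mult[OF car(4) car(3)] det_transpose[OF car(3)] det_diagonal_mat[of K "\<lambda>k. 1 / (dd k)\<^sup>2"]
    unfolding 2 DM_def by simp
  ultimately show ?thesis unfolding AM_def TM_def K_def by (simp add: mult_ac)
qed

lemma inner_supported: "trunc K x = x \<Longrightarrow> inner y x = (\<Sum>k<K. crd y k * crd x k)"
proof -
  assume x: "trunc K x = x"
  have "inner y (trunc K x) = (\<Sum>k<K. crd y k * crd x k)"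
    by (simp add: trunc_def inner_sum_right inner_unit_seq mult.commute)
  then show ?thesis using x by simp
qed

lemma A_fin_form:
  assumes "trunc K x = x"
  shows "inner (A_fin K x) x = (\<Sum>k<K. \<Sum>l<K. A k l * crd x k * crd x l)"
proof -
  have "inner (A_fin K x) x = (\<Sum>k<K. crd x k * inner (A_col k) x)" by (simp add: A_fin_def inner_sum_left)
  then show ?thesis by (simp add: inner_supported[OF assms] crd_A_col sum_distrib_left mult_ac)
qed

lemma Top_form:
  assumes "trunc K x = x"
  shows "inner (Top x) x = (\<Sum>k<K. \<Sum>l<K. Tm k l * crd x k * crd x l)"
  using mat_op_trunc_inner[OF hs_Tm, of K x] assms by simp

lemma supported_seq:
  obtains x where "trunc K x = x" "\<And>k. k < K \<Longrightarrow> crd x k = f k"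
proof -
  define x where "x = (\<Sum>k<K. f k *\<^sub>R unit_seq k)"
  have xk: "crd x k = (if k < K then f k else 0)" for k
  proof -
    have "crd x k = (\<Sum>j<K. if j = k then f j else 0)"
      unfolding x_def crd_sum by (intro sum.cong) (auto simp: crd_simps crd_unit_seq)
    then show ?thesis by simp
  qed
  show thesis by (rule that[of x]) (auto intro!: ell2_eqI simp: crd_trunc xk)
qed

text \<open>The spectral theorem lists eigenvalues from the top, while the comparison needs them
  from the bottom; hence it is applied to c - A, with c large enough for positive
  definiteness.\<close>

lemma A_block_eigenvalues:
  obtains u \<alpha> where "\<And>i j. inner (u i) (u j) = (if i = j then 1 else 0)" "\<And>i. i < K \<Longrightarrow> trunc K (u i) = u i"
    "\<And>i k. i < K \<Longrightarrow> k < K \<Longrightarrow> (\<Sum>l<K. A k l * crd (u i) l) = \<alpha> i * crd (u i) k" "mono \<alpha>"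
    "\<And>n y. trunc K y = y \<Longrightarrow> \<forall>i<n. inner y (u i) = 0 \<Longrightarrow> \<alpha> n * inner y y \<le> inner (A_fin K y) y"
proof -
  define c where "c = (\<Sum>k<K. \<Sum>l<K. \<bar>A k l\<bar>) + 1"
  define X where "X k l = (if k = l then c else 0) - A k l" for k l
  have XA: "(\<Sum>k<K. \<Sum>l<K. X k l * x k * x l) = c * (\<Sum>k<K. (x k)\<^sup>2) - (\<Sum>k<K. \<Sum>l<K. A k l * x k * x l)" for x
  proof -
    have "(\<Sum>k<K. \<Sum>l<K. X k l * x k * x l) = (\<Sum>k<K. (\<Sum>l<K. if l = k then c * x k * x k else 0) - (\<Sum>l<K. A k l * x k * x l))"
      unfolding sum_subtractf[symmetric] by (intro sum.cong) (auto simp: X_def left_diff_distrib)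
    then show ?thesis by (simp add: sum_subtractf sum_distrib_left power2_eq_square mult.assoc)
  qed
  have pd: "0 < (\<Sum>k<K. \<Sum>l<K. X k l * x k * x l)" if x: "\<exists>k<K. x k \<noteq> 0" for x
  proof -
    define s where "s = (\<Sum>k<K. (x k)\<^sup>2)"
    have s: "s > 0" 
    proof -
      obtain k0 where "k0 < K" "x k0 \<noteq> 0" using x by blast
      then show ?thesis unfolding s_def by (intro sum_pos2[of _ k0]) auto
    qed
    have xs: "\<bar>x k * x l\<bar> \<le> s" if "k < K" "l < K" for k l
    proof -
      have "(x k)\<^sup>2 \<le> s" "(x l)\<^sup>2 \<le> s" unfolding s_def using that by (auto intro!: member_le_sum)
      moreover have "2 * (\<bar>x k\<bar> * \<bar>x l\<bar>) \<le> (x k)\<^sup>2 + (x l)\<^sup>2"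
        using zero_le_power2[of "\<bar>x k\<bar> - \<bar>x l\<bar>"] by (simp add: power2_diff)
      ultimately show ?thesis unfolding abs_mult by linarith
    qed
    have "(\<Sum>k<K. \<Sum>l<K. A k l * x k * x l) \<le> (\<Sum>k<K. \<Sum>l<K. \<bar>A k l\<bar> * s)"
    proof (intro sum_mono)
      fix k l assume "k \<in> {..<K}" "l \<in> {..<K}"
      then have "\<bar>A k l\<bar> * \<bar>x k * x l\<bar> \<le> \<bar>A k l\<bar> * s" using xs by (intro mult_left_mono) auto
      moreover have "A k l * x k * x l \<le> \<bar>A k l\<bar> * \<bar>x k * x l\<bar>" by (metis abs_ge_self abs_mult mult.assoc)
      ultimately show "A k l * x k * x l \<le> \<bar>A k l\<bar> * s" by linarith
    qed
    also have "\<dots> = (c - 1) * s" by (simp add: c_def sum_distrib_right)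
    finally show ?thesis unfolding XA s_def[symmetric] using s by (simp add: left_diff_distrib)
  qed
  have Xs: "X k l = X l k" for k l by (auto simp: X_def A_sym)
  obtain u t where u: "\<And>i j. inner (u i) (u j) = (if i = j then 1 else 0)" "\<And>i. i < K \<Longrightarrow> trunc K (u i) = u i"
    "\<And>i k. i < K \<Longrightarrow> k < K \<Longrightarrow> (\<Sum>l<K. X k l * crd (u i) l) = t i * crd (u i) k"
    "\<And>i. i < K \<Longrightarrow> 0 < t i" "antimono t"
    "\<And>n y. trunc K y = y \<Longrightarrow> \<forall>i<n. inner y (u i) = 0 \<Longrightarrow>
        (\<Sum>k<K. \<Sum>l<K. X k l * crd y k * crd y l) \<le> t n * inner y y"
    by (rule finite_spectral[OF Xs pd]) blast+
  show thesis
  proof (rule that[of u "\<lambda>i. c - t i"])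
    show "(\<Sum>l<K. A k l * crd (u i) l) = (c - t i) * crd (u i) k" if ik: "i < K" "k < K" for i k
    proof -
      have "(\<Sum>l<K. X k l * crd (u i) l) = (\<Sum>l<K. if l = k then c * crd (u i) k else 0) - (\<Sum>l<K. A k l * crd (u i) l)"
        unfolding sum_subtractf[symmetric] by (intro sum.cong) (auto simp: X_def left_diff_distrib)
      then show ?thesis using u(3)[OF ik] ik by (simp add: algebra_simps)
    qed
    show "mono (\<lambda>i. c - t i)" using u(5) by (auto simp: monotone_on_def)
    show "(c - t n) * inner y y \<le> inner (A_fin K y) y"
      if y: "trunc K y = y" "\<forall>i<n. inner y (u i) = 0" for n y
    proof -
      have "inner y y = (\<Sum>k<K. (crd y k)\<^sup>2)" by (simp add: inner_supported[OF y(1)] power2_eq_square)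
      then show ?thesis using u(6)[OF y] unfolding XA A_fin_form[OF y(1)] by (simp add: left_diff_distrib)
    qed
  qed (use u in auto)
qed

lemma T_block_eigenvalues:
  obtains v \<mu> where "\<And>i j. inner (v i) (v j) = (if i = j then 1 else 0)" "\<And>i. i < K \<Longrightarrow> trunc K (v i) = v i"
    "\<And>i k. i < K \<Longrightarrow> k < K \<Longrightarrow> (\<Sum>l<K. Tm k l * crd (v i) l) = \<mu> i * crd (v i) k" "antimono \<mu>"
    "\<And>i. i < K \<Longrightarrow> 0 < \<mu> i"
    "\<And>n y. trunc K y = y \<Longrightarrow> \<forall>i<n. inner y (v i) = 0 \<Longrightarrow> inner (Top y) y \<le> \<mu> n * inner y y"
proof -
  have pd: "0 < (\<Sum>k<K. \<Sum>l<K. Tm k l * f k * f l)" if f: "\<exists>k<K. f k \<noteq> 0" for f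
  proof -
    obtain x where x: "trunc K x = x" "\<And>k. k < K \<Longrightarrow> crd x k = f k" using supported_seq[of K f] by blast
    have "x \<noteq> 0" using f x(2) crd_zero by metis
    then have "0 < inner (Top x) x" using Top_nonneg[of x] Top_inner_zero[of x] by fastforce
    also have "inner (Top x) x = (\<Sum>k<K. \<Sum>l<K. Tm k l * f k * f l)" unfolding Top_form[OF x(1)] by (simp add: x(2))
    finally show ?thesis .
  qed
  obtain u t where u: "\<And>i j. inner (u i) (u j) = (if i = j then 1 else 0)" "\<And>i. i < K \<Longrightarrow> trunc K (u i) = u i"
    "\<And>i k. i < K \<Longrightarrow> k < K \<Longrightarrow> (\<Sum>l<K. Tm k l * crd (u i) l) = t i * crd (u i) k"
    "\<And>i. i < K \<Longrightarrow> 0 < t i" "antimono t"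
    "\<And>n y. trunc K y = y \<Longrightarrow> \<forall>i<n. inner y (u i) = 0 \<Longrightarrow>
        (\<Sum>k<K. \<Sum>l<K. Tm k l * crd y k * crd y l) \<le> t n * inner y y"
    by (rule finite_spectral[OF Tm_sym pd]) blast+
  show thesis by (rule that[of u t]) (use u in \<open>auto simp: Top_form\<close>)
qed

lemma prod_eig_block:
  assumes "\<And>i j. inner (u i) (u j) = (if i = j then 1 else 0)" "\<And>i. i < K \<Longrightarrow> trunc K (u i) = u i"
    "\<And>i k. i < K \<Longrightarrow> k < K \<Longrightarrow> (\<Sum>l<K. X k l * crd (u i) l) = t i * crd (u i) k"
  shows "Determinant.det (Matrix.mat K K (\<lambda>(k, l). X k l)) = (\<Prod>i<K. t i)"
proof (rule det_eq_prod_eigenvalues[where Q = "\<lambda>i k. crd (u i) k"])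
  show "(\<Sum>k<K. crd (u i) k * crd (u j) k) = (if i = j then 1 else 0)" if "i < K" "j < K" for i j
    using inner_supported[OF assms(2)[OF that(2)], of "u i"] assms(1) by simp
qed (use assms(3) in auto)

lemma trunc_comb:
  assumes "\<And>i. i \<le> n \<Longrightarrow> trunc K (u i) = u i"
  shows "trunc K (\<Sum>i\<le>n. c i *\<^sub>R u i) = (\<Sum>i\<le>n. c i *\<^sub>R u i)"
proof (rule ell2_eqI)
  fix k
  have "crd (u i) k = 0" if "i \<le> n" "\<not> k < K" for i using assms[OF that(1)] that(2) by (metis crd_trunc)
  then show "crd (trunc K (\<Sum>i\<le>n. c i *\<^sub>R u i)) k = crd (\<Sum>i\<le>n. c i *\<^sub>R u i) k"
    by (auto simp: crd_trunc crd_sum crd_simps)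
qed

text \<open>A section of the inverse dominates the inverse of the section, and the symplectic symmetry relates
  the two; hence the determinant of a section of A is at least that of its diagonal part.\<close>

lemma section_eigenvalues:
  obtains \<alpha> where "\<And>k. k < 2 * M \<Longrightarrow> lam 0 \<le> \<alpha> k" "(\<Prod>k<2*M. dd k) \<le> (\<Prod>k<2*M. \<alpha> k)"
    "(\<Prod>k<2*M. lam k) \<le> (\<Prod>k<2*M. dd k)"
    "\<And>k. k < 2 * M \<Longrightarrow> \<exists>x. trunc (2 * M) x = x \<and> norm x = 1 \<and> \<alpha> k = inner (A_fin (2 * M) x) x"
    "\<And>k e. k < 2 * M \<Longrightarrow> \<alpha> k \<le> dd (2 * M) \<Longrightarrow>
       \<forall>x. \<bar>inner (Rop x) x - inner (Rop (trunc (2 * M) x)) (trunc (2 * M) x)\<bar> \<le> 2 * e * (norm x)\<^sup>2 \<Longrightarrow>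
       \<alpha> k - 2 * e \<le> lam k"
proof -
  define K where "K = 2 * M"
  obtain u \<alpha> where u: "\<And>i j. inner (u i) (u j) = (if i = j then 1 else 0)" "\<And>i. i < K \<Longrightarrow> trunc K (u i) = u i"
    "\<And>i k. i < K \<Longrightarrow> k < K \<Longrightarrow> (\<Sum>l<K. A k l * crd (u i) l) = \<alpha> i * crd (u i) k" "mono \<alpha>"
    "\<And>n y. trunc K y = y \<Longrightarrow> \<forall>i<n. inner y (u i) = 0 \<Longrightarrow> \<alpha> n * inner y y \<le> inner (A_fin K y) y"
    by (rule A_block_eigenvalues[of K]) blast
  obtain v \<mu> where v: "\<And>i j. inner (v i) (v j) = (if i = j then 1 else 0)" "\<And>i. i < K \<Longrightarrow> trunc K (v i) = v i"
    "\<And>i k. i < K \<Longrightarrow> k < K \<Longrightarrow> (\<Sum>l<K. Tm k l * crd (v i) l) = \<mu> i * crd (v i) k" "antimono \<mu>"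
    "\<And>i. i < K \<Longrightarrow> 0 < \<mu> i"
    "\<And>n y. trunc K y = y \<Longrightarrow> \<forall>i<n. inner y (v i) = 0 \<Longrightarrow> inner (Top y) y \<le> \<mu> n * inner y y"
    by (rule T_block_eigenvalues[of K]) blast
  have crdA: "crd (A_fin K x) k = (\<Sum>l<K. A k l * crd x l)" for x k
    by (simp add: A_fin_def crd_sum crd_simps crd_A_col A_sym[of k] mult.commute)
  have Au: "crd (A_fin K (u i)) k = \<alpha> i * crd (u i) k" if "i < K" "k < K" for i k
    using u(3)[OF that] by (simp add: crdA)
  have formu: "inner (A_fin K (u i)) (u i) = \<alpha> i" if i: "i < K" for i
  proof -
    have "inner (A_fin K (u i)) (u i) = \<alpha> i * inner (u i) (u i)"
      unfolding inner_supported[OF u(2)[OF i]] by (simp add: Au[OF i] sum_distrib_left mult.assoc)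
    then show ?thesis by (simp add: u(1))
  qed
  have a_lam: "lam 0 \<le> \<alpha> i" if i: "i < K" for i
    using A_form_lower[OF A_graph_fin[OF u(2)[OF i]], of 0] by (simp add: formu[OF i] u(1))
  have a_pos: "\<alpha> i > 0" if "i < K" for i using a_lam[OF that] lam_pos[of 0] by simp
  \<comment> \<open>The form of T and that of the inverse of the section of A are compared on a
    combination of the lowest k + 1 eigenvectors of that section.\<close>
  have mu_ge: "1 / \<alpha> k \<le> \<mu> k" if k: "k < K" for k
  proof -
    obtain c where c: "(\<Sum>i\<le>k. c i *\<^sub>R u i) \<noteq> 0" "\<And>j. j < k \<Longrightarrow> inner (\<Sum>i\<le>k. c i *\<^sub>R u i) (v j) = 0"
      "inner (\<Sum>i\<le>k. c i *\<^sub>R u i) (\<Sum>i\<le>k. c i *\<^sub>R u i) = (\<Sum>i\<le>k. (c i)\<^sup>2)"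
      "\<And>e. inner (\<Sum>i\<le>k. (e i * c i) *\<^sub>R u i) (\<Sum>i\<le>k. c i *\<^sub>R u i) = (\<Sum>i\<le>k. e i * (c i)\<^sup>2)"
      by (rule orthogonal_combination[of k u v, OF u(1)]) blast
    define x where "x = (\<Sum>i\<le>k. c i *\<^sub>R u i)"
    \<comment> \<open>The solution of A_K z = x within the section, as \<open>Az\<close>
      confirms.\<close>
    define z where "z = (\<Sum>i\<le>k. (1 / \<alpha> i * c i) *\<^sub>R u i)"
    have tx: "trunc K x = x" and tz: "trunc K z = z"
      unfolding x_def z_def using k by (auto intro!: trunc_comb u(2))
    have Az: "crd (A_fin K z) l = crd x l" if l: "l < K" for l
    proof -
      have "crd (A_fin K z) l = (\<Sum>m<K. \<Sum>i\<le>k. A l m * (1 / \<alpha> i * c i * crd (u i) m))"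
        by (simp add: crdA z_def crd_sum crd_simps sum_distrib_left)
      also have "\<dots> = (\<Sum>i\<le>k. 1 / \<alpha> i * c i * (\<Sum>m<K. A l m * crd (u i) m))"
        by (subst sum.swap) (simp add: sum_distrib_left mult_ac)
      also have "\<dots> = (\<Sum>i\<le>k. c i * crd (u i) l)"
      proof (intro sum.cong refl)
        fix i assume "i \<in> {..k}"
        then have "i < K" using k by simp
        then show "1 / \<alpha> i * c i * (\<Sum>m<K. A l m * crd (u i) m) = c i * crd (u i) l"
          using u(3)[of i l] a_pos[of i] l by simp
      qed
      finally show ?thesis by (simp add: x_def crd_sum crd_simps)
    qed
    have xz: "inner (A_fin K z) z = inner x z" by (simp add: inner_supported[OF tz] Az)
    have Tz: "Top (A_fin K z) = z" using A_graph_fin[OF tz] by (simp add: A_graph_iff)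
    \<comment> \<open>T maps the full vector A z back to z, so <x, z> = <T x, A z>, and
      Cauchy--Schwarz in the form of T applies.\<close>
    have cs: "inner x z * inner x z \<le> inner (Top x) x * inner x z"
      using Top_Cauchy_Schwarz[of x "A_fin K z"] Top_selfadjoint[of x "A_fin K z"]
      by (simp add: Tz xz inner_commute[of z] power2_eq_square)
    have zx: "inner z x = (\<Sum>i\<le>k. 1 / \<alpha> i * (c i)\<^sup>2)" unfolding z_def x_def by (rule c(4))
    have "(\<Sum>i\<le>k. 1 / \<alpha> k * (c i)\<^sup>2) \<le> inner z x"
      unfolding zx
    proof (intro sum_mono mult_right_mono)
      fix i assume "i \<in> {..k}"
      then show "1 / \<alpha> k \<le> 1 / \<alpha> i" using monoD[OF u(4), of i k] a_pos[of i] k by (simp add: frac_le)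
    qed auto
    then have low: "1 / \<alpha> k * inner x x \<le> inner x z" by (simp add: x_def c(3) sum_distrib_left inner_commute)
    have xx: "0 < inner x x" using c(1) by (simp add: x_def)
    have xz0: "0 < inner x z"
      by (rule less_le_trans[OF _ low]) (use xx a_pos[OF k] in simp)
    have "inner x z \<le> inner (Top x) x"
      using cs by (rule mult_right_le_imp_le[OF _ xz0])
    also have "\<dots> \<le> \<mu> k * inner x x" using c(2) by (intro v(6) tx) (simp add: x_def)
    finally have "1 / \<alpha> k * inner x x \<le> \<mu> k * inner x x" using low by linarith
    then show ?thesis using xx by (rule mult_right_le_imp_le)
  qed
  \<comment> \<open>Interlacing: the section of T is a compression of T.\<close>
  have tau_ge: "\<mu> k \<le> tau k" if k: "k < K" for k
  proof -
    obtain c where c: "(\<Sum>i\<le>k. c i *\<^sub>R v i) \<noteq> 0" "\<And>j. j < k \<Longrightarrow> inner (\<Sum>i\<le>k. c i *\<^sub>R v i) (ev j) = 0"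
      "inner (\<Sum>i\<le>k. c i *\<^sub>R v i) (\<Sum>i\<le>k. c i *\<^sub>R v i) = (\<Sum>i\<le>k. (c i)\<^sup>2)"
      "\<And>e. inner (\<Sum>i\<le>k. (e i * c i) *\<^sub>R v i) (\<Sum>i\<le>k. c i *\<^sub>R v i) = (\<Sum>i\<le>k. e i * (c i)\<^sup>2)"
      by (rule orthogonal_combination[of k v ev, OF v(1)]) blast
    define x where "x = (\<Sum>i\<le>k. c i *\<^sub>R v i)"
    have tx: "trunc K x = x" unfolding x_def using k by (auto intro!: trunc_comb v(2))
    have "inner (Top x) x = (\<Sum>m<K. (\<Sum>l<K. Tm m l * crd x l) * crd x m)"
      unfolding Top_form[OF tx] by (simp only: sum_distrib_right) (simp add: mult_ac)
    also have "\<dots> = (\<Sum>m<K. crd (\<Sum>i\<le>k. (\<mu> i * c i) *\<^sub>R v i) m * crd x m)"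
    proof (intro sum.cong refl arg_cong2[where f = "times"])
      fix m assume m: "m \<in> {..<K}"
      have "(\<Sum>l<K. Tm m l * crd x l) = (\<Sum>i\<le>k. c i * (\<Sum>l<K. Tm m l * crd (v i) l))"
        unfolding x_def crd_sum crd_simps sum_distrib_left by (subst sum.swap) (simp add: mult_ac)
      also have "\<dots> = (\<Sum>i\<le>k. c i * (\<mu> i * crd (v i) m))"
        using m k by (intro sum.cong refl arg_cong2[where f = "times"] v(3)) auto
      finally show "(\<Sum>l<K. Tm m l * crd x l) = crd (\<Sum>i\<le>k. (\<mu> i * c i) *\<^sub>R v i) m"
        by (simp add: crd_sum crd_simps mult_ac)
    qed
    also have "\<dots> = (\<Sum>i\<le>k. \<mu> i * (c i)\<^sup>2)"
      using c(4)[of \<mu>] unfolding x_def[symmetric] inner_supported[OF tx] .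
    also have "\<dots> \<ge> (\<Sum>i\<le>k. \<mu> k * (c i)\<^sup>2)"
      by (intro sum_mono mult_right_mono antimonoD[OF v(4)]) auto
    finally have "\<mu> k * inner x x \<le> inner (Top x) x" by (simp add: x_def c(3) sum_distrib_left)
    also have "\<dots> \<le> tau k * inner x x" using c(2) by (intro Top_max) (simp add: x_def)
    finally show ?thesis using c(1) by (simp add: x_def)
  qed
  have pmu: "(\<Prod>k<K. \<mu> k) = (\<Prod>k<K. 1 / (dd k)\<^sup>2) * (\<Prod>k<K. \<alpha> k)"
    using det_Tm_block[of M] prod_eig_block[where X = Tm and K = K, OF v(1-3)] prod_eig_block[where X = A and K = K, OF u(1-3)]
    by (simp add: K_def)
  define P where "P = (\<Prod>k<K. \<alpha> k)"
  define D where "D = (\<Prod>k<K. dd k)"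
  have P0: "P > 0" unfolding P_def by (intro prod_pos) (use a_pos in auto)
  have D0: "D > 0" unfolding D_def by (intro prod_pos) auto
  have pmu': "(\<Prod>k<K. \<mu> k) = P / D\<^sup>2"
    unfolding pmu by (simp add: P_def D_def prod_dividef prod_power_distrib)
  \<comment> \<open>By \<open>mu_ge\<close> this yields 1 / P \<le> P / D^2, that is, D \<le>
    P.\<close>
  have "1 / P \<le> (\<Prod>k<K. \<mu> k)"
  proof -
    have "(\<Prod>k<K. 1 / \<alpha> k) \<le> (\<Prod>k<K. \<mu> k)"
      using mu_ge a_pos by (intro prod_mono) (auto intro: less_imp_le)
    then show ?thesis by (simp add: prod_dividef P_def)
  qed
  then have "D\<^sup>2 \<le> P\<^sup>2" using P0 D0 by (simp add: pmu' field_simps power2_eq_square)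
  then have DP: "D \<le> P" using P0 by (meson less_imp_le power2_le_imp_le)
  \<comment> \<open>By \<open>tau_ge\<close>, P / D^2 is at most the reciprocal of the product of
    the eigenvalues, and D \<le> P bounds it below by 1 / D.\<close>
  have "(\<Prod>k<K. \<mu> k) \<le> (\<Prod>k<K. tau k)"
    using tau_ge v(5) by (intro prod_mono) (auto intro: less_imp_le)
  moreover have "(\<Prod>k<K. tau k) = 1 / (\<Prod>k<K. lam k)"
    by (simp add: lam_def prod_dividef)
  moreover have "1 / D \<le> P / D\<^sup>2" using DP D0 by (simp add: field_simps power2_eq_square)
  ultimately have "1 / D \<le> 1 / (\<Prod>k<K. lam k)" by (simp add: pmu')
  moreover have L0: "(\<Prod>k<K. lam k) > 0" by (intro prod_pos) (use lam_pos in auto)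
  ultimately have LD: "(\<Prod>k<K. lam k) \<le> D" using D0 by (simp add: field_simps)
  \<comment> \<open>Test vector from the first k + 1 eigenvectors of A, orthogonal to the first k of
    the section. Its head l is controlled by the section, its tail h by d_K \<ge> \<alpha>_k, and
    truncating the perturbation costs 2 e.\<close>
  have lam_ge: "\<alpha> k - 2 * e \<le> lam k" if k: "k < K" and ak: "\<alpha> k \<le> dd K"
    and e: "\<And>x. \<bar>inner (Rop x) x - inner (Rop (trunc K x)) (trunc K x)\<bar> \<le> 2 * e * (norm x)\<^sup>2" for k e
  proof -
    obtain c where c: "(\<Sum>i\<le>k. c i *\<^sub>R ev i) \<noteq> 0" "\<And>j. j < k \<Longrightarrow> inner (\<Sum>i\<le>k. c i *\<^sub>R ev i) (u j) = 0"
      "inner (\<Sum>i\<le>k. c i *\<^sub>R ev i) (\<Sum>i\<le>k. c i *\<^sub>R ev i) = (\<Sum>i\<le>k. (c i)\<^sup>2)"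
      "\<And>e. inner (\<Sum>i\<le>k. (e i * c i) *\<^sub>R ev i) (\<Sum>i\<le>k. c i *\<^sub>R ev i) = (\<Sum>i\<le>k. e i * (c i)\<^sup>2)"
      by (rule orthogonal_combination[of k ev u, OF ev_orthonormal]) blast
    define x where "x = (\<Sum>i\<le>k. c i *\<^sub>R ev i)"
    define y where "y = (\<Sum>i\<le>k. (lam i * c i) *\<^sub>R ev i)"
    define l h where "l = trunc K x" and "h = x - trunc K x"
    have g: "A_graph x y" unfolding x_def y_def by (rule A_graph_comb)
    have tl: "trunc K l = l" unfolding l_def by (rule ell2_eqI) (simp add: crd_trunc)
    have "inner y x \<le> (\<Sum>i\<le>k. lam k * (c i)\<^sup>2)"
      unfolding x_def y_def c(4) by (intro sum_mono mult_right_mono lam_mono) auto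
    then have 1: "inner y x \<le> lam k * inner x x" by (simp add: x_def c(3) sum_distrib_left)
    have "(inner (A_fin K l) l - inner (Rop l) l) + dd K * (norm h)\<^sup>2 \<le> inner y x - inner (Rop x) x"
    proof (rule sums_le[OF _ sums_add[OF A_form_sums[OF A_graph_fin[OF tl]] sums_mult[OF norm_sums]] A_form_sums[OF g]])
      fix j
      show "dd j * (crd l j)\<^sup>2 + dd K * (crd h j)\<^sup>2 \<le> dd j * (crd x j)\<^sup>2"
        using dd_mono[of K j] by (cases "j < K") (auto simp: l_def h_def crd_simps crd_trunc intro: mult_right_mono)
    qed
    moreover have "\<bar>inner (Rop x) x - inner (Rop l) l\<bar> \<le> 2 * e * (norm x)\<^sup>2" unfolding l_def by (rule e)
    moreover have "\<alpha> k * (norm l)\<^sup>2 \<le> inner (A_fin K l) l"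
      unfolding power2_norm_eq_inner
    proof (intro u(5)[OF tl] allI impI)
      fix i assume i: "i < k"
      then have tu: "trunc K (u i) = u i" using k u(2) by simp
      have "inner l (u i) = inner x (u i)" unfolding inner_supported[OF tu] by (simp add: l_def crd_trunc)
      then show "inner l (u i) = 0" using c(2)[OF i] by (simp add: x_def)
    qed
    moreover have "\<alpha> k * (norm h)\<^sup>2 \<le> dd K * (norm h)\<^sup>2" using ak by (intro mult_right_mono) auto
    ultimately have "\<alpha> k * ((norm l)\<^sup>2 + (norm h)\<^sup>2) - 2 * e * (norm x)\<^sup>2 \<le> lam k * inner x x"
      using 1 by (simp add: distrib_left)
    then have "(\<alpha> k - 2 * e) * inner x x \<le> lam k * inner x x"
      unfolding l_def h_def norm_split by (simp add: power2_norm_eq_inner left_diff_distrib)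
    then show ?thesis using c(1) by (simp add: x_def)
  qed
  show thesis
  proof (rule that[of \<alpha>])
    show "\<exists>x. trunc (2 * M) x = x \<and> norm x = 1 \<and> \<alpha> k = inner (A_fin (2 * M) x) x" if "k < 2 * M" for k
      using formu[of k] u(2)[of k] u(1)[of k k] that unfolding K_def
      by (intro exI[of _ "u k"]) (simp add: norm_eq_1)
  qed (use a_lam DP LD lam_ge in \<open>simp_all add: K_def P_def D_def\<close>)
qed

lemma prod_lam_le: "(\<Prod>k<2*M. lam k) \<le> (\<Prod>k<2*M. dd k)"
  by (rule section_eigenvalues[of M])

text \<open>Each factor satisfies (1 - q) \<alpha>_k \<le> \<lambda>_k with relative error q = 2 e /
  \<lambda>_0. By Bernoulli the 2 M factors together lose at most 2 M q, which tends to 0 because e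
  decays like M^-2.\<close>

lemma prod_lam_ge:
  assumes "\<eta> > 0"
  shows "\<exists>M0. \<forall>M\<ge>M0. (1 - \<eta>) * (\<Prod>k<2*M. dd k) \<le> (\<Prod>k<2*M. lam k)"
proof -
  obtain C where C: "C \<ge> 0" "\<And>N x. norm (Rop x - trunc N (Rop x)) \<le> C / real (Suc N) ^ 2 * norm x"
    by (rule Rop_tail[of 2]) blast
  define e where "e N = C / real (Suc N) ^ 2" for N
  have e: "\<And>N x. norm (Rop x - trunc N (Rop x)) \<le> e N * norm x" "\<And>N. e N \<ge> 0" using C by (auto simp: e_def)
  obtain N0 where N0: "\<And>N x y. N \<ge> N0 \<Longrightarrow> trunc (Suc N) x = x \<Longrightarrow> A_graph x y \<Longrightarrow>
      inner y x \<le> (dd N + 2 * e (N div 2)) * (norm x)\<^sup>2"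
    using A_form_upper[OF e] by blast
  have "(\<lambda>M. 2 * e ((2 * M - 1) div 2)) \<longlonglongrightarrow> 0"
  proof -
    have "(2 * M - 1) div 2 = M - 1" for M :: nat by presburger
    moreover have "(\<lambda>M. 2 * (C / real (Suc (M - 1)) ^ 2)) \<longlonglongrightarrow> 0" by real_asymp
    ultimately show ?thesis by (simp add: e_def)
  qed
  then have ev1: "\<forall>\<^sub>F M in sequentially. 2 * e ((2 * M - 1) div 2) < 1" by (rule order_tendstoD) simp
  have "(\<lambda>M. 4 * real M * e (2 * M) / lam 0) \<longlonglongrightarrow> 0"
  proof -
    have "(\<lambda>M. 4 * real M * (C / real (Suc (2 * M)) ^ 2)) \<longlonglongrightarrow> 0" by real_asymp
    from tendsto_divide[OF this tendsto_const[of "lam 0"]] show ?thesis using lam_pos[of 0] by (simp add: e_def)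
  qed
  then have ev2: "\<forall>\<^sub>F M in sequentially. 4 * real M * e (2 * M) / lam 0 < min \<eta> 1" 
    by (rule order_tendstoD) (use assms in simp)
  have "\<forall>\<^sub>F M in sequentially. M \<ge> N0 + 1" by (rule eventually_ge_at_top)
  with ev1 ev2 have "\<forall>\<^sub>F M in sequentially. (1 - \<eta>) * (\<Prod>k<2*M. dd k) \<le> (\<Prod>k<2*M. lam k)"
  proof eventually_elim
    fix M assume M: "2 * e ((2 * M - 1) div 2) < 1" "4 * real M * e (2 * M) / lam 0 < min \<eta> 1" "M \<ge> N0 + 1"
    obtain \<alpha> where a: "\<And>k. k < 2 * M \<Longrightarrow> lam 0 \<le> \<alpha> k" "(\<Prod>k<2*M. dd k) \<le> (\<Prod>k<2*M. \<alpha> k)"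
      "\<And>k. k < 2 * M \<Longrightarrow> \<exists>x. trunc (2 * M) x = x \<and> norm x = 1 \<and> \<alpha> k = inner (A_fin (2 * M) x) x"
      "\<And>k e. k < 2 * M \<Longrightarrow> \<alpha> k \<le> dd (2 * M) \<Longrightarrow>
       \<forall>x. \<bar>inner (Rop x) x - inner (Rop (trunc (2 * M) x)) (trunc (2 * M) x)\<bar> \<le> 2 * e * (norm x)\<^sup>2 \<Longrightarrow>
       \<alpha> k - 2 * e \<le> lam k" by (rule section_eigenvalues[of M]) blast
    define q where "q = 2 * e (2 * M) / lam 0"
    have q0: "q \<ge> 0" using e(2) lam_pos[of 0] by (simp add: q_def)
    have Mq: "2 * real M * q < min \<eta> 1" using M(2) by (simp add: q_def field_simps)
    have q1: "q \<le> 1"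
    proof -
      have "1 * q \<le> 2 * real M * q" using M(3) q0 by (intro mult_right_mono) auto
      then show ?thesis using Mq by linarith
    qed
    have lk: "\<alpha> k * (1 - q) \<le> lam k" if k: "k < 2 * M" for k
    proof -
      obtain x where x: "trunc (2 * M) x = x" "norm x = 1" "\<alpha> k = inner (A_fin (2 * M) x) x" using a(3)[OF k] by blast
      \<comment> \<open>The error is below 1 and d_{2M} = d_{2M-1} + 1; hence \<alpha>_k \<le>
        d_{2M}, as the comparison with the tail requires.\<close>
      have "\<alpha> k \<le> dd (2 * M - 1) + 2 * e ((2 * M - 1) div 2)"
        using N0[of "2 * M - 1" x "A_fin (2 * M) x"] x M(3) A_graph_fin[OF x(1)] by simp
      also have "\<dots> \<le> dd (2 * M - 1) + 1" using M(1) by simp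
      also have "\<dots> = dd (2 * M)"
      proof -
        have "Suc ((2 * M - 1) div 2) = M" using M(3) by presburger
        then show ?thesis by (simp add: dd_def)
      qed
      finally have "\<alpha> k - 2 * e (2 * M) \<le> lam k" using Rop_form_tail[OF e] by (intro a(4)[OF k]) auto
      moreover have "2 * e (2 * M) \<le> \<alpha> k * q"
      proof -
        have "2 * e (2 * M) = lam 0 * q" using lam_pos[of 0] by (simp add: q_def)
        also have "\<dots> \<le> \<alpha> k * q" using a(1)[OF k] q0 by (intro mult_right_mono) auto
        finally show ?thesis .
      qed
      ultimately show ?thesis by (simp add: right_diff_distrib)
    qed
    have apos: "\<alpha> k > 0" if "k < 2 * M" for k using a(1)[OF that] lam_pos[of 0] by linarith
    have "1 - \<eta> \<le> 1 + real (2 * M) * (- q)" using Mq by simp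
    also have "\<dots> \<le> (1 + (- q)) ^ (2 * M)" using q1 by (intro Bernoulli_inequality) simp
    finally have "1 - \<eta> \<le> (1 - q) ^ (2 * M)" by simp
    then have "(1 - \<eta>) * (\<Prod>k<2*M. dd k) \<le> (1 - q) ^ (2 * M) * (\<Prod>k<2*M. dd k)"
      by (intro mult_right_mono prod_nonneg) (auto intro: less_imp_le)
    also have "\<dots> \<le> (1 - q) ^ (2 * M) * (\<Prod>k<2*M. \<alpha> k)"
      using q1 a(2) by (intro mult_left_mono) auto
    also have "\<dots> = (\<Prod>k<2*M. \<alpha> k * (1 - q))" by (simp add: prod.distrib)
    also have "\<dots> \<le> (\<Prod>k<2*M. lam k)"
      using lk apos q1 by (intro prod_mono) (auto intro!: mult_nonneg_nonneg intro: less_imp_le)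
    finally show "(1 - \<eta>) * (\<Prod>k<2*M. dd k) \<le> (\<Prod>k<2*M. lam k)" .
  qed
  then show ?thesis by (simp add: eventually_sequentially)
qed

end

section \<open>The zeta difference of a log-majorized spectrum\<close>

text \<open>Strictness comes from 1 + x < (1 + x/2)^2. It is what later forces the logarithms
  \<open>xk\<close> to vanish in the case of equality.\<close>

lemma exp_gt_one_plus: "x \<noteq> 0 \<Longrightarrow> 1 + x < exp (x::real)"
proof -
  assume x: "x \<noteq> 0"
  show ?thesis
  proof (cases "1 + x / 2 \<ge> 0")
    case True
    have "1 + x < (1 + x / 2)\<^sup>2" using zero_less_power2[of "x / 2"] x by (simp add: power2_sum)
    also have "\<dots> \<le> (exp (x / 2))\<^sup>2" using True exp_ge_add_one_self[of "x / 2"] by (intro power_mono)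
    also have "\<dots> = exp x" by (simp add: power2_eq_square exp_add[symmetric])
    finally show ?thesis .
  next
    case False
    then show ?thesis using exp_gt_zero[of x] by linarith
  qed
qed

lemma norm_exp_minus_one_le: "norm (exp z - 1) \<le> norm z * exp (norm z)" for z :: complex
proof -
  have "norm (exp z - exp 0) \<le> exp (norm z) * norm (z - 0)"
  proof (rule field_differentiable_bound[of "cball 0 (norm z)" exp exp])
    show "(exp has_field_derivative exp w) (at w within cball 0 (norm z))" for w :: complex
      by (auto intro: derivative_eq_intros)
    show "norm (exp w) \<le> exp (norm z)" if "w \<in> cball 0 (norm z)" for w :: complex
      using norm_exp[of w] that by (meson exp_le_cancel_iff mem_cball_0 order_trans)
  qed auto
  then show ?thesis by (simp add: mult.commute)
qed

lemma abel_summation: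
  fixes c S :: "nat \<Rightarrow> real"
  assumes "S 0 = 0"
  shows "(\<Sum>m<M. c m * (S (Suc m) - S m)) = c M * S M + (\<Sum>m<M. (c m - c (Suc m)) * S (Suc m))"
  by (induction M) (simp_all add: assms algebra_simps)

lemma dd_powr_summable:
  assumes "Re s > 1"
  shows "summable (\<lambda>k. norm (of_real (dd k) powr (- s)))"
proof (rule summable_comparison_test')
  show "summable (\<lambda>k. 2 powr (Re s) * real (Suc k) powr (- Re s))"
    using assms by (intro summable_mult) (subst summable_Suc_iff[of "\<lambda>k. real k powr (- Re s)"], simp add: summable_real_powr_iff)
  fix k :: nat
  have "norm (complex_of_real (dd k) powr (- s)) = dd k powr (- Re s)"
    by (simp add: norm_powr_real_powr less_imp_le[OF dd_pos(1)])
  also have "\<dots> \<le> (real (Suc k) / 2) powr (- Re s)"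
    using assms dd_lower[of k] by (intro powr_mono2') auto
  also have "\<dots> = 2 powr (Re s) * real (Suc k) powr (- Re s)"
    by (simp add: powr_divide powr_minus field_simps)
  finally show "norm (norm (complex_of_real (dd k) powr (- s))) \<le> 2 powr (Re s) * real (Suc k) powr (- Re s)" by simp
qed

section \<open>Logarithms of the eigenvalue ratios and the entire series of the zeta
  difference\<close>

context steklov_matrix
begin

definition xk :: "nat \<Rightarrow> real" where "xk k = ln (lam k / dd k)"

lemma lam_exp: "lam k = dd k * exp (xk k)"
  using lam_pos[of k] by (simp add: xk_def)

text \<open>The inequality ln t \<le> t - 1 is used for t = \<lambda>_k / d_k and for its inverse; q
  dominates both 1 / d_k and 1 / \<lambda>_k.\<close>

lemma xk_decay: obtains C where "C \<ge> 0" "\<And>k. \<bar>xk k\<bar> \<le> C / real (Suc k) ^ p"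
proof -
  obtain C where C: "\<And>k. \<bar>lam k - dd k\<bar> \<le> C / real (Suc k) ^ p" using lam_asymptotics by blast
  have C0: "C \<ge> 0" using C[of 0] by simp
  define q where "q = 1 + 1 / lam 0"
  have q: "q \<ge> 0" using lam_pos[of 0] by (simp add: q_def)
  have "\<bar>xk k\<bar> \<le> C * q / real (Suc k) ^ p" for k
  proof -
    have r: "0 < lam k / dd k" "0 < dd k / lam k" using lam_pos[of k] by auto
    have "xk k \<le> lam k / dd k - 1" unfolding xk_def by (rule ln_le_minus_one[OF r(1)])
    also have "\<dots> = (lam k - dd k) * (1 / dd k)" by (simp add: field_simps)
    also have "\<dots> \<le> \<bar>lam k - dd k\<bar> * q"
      using dd_ge1[of k] lam_pos[of 0] by (intro mult_mono) (auto simp: q_def intro: order_trans[of _ 1])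
    finally have 1: "xk k \<le> \<bar>lam k - dd k\<bar> * q" .
    have "- xk k = ln (dd k / lam k)" using lam_pos[of k] by (simp add: xk_def ln_div)
    also have "\<dots> \<le> dd k / lam k - 1" by (rule ln_le_minus_one[OF r(2)])
    also have "\<dots> = (dd k - lam k) * (1 / lam k)" using lam_pos[of k] by (simp add: field_simps)
    also have "\<dots> \<le> \<bar>lam k - dd k\<bar> * q"
    proof (intro mult_mono)
      have "1 / lam k \<le> 1 / lam 0" using lam_mono[of 0 k] lam_pos[of 0] by (simp add: frac_le)
      then show "1 / lam k \<le> q" by (simp add: q_def)
    qed (use lam_pos[of k] in auto)
    finally have "\<bar>xk k\<bar> \<le> \<bar>lam k - dd k\<bar> * q" using 1 by linarith
    also have "\<dots> \<le> C / real (Suc k) ^ p * q" by (intro mult_right_mono C q)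
    finally show ?thesis by simp
  qed
  then show thesis using that[of "C * q"] C0 q by simp
qed

lemma dd_powr_le: "\<bar>s\<bar> \<le> real n \<Longrightarrow> dd k powr s \<le> real (Suc k) ^ n"
proof -
  assume s: "\<bar>s\<bar> \<le> real n"
  have "dd k powr s \<le> dd k powr real n" using s dd_ge1[of k] by (intro powr_mono) auto
  also have "\<dots> = dd k ^ n" by (simp add: powr_realpow)
  also have "\<dots> \<le> real (Suc k) ^ n"
    using dd_upper[of k] dd_ge1[of k] by (intro power_mono) (auto simp: dd_def)
  finally show ?thesis .
qed

definition zterm :: "nat \<Rightarrow> complex \<Rightarrow> complex" where
  "zterm k s = of_real (lam k) powr (- s) - of_real (dd k) powr (- s)"

definition zdiff :: "complex \<Rightarrow> complex" where "zdiff s = (\<Sum>k. zterm k s)"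

text \<open>For |s| \<le> n the factor d_k powr (-s) grows at most like (k + 1)^n, and decay of
  \<open>xk\<close> of order n + 2 leaves the summable 1 / (k + 1)^2. As every order is available,
  this works on every disk.\<close>

lemma zterm_bound:
  obtains M where "summable M" "\<And>k s. norm s \<le> \<rho> \<Longrightarrow> norm (zterm k s) \<le> M k"
proof -
  obtain n :: nat where n: "\<rho> \<le> real n" using real_arch_simple by blast
  obtain C where C: "C \<ge> 0" "\<And>k. \<bar>xk k\<bar> \<le> C / real (Suc k) ^ (n + 2)" by (rule xk_decay[of "n + 2"]) blast
  have xC: "\<bar>xk k\<bar> \<le> C" for k
  proof -
    have "C / real (Suc k) ^ (n + 2) \<le> C / 1" using C(1) by (intro divide_left_mono one_le_power) auto
    then show ?thesis using C(2)[of k] by simp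
  qed
  define M where "M k = real n * exp (real n * C) * C * (1 / real (Suc k))\<^sup>2" for k
  have "norm (zterm k s) \<le> M k" if s: "norm s \<le> \<rho>" for k s
  proof -
    have sn: "norm s \<le> real n" using s n by linarith
    have "of_real (lam k) powr (- s) = of_real (dd k) powr (- s) * exp (- s * of_real (xk k))"
    proof -
      have "ln (lam k) = ln (dd k) + xk k" using lam_pos[of k] by (simp add: xk_def ln_div)
      then show ?thesis using lam_pos[of k]
        by (simp add: powr_def Ln_of_real exp_add[symmetric] algebra_simps)
    qed
    then have "zterm k s = of_real (dd k) powr (- s) * (exp (- s * of_real (xk k)) - 1)"
      by (simp add: zterm_def algebra_simps)
    then have "norm (zterm k s) = dd k powr (- Re s) * norm (exp (- s * of_real (xk k)) - 1)"
      by (simp add: norm_mult norm_powr_real_powr less_imp_le[OF dd_pos(1)])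
    also have "\<dots> \<le> real (Suc k) ^ n * (real n * (C / real (Suc k) ^ (n + 2)) * exp (real n * C))"
    proof (intro mult_mono)
      show "dd k powr (- Re s) \<le> real (Suc k) ^ n"
        using abs_Re_le_cmod[of s] sn by (intro dd_powr_le) auto
      have "norm (exp (- s * of_real (xk k)) - 1) \<le> norm (- s * of_real (xk k)) * exp (norm (- s * of_real (xk k)))"
        by (rule norm_exp_minus_one_le)
      also have "\<dots> = (norm s * \<bar>xk k\<bar>) * exp (norm s * \<bar>xk k\<bar>)" by (simp add: norm_mult)
      also have "\<dots> \<le> (real n * (C / real (Suc k) ^ (n + 2))) * exp (real n * C)"
        using sn C xC[of k] by (intro mult_mono) (auto intro!: mult_mono simp del: power_Suc)
      finally show "norm (exp (- s * of_real (xk k)) - 1) \<le> real n * (C / real (Suc k) ^ (n + 2)) * exp (real n * C)" .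
    qed auto
    also have "\<dots> = M k" by (simp add: M_def power_add power_divide power2_eq_square mult_ac)
    finally show ?thesis .
  qed
  moreover have "summable M" unfolding M_def by (intro summable_mult summable_inverse_squares)
  ultimately show thesis using that by blast
qed

lemma zterm_summable: "summable (\<lambda>k. norm (zterm k s))"
proof -
  obtain M where M: "summable M" "\<And>k t. norm t \<le> norm s \<Longrightarrow> norm (zterm k t) \<le> M k"
    by (rule zterm_bound[of "norm s"]) blast
  show ?thesis by (rule summable_comparison_test'[OF M(1)]) (use M(2) in auto)
qed

lemma zdiff_holomorphic: "zdiff holomorphic_on UNIV"
proof (rule holomorphic_uniform_sequence[of UNIV "\<lambda>n s. \<Sum>k<n. zterm k s"])
  show "(\<lambda>s. \<Sum>k<n. zterm k s) holomorphic_on UNIV" for n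
    unfolding zterm_def using lam_pos
    by (intro holomorphic_intros)
  show "\<exists>d>0. cball z d \<subseteq> UNIV \<and> uniform_limit (cball z d) (\<lambda>n s. \<Sum>k<n. zterm k s) zdiff sequentially" for z
  proof -
    obtain M where M: "summable M" "\<And>k s. norm s \<le> norm z + 1 \<Longrightarrow> norm (zterm k s) \<le> M k"
      by (rule zterm_bound[of "norm z + 1"]) blast
    have "uniform_limit (cball z 1) (\<lambda>n s. \<Sum>k<n. zterm k s) (\<lambda>s. \<Sum>k. zterm k s) sequentially"
    proof (rule Weierstrass_m_test[OF _ M(1)])
      fix k s assume "s \<in> cball z 1"
      then have "norm s \<le> norm z + 1" using norm_triangle_ineq2[of s z] by (simp add: dist_norm norm_minus_commute)
      then show "norm (zterm k s) \<le> M k" by (rule M(2))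
    qed
    then show ?thesis unfolding zdiff_def[abs_def] by (intro exI[of _ 1]) auto
  qed
qed auto

definition rterm :: "nat \<Rightarrow> real \<Rightarrow> real" where
  "rterm k s = dd k powr (- s) * (exp (- s * xk k) - 1)"

lemma zterm_real: "zterm k (of_real s) = of_real (rterm k s)"
proof -
  have "lam k powr (- s) = dd k powr (- s) * exp (- s * xk k)"
    unfolding lam_exp by (subst powr_mult) (auto simp: powr_def less_imp_le[OF dd_pos(1)])
  moreover have "zterm k (of_real s) = of_real (lam k powr (- s) - dd k powr (- s))"
    using lam_pos[of k] less_imp_le[OF dd_pos(1), of k] by (simp add: zterm_def powr_of_real flip: of_real_minus)
  ultimately show ?thesis by (simp add: rterm_def algebra_simps)
qed

lemma rterm_summable: "summable (\<lambda>k. rterm k s)"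
proof -
  have "summable (\<lambda>k. \<bar>rterm k s\<bar>)" using zterm_summable[of "of_real s"] by (simp add: zterm_real)
  then show ?thesis by (rule summable_rabs_cancel)
qed

lemma zdiff_real: "zdiff (of_real s) = of_real (\<Sum>k. rterm k s)"
  unfolding zdiff_def zterm_real by (rule suminf_of_real[OF rterm_summable, symmetric])

lemma weighted_xk_summable: "summable (\<lambda>k. \<bar>dd k powr (- s) * xk k\<bar>)"
proof -
  obtain n :: nat where n: "\<bar>s\<bar> \<le> real n" using real_arch_simple by blast
  obtain C where C: "C \<ge> 0" "\<And>k. \<bar>xk k\<bar> \<le> C / real (Suc k) ^ (n + 2)" by (rule xk_decay[of "n + 2"]) blast
  show ?thesis
  proof (rule summable_comparison_test'[OF summable_mult[OF summable_inverse_squares, of C]])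
    fix k :: nat
    have "\<bar>dd k powr (- s) * xk k\<bar> = dd k powr (- s) * \<bar>xk k\<bar>" by (simp add: abs_mult)
    also have "\<dots> \<le> real (Suc k) ^ n * (C / real (Suc k) ^ (n + 2))"
      using n C(2) by (intro mult_mono dd_powr_le) auto
    also have "\<dots> = C * (1 / real (Suc k))\<^sup>2" by (simp add: power_add power_divide power2_eq_square)
    finally show "norm \<bar>dd k powr (- s) * xk k\<bar> \<le> C * (1 / real (Suc k))\<^sup>2" by simp
  qed
qed

definition Sx :: "nat \<Rightarrow> real" where "Sx M = (\<Sum>k<2*M. xk k)"

lemma exp_Sx: "exp (Sx M) = (\<Prod>k<2*M. lam k) / (\<Prod>k<2*M. dd k)"
proof -
  have "exp (Sx M) = (\<Prod>k<2*M. lam k / dd k)"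
    using lam_pos by (simp add: Sx_def exp_sum xk_def)
  then show ?thesis by (simp add: prod_dividef)
qed

lemma prod_dd_pos: "0 < (\<Prod>k\<in>S. dd k)" by (intro prod_pos) auto

lemma Sx_nonpos: "Sx M \<le> 0"
proof -
  have "exp (Sx M) \<le> exp 0" using prod_lam_le[of M] prod_dd_pos by (simp add: exp_Sx)
  then show ?thesis by (simp only: exp_le_cancel_iff)
qed

text \<open>\<open>prod_lam_le\<close> bounds the limit of the even partial sums by 0;
  \<open>prod_lam_ge\<close> bounds its exponential below by 1 - \<eta> for every \<eta>.\<close>

lemma xk_sums: "xk sums 0"
proof -
  have ab: "summable (\<lambda>k. \<bar>xk k\<bar>)" using weighted_xk_summable[of 0] by simp
  then have s: "summable xk" by (rule summable_rabs_cancel)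
  have "(\<lambda>n. \<Sum>k<n. xk k) \<longlonglongrightarrow> suminf xk" using summable_LIMSEQ[OF s] .
  then have lim: "Sx \<longlonglongrightarrow> suminf xk"
    unfolding Sx_def[abs_def] by (rule LIMSEQ_subseq_LIMSEQ[of "\<lambda>n. \<Sum>k<n. xk k" _ "\<lambda>M. 2 * M", unfolded o_def]) (simp add: strict_mono_def)
  have "suminf xk \<le> 0" using lim Sx_nonpos by (intro LIMSEQ_le_const2) auto
  moreover have "1 \<le> exp (suminf xk)"
  proof (rule field_le_epsilon)
    fix \<eta> :: real assume "\<eta> > 0"
    then obtain M0 where M0: "\<And>M. M \<ge> M0 \<Longrightarrow> (1 - \<eta>) * (\<Prod>k<2*M. dd k) \<le> (\<Prod>k<2*M. lam k)"
      using prod_lam_ge by blast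
    have "1 - \<eta> \<le> exp (Sx M)" if "M \<ge> M0" for M
      using M0[OF that] prod_dd_pos by (simp add: exp_Sx field_simps)
    then have "1 - \<eta> \<le> exp (suminf xk)"
      by (intro LIMSEQ_le_const[OF tendsto_exp[OF lim]]) blast
    then show "1 \<le> exp (suminf xk) + \<eta>" by simp
  qed
  ultimately have "suminf xk = 0" by (simp add: one_le_exp_iff)
  then show ?thesis using summable_sums[OF s] by simp
qed

section \<open>Summation by parts and positivity\<close>

lemma pair_sum:
  fixes f :: "nat \<Rightarrow> real"
  shows "(\<Sum>k<2*M. f k) = (\<Sum>m<M. f (2*m) + f (2*m+1))"
  by (induction M) auto

lemma dd_even: "dd (2 * m) = real (Suc m)" "dd (2 * m + 1) = real (Suc m)" "dd (Suc (2 * m)) = real (Suc m)"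
  by (auto simp: dd_def)

text \<open>The two indices of a pair share the weight c m, so Abel summation involves only the sums
  \<open>Sx\<close>, all \<le> 0. For s > 0 the weights decrease and every term has the right sign.
  For s < 0 they increase and the boundary term has the wrong sign, but it tends to 0 because
  \<open>xk\<close> has total 0.\<close>

lemma weighted_xk_sign: "s * (\<Sum>k. dd k powr (- s) * xk k) \<le> 0"
proof -
  define c where "c m = real (Suc m) powr (- s)" for m
  define W where "W = (\<Sum>k. dd k powr (- s) * xk k)"
  define P where "P M = (\<Sum>m<M. c m * (Sx (Suc m) - Sx m))" for M
  have ws: "summable (\<lambda>k. dd k powr (- s) * xk k)" using weighted_xk_summable by (rule summable_rabs_cancel)
  have Sd: "Sx (Suc m) - Sx m = xk (2 * m) + xk (2 * m + 1)" for m by (simp add: Sx_def)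
  have P_eq: "P M = (\<Sum>k<2*M. dd k powr (- s) * xk k)" for M
    unfolding pair_sum P_def by (intro sum.cong) (simp_all add: Sd c_def dd_even distrib_left)
  have limP: "P \<longlonglongrightarrow> W"
    using summable_LIMSEQ[OF ws] unfolding P_eq[abs_def] W_def
    by (rule LIMSEQ_subseq_LIMSEQ[of "\<lambda>n. \<Sum>k<n. dd k powr (- s) * xk k" _ "\<lambda>M. 2 * M", unfolded o_def]) (simp add: strict_mono_def)
  have P_abel: "P M = c M * Sx M + (\<Sum>m<M. (c m - c (Suc m)) * Sx (Suc m))" for M
    unfolding P_def by (rule abel_summation) (simp add: Sx_def)
  consider "s > 0" | "s = 0" | "s < 0" by linarith
  then show ?thesis
  proof cases
    case 1
    have "P M \<le> 0" for M
    proof -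
      have "(c m - c (Suc m)) * Sx (Suc m) \<le> 0" for m
        using 1 Sx_nonpos by (intro mult_nonneg_nonpos) (auto simp: c_def intro!: powr_mono2')
      moreover have "c M * Sx M \<le> 0" by (intro mult_nonneg_nonpos Sx_nonpos) (simp add: c_def)
      ultimately show ?thesis unfolding P_abel by (simp add: add_nonpos_nonpos sum_nonpos)
    qed
    then have "W \<le> 0" using limP by (intro LIMSEQ_le_const2) auto
    then show ?thesis using 1 by (simp add: W_def mult_nonneg_nonpos)
  next
    case 2
    then show ?thesis by simp
  next
    case 3
    \<comment> \<open>\<open>Sx M\<close> is minus a tail of the series of \<open>xk\<close>. Moving
      the increasing weight inside that tail bounds the boundary term by t M, a tail of a convergent
      series.\<close>
    define t where "t M = (\<Sum>k. \<bar>dd (k + 2 * M) powr (- s) * xk (k + 2 * M)\<bar>)" for M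
    have tlim: "t \<longlonglongrightarrow> 0"
      unfolding t_def[abs_def]
      using suminf_exist_split2[OF weighted_xk_summable[of s]]
      by (rule LIMSEQ_subseq_LIMSEQ[of "\<lambda>n. \<Sum>k. \<bar>dd (k + n) powr (- s) * xk (k + n)\<bar>" _ "\<lambda>M. 2 * M", unfolded o_def]) (simp add: strict_mono_def)
    have "- t M \<le> P M" for M
    proof -
      have "0 \<le> (c m - c (Suc m)) * Sx (Suc m)" for m
        using 3 Sx_nonpos by (intro mult_nonpos_nonpos) (auto simp: c_def intro!: powr_mono2)
      then have 1: "c M * Sx M \<le> P M" unfolding P_abel by (simp add: sum_nonneg)
      have xs: "summable (\<lambda>k. \<bar>xk (k + 2 * M)\<bar>)"
        using summable_ignore_initial_segment[OF weighted_xk_summable[of 0], of "2 * M"] by simp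
      have "Sx M = - (\<Sum>k. xk (k + 2 * M))"
        using suminf_split_initial_segment[OF sums_summable[OF xk_sums], of "2 * M"] sums_unique[OF xk_sums]
        by (simp add: Sx_def)
      then have "\<bar>c M * Sx M\<bar> = c M * \<bar>\<Sum>k. xk (k + 2 * M)\<bar>" by (simp add: abs_mult c_def)
      also have "\<dots> \<le> c M * (\<Sum>k. \<bar>xk (k + 2 * M)\<bar>)"
      proof (intro mult_left_mono summable_rabs)
        show "summable (\<lambda>k. \<bar>xk (k + 2 * M)\<bar>)" by (rule xs)
      qed (simp add: c_def)
      also have "\<dots> = (\<Sum>k. c M * \<bar>xk (k + 2 * M)\<bar>)"
        by (rule suminf_mult[OF xs, symmetric])
      also have "\<dots> \<le> t M" unfolding t_def
      proof (intro suminf_le)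
        show "summable (\<lambda>k. c M * \<bar>xk (k + 2 * M)\<bar>)"
          by (rule summable_mult[OF xs])
        show "summable (\<lambda>k. \<bar>dd (k + 2 * M) powr (- s) * xk (k + 2 * M)\<bar>)"
          using summable_ignore_initial_segment[OF weighted_xk_summable[of s], of "2 * M"] .
        show "c M * \<bar>xk (k + 2 * M)\<bar> \<le> \<bar>dd (k + 2 * M) powr (- s) * xk (k + 2 * M)\<bar>" for k
        proof -
          have "c M \<le> dd (k + 2 * M) powr (- s)"
            unfolding c_def using 3 dd_mono[of "2 * M" "k + 2 * M"] by (intro powr_mono2) (auto simp: dd_even)
          then show ?thesis by (simp add: abs_mult mult_right_mono)
        qed
      qed
      finally show ?thesis using 1 by linarith
    qed
    then have "- 0 \<le> W" by (intro LIMSEQ_le[OF tendsto_minus[OF tlim] limP]) auto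
    then show ?thesis using 3 by (simp add: W_def mult_nonpos_nonneg)
  qed
qed

lemma rterm_decomp:
  "(\<Sum>k. rterm k s) = (\<Sum>k. dd k powr (- s) * (exp (- s * xk k) - 1 + s * xk k)) - s * (\<Sum>k. dd k powr (- s) * xk k)"
  "summable (\<lambda>k. dd k powr (- s) * (exp (- s * xk k) - 1 + s * xk k))"
proof -
  have ws: "summable (\<lambda>k. s * (dd k powr (- s) * xk k))"
    using weighted_xk_summable by (intro summable_mult) (rule summable_rabs_cancel)
  have eq: "(\<lambda>k. dd k powr (- s) * (exp (- s * xk k) - 1 + s * xk k)) = (\<lambda>k. rterm k s + s * (dd k powr (- s) * xk k))"
    by (simp add: rterm_def algebra_simps)
  show "summable (\<lambda>k. dd k powr (- s) * (exp (- s * xk k) - 1 + s * xk k))"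
    unfolding eq by (intro summable_add rterm_summable ws)
  show "(\<Sum>k. rterm k s) = (\<Sum>k. dd k powr (- s) * (exp (- s * xk k) - 1 + s * xk k)) - s * (\<Sum>k. dd k powr (- s) * xk k)"
    unfolding eq suminf_add[OF rterm_summable ws, symmetric]
    by (subst suminf_mult) (auto intro: summable_rabs_cancel[OF weighted_xk_summable])
qed

lemma excess_nonneg: "0 \<le> dd k powr (- s) * (exp (- s * xk k) - 1 + s * xk k)"
  using exp_ge_add_one_self[of "- s * xk k"] by (intro mult_nonneg_nonneg) auto

lemma zdiff_nonneg: "Im (zdiff (of_real s)) = 0" "0 \<le> Re (zdiff (of_real s))"
proof -
  have "0 \<le> (\<Sum>k. dd k powr (- s) * (exp (- s * xk k) - 1 + s * xk k))"
    by (intro suminf_nonneg rterm_decomp(2) excess_nonneg)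
  then show "Im (zdiff (of_real s)) = 0" "0 \<le> Re (zdiff (of_real s))"
    using weighted_xk_sign[of s] by (auto simp: zdiff_real rterm_decomp(1))
qed

text \<open>Both parts in \<open>rterm_decomp\<close> are nonnegative, so every excess term
  vanishes, and the exponential meets its tangent only at 0.\<close>

lemma zdiff_zero_imp:
  assumes "zdiff (of_real s) = 0" "s \<noteq> 0"
  shows "lam k = dd k"
proof -
  have "(\<Sum>k. rterm k s) = 0" using assms(1) by (simp add: zdiff_real)
  moreover have "0 \<le> (\<Sum>k. dd k powr (- s) * (exp (- s * xk k) - 1 + s * xk k))"
    by (intro suminf_nonneg rterm_decomp(2) excess_nonneg)
  ultimately have "(\<Sum>k. dd k powr (- s) * (exp (- s * xk k) - 1 + s * xk k)) = 0"
    using weighted_xk_sign[of s] by (simp add: rterm_decomp(1))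
  then have "dd k powr (- s) * (exp (- s * xk k) - 1 + s * xk k) = 0"
    using suminf_eq_zero_iff[OF rterm_decomp(2)[of s] excess_nonneg] by blast
  then have "exp (- s * xk k) = 1 + (- s * xk k)" by simp
  then have "xk k = 0" using exp_gt_one_plus[of "- s * xk k"] assms(2) by fastforce
  then show ?thesis by (simp add: lam_exp)
qed

lemma zdiff_zero: "(\<And>k. lam k = dd k) \<Longrightarrow> zdiff s = 0"
  by (simp add: zdiff_def zterm_def)

text \<open>Without perturbation \<lambda>_k \<ge> d_k for all k; the opposite inequality between
  the products leaves only equality.\<close>

lemma lam_eq_of_Rm_zero:
  assumes "\<And>k l. Rm k l = 0"
  shows "lam k = dd k"
proof -
  have x0: "0 \<le> xk j" for j
    using lam_ge_of_Rm_zero[OF assms, of j] lam_pos[of j] by (simp add: xk_def)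
  have "Sx (Suc k) = 0" using Sx_nonpos[of "Suc k"] x0 by (simp add: Sx_def sum_nonneg order_antisym)
  then have "xk k = 0" unfolding Sx_def using x0 by (subst (asm) sum_nonneg_eq_0_iff) auto
  then show ?thesis by (simp add: lam_exp)
qed

lemma lam_powr_summable:
  assumes "Re s > 1"
  shows "summable (\<lambda>k. norm (of_real (lam k) powr (- s)))"
proof (rule summable_comparison_test')
  show "summable (\<lambda>k. norm (zterm k s) + norm (of_real (dd k) powr (- s)))"
    by (intro summable_add zterm_summable dd_powr_summable assms)
  show "norm (norm (of_real (lam k) powr (- s))) \<le> norm (zterm k s) + norm (of_real (dd k) powr (- s))" for k
    using norm_triangle_ineq[of "zterm k s" "of_real (dd k) powr (- s)"] by (simp add: zterm_def)
qed

lemma zdiff_eq: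
  assumes "Re s > 1"
  shows "zdiff s = (\<Sum>k. of_real (lam k) powr (- s)) - (\<Sum>k. of_real (dd k) powr (- s))"
  unfolding zdiff_def zterm_def
  by (rule suminf_diff[OF summable_norm_cancel[OF lam_powr_summable[OF assms]]
        summable_norm_cancel[OF dd_powr_summable[OF assms]], symmetric])

end

section \<open>Uniformly smooth families of periodic functions\<close>

lemma periodic2pi_add_int: "periodic2pi f \<Longrightarrow> f (x + 2 * pi * of_int n) = f x"
proof -
  assume p: "periodic2pi f"
  have nat: "f (x + 2 * pi * real m) = f x" for m x
  proof (induction m)
    case (Suc m)
    have "f (x + 2 * pi * real (Suc m)) = f ((x + 2 * pi * real m) + 2 * pi)" by (simp add: algebra_simps)
    then show ?case using Suc p by (simp add: periodic2pi_def)
  qed simp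
  show ?thesis
  proof (cases "n \<ge> 0")
    case True
    then show ?thesis using nat[of x "nat n"] by simp
  next
    case False
    then show ?thesis using nat[of "x + 2 * pi * of_int n" "nat (- n)"] by (simp add: algebra_simps)
  qed
qed

lemma periodic2pi_reduce:
  assumes "periodic2pi f"
  obtains y where "y \<in> {0..2 * pi}" "f x = f y"
proof -
  define y where "y = x + 2 * pi * of_int (- \<lfloor>x / (2 * pi)\<rfloor>)"
  have p: "0 < 2 * pi" by simp
  have "of_int \<lfloor>x / (2 * pi)\<rfloor> \<le> x / (2 * pi)" "x / (2 * pi) < of_int \<lfloor>x / (2 * pi)\<rfloor> + 1" by linarith+
  then have "of_int \<lfloor>x / (2 * pi)\<rfloor> * (2 * pi) \<le> x" "x < (of_int \<lfloor>x / (2 * pi)\<rfloor> + 1) * (2 * pi)"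
    unfolding pos_le_divide_eq[OF p] pos_divide_less_eq[OF p] by blast+
  then have "y \<in> {0..2 * pi}" by (auto simp: y_def algebra_simps)
  moreover have "f x = f y" unfolding y_def by (rule periodic2pi_add_int[OF assms, symmetric])
  ultimately show thesis using that by blast
qed

lemma periodic_continuous_bounded:
  fixes f :: "real \<Rightarrow> 'a::real_normed_vector"
  assumes "periodic2pi f" "continuous_on UNIV f"
  obtains B where "\<And>x. norm (f x) \<le> B"
proof -
  have "compact (f ` {0..2 * pi})"
    using assms(2) by (intro compact_continuous_image) (auto intro: continuous_on_subset)
  then obtain B where "\<forall>y\<in>f ` {0..2 * pi}. norm y \<le> B" using compact_imp_bounded bounded_iff by metis
  then show thesis using that periodic2pi_reduce[OF assms(1)] by (metis image_eqI)
qed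

lemma periodic_derivative:
  fixes f :: "real \<Rightarrow> 'a::real_normed_vector"
  assumes "periodic2pi f" "\<And>x. (f has_vector_derivative f' x) (at x)"
  shows "periodic2pi f'"
  unfolding periodic2pi_def
proof
  fix x
  have "((f \<circ> (\<lambda>t. t + 2 * pi)) has_vector_derivative 1 *\<^sub>R f' (x + 2 * pi)) (at x)"
    by (rule vector_diff_chain_at) (auto intro!: derivative_eq_intros assms(2))
  moreover have "f \<circ> (\<lambda>t. t + 2 * pi) = f" using assms(1) by (auto simp: periodic2pi_def)
  ultimately show "f' (x + 2 * pi) = f' x" using assms(2)[of x] vector_derivative_unique_at by fastforce
qed

text \<open>Periodic families bounded together with k derivatives, uniformly in the parameter p. The
  parameter will be a frequency or a pair of frequencies, so that one constant serves all of
  them.\<close>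

primrec Cb :: "nat \<Rightarrow> ('p \<Rightarrow> real \<Rightarrow> complex) \<Rightarrow> bool" where
  "Cb 0 F \<longleftrightarrow> (\<forall>p. periodic2pi (F p)) \<and> (\<exists>B. \<forall>p x. norm (F p x) \<le> B)"
| "Cb (Suc k) F \<longleftrightarrow> (\<forall>p. periodic2pi (F p)) \<and> (\<exists>B. \<forall>p x. norm (F p x) \<le> B) \<and>
     (\<exists>F'. (\<forall>p x. (F p has_vector_derivative F' p x) (at x)) \<and> Cb k F')"

lemma Cb_base: "Cb k F \<Longrightarrow> (\<forall>p. periodic2pi (F p)) \<and> (\<exists>B. \<forall>p x. norm (F p x) \<le> B)"
  by (cases k) auto

lemma Cb_SucD: "Cb (Suc k) F \<Longrightarrow> Cb k F"
proof (induction k arbitrary: F)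
  case (Suc k)
  then obtain F' where F': "\<forall>p x. (F p has_vector_derivative F' p x) (at x)" "Cb (Suc k) F'" by auto
  have "Cb k F'" by (rule Suc.IH[OF F'(2)])
  then show ?case using Cb_base[OF Suc.prems] F'(1) by auto
qed auto

lemma Cb_add: "Cb k F \<Longrightarrow> Cb k G \<Longrightarrow> Cb k (\<lambda>p x. F p x + G p x)"
proof (induction k arbitrary: F G)
  case 0
  then obtain B B' where "\<And>p x. norm (F p x) \<le> B" "\<And>p x. norm (G p x) \<le> B'" by auto
  then have "norm (F p x + G p x) \<le> B + B'" for p x by (meson add_mono norm_triangle_le)
  then show ?case using 0 by (auto simp: periodic2pi_def)
next
  case (Suc k)
  then obtain F' G' where *: "\<forall>p x. (F p has_vector_derivative F' p x) (at x)" "Cb k F'"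
    "\<forall>p x. (G p has_vector_derivative G' p x) (at x)" "Cb k G'" by auto
  obtain B B' where "\<And>p x. norm (F p x) \<le> B" "\<And>p x. norm (G p x) \<le> B'" using Suc.prems by auto
  then have "norm (F p x + G p x) \<le> B + B'" for p x by (meson add_mono norm_triangle_le)
  then have "\<exists>B. \<forall>p x. norm (F p x + G p x) \<le> B" by blast
  moreover have "\<exists>H. (\<forall>p x. ((\<lambda>x. F p x + G p x) has_vector_derivative H p x) (at x)) \<and> Cb k H"
    using * Suc.IH[OF *(2,4)] by (intro exI[of _ "\<lambda>p x. F' p x + G' p x"]) (auto intro: has_vector_derivative_add)
  ultimately show ?case using Suc.prems by (auto simp: periodic2pi_def)
qed

lemma Cb_mult: "Cb k F \<Longrightarrow> Cb k G \<Longrightarrow> Cb k (\<lambda>p x. F p x * G p x)"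
proof (induction k arbitrary: F G)
  case 0
  then obtain B B' where b: "\<And>p x. norm (F p x) \<le> B" "\<And>p x. norm (G p x) \<le> B'" by auto
  have "norm (F p x * G p x) \<le> B * B'" for p x
    unfolding norm_mult using b order_trans[OF norm_ge_zero b(1)] by (intro mult_mono) auto
  then show ?case using 0 by (auto simp: periodic2pi_def)
next
  case (Suc k)
  then obtain F' G' where *: "\<forall>p x. (F p has_vector_derivative F' p x) (at x)" "Cb k F'"
    "\<forall>p x. (G p has_vector_derivative G' p x) (at x)" "Cb k G'" by auto
  obtain B B' where b: "\<And>p x. norm (F p x) \<le> B" "\<And>p x. norm (G p x) \<le> B'" using Suc.prems by auto
  have "norm (F p x * G p x) \<le> B * B'" for p x
    unfolding norm_mult using b order_trans[OF norm_ge_zero b(1)] by (intro mult_mono) auto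
  then have "\<exists>B. \<forall>p x. norm (F p x * G p x) \<le> B" by blast
  moreover have "\<exists>H. (\<forall>p x. ((\<lambda>x. F p x * G p x) has_vector_derivative H p x) (at x)) \<and> Cb k H"
    using * Cb_add[OF Suc.IH[OF Cb_SucD[OF Suc.prems(1)] *(4)] Suc.IH[OF *(2) Cb_SucD[OF Suc.prems(2)]]]
    by (intro exI[of _ "\<lambda>p x. F p x * G' p x + F' p x * G p x"]) (auto intro: has_vector_derivative_mult)
  ultimately show ?case using Suc.prems by (auto simp: periodic2pi_def)
qed

lemma Cb_const:
  fixes c :: "'a \<Rightarrow> complex"
  shows "(\<And>p. norm (c p) \<le> B) \<Longrightarrow> Cb k (\<lambda>p x. c p)"
proof (induction k arbitrary: c B)
  case (Suc k)
  have "Cb k (\<lambda>(p::'a) x. 0)" by (rule Suc.IH[of "\<lambda>_. 0" 0]) simp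
  then have "\<exists>H. (\<forall>p x. ((\<lambda>x. c p) has_vector_derivative H p x) (at x)) \<and> Cb k H"
    by (intro exI[of _ "\<lambda>p x. 0"]) auto
  then show ?case using Suc.prems by (auto simp: periodic2pi_def)
qed (auto simp: periodic2pi_def)

lemma Cb_cmult: "Cb k F \<Longrightarrow> Cb k (\<lambda>p x. c * F p x)"
  by (rule Cb_mult[OF Cb_const[of "\<lambda>_. c" "norm c"]]) auto

text \<open>The derivative of 1 / F contains 1 / F itself, but it is needed only to the order of the
  induction hypothesis.\<close>

lemma Cb_inverse:
  assumes "c > 0" "\<And>p x. c \<le> norm (F p x)"
  shows "Cb k F \<Longrightarrow> Cb k (\<lambda>p x. inverse (F p x))"
proof (induction k)
  case 0
  have "norm (inverse (F p x)) \<le> inverse c" for p x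
    using assms by (simp add: norm_inverse le_imp_inverse_le)
  then show ?case using 0 by (auto simp: periodic2pi_def)
next
  case (Suc k)
  obtain F' where F': "\<forall>p x. (F p has_vector_derivative F' p x) (at x)" "Cb k F'" using Suc.prems by auto
  have IH: "Cb k (\<lambda>p x. inverse (F p x))" by (rule Suc.IH[OF Cb_SucD[OF Suc.prems]])
  have "((\<lambda>x. inverse (F p x)) has_vector_derivative (- 1) * (F' p x * (inverse (F p x) * inverse (F p x)))) (at x)" for p x
  proof -
    have "F p x \<noteq> 0" using assms(1) assms(2)[of p x] by auto
    then have "(inverse has_field_derivative - (inverse (F p x) ^ Suc (Suc 0))) (at (F p x))" by (rule DERIV_inverse)
    from field_vector_diff_chain_at[OF F'(1)[rule_format] this] show ?thesis by (simp add: o_def)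
  qed
  moreover have "Cb k (\<lambda>p x. (- 1) * (F' p x * (inverse (F p x) * inverse (F p x))))"
    by (intro Cb_cmult Cb_mult F'(2) IH)
  ultimately have "\<exists>H. (\<forall>p x. ((\<lambda>x. inverse (F p x)) has_vector_derivative H p x) (at x)) \<and> Cb k H"
    by (intro exI[of _ "\<lambda>p x. (- 1) * (F' p x * (inverse (F p x) * inverse (F p x)))"]) blast
  moreover have "norm (inverse (F p x)) \<le> inverse c" for p x
    using assms by (simp add: norm_inverse le_imp_inverse_le)
  then have "\<exists>B. \<forall>p x. norm (inverse (F p x)) \<le> B" by blast
  ultimately show ?case using Suc.prems by (auto simp: periodic2pi_def)
qed

text \<open>The derivative families supplied for different k coincide, by uniqueness of the
  derivative.\<close>

lemma Cb_derivative:
  assumes "\<And>k. Cb k F"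
  obtains F' where "\<And>p x. (F p has_vector_derivative F' p x) (at x)" "\<And>k. Cb k F'"
proof -
  define F' where "F' p x = vector_derivative (F p) (at x)" for p x
  have *: "(\<forall>p x. (F p has_vector_derivative F' p x) (at x)) \<and> Cb k F'" for k
  proof -
    obtain G where G: "\<forall>p x. (F p has_vector_derivative G p x) (at x)" "Cb k G" using assms[of "Suc k"] by auto
    then have "G = F'" by (auto simp: F'_def fun_eq_iff intro!: vector_derivative_at[symmetric])
    then show ?thesis using G by blast
  qed
  then show thesis using that by blast
qed

lemma Cb_continuous: "(\<And>k. Cb k F) \<Longrightarrow> continuous_on S (F p)"
  by (meson Cb_derivative continuous_at_imp_continuous_on has_vector_derivative_continuous)

lemma smooth_circle_imp_Cb: "smooth_circle u \<Longrightarrow> Cb k (\<lambda>_::'p. u)"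
proof -
  assume u: "smooth_circle u"
  then obtain D where D: "D 0 = u" "\<And>n x. (D n has_vector_derivative D (Suc n) x) (at x)"
    by (auto simp: smooth_circle_def smooth_fun_def)
  have per: "periodic2pi (D n)" for n
  proof (induction n)
    case 0
    then show ?case using u D(1) by (simp add: smooth_circle_def)
  next
    case (Suc n)
    then show ?case using periodic_derivative[OF _ D(2)] by blast
  qed
  have bdd: "\<exists>B. \<forall>x. norm (D n x) \<le> B" for n
  proof -
    have "continuous_on UNIV (D n)"
      using D(2) by (meson continuous_at_imp_continuous_on has_vector_derivative_continuous)
    then show ?thesis using periodic_continuous_bounded[OF per] by metis
  qed
  have "Cb k (\<lambda>_::'p. D n)" for n
  proof (induction k arbitrary: n)
    case (Suc k)
    then have "\<exists>F'. (\<forall>p x. (D n has_vector_derivative F' p x) (at x)) \<and> Cb k (F' :: 'p \<Rightarrow> _)"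
      using D(2) by (intro exI[of _ "\<lambda>_. D (Suc n)"]) blast
    then show ?case using per bdd by auto
  qed (use per bdd in auto)
  from this[of 0] show ?thesis by (simp add: D(1))
qed

text \<open>Iterating the vector derivative produces the sequence of derivatives that
  \<open>smooth_fun\<close> asks for.\<close>

lemma Cb_imp_smooth_circle:
  assumes "\<And>k. Cb k (\<lambda>_::unit. u)"
  shows "smooth_circle u"
proof -
  define dv :: "(real \<Rightarrow> complex) \<Rightarrow> real \<Rightarrow> complex" where "dv f x = vector_derivative f (at x)" for f x
  define D where "D n = (dv ^^ n) u" for n
  have step: "(\<forall>x. (f has_vector_derivative dv f x) (at x)) \<and> (\<forall>k. Cb k (\<lambda>_::unit. dv f))"
    if h: "\<And>k. Cb k (\<lambda>_::unit. f)" for f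
  proof -
    obtain F' where F': "\<And>p x. (f has_vector_derivative F' p x) (at x)" "\<And>k. Cb k (F' :: unit \<Rightarrow> _)"
      by (rule Cb_derivative[of "\<lambda>_::unit. f", OF h]) blast
    have "F' = (\<lambda>_. dv f)" using F'(1) by (auto simp: dv_def fun_eq_iff intro!: vector_derivative_at[symmetric])
    then show ?thesis using F' by auto
  qed
  have all: "Cb k (\<lambda>_::unit. D n)" for n k
  proof (induction n arbitrary: k)
    case 0 then show ?case using assms by (simp add: D_def)
  next
    case (Suc n)
    then show ?case using step[of "D n"] by (simp add: D_def)
  qed
  have "(D n has_vector_derivative D (Suc n) x) (at x)" for n x
    using step[of "D n"] all by (simp add: D_def)
  then have "smooth_fun u" unfolding smooth_fun_def by (intro exI[of _ D]) (auto simp: D_def)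
  then show ?thesis using Cb_base[OF assms[of 0]] by (simp add: smooth_circle_def)
qed

section \<open>Closure properties of smooth functions on the circle\<close>

lemma smooth_circle_add: "smooth_circle u \<Longrightarrow> smooth_circle v \<Longrightarrow> smooth_circle (\<lambda>x. u x + v x :: complex)"
  and smooth_circle_mult: "smooth_circle u \<Longrightarrow> smooth_circle v \<Longrightarrow> smooth_circle (\<lambda>x. u x * v x :: complex)"
  by (rule Cb_imp_smooth_circle; intro Cb_add Cb_mult smooth_circle_imp_Cb; assumption)+

lemma smooth_circle_const: "smooth_circle (\<lambda>x. c :: complex)"
  by (rule Cb_imp_smooth_circle, rule Cb_const[of "\<lambda>_. c" "norm c"]) simp

lemma smooth_circle_cmult: "smooth_circle u \<Longrightarrow> smooth_circle (\<lambda>x. c * u x :: complex)"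
  by (intro smooth_circle_mult smooth_circle_const)

lemma smooth_circle_diff: "smooth_circle u \<Longrightarrow> smooth_circle v \<Longrightarrow> smooth_circle (\<lambda>x. u x - v x :: complex)"
  using smooth_circle_add[of u "\<lambda>x. (- 1) * v x"] smooth_circle_cmult[of v "- 1"] by simp

lemma smooth_circle_inverse:
  fixes u :: "real \<Rightarrow> complex"
  assumes "smooth_circle u" "c > 0" "\<And>x. c \<le> norm (u x)"
  shows "smooth_circle (\<lambda>x. inverse (u x))"
  by (rule Cb_imp_smooth_circle, rule Cb_inverse[OF assms(2)]) (use assms smooth_circle_imp_Cb in auto)

lemma smooth_circle_continuous: "smooth_circle (u :: real \<Rightarrow> complex) \<Longrightarrow> continuous_on S u"
  using Cb_continuous[of "\<lambda>_::unit. u"] smooth_circle_imp_Cb by blast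

lemma smooth_circle_periodic: "smooth_circle u \<Longrightarrow> periodic2pi u"
  by (simp add: smooth_circle_def)

lemma smooth_circle_of_real:
  assumes "smooth_circle (a :: real \<Rightarrow> real)"
  shows "smooth_circle (\<lambda>x. complex_of_real (a x))"
proof -
  obtain D where D: "D 0 = a" "\<And>n x. (D n has_vector_derivative D (Suc n) x) (at x)"
    using assms by (auto simp: smooth_circle_def smooth_fun_def)
  have "smooth_fun (\<lambda>x. complex_of_real (a x))"
    unfolding smooth_fun_def
    by (intro exI[of _ "\<lambda>n x. complex_of_real (D n x)"])
      (auto simp: D(1) intro!: bounded_linear.has_vector_derivative[OF bounded_linear_of_real] D(2))
  then show ?thesis using assms by (auto simp: smooth_circle_def periodic2pi_def)
qed

text \<open>Bootstrapping: if u has k bounded derivatives, so has u' = v u. This covers exponentials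
  and square roots alike.\<close>

lemma smooth_circle_ode:
  fixes u v :: "real \<Rightarrow> complex"
  assumes "periodic2pi u" "\<And>x. (u has_vector_derivative v x * u x) (at x)" "smooth_circle v"
  shows "smooth_circle u"
proof (rule Cb_imp_smooth_circle)
  have cont: "continuous_on UNIV u"
    using assms(2) by (meson continuous_at_imp_continuous_on has_vector_derivative_continuous)
  obtain B where B: "\<And>x. norm (u x) \<le> B" by (rule periodic_continuous_bounded[OF assms(1) cont]) blast
  show "Cb k (\<lambda>_::unit. u)" for k
  proof (induction k)
    case (Suc k)
    have "Cb k (\<lambda>_::unit. \<lambda>x. v x * u x)" by (intro Cb_mult smooth_circle_imp_Cb assms(3) Suc)
    then have "\<exists>F'. (\<forall>p x. (u has_vector_derivative F' p x) (at x)) \<and> Cb k (F' :: unit \<Rightarrow> _)"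
      using assms(2) by (intro exI[of _ "\<lambda>_ x. v x * u x"]) blast
    then show ?case using assms(1) B by auto
  qed (use assms(1) B in auto)
qed

lemma integral_periodic_derivative:
  fixes f :: "real \<Rightarrow> complex"
  assumes "periodic2pi f" "\<And>x. (f has_vector_derivative f' x) (at x)"
  shows "(f' has_integral 0) {0..2 * pi}"
proof -
  have "(f' has_integral (f (2 * pi) - f 0)) {0..2 * pi}"
    by (rule fundamental_theorem_of_calculus) (auto intro: has_vector_derivative_at_within assms(2))
  moreover have "f (2 * pi) = f 0" using assms(1) unfolding periodic2pi_def by (metis add_0)
  ultimately show ?thesis by simp
qed

text \<open>Each integration by parts gains a factor 1 / N, because \<rho> stays away from 0; the
  constants are uniform in p.\<close>

lemma nonstationary_phase:
  fixes E \<rho> :: "'p \<Rightarrow> real \<Rightarrow> complex" and N :: "'p \<Rightarrow> real"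
  assumes N: "\<And>p. N p > 0" and per: "\<And>p. periodic2pi (E p)" and bd: "\<And>p x. norm (E p x) \<le> 1"
    and E': "\<And>p x. (E p has_vector_derivative \<i> * of_real (N p) * \<rho> p x * E p x) (at x)"
    and \<rho>: "\<And>k. Cb k \<rho>" "\<And>p x. c \<le> norm (\<rho> p x)" "c > 0"
    and G: "\<And>k. Cb k G"
  shows "\<exists>C. \<forall>p. norm (integral {0..2 * pi} (\<lambda>x. G p x * E p x)) \<le> C / N p ^ j"
  using G
proof (induction j arbitrary: G)
  have contE: "continuous_on S (E p)" for S p
    using E' by (meson continuous_at_imp_continuous_on has_vector_derivative_continuous)
  case 0
  obtain B where B: "\<And>p x. norm (G p x) \<le> B" using Cb_base[OF 0[of 0]] by blast
  have "norm (integral {0..2 * pi} (\<lambda>x. G p x * E p x)) \<le> B * (2 * pi - 0)" for p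
  proof (rule integral_bound)
    show "continuous_on {0..2 * pi} (\<lambda>x. G p x * E p x)"
      by (intro continuous_intros contE Cb_continuous 0)
    fix t
    have "norm (G p t) * norm (E p t) \<le> B * 1"
      using B bd order_trans[OF norm_ge_zero B] by (intro mult_mono) auto
    then show "norm (G p t * E p t) \<le> B" by (simp add: norm_mult)
  qed auto
  then show ?case by auto
next
  have contE: "continuous_on S (E p)" for S p
    using E' by (meson continuous_at_imp_continuous_on has_vector_derivative_continuous)
  case (Suc j)
  have r0: "\<rho> p x \<noteq> 0" for p x using \<rho>(2)[of p x] \<rho>(3) by auto
  \<comment> \<open>G E = H \<rho> E, and \<rho> E is the derivative of E divided by i N;
    integration by parts moves that derivative to H.\<close>
  define H where "H p x = G p x * inverse (\<rho> p x)" for p x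
  have HC: "Cb k H" for k unfolding H_def by (intro Cb_mult Cb_inverse[OF \<rho>(3,2)] \<rho>(1) Suc.prems)
  obtain H' where H': "\<And>p x. (H p has_vector_derivative H' p x) (at x)" "\<And>k. Cb k H'"
    by (rule Cb_derivative[OF HC]) blast
  obtain C where C: "\<And>p. norm (integral {0..2 * pi} (\<lambda>x. H' p x * E p x)) \<le> C / N p ^ j"
    using Suc.IH[OF H'(2)] by blast
  have "norm (integral {0..2 * pi} (\<lambda>x. G p x * E p x)) \<le> C / N p ^ Suc j" for p
  proof -
    have HG: "H p x * \<rho> p x = G p x" for x using r0 by (simp add: H_def)
    have "((\<lambda>x. H p x * (\<i> * of_real (N p) * \<rho> p x * E p x) + H' p x * E p x) has_integral 0) {0..2 * pi}"
    proof (rule integral_periodic_derivative[of "\<lambda>x. H p x * E p x"])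
      show "periodic2pi (\<lambda>x. H p x * E p x)"
        using Cb_base[OF HC[of 0]] per[of p] by (auto simp: periodic2pi_def)
      show "((\<lambda>x. H p x * E p x) has_vector_derivative H p x * (\<i> * of_real (N p) * \<rho> p x * E p x) + H' p x * E p x) (at x)" for x
        by (intro has_vector_derivative_mult H'(1) E')
    qed
    moreover have "H p x * (\<i> * of_real (N p) * \<rho> p x * E p x) = \<i> * of_real (N p) * (G p x * E p x)" for x
      by (simp add: HG[symmetric] mult_ac)
    ultimately have "((\<lambda>x. \<i> * of_real (N p) * (G p x * E p x) + H' p x * E p x) has_integral 0) {0..2 * pi}" by simp
    then have "0 = integral {0..2 * pi} (\<lambda>x. \<i> * of_real (N p) * (G p x * E p x) + H' p x * E p x)"
      by (simp add: integral_unique)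
    also have "\<dots> = \<i> * of_real (N p) * integral {0..2 * pi} (\<lambda>x. G p x * E p x) + integral {0..2 * pi} (\<lambda>x. H' p x * E p x)"
    proof -
      have "(\<lambda>x. \<i> * of_real (N p) * (G p x * E p x)) integrable_on {0..2 * pi}" "(\<lambda>x. H' p x * E p x) integrable_on {0..2 * pi}"
        by (intro integrable_continuous_interval continuous_on_mult continuous_on_const contE
            Cb_continuous[OF Suc.prems] Cb_continuous[OF H'(2)])+
      then show ?thesis by (simp add: integral_add)
    qed
    finally have "\<i> * of_real (N p) * integral {0..2 * pi} (\<lambda>x. G p x * E p x) = - integral {0..2 * pi} (\<lambda>x. H' p x * E p x)"
      by (simp add: eq_neg_iff_add_eq_0)
    then have "N p * norm (integral {0..2 * pi} (\<lambda>x. G p x * E p x)) = norm (integral {0..2 * pi} (\<lambda>x. H' p x * E p x))"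
      using N[of p] by (metis abs_of_pos norm_ii norm_minus_cancel norm_mult norm_of_real mult_1)
    then have "N p * norm (integral {0..2 * pi} (\<lambda>x. G p x * E p x)) \<le> C / N p ^ j" using C[of p] by simp
    then show ?thesis using N[of p] by (simp add: field_simps)
  qed
  then show ?case by blast
qed

section \<open>Fourier series in a circle parameter\<close>

definition rapid :: "(nat \<Rightarrow> complex) \<Rightarrow> bool" where
  "rapid c \<longleftrightarrow> (\<forall>p. \<exists>C. \<forall>k. norm (c k) \<le> C / real (Suc k) ^ p)"

lemma rapidD:
  assumes "rapid c"
  obtains C where "C \<ge> 0" "\<And>k. norm (c k) \<le> C / real (Suc k) ^ p"
proof -
  obtain C where C: "\<And>k. norm (c k) \<le> C / real (Suc k) ^ p" using assms unfolding rapid_def by blast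
  have "C \<ge> 0" using order_trans[OF norm_ge_zero C[of 0]] by simp
  then show thesis using that C by blast
qed

lemma rapid_summable: "rapid c \<Longrightarrow> summable (\<lambda>k. norm (c k))"
proof -
  assume "rapid c"
  then obtain C where "\<And>k. norm (c k) \<le> C / real (Suc k) ^ 2" by (rule rapidD[of c 2]) blast
  then show ?thesis
    by (intro summable_comparison_test'[OF summable_mult[OF summable_inverse_squares, of C]])
      (simp add: power_divide)
qed

text \<open>A factor of order d_k costs one power, and the exchange of partners a factor 2 in k +
  1.\<close>

lemma rapid_partner_dd:
  assumes "rapid c" "\<And>k. norm (e k) \<le> B * dd k"
  shows "rapid (\<lambda>k. e k * c (partner k))"
  unfolding rapid_def
proof
  fix p
  obtain C where C: "C \<ge> 0" "\<And>k. norm (c k) \<le> C / real (Suc k) ^ (p + 1)" using rapidD[OF assms(1)] by metis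
  have B: "B \<ge> 0" using order_trans[OF norm_ge_zero assms(2)[of 0]] by (simp add: dd_def)
  have "norm (e k * c (partner k)) \<le> (B * C * 2 ^ (p + 1)) / real (Suc k) ^ p" for k
  proof -
    have pk: "real (Suc k) \<le> 2 * real (Suc (partner k))"
      by (cases "even k") (auto simp: partner_def elim!: oddE)
    have "norm (e k * c (partner k)) \<le> (B * real (Suc k)) * (C / real (Suc (partner k)) ^ (p + 1))"
      unfolding norm_mult
    proof (intro mult_mono C(2))
      have "B * dd k \<le> B * real (Suc k)" using B dd_upper[of k] dd_ge1[of k] by (intro mult_left_mono) (auto simp: dd_def)
      then show "norm (e k) \<le> B * real (Suc k)" using assms(2)[of k] by linarith
    qed (use B C(1) in auto)
    also have "\<dots> \<le> (B * real (Suc k)) * (C * 2 ^ (p + 1) / real (Suc k) ^ (p + 1))"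
    proof (intro mult_left_mono)
      have "real (Suc k) ^ (p + 1) \<le> (2 * real (Suc (partner k))) ^ (p + 1)" by (intro power_mono pk) auto
      then have "C * real (Suc k) ^ (p + 1) \<le> C * (2 ^ (p + 1) * real (Suc (partner k)) ^ (p + 1))"
        unfolding power_mult_distrib by (intro mult_left_mono C(1))
      then show "C / real (Suc (partner k)) ^ (p + 1) \<le> C * 2 ^ (p + 1) / real (Suc k) ^ (p + 1)"
        by (simp add: divide_simps mult_ac del: of_nat_Suc power_Suc)
    qed (use B in auto)
    also have "\<dots> = (B * C * 2 ^ (p + 1)) / real (Suc k) ^ p" by (simp add: field_simps del: of_nat_Suc)
    finally show ?thesis .
  qed
  then show "\<exists>C. \<forall>k. norm (e k * c (partner k)) \<le> C / real (Suc k) ^ p" by blast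
qed

lemma rapid_dd:
  assumes "rapid c" "\<And>k. norm (e k) \<le> B * dd k"
  shows "rapid (\<lambda>k. e k * c k)"
proof -
  have 1: "rapid (\<lambda>k. 1 * c (partner k))" by (rule rapid_partner_dd[OF assms(1), of _ 1]) (simp add: dd_ge1)
  have "rapid (\<lambda>k. e k * (1 * c (partner (partner k))))" by (rule rapid_partner_dd[OF 1 assms(2)])
  then show ?thesis by simp
qed

text \<open>Exponentials and trigonometric functions, or a series and its derivative, correspond
  only pair by pair; since both series converge, the even partial sums decide.\<close>

lemma suminf_pairs:
  fixes f g :: "nat \<Rightarrow> complex"
  assumes "summable f" "summable g" "\<And>m. f (2 * m) + f (2 * m + 1) = g (2 * m) + g (2 * m + 1)"
  shows "suminf f = suminf g"
proof -
  have "(\<Sum>k<2*M. f k) = (\<Sum>k<2*M. g k)" for M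
  proof (induction M)
    case (Suc M)
    then show ?case using assms(3)[of M] by (simp add: add.assoc)
  qed simp
  moreover have "strict_mono (\<lambda>M::nat. 2 * M)" by (simp add: strict_mono_def)
  ultimately have "(\<lambda>M. \<Sum>k<2*M. g k) \<longlonglongrightarrow> suminf f" "(\<lambda>M. \<Sum>k<2*M. g k) \<longlonglongrightarrow> suminf g"
    using LIMSEQ_subseq_LIMSEQ[OF summable_LIMSEQ[OF assms(1)], of "\<lambda>M. 2 * M"]
      LIMSEQ_subseq_LIMSEQ[OF summable_LIMSEQ[OF assms(2)], of "\<lambda>M. 2 * M"] by (auto simp: o_def)
  then show ?thesis using LIMSEQ_unique by blast
qed

lemma norm_divide_le: "1 \<le> norm w \<Longrightarrow> norm (z / w) \<le> norm (z :: complex)"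
  using frac_le[of "norm z" "norm z" 1 "norm w"] by (simp add: norm_divide)

text \<open>A continuous surjection from a compact interval is a closed map, so the function it
  induces on the circle is continuous.\<close>

lemma continuous_periodic_image_sphere:
  fixes f :: "real \<Rightarrow> 'a::topological_space"
  assumes \<gamma>: "continuous_on {0..2 * pi} \<gamma>" "\<gamma> ` {0..2 * pi} = sphere (0::complex) 1"
    and f: "continuous_on {0..2 * pi} f" "\<And>x y. x \<in> {0..2 * pi} \<Longrightarrow> y \<in> {0..2 * pi} \<Longrightarrow> \<gamma> x = \<gamma> y \<Longrightarrow> f x = f y"
  obtains F where "continuous_on (sphere 0 1) F" "\<And>x. x \<in> {0..2 * pi} \<Longrightarrow> F (\<gamma> x) = f x"
proof -
  define F where "F z = f (SOME x. x \<in> {0..2 * pi} \<and> \<gamma> x = z)" for z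
  have F: "F (\<gamma> x) = f x" if "x \<in> {0..2 * pi}" for x
  proof -
    have "(SOME y. y \<in> {0..2 * pi} \<and> \<gamma> y = \<gamma> x) \<in> {0..2 * pi} \<and> \<gamma> (SOME y. y \<in> {0..2 * pi} \<and> \<gamma> y = \<gamma> x) = \<gamma> x"
      by (rule someI[of _ x]) (use that in simp)
    then show ?thesis unfolding F_def using f(2) that by blast
  qed
  have "continuous_on (sphere 0 1) F"
    unfolding continuous_on_closed_vimage[OF closed_sphere]
  proof (intro allI impI)
    fix B :: "'a set" assume B: "closed B"
    have "F -` B \<inter> sphere 0 1 = \<gamma> ` ({0..2 * pi} \<inter> f -` B)"
      unfolding \<gamma>(2)[symmetric] using F by auto
    moreover have "closed ({0..2 * pi} \<inter> f -` B)"
      using f(1) B by (simp add: continuous_on_closed_vimage Int_commute)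
    then have "compact ({0..2 * pi} \<inter> f -` B)" by (simp add: compact_Int_closed closed_Int compact_eq_bounded_closed bounded_Int)
    then have "compact (\<gamma> ` ({0..2 * pi} \<inter> f -` B))"
      by (intro compact_continuous_image continuous_on_subset[OF \<gamma>(1)]) auto
    ultimately show "closed (F -` B \<inter> sphere 0 1)" by (simp add: compact_imp_closed)
  qed
  then show thesis using that F by blast
qed

text \<open>Fourier analysis is developed once for the measure b dx and used twice: with b = 1 for
  the angle \<theta>, and with b = 1 / a for the arc-length parameter \<phi>.\<close>

locale circle_param =
  fixes b \<Phi> :: "real \<Rightarrow> real"
  assumes b_smooth: "smooth_circle b" and b_pos: "b x > 0"
    and \<Phi>_deriv: "(\<Phi> has_real_derivative b x) (at x)"
    and \<Phi>_per: "\<Phi> (x + 2 * pi) = \<Phi> x + 2 * pi"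
begin

abbreviation bc :: "real \<Rightarrow> complex" where "bc x \<equiv> complex_of_real (b x)"

lemma bc_smooth: "smooth_circle bc" by (rule smooth_circle_of_real[OF b_smooth])

lemmas bc_cont = smooth_circle_continuous[OF bc_smooth]

lemma b_bounds: obtains B c where "\<And>x. b x \<le> B" "c > 0" "\<And>x. c \<le> b x"
proof -
  obtain B where B: "\<And>x. norm (bc x) \<le> B"
    by (rule periodic_continuous_bounded[OF smooth_circle_periodic[OF bc_smooth] bc_cont]) blast
  have bcont: "continuous_on {0..2 * pi} b" using bc_cont[of "{0..2 * pi}"] continuous_on_Re[of _ bc] by simp
  obtain x0 where x0: "x0 \<in> {0..2 * pi}" "\<And>y. y \<in> {0..2 * pi} \<Longrightarrow> b x0 \<le> b y"
    using continuous_attains_inf[of "{0..2 * pi}" b] bcont by auto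
  have "b x0 \<le> b x" for x
    using periodic2pi_reduce[OF smooth_circle_periodic[OF b_smooth], of x] x0(2) by metis
  then show thesis using that[of B "b x0"] B b_pos by (metis abs_le_D1 norm_of_real)
qed

section \<open>Exponentials and trigonometric functions of the parameter\<close>

definition E :: "int \<Rightarrow> real \<Rightarrow> complex" where "E n x = exp (\<i> * of_int n * of_real (\<Phi> x))"

lemma E_add: "E m x * E n x = E (m + n) x" by (simp add: E_def exp_add[symmetric] algebra_simps)

lemma E_0: "E 0 x = 1" by (simp add: E_def)

lemma norm_E: "norm (E n x) = 1" by (simp add: E_def norm_exp_eq_Re)

lemma cnj_E: "cnj (E n x) = E (- n) x" by (simp add: E_def exp_cnj)

lemma E_deriv: "(E n has_vector_derivative \<i> * of_int n * bc x * E n x) (at x)"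
proof -
  have "(\<Phi> has_vector_derivative b x) (at x)"
    using \<Phi>_deriv[of x] by (simp add: has_real_derivative_iff_has_vector_derivative)
  from has_vector_derivative_mult_right[OF bounded_linear.has_vector_derivative[OF bounded_linear_of_real this], of "\<i> * of_int n"]
  have "((\<lambda>x. \<i> * of_int n * complex_of_real (\<Phi> x)) has_vector_derivative \<i> * of_int n * bc x) (at x)" .
  from field_vector_diff_chain_at[OF this DERIV_exp] show ?thesis by (simp add: o_def E_def[abs_def])
qed

lemma E_periodic: "periodic2pi (E n)"
proof -
  have "exp (\<i> * of_int n * complex_of_real (\<Phi> x + 2 * pi)) = exp (\<i> * of_int n * complex_of_real (\<Phi> x))" for x
  proof -
    have "\<i> * of_int n * complex_of_real (\<Phi> x + 2 * pi) = \<i> * of_int n * complex_of_real (\<Phi> x) + 2 * of_int n * pi * \<i>"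
      by (simp add: algebra_simps)
    then show ?thesis by (simp only: exp_add exp_integer_2pi Ints_of_int mult_1_right)
  qed
  then show ?thesis by (simp add: periodic2pi_def E_def \<Phi>_per)
qed

lemma E_smooth: "smooth_circle (E n)"
  by (rule smooth_circle_ode[OF E_periodic E_deriv]) (intro smooth_circle_cmult bc_smooth)

lemmas E_cont = smooth_circle_continuous[OF E_smooth]

text \<open>The factor \<open>sqrt 2\<close> normalizes in the mean with respect to b dx. The
  constant is left out of the system and is represented by the mean \<open>mn\<close>.\<close>

definition eb :: "nat \<Rightarrow> real \<Rightarrow> complex" where
  "eb k x = of_real (sqrt 2 * (if even k then cos (dd k * \<Phi> x) else sin (dd k * \<Phi> x)))"

abbreviation di :: "nat \<Rightarrow> int" where "di k \<equiv> int (k div 2 + 1)"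

lemma eb_E: "eb k x = (if even k then (E (di k) x + E (- di k) x) / sqrt 2 else (E (di k) x - E (- di k) x) / (sqrt 2 * \<i>))"
proof -
  have s: "complex_of_real (sqrt 2) * complex_of_real (sqrt 2) = 2" by (metis of_real_mult of_real_numeral real_sqrt_mult_self abs_numeral)
  have e: "E (di k) x = of_real (cos (dd k * \<Phi> x)) + \<i> * of_real (sin (dd k * \<Phi> x))"
    "E (- di k) x = of_real (cos (dd k * \<Phi> x)) - \<i> * of_real (sin (dd k * \<Phi> x))"
  proof -
    have "E (di k) x = cis (dd k * \<Phi> x)" by (simp add: E_def cis_conv_exp dd_def mult_ac)
    moreover have "E (- di k) x = cis (- (dd k * \<Phi> x))" by (simp add: E_def cis_conv_exp dd_def algebra_simps)
    ultimately show "E (di k) x = of_real (cos (dd k * \<Phi> x)) + \<i> * of_real (sin (dd k * \<Phi> x))"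
      "E (- di k) x = of_real (cos (dd k * \<Phi> x)) - \<i> * of_real (sin (dd k * \<Phi> x))" by (auto simp: complex_eq_iff)
  qed
  show ?thesis unfolding e eb_def using s by (auto simp: field_simps)
qed

lemma norm_eb: "norm (eb k x) \<le> 2"
proof -
  have "\<bar>if even k then cos (dd k * \<Phi> x) else sin (dd k * \<Phi> x)\<bar> \<le> 1" by simp
  moreover have "sqrt 2 \<le> 2" by (simp add: real_le_lsqrt)
  ultimately have "\<bar>sqrt 2\<bar> * \<bar>if even k then cos (dd k * \<Phi> x) else sin (dd k * \<Phi> x)\<bar> \<le> 2 * 1" by (intro mult_mono) auto
  then show ?thesis by (simp add: eb_def norm_mult abs_mult del: of_real_mult)
qed

lemma cnj_eb: "cnj (eb k x) = eb k x" by (simp add: eb_def)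

lemma eb_smooth: "smooth_circle (eb k)"
proof (cases "even k")
  case True
  then have "eb k = (\<lambda>x. (1 / sqrt 2) * (E (di k) x + E (- di k) x))" by (auto simp: eb_E)
  then show ?thesis by (simp only:) (intro smooth_circle_cmult smooth_circle_add E_smooth)
next
  case False
  then have "eb k = (\<lambda>x. (1 / (sqrt 2 * \<i>)) * (E (di k) x - E (- di k) x))" by (auto simp: eb_E)
  then show ?thesis by (simp only:) (intro smooth_circle_cmult smooth_circle_diff E_smooth)
qed

lemmas eb_cont = smooth_circle_continuous[OF eb_smooth]

lemma eb_deriv: "(eb k has_vector_derivative bc x * of_real (- sg k * dd k) * eb (partner k) x) (at x)"
proof -
  have "((\<lambda>x. sqrt 2 * (if even k then cos (dd k * \<Phi> x) else sin (dd k * \<Phi> x))) has_real_derivative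
      b x * (- sg k * dd k) * (sqrt 2 * (if even (partner k) then cos (dd k * \<Phi> x) else sin (dd k * \<Phi> x)))) (at x)"
    by (cases "even k") (auto intro!: derivative_eq_intros \<Phi>_deriv simp: sg_def partner_def)
  then have "((\<lambda>x. complex_of_real (sqrt 2 * (if even k then cos (dd k * \<Phi> x) else sin (dd k * \<Phi> x)))) has_vector_derivative
      of_real (b x * (- sg k * dd k) * (sqrt 2 * (if even (partner k) then cos (dd k * \<Phi> x) else sin (dd k * \<Phi> x))))) (at x)"
    by (intro bounded_linear.has_vector_derivative[OF bounded_linear_of_real])
      (simp add: has_real_derivative_iff_has_vector_derivative)
  then show ?thesis by (simp only: eb_def[abs_def] of_real_mult partner_simps)
qed

text \<open>Bilinear, without conjugation: the coefficient at frequency n is the product with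
  \<open>E (- n)\<close>.\<close>

definition ip :: "(real \<Rightarrow> complex) \<Rightarrow> (real \<Rightarrow> complex) \<Rightarrow> complex" where
  "ip f g = integral {0..2 * pi} (\<lambda>x. f x * g x * bc x) / (2 * pi)"

definition co :: "(real \<Rightarrow> complex) \<Rightarrow> nat \<Rightarrow> complex" where "co f k = ip f (eb k)"

definition mn :: "(real \<Rightarrow> complex) \<Rightarrow> complex" where "mn f = ip f (\<lambda>_. 1)"

lemma ip_commute: "ip f g = ip g f" by (simp add: ip_def mult_ac)

lemma ip_integrable:
  assumes "continuous_on UNIV f" "continuous_on UNIV g"
  shows "(\<lambda>x. f x * g x * bc x) integrable_on {0..2 * pi}"
  by (intro integrable_continuous_interval continuous_on_mult bc_cont)
    (use assms in \<open>auto intro: continuous_on_subset\<close>)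

lemma ip_add_left:
  assumes "continuous_on UNIV f" "continuous_on UNIV f'" "continuous_on UNIV g"
  shows "ip (\<lambda>x. f x + f' x) g = ip f g + ip f' g"
  unfolding ip_def distrib_right
  by (subst integral_add) (use assms in \<open>auto intro: ip_integrable simp: add_divide_distrib\<close>)

lemma ip_cmult_left: "ip (\<lambda>x. c * f x) g = c * ip f g"
  unfolding ip_def by (simp add: mult.assoc)

lemma ip_add_right:
  assumes "continuous_on UNIV f" "continuous_on UNIV f'" "continuous_on UNIV g"
  shows "ip g (\<lambda>x. f x + f' x) = ip g f + ip g f'"
  unfolding ip_commute[of g] by (rule ip_add_left[OF assms])

lemma ip_cmult_right: "ip g (\<lambda>x. c * f x) = c * ip g f"
  unfolding ip_commute[of g] by (rule ip_cmult_left)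

lemma ip_diff_left:
  assumes "continuous_on UNIV f" "continuous_on UNIV f'" "continuous_on UNIV g"
  shows "ip (\<lambda>x. f x - f' x) g = ip f g - ip f' g"
  using ip_add_left[OF assms(1) _ assms(3), of "\<lambda>x. - 1 * f' x"] ip_cmult_left[of "- 1" f' g] assms(2)
  by (simp add: continuous_on_minus)

lemma ip_cnj: "ip (\<lambda>x. cnj (f x)) (\<lambda>x. cnj (g x)) = cnj (ip f g)"
  by (simp add: ip_def integral_cnj)

lemma co_cnj: "co (\<lambda>x. cnj (f x)) k = cnj (co f k)"
  using ip_cnj[of f "eb k"] by (simp add: co_def cnj_eb)

text \<open>For n = 0 the integral of b is the increment of \<Phi>; otherwise the integrand is the
  derivative of a periodic function.\<close>

lemma ip_E_one: "ip (E n) (\<lambda>_. 1) = (if n = 0 then 1 else 0)"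
proof (cases "n = 0")
  case True
  have "(b has_integral (\<Phi> (2 * pi) - \<Phi> 0)) {0..2 * pi}"
    by (rule fundamental_theorem_of_calculus)
      (auto intro: has_field_derivative_at_within \<Phi>_deriv simp: has_real_derivative_iff_has_vector_derivative[symmetric])
  moreover have "\<Phi> (2 * pi) - \<Phi> 0 = 2 * pi" using \<Phi>_per[of 0] by simp
  ultimately have "(bc has_integral complex_of_real (2 * pi)) {0..2 * pi}"
    using has_integral_linear[OF _ bounded_linear_of_real, of b "2 * pi" "{0..2 * pi}"] by (simp add: o_def)
  then show ?thesis using True by (simp add: ip_def E_0 integral_unique)
next
  case False
  have "((\<lambda>x. (1 / (\<i> * of_int n)) * (\<i> * of_int n * bc x * E n x)) has_integral 0) {0..2 * pi}"
  proof (rule integral_periodic_derivative[of "\<lambda>x. (1 / (\<i> * of_int n)) * E n x"])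
    show "periodic2pi (\<lambda>x. 1 / (\<i> * of_int n) * E n x)" using E_periodic by (simp add: periodic2pi_def)
    show "((\<lambda>x. 1 / (\<i> * of_int n) * E n x) has_vector_derivative 1 / (\<i> * of_int n) * (\<i> * of_int n * bc x * E n x)) (at x)" for x
      by (intro has_vector_derivative_mult_right E_deriv)
  qed
  then have "((\<lambda>x. E n x * 1 * bc x) has_integral 0) {0..2 * pi}" using False by (simp add: mult_ac)
  then show ?thesis using False by (simp add: ip_def integral_unique)
qed

lemma ip_E: "ip (E m) (E n) = (if m + n = 0 then 1 else 0)"
  using ip_E_one[of "m + n"] by (simp add: ip_def E_add)

lemma ip_E_eb: "ip f (eb k) = (if even k then (ip f (E (di k)) + ip f (E (- di k))) / sqrt 2
    else (ip f (E (di k)) - ip f (E (- di k))) / (sqrt 2 * \<i>))" if f: "continuous_on UNIV f"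
proof (cases "even k")
  case True
  then have e: "eb k = (\<lambda>x. (1 / sqrt 2) * (E (di k) x + E (- di k) x))" by (auto simp: eb_E)
  show ?thesis unfolding e ip_cmult_right ip_add_right[OF E_cont E_cont f] using True by simp
next
  case False
  then have e: "eb k = (\<lambda>x. (1 / (sqrt 2 * \<i>)) * (E (di k) x + (- 1) * E (- di k) x))" by (auto simp: eb_E)
  have c: "continuous_on UNIV (\<lambda>x. (- 1) * E (- di k) x)" by (intro continuous_intros E_cont)
  show ?thesis unfolding e ip_cmult_right ip_add_right[OF E_cont c f] using False by simp
qed

lemma mn_eb: "mn (eb k) = 0"
proof -
  have "mn (eb k) = ip (\<lambda>_. 1) (eb k)" unfolding mn_def by (rule ip_commute)
  moreover have "ip (\<lambda>_. 1) (E n) = (if n = 0 then 1 else 0)" for n using ip_E_one[of n] ip_commute by metis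
  ultimately show ?thesis unfolding ip_E_eb[OF continuous_on_const] by simp
qed

lemma co_eb: "co (eb k) l = (if k = l then 1 else 0)"
proof -
  have s: "complex_of_real (sqrt 2) * complex_of_real (sqrt 2) = 2" by (metis of_real_mult of_real_numeral real_sqrt_mult_self abs_numeral)
  have 1: "ip (eb k) (E n) = (if even k then (ip (E n) (E (di k)) + ip (E n) (E (- di k))) / sqrt 2
    else (ip (E n) (E (di k)) - ip (E n) (E (- di k))) / (sqrt 2 * \<i>))" for n
    unfolding ip_commute[of "eb k"] by (rule ip_E_eb[OF E_cont])
  have dk: "k = l \<longleftrightarrow> (even k \<longleftrightarrow> even l) \<and> k div 2 = l div 2"
    by (metis dvd_mult_div_cancel odd_two_times_div_two_succ)
  have d: "k div 2 = l div 2 \<longleftrightarrow> di k = di l" by simp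
  have p: "di k + di l \<noteq> 0" "- di k - di l \<noteq> 0" "di l + di k \<noteq> 0" "- di l - di k \<noteq> 0" by linarith+
  show ?thesis
    unfolding co_def ip_E_eb[OF eb_cont] 1 ip_E
    using s p by (cases "even k"; cases "even l"; cases "di k = di l") (auto simp: dk field_simps)
qed

lemma co_lincomb:
  assumes "continuous_on UNIV f" "continuous_on UNIV g"
  shows "co (\<lambda>x. f x + g x) k = co f k + co g k" "co (\<lambda>x. f x - g x) k = co f k - co g k"
    "co (\<lambda>x. c * f x) k = c * co f k" "mn (\<lambda>x. f x - g x) = mn f - mn g"
  using assms by (simp_all add: co_def mn_def ip_add_left ip_diff_left ip_cmult_left eb_cont)

section \<open>Trigonometric series with rapidly decreasing coefficients\<close>

definition ser :: "(nat \<Rightarrow> complex) \<Rightarrow> real \<Rightarrow> complex" where "ser c x = (\<Sum>k. c k * eb k x)"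

lemma ser_bound: "norm (c k * eb k x) \<le> 2 * norm (c k)"
  using mult_left_mono[OF norm_eb[of k x] norm_ge_zero[of "c k"]] by (simp add: norm_mult mult.commute)

lemma ser_summable:
  assumes "rapid c"
  shows "summable (\<lambda>k. norm (c k * eb k x))"
  by (rule summable_comparison_test'[OF summable_mult[OF rapid_summable[OF assms], of 2]])
    (use ser_bound in auto)

text \<open>Uniform convergence permits integration term by term.\<close>

lemma ip_ser:
  assumes f: "continuous_on UNIV f" and c: "rapid c"
  shows "(\<lambda>k. c k * co f k) sums ip f (ser c)"
proof -
  have "compact ((\<lambda>x. f x * bc x) ` {0..2 * pi})"
    using f by (intro compact_continuous_image continuous_on_mult bc_cont) (auto intro: continuous_on_subset)
  then obtain B where B: "\<And>x. x \<in> {0..2 * pi} \<Longrightarrow> norm (f x * bc x) \<le> B"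
    using compact_imp_bounded[of "(\<lambda>x. f x * bc x) ` {0..2 * pi}"] unfolding bounded_iff by blast
  have u: "uniform_limit {0..2 * pi} (\<lambda>n x. \<Sum>k<n. f x * (c k * eb k x) * bc x) (\<lambda>x. \<Sum>k. f x * (c k * eb k x) * bc x) sequentially"
  proof (rule Weierstrass_m_test[OF _ summable_mult[OF rapid_summable[OF c], of "2 * B"]])
    fix k x assume x: "x \<in> {0..2 * pi}"
    have "norm (f x * (c k * eb k x) * bc x) = norm (f x * bc x) * norm (c k * eb k x)" by (simp add: norm_mult)
    also have "\<dots> \<le> B * (2 * norm (c k))"
      using B[OF x] order_trans[OF norm_ge_zero B[OF x]] by (intro mult_mono ser_bound) auto
    finally show "norm (f x * (c k * eb k x) * bc x) \<le> 2 * B * norm (c k)" by (simp add: mult_ac)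
  qed
  have cont: "continuous_on {0..2 * pi} (\<lambda>x. \<Sum>k<n. f x * (c k * eb k x) * bc x)" for n
    using f by (intro continuous_on_sum continuous_on_mult continuous_on_const bc_cont eb_cont) (auto intro: continuous_on_subset)
  obtain I J where IJ: "\<And>n. ((\<lambda>x. \<Sum>k<n. f x * (c k * eb k x) * bc x) has_integral I n) {0..2 * pi}"
    "((\<lambda>x. \<Sum>k. f x * (c k * eb k x) * bc x) has_integral J) {0..2 * pi}" "I \<longlonglongrightarrow> J"
    by (rule uniform_limit_integral[OF u cont]) auto
  have In: "I n = (\<Sum>k<n. c k * co f k) * (2 * pi)" for n
  proof -
    have "I n = (\<Sum>k<n. integral {0..2 * pi} (\<lambda>x. f x * (c k * eb k x) * bc x))"
      unfolding integral_unique[OF IJ(1)[of n], symmetric]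
      by (rule integral_sum) (auto intro!: ip_integrable f continuous_on_mult continuous_on_const eb_cont)
    also have "\<dots> = (\<Sum>k<n. c k * co f k * (2 * pi))"
    proof (intro sum.cong refl)
      fix k
      have "ip f (\<lambda>x. c k * eb k x) = c k * co f k" by (simp add: ip_cmult_right co_def)
      then show "integral {0..2 * pi} (\<lambda>x. f x * (c k * eb k x) * bc x) = c k * co f k * (2 * pi)"
        unfolding ip_def by (simp add: field_simps)
    qed
    finally show ?thesis by (simp add: sum_distrib_right)
  qed
  have "(\<lambda>n. (\<Sum>k<n. c k * co f k) * (2 * pi)) \<longlonglongrightarrow> J" using IJ(3) unfolding In[abs_def] .
  from tendsto_divide[OF this tendsto_const[of "complex_of_real (2 * pi)"]]
  have "(\<lambda>k. c k * co f k) sums (J / (2 * pi))" by (simp add: sums_def)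
  moreover have "(\<Sum>k. f x * (c k * eb k x) * bc x) = f x * ser c x * bc x" for x
    unfolding ser_def using summable_norm_cancel[OF ser_summable[OF c, of x]]
    by (simp add: suminf_mult suminf_mult2[symmetric] summable_mult)
  then have "J = integral {0..2 * pi} (\<lambda>x. f x * ser c x * bc x)" using integral_unique[OF IJ(2)] by simp
  ultimately show ?thesis by (simp add: ip_def)
qed

text \<open>Coefficients of the derivative with respect to \<Phi>, in which cosines and sines change
  places.\<close>

definition dcoef :: "(nat \<Rightarrow> complex) \<Rightarrow> nat \<Rightarrow> complex" where
  "dcoef c k = of_real (sg k * dd k) * c (partner k)"

lemma rapid_dcoef: "rapid c \<Longrightarrow> rapid (dcoef c)"
  unfolding dcoef_def[abs_def]
  by (rule rapid_partner_dd[where B = 1]) (simp_all add: norm_mult abs_mult less_imp_le)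

text \<open>The termwise derivatives converge uniformly. They carry \<open>eb (partner k)\<close> in
  place k, and \<open>suminf_pairs\<close> restores the order.\<close>

lemma ser_deriv:
  assumes c: "rapid c"
  shows "(ser c has_vector_derivative bc x * ser (dcoef c) x) (at x)"
proof -
  obtain B c0 where B: "\<And>x. b x \<le> B" "c0 > 0" "\<And>x. c0 \<le> b x" by (rule b_bounds) blast
  have nb: "norm (bc x) \<le> B" for x using B(1)[of x] b_pos[of x] by simp
  have B0: "B \<ge> 0" using order_trans[OF norm_ge_zero nb] .
  define g where "g k x = c k * (bc x * of_real (- sg k * dd k) * eb (partner k) x)" for k x
  have rd: "rapid (\<lambda>k. of_real (- sg k * dd k) * c k)"
    by (rule rapid_dd[OF c, of _ 1]) (simp add: norm_mult abs_mult less_imp_le)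
  have gb: "norm (g k x) \<le> 2 * B * norm (of_real (- sg k * dd k) * c k)" for k x
  proof -
    have "norm (g k x) = norm (bc x) * norm (of_real (- sg k * dd k) * c k) * norm (eb (partner k) x)"
      by (simp add: g_def norm_mult mult_ac)
    also have "\<dots> \<le> B * norm (of_real (- sg k * dd k) * c k) * 2"
      using B0 by (intro mult_mono norm_eb nb) auto
    finally show ?thesis by (simp add: mult_ac)
  qed
  have u: "uniform_limit UNIV (\<lambda>n x. \<Sum>k<n. g k x) (\<lambda>x. \<Sum>k. g k x) sequentially"
    by (rule Weierstrass_m_test[OF _ summable_mult[OF rapid_summable[OF rd], of "2 * B"]]) (rule gb)
  have "\<exists>s. \<forall>x\<in>UNIV. (\<lambda>k. c k * eb k x) sums s x \<and> (s has_derivative (\<lambda>h. h *\<^sub>R (\<Sum>k. g k x))) (at x within UNIV)"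
  proof (rule has_derivative_series[where f' = "\<lambda>k x h. h *\<^sub>R g k x"])
    show "((\<lambda>x. c k * eb k x) has_derivative (\<lambda>h. h *\<^sub>R g k x)) (at x within UNIV)" for k x
      using has_vector_derivative_mult_right[OF eb_deriv[of k x], of "c k"] by (simp add: g_def has_vector_derivative_def)
    show "\<forall>\<^sub>F n in sequentially. \<forall>x\<in>UNIV. \<forall>h. norm ((\<Sum>i<n. h *\<^sub>R g i x) - h *\<^sub>R (\<Sum>k. g k x)) \<le> e * norm h"
      if "e > 0" for e
    proof -
      have "\<forall>\<^sub>F n in sequentially. \<forall>x\<in>UNIV. dist (\<Sum>k<n. g k x) (\<Sum>k. g k x) < e"
        using u that unfolding uniform_limit_iff by blast
      then show ?thesis
      proof eventually_elim
        fix n assume n: "\<forall>x\<in>UNIV. dist (\<Sum>k<n. g k x) (\<Sum>k. g k x) < e"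
        have "norm ((\<Sum>i<n. h *\<^sub>R g i x) - h *\<^sub>R (\<Sum>k. g k x)) \<le> e * norm h" for x h
        proof -
          have "(\<Sum>i<n. h *\<^sub>R g i x) - h *\<^sub>R (\<Sum>k. g k x) = h *\<^sub>R ((\<Sum>k<n. g k x) - (\<Sum>k. g k x))"
            by (simp add: scaleR_right.sum[symmetric] scaleR_diff_right)
          then have "norm ((\<Sum>i<n. h *\<^sub>R g i x) - h *\<^sub>R (\<Sum>k. g k x)) = \<bar>h\<bar> * dist (\<Sum>k<n. g k x) (\<Sum>k. g k x)"
            by (simp add: dist_norm)
          also have "\<dots> \<le> \<bar>h\<bar> * e" using n by (intro mult_left_mono) (auto intro: less_imp_le)
          finally show ?thesis by (simp add: mult.commute)
        qed
        then show "\<forall>x\<in>UNIV. \<forall>h. norm ((\<Sum>i<n. h *\<^sub>R g i x) - h *\<^sub>R (\<Sum>k. g k x)) \<le> e * norm h" by blast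
      qed
    qed
    show "(\<lambda>k. c k * eb k 0) sums ser c 0"
      unfolding ser_def by (rule summable_sums[OF summable_norm_cancel[OF ser_summable[OF c]]])
  qed auto
  then obtain s where s: "\<And>x. (\<lambda>k. c k * eb k x) sums s x" "\<And>x. (s has_derivative (\<lambda>h. h *\<^sub>R (\<Sum>k. g k x))) (at x)" by auto
  have "s = ser c" using s(1) by (auto simp: ser_def sums_iff fun_eq_iff)
  then have 1: "(ser c has_vector_derivative (\<Sum>k. g k x)) (at x)" using s(2) by (simp add: has_vector_derivative_def)
  have "(\<Sum>k. g k x) = (\<Sum>k. bc x * (dcoef c k * eb k x))"
  proof (rule suminf_pairs)
    have "summable (\<lambda>k. norm (g k x))"
      by (rule summable_comparison_test'[OF summable_mult[OF rapid_summable[OF rd], of "2 * B"]]) (use gb in auto)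
    then show "summable (\<lambda>k. g k x)" by (rule summable_norm_cancel)
    show "summable (\<lambda>k. bc x * (dcoef c k * eb k x))"
      by (intro summable_mult summable_norm_cancel[OF ser_summable[OF rapid_dcoef[OF c]]])
    show "g (2 * m) x + g (2 * m + 1) x = bc x * (dcoef c (2 * m) * eb (2 * m) x) + bc x * (dcoef c (2 * m + 1) * eb (2 * m + 1) x)" for m
      by (simp add: g_def dcoef_def sg_def partner_def dd_def)
  qed
  also have "\<dots> = bc x * ser (dcoef c) x"
    unfolding ser_def by (rule suminf_mult[OF summable_norm_cancel[OF ser_summable[OF rapid_dcoef[OF c]]]])
  finally show ?thesis using 1 by simp
qed

lemma ser_smooth:
  assumes "rapid c"
  shows "smooth_circle (ser c)"
proof (rule Cb_imp_smooth_circle)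
  have base: "periodic2pi (ser c) \<and> (\<exists>B. \<forall>x. norm (ser c x) \<le> B)" if c: "rapid c" for c
  proof
    show per: "periodic2pi (ser c)"
      using smooth_circle_periodic[OF eb_smooth] by (simp add: periodic2pi_def ser_def)
    have "continuous_on UNIV (ser c)"
      using ser_deriv[OF c] by (meson continuous_at_imp_continuous_on has_vector_derivative_continuous)
    then show "\<exists>B. \<forall>x. norm (ser c x) \<le> B" by (metis periodic_continuous_bounded[OF per])
  qed
  show "Cb k (\<lambda>_::unit. ser c)" for k using assms
  proof (induction k arbitrary: c)
    case (Suc k)
    have "Cb k (\<lambda>_::unit. \<lambda>x. bc x * ser (dcoef c) x)"
      by (intro Cb_mult smooth_circle_imp_Cb bc_smooth Suc.IH rapid_dcoef Suc.prems)
    then have "\<exists>F'. (\<forall>p x. (ser c has_vector_derivative F' p x) (at x)) \<and> Cb k (F' :: unit \<Rightarrow> _)"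
      using ser_deriv[OF Suc.prems] by (intro exI[of _ "\<lambda>_ x. bc x * ser (dcoef c) x"]) blast
    then show ?case using base[OF Suc.prems] by auto
  qed (use base in auto)
qed

lemmas ser_cont = smooth_circle_continuous[OF ser_smooth]

lemma co_ser:
  assumes "rapid c"
  shows "co (ser c) k = c k" "mn (ser c) = 0"
proof -
  have "(\<lambda>l. c l * co (eb k) l) sums ip (eb k) (ser c)" by (rule ip_ser[OF eb_cont assms])
  moreover have "(\<lambda>l. c l * co (eb k) l) sums c k"
    using sums_If_finite_set[of "{k}" c] by (simp add: co_eb if_distrib[of "times _"] eq_commute cong: if_cong)
  ultimately show "co (ser c) k = c k" using sums_unique2 by (simp add: co_def ip_commute)
  have "(\<lambda>l. c l * co (\<lambda>_. 1) l) sums ip (\<lambda>_. 1) (ser c)" by (rule ip_ser[OF continuous_on_const assms])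
  moreover have "co (\<lambda>_. 1) l = 0" for l using mn_eb[of l] by (simp add: co_def mn_def ip_commute)
  ultimately show "mn (ser c) = 0" by (simp add: mn_def ip_commute sums_iff)
qed

section \<open>Completeness of the trigonometric system\<close>

lemma \<Phi>_strict_mono: "x < y \<Longrightarrow> \<Phi> x < \<Phi> y"
  using DERIV_pos_imp_increasing[of x y \<Phi>] \<Phi>_deriv b_pos by blast

lemma \<Phi>_per_int: "\<Phi> (x + 2 * pi * of_int n) = \<Phi> x + 2 * pi * of_int n"
proof -
  have "periodic2pi (\<lambda>x. \<Phi> x - x)" by (simp add: periodic2pi_def \<Phi>_per)
  from periodic2pi_add_int[OF this, of x n] show ?thesis by simp
qed

lemma E_one_eq: "E 1 x = E 1 y \<Longrightarrow> \<exists>n::int. x = y + 2 * pi * of_int n"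
proof -
  assume "E 1 x = E 1 y"
  then obtain n :: int where "\<i> * complex_of_real (\<Phi> x) = \<i> * complex_of_real (\<Phi> y) + (of_int (2 * n) * pi) * \<i>"
    unfolding E_def exp_eq by auto
  then have "Im (\<i> * complex_of_real (\<Phi> x)) = Im (\<i> * complex_of_real (\<Phi> y) + (of_int (2 * n) * pi) * \<i>)" by simp
  then have "\<Phi> x = \<Phi> y + 2 * pi * of_int n" by simp
  then have "\<Phi> x = \<Phi> (y + 2 * pi * of_int n)" by (simp add: \<Phi>_per_int)
  then show ?thesis using \<Phi>_strict_mono by (metis linorder_neqE_linordered_idom order_less_irrefl)
qed

lemma E_one_surj: "E 1 ` {0..2 * pi} = sphere 0 1"
proof
  show "E 1 ` {0..2 * pi} \<subseteq> sphere 0 1" by (auto simp: norm_E)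
  show "sphere 0 1 \<subseteq> E 1 ` {0..2 * pi}"
  proof
    fix z :: complex assume "z \<in> sphere 0 1"
    then obtain t where t: "z = exp (\<i> * of_real t)" using complex_norm_eq_1_exp[of z] by (metis mem_sphere_0)
    define n where "n = \<lfloor>(t - \<Phi> 0) / (2 * pi)\<rfloor>"
    have p: "0 < 2 * pi" by simp
    have "of_int n \<le> (t - \<Phi> 0) / (2 * pi)" "(t - \<Phi> 0) / (2 * pi) < of_int n + 1" unfolding n_def by linarith+
    then have n: "of_int n * (2 * pi) \<le> t - \<Phi> 0" "t - \<Phi> 0 < (of_int n + 1) * (2 * pi)"
      unfolding pos_le_divide_eq[OF p] pos_divide_less_eq[OF p] by blast+
    have "\<exists>x\<ge>0. x \<le> 2 * pi \<and> \<Phi> x = t - 2 * pi * of_int n"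
    proof (rule IVT)
      show "\<Phi> 0 \<le> t - 2 * pi * of_int n" using n(1) by (simp add: algebra_simps)
      show "t - 2 * pi * of_int n \<le> \<Phi> (2 * pi)" using n(2) \<Phi>_per[of 0] by (simp add: algebra_simps)
    qed (use \<Phi>_deriv DERIV_isCont in auto)
    then obtain x where x: "x \<in> {0..2 * pi}" "\<Phi> x = t - 2 * pi * of_int n" by auto
    have "\<i> * complex_of_real (\<Phi> x) + 2 * of_int n * pi * \<i> = \<i> * of_real t" by (simp add: x(2) algebra_simps)
    then have "exp (\<i> * of_real t) = exp (\<i> * complex_of_real (\<Phi> x)) * exp (2 * of_int n * pi * \<i>)"
      by (metis exp_add)
    then have "E 1 x = z" unfolding t E_def by (simp only: exp_integer_2pi Ints_of_int mult_1_right of_int_1)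
    then show "z \<in> E 1 ` {0..2 * pi}" using x(1) by blast
  qed
qed

text \<open>Multiplication by a linear function of the point \<open>E 1 x\<close> shifts frequencies
  by 1 and -1; so the vanishing of all coefficients survives multiplication by polynomials.\<close>

lemma polynomial_preserves_vanishing:
  assumes "real_polynomial_function p" "continuous_on UNIV g" "\<And>n. ip g (E n) = 0"
  shows "ip (\<lambda>x. of_real (p (E 1 x)) * g x) (E n) = 0"
  using assms
proof (induction p arbitrary: g n rule: real_polynomial_function.induct)
  case (linear h)
  then have lin: "linear h" by (simp add: bounded_linear.linear)
  define \<alpha> where "\<alpha> = (of_real (h 1) - \<i> * of_real (h \<i>)) / 2"
  define \<beta> where "\<beta> = (of_real (h 1) + \<i> * of_real (h \<i>)) / 2"
  have "complex_of_real (h (E 1 x)) = \<alpha> * E 1 x + \<beta> * E (- 1) x" for x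
  proof -
    define z where "z = E 1 x"
    have "h z = h (Re z *\<^sub>R 1 + Im z *\<^sub>R \<i>)" by (rule arg_cong[where f = h]) (simp add: complex_eq_iff)
    also have "\<dots> = Re z * h 1 + Im z * h \<i>" by (simp only: linear_add[OF lin] linear_scale[OF lin] real_scaleR_def)
    finally have "complex_of_real (h z) = \<alpha> * z + \<beta> * cnj z" by (simp add: \<alpha>_def \<beta>_def complex_eq_iff field_simps)
    then show ?thesis by (simp add: z_def cnj_E)
  qed
  then have "ip (\<lambda>x. of_real (h (E 1 x)) * g x) (E n) = ip (\<lambda>x. \<alpha> * (E 1 x * g x) + \<beta> * (E (- 1) x * g x)) (E n)"
    by (simp add: algebra_simps)
  also have "\<dots> = ip (\<lambda>x. \<alpha> * (E 1 x * g x)) (E n) + ip (\<lambda>x. \<beta> * (E (- 1) x * g x)) (E n)"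
    by (intro ip_add_left continuous_on_mult continuous_on_const E_cont linear.prems)
  also have "\<dots> = \<alpha> * ip g (E (1 + n)) + \<beta> * ip g (E (- 1 + n))"
  proof -
    have "ip (\<lambda>x. E m x * g x) (E n) = ip g (E (m + n))" for m
      unfolding ip_def E_add[symmetric] by (simp add: mult_ac)
    then show ?thesis by (simp add: ip_cmult_left)
  qed
  finally show ?case using linear.prems(2) by simp
next
  case (const c)
  then show ?case by (simp add: ip_cmult_left)
next
  case (add p q)
  have cont: "continuous_on UNIV (\<lambda>x. complex_of_real (r (E 1 x)) * g x)" if "real_polynomial_function r" for r
    using that add.prems
    by (intro continuous_on_mult continuous_on_of_real continuous_on_compose2[OF _ E_cont[of UNIV 1], of UNIV r])
      (auto intro: continuous_on_polymonial_function simp: real_polynomial_function_eq)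
  show ?case
    using ip_add_left[OF cont[OF add.hyps(1)] cont[OF add.hyps(2)] E_cont[of UNIV n]] add.IH[OF add.prems]
    by (simp add: distrib_right)
next
  case (mult p q)
  have cont: "continuous_on UNIV (\<lambda>x. complex_of_real (q (E 1 x)) * g x)"
    using mult
    by (intro continuous_on_mult continuous_on_of_real continuous_on_compose2[OF _ E_cont[of UNIV 1], of UNIV q])
      (auto intro: continuous_on_polymonial_function simp: real_polynomial_function_eq)
  from mult.IH(1)[OF cont mult.IH(2)[OF mult.prems]] show ?case by (simp add: mult.assoc)
qed

text \<open>By Stone--Weierstrass on the circle the conjugate of f is uniformly close to some P,
  polynomial in \<open>E 1 x\<close>, and f P integrates to 0; hence the integral of |f|^2 is
  arbitrarily small.\<close>

lemma fourier_unique: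
  assumes f: "continuous_on UNIV f" "periodic2pi f" and zero: "\<And>n. ip f (E n) = 0"
  shows "f x = 0"
proof -
  have inj: "f x = f y" if "E 1 x = E 1 y" for x y
    using E_one_eq[OF that] periodic2pi_add_int[OF f(2)] by auto
  obtain F where F: "continuous_on (sphere 0 1) F" "\<And>x. x \<in> {0..2 * pi} \<Longrightarrow> F (E 1 x) = f x"
    by (rule continuous_periodic_image_sphere[OF E_cont E_one_surj continuous_on_subset[OF f(1) subset_UNIV] inj]) blast+
  obtain Bf where Bf: "\<And>x. norm (f x) \<le> Bf" by (rule periodic_continuous_bounded[OF f(2,1)]) blast
  obtain B c0 where B: "\<And>x. b x \<le> B" "c0 > 0" "\<And>x. c0 \<le> b x" by (rule b_bounds) blast
  have nb: "norm (bc x) \<le> B" for x using B(1)[of x] b_pos[of x] by simp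
  define I where "I = integral {0..2 * pi} (\<lambda>x. (norm (f x))\<^sup>2 * b x)"
  have bcont: "continuous_on {0..2 * pi} b" using bc_cont[of "{0..2 * pi}"] continuous_on_Re[of _ bc] by simp
  have fcont: "continuous_on {0..2 * pi} f" using f(1) by (rule continuous_on_subset) auto
  have Icont: "continuous_on {0..2 * pi} (\<lambda>x. (norm (f x))\<^sup>2 * b x)"
    by (intro continuous_intros fcont bcont)
  have bound: "norm (complex_of_real I) \<le> Bf * (2 * e) * B * (2 * pi)" if e: "e > 0" for e
  proof -
    obtain p where p: "real_polynomial_function p" "\<And>z. z \<in> sphere 0 1 \<Longrightarrow> \<bar>Re (F z) - p z\<bar> < e"
      using Stone_Weierstrass_real_polynomial_function[of "sphere 0 1" "\<lambda>z. Re (F z)" e] F(1) e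
      by (auto intro: continuous_on_Re)
    obtain q where q: "real_polynomial_function q" "\<And>z. z \<in> sphere 0 1 \<Longrightarrow> \<bar>Im (F z) - q z\<bar> < e"
      using Stone_Weierstrass_real_polynomial_function[of "sphere 0 1" "\<lambda>z. Im (F z)" e] F(1) e
      by (auto intro: continuous_on_Im)
    define P where "P x = complex_of_real (p (E 1 x)) - \<i> * of_real (q (E 1 x))" for x
    have pc: "continuous_on UNIV (\<lambda>x. complex_of_real (r (E 1 x)))" if "real_polynomial_function r" for r
      using that by (intro continuous_on_of_real continuous_on_compose2[OF _ E_cont[of UNIV 1], of UNIV r])
        (auto intro: continuous_on_polymonial_function simp: real_polynomial_function_eq)
    have Pc: "continuous_on UNIV P" unfolding P_def by (intro continuous_intros pc p q)
    have "ip (\<lambda>x. of_real (p (E 1 x)) * f x - \<i> * (of_real (q (E 1 x)) * f x)) (E 0) = 0"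
      using polynomial_preserves_vanishing[OF p(1) f(1) zero, of 0] polynomial_preserves_vanishing[OF q(1) f(1) zero, of 0]
      by (subst ip_diff_left) (auto intro!: continuous_on_mult continuous_on_const pc p q f E_cont simp: ip_cmult_left)
    then have "integral {0..2 * pi} (\<lambda>x. (of_real (p (E 1 x)) * f x - \<i> * (of_real (q (E 1 x)) * f x)) * E 0 x * bc x) = 0"
      by (simp add: ip_def)
    then have z: "integral {0..2 * pi} (\<lambda>x. f x * P x * bc x) = 0"
      by (simp add: E_0 P_def algebra_simps)
    have "complex_of_real I = integral {0..2 * pi} (\<lambda>x. f x * cnj (f x) * bc x)"
      using integral_linear[OF integrable_continuous_interval[OF Icont] bounded_linear_of_real[where 'a = complex]]
      unfolding I_def o_def of_real_mult complex_norm_square by simp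
    also have "\<dots> = integral {0..2 * pi} (\<lambda>x. f x * (cnj (f x) - P x) * bc x)"
    proof -
      have "integral {0..2 * pi} (\<lambda>x. f x * (cnj (f x) - P x) * bc x) =
          integral {0..2 * pi} (\<lambda>x. f x * cnj (f x) * bc x) - integral {0..2 * pi} (\<lambda>x. f x * P x * bc x)"
        unfolding right_diff_distrib left_diff_distrib
        by (rule integral_diff) (auto intro!: ip_integrable f Pc continuous_intros)
      then show ?thesis using z by simp
    qed
    also have "norm \<dots> \<le> Bf * (2 * e) * B * (2 * pi - 0)"
    proof (rule integral_bound)
      show "continuous_on {0..2 * pi} (\<lambda>x. f x * (cnj (f x) - P x) * bc x)"
        by (intro continuous_intros fcont bc_cont continuous_on_subset[OF Pc]) auto
      fix t :: real assume t: "t \<in> {0..2 * pi}"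
      have "E 1 t \<in> sphere 0 1" by (simp add: norm_E)
      then have "\<bar>Re (f t) - p (E 1 t)\<bar> < e" "\<bar>Im (f t) - q (E 1 t)\<bar> < e" using p(2) q(2) F(2)[OF t] by metis+
      then have "norm (cnj (f t) - P t) \<le> 2 * e"
        using cmod_le[of "cnj (f t) - P t"] by (simp add: P_def)
      then show "norm (f t * (cnj (f t) - P t) * bc t) \<le> Bf * (2 * e) * B"
        unfolding norm_mult using Bf nb e order_trans[OF norm_ge_zero Bf]
        by (intro mult_mono) auto
    qed auto
    finally show ?thesis by simp
  qed
  have I0: "I \<ge> 0" unfolding I_def
    by (rule integral_nonneg[OF integrable_continuous_interval[OF Icont]]) (use b_pos in \<open>auto intro!: mult_nonneg_nonneg intro: less_imp_le\<close>)
  have "I \<le> 0"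
  proof (rule field_le_epsilon)
    fix \<eta> :: real assume \<eta>: "\<eta> > 0"
    define K where "K = Bf * 2 * B * (2 * pi) + 1"
    have "Bf \<ge> 0" "B \<ge> 0" using order_trans[OF norm_ge_zero Bf] order_trans[OF norm_ge_zero nb] by auto
    then have K: "K > 0" by (simp add: K_def add_nonneg_pos)
    have "I \<le> (K - 1) * (\<eta> / K)" using bound[of "\<eta> / K"] \<eta> K I0 by (simp add: K_def field_simps)
    also have "\<dots> \<le> \<eta>" using K \<eta> by (simp add: field_simps)
    finally show "I \<le> 0 + \<eta>" by simp
  qed
  then have "I = 0" using I0 by simp
  then have "\<forall>x\<in>{0..2 * pi}. (norm (f x))\<^sup>2 * b x = 0"
    unfolding I_def using integral_eq_0_iff[OF Icont] b_pos by (simp add: less_imp_le)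
  then have "f y = 0" if "y \<in> {0..2 * pi}" for y using that b_pos[of y] by auto
  then show ?thesis using periodic2pi_reduce[OF f(2), of x] by metis
qed

text \<open>The phase n \<Phi> has derivative n b, and b is bounded away from 0; so
  \<open>nonstationary_phase\<close> applies with N = d_k.\<close>

lemma co_rapid:
  assumes f: "smooth_circle f"
  shows "rapid (co f)"
  unfolding rapid_def
proof
  fix p
  obtain B c0 where B: "\<And>x. b x \<le> B" "c0 > 0" "\<And>x. c0 \<le> b x" by (rule b_bounds) blast
  have fc: "continuous_on UNIV f" by (rule smooth_circle_continuous[OF f])
  have bound: "\<exists>C. \<forall>k. norm (integral {0..2 * pi} (\<lambda>x. (f x * bc x) * E (\<sigma> * di k) x)) \<le> C / dd k ^ p" if "\<sigma> = 1 \<or> \<sigma> = - 1" for \<sigma> :: int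
  proof (rule nonstationary_phase[where \<rho> = "\<lambda>k x. of_int \<sigma> * bc x" and N = dd and c = c0])
    show "(E (\<sigma> * di k) has_vector_derivative \<i> * of_real (dd k) * (of_int \<sigma> * bc x) * E (\<sigma> * di k) x) (at x)" for k x
      using E_deriv[of "\<sigma> * di k" x] by (simp add: dd_def mult_ac)
    show "Cb j (\<lambda>k x. of_int \<sigma> * bc x)" for j by (intro Cb_cmult smooth_circle_imp_Cb bc_smooth)
    show "c0 \<le> norm (of_int \<sigma> * bc x)" for x
    proof -
      have "norm (of_int \<sigma> * bc x) = b x" using that b_pos[of x] by (auto simp: norm_mult)
      then show ?thesis using B(3) by simp
    qed
    show "Cb j (\<lambda>k x. f x * bc x)" for j by (intro Cb_mult smooth_circle_imp_Cb bc_smooth f)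
  qed (use B E_periodic norm_E in auto)
  obtain C1 C2 where C: "\<And>k. norm (integral {0..2 * pi} (\<lambda>x. (f x * bc x) * E (di k) x)) \<le> C1 / dd k ^ p"
    "\<And>k. norm (integral {0..2 * pi} (\<lambda>x. (f x * bc x) * E (- di k) x)) \<le> C2 / dd k ^ p"
    using bound[of 1] bound[of "- 1"] by auto
  have ipE: "norm (ip f (E n)) \<le> norm (integral {0..2 * pi} (\<lambda>x. (f x * bc x) * E n x))" for n
  proof -
    have "ip f (E n) = integral {0..2 * pi} (\<lambda>x. (f x * bc x) * E n x) / (2 * pi)" by (simp add: ip_def mult_ac)
    moreover have "2 * pi \<ge> 1" using pi_ge_two by linarith
    ultimately show ?thesis using norm_divide_le[of "complex_of_real (2 * pi)"] by simp
  qed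
  have C0: "C1 + C2 \<ge> 0"
    using order_trans[OF norm_ge_zero C(1)[of 0]] order_trans[OF norm_ge_zero C(2)[of 0]] by (simp add: dd_def)
  have "norm (co f k) \<le> (C1 + C2) * 2 ^ p / real (Suc k) ^ p" for k
  proof -
    have s2: "1 \<le> norm (complex_of_real (sqrt 2))" by simp
    have "norm (co f k) \<le> norm (ip f (E (di k))) + norm (ip f (E (- di k)))"
    proof -
      have "norm (co f k) \<le> norm (ip f (E (di k)) + ip f (E (- di k))) \<or> norm (co f k) \<le> norm (ip f (E (di k)) - ip f (E (- di k)))"
        unfolding co_def ip_E_eb[OF fc] using s2 by (auto intro!: norm_divide_le simp: norm_mult)
      then show ?thesis using norm_triangle_ineq norm_triangle_ineq4 order_trans by blast
    qed
    also have "\<dots> \<le> (C1 + C2) / dd k ^ p"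
      using ipE[of "di k"] ipE[of "- di k"] C(1)[of k] C(2)[of k] by (simp add: add_divide_distrib)
    also have "\<dots> \<le> (C1 + C2) * 2 ^ p / real (Suc k) ^ p"
    proof -
      have "real (Suc k) ^ p \<le> 2 ^ p * dd k ^ p" using power_mono[OF dd_lower[of k], of p] by (simp add: power_mult_distrib)
      then have "(C1 + C2) * real (Suc k) ^ p \<le> (C1 + C2) * (2 ^ p * dd k ^ p)" by (intro mult_left_mono C0)
      then show ?thesis by (simp add: divide_simps mult_ac del: of_nat_Suc)
    qed
    finally show ?thesis .
  qed
  then show "\<exists>C. \<forall>k. norm (co f k) \<le> C / real (Suc k) ^ p" by blast
qed

lemma E_eb: "\<exists>k. \<exists>\<alpha> \<beta>. \<forall>f. continuous_on UNIV f \<longrightarrow> ip f (E n) = \<alpha> * co f (2 * k) + \<beta> * co f (2 * k + 1)" if "n \<noteq> 0"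
proof -
  have s: "complex_of_real (sqrt 2) * complex_of_real (sqrt 2) = 2" by (metis of_real_mult of_real_numeral real_sqrt_mult_self abs_numeral)
  define k where "k = nat (\<bar>n\<bar> - 1)"
  have d: "di (2 * k) = \<bar>n\<bar>" "di (2 * k + 1) = \<bar>n\<bar>" using that by (auto simp: k_def)
  define \<sigma> :: complex where "\<sigma> = (if n > 0 then 1 else - 1)"
  have "ip f (E n) = (1 / sqrt 2) * co f (2 * k) + (\<sigma> * \<i> / sqrt 2) * co f (2 * k + 1)" if f: "continuous_on UNIV f" for f
    unfolding co_def ip_E_eb[OF f] d using s \<open>n \<noteq> 0\<close> by (cases "n > 0") (auto simp: \<sigma>_def field_simps)
  then show ?thesis by blast
qed

lemma fourier_unique_co:
  assumes f: "continuous_on UNIV f" "periodic2pi f" and zero: "\<And>k. co f k = 0" "mn f = 0"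
  shows "f x = 0"
proof (rule fourier_unique[OF f])
  show "ip f (E n) = 0" for n
  proof (cases "n = 0")
    case True
    then show ?thesis using zero(2) by (simp add: mn_def ip_def E_0)
  next
    case False
    then show ?thesis using E_eb[OF False] f(1) zero(1) by fastforce
  qed
qed

text \<open>The difference of the two sides is smooth with vanishing mean and coefficients, so
  uniqueness applies.\<close>

lemma fourier_expansion:
  assumes f: "smooth_circle f"
  shows "f x = mn f + ser (co f) x"
proof -
  define g where "g = (\<lambda>x. f x - (mn f + ser (co f) x))"
  have r: "rapid (co f)" by (rule co_rapid[OF f])
  have gs: "smooth_circle g" unfolding g_def
    by (intro smooth_circle_diff smooth_circle_add smooth_circle_const ser_smooth r f)
  have fc: "continuous_on UNIV f" by (rule smooth_circle_continuous[OF f])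
  have c1: "co (\<lambda>_. c) k = 0" for c k
    using mn_eb[of k] ip_cmult_left[of c "\<lambda>_. 1" "eb k"] by (simp add: co_def mn_def ip_commute)
  have m1: "mn (\<lambda>_. c) = c" for c
    using ip_E_one[of 0] ip_cmult_left[of c "\<lambda>_. 1" "\<lambda>_. 1"] by (simp add: mn_def E_0[abs_def])
  have mc: "continuous_on UNIV (\<lambda>x. mn f + ser (co f) x)" by (intro continuous_intros ser_cont r)
  have "co g k = 0" for k
    unfolding g_def co_lincomb(2)[OF fc mc] co_lincomb(1)[OF continuous_on_const ser_cont[OF r]]
    by (simp add: c1 co_ser r)
  moreover have "mn g = 0"
  proof -
    have "mn (\<lambda>x. mn f + ser (co f) x) = mn f"
      using ip_add_left[OF continuous_on_const[of _ "mn f"] ser_cont[OF r, of UNIV] continuous_on_const[of _ 1]] m1 co_ser(2)[OF r]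
      by (simp add: mn_def)
    then show ?thesis unfolding g_def co_lincomb(4)[OF fc mc] by simp
  qed
  ultimately have "g x = 0"
    using fourier_unique_co[OF smooth_circle_continuous[OF gs] smooth_circle_periodic[OF gs]] by blast
  then show ?thesis by (simp add: g_def)
qed

text \<open>The means are subtracted because the constant is not among the
  \<open>eb k\<close>.\<close>

lemma parseval:
  assumes f: "smooth_circle f" and g: "continuous_on UNIV g"
  shows "(\<lambda>k. co f k * co g k) sums (ip f g - mn f * mn g)"
proof -
  have r: "rapid (co f)" by (rule co_rapid[OF f])
  have fe: "f = (\<lambda>x. mn f + ser (co f) x)" using fourier_expansion[OF f] by blast
  have "ip f g = ip g (\<lambda>x. mn f + ser (co f) x)" using fe by (metis ip_commute)
  also have "\<dots> = ip g (\<lambda>_. mn f) + ip g (ser (co f))"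
    by (rule ip_add_right[OF continuous_on_const ser_cont[OF r] g])
  also have "ip g (\<lambda>_. mn f) = mn f * mn g"
    using ip_cmult_right[of g "mn f" "\<lambda>_. 1"] by (simp add: mn_def)
  finally have "ip f g - mn f * mn g = ip g (ser (co f))" by simp
  then show ?thesis using ip_ser[OF g r] by simp
qed

end

section \<open>The Dirichlet-to-Neumann operator of the disk\<close>

interpretation TH: circle_param "\<lambda>_. 1" "\<lambda>x. x"
proof
  show "smooth_circle (\<lambda>_::real. 1::real)"
    unfolding smooth_circle_def smooth_fun_def periodic2pi_def
    by (intro conjI exI[of _ "\<lambda>n x. if n = 0 then 1 else 0"]) (auto intro!: derivative_eq_intros)
qed (auto intro!: derivative_eq_intros)

lemma TH_ip_eq: "TH.ip f g = integral {0..2 * pi} (\<lambda>x. f x * g x) / (2 * pi)"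
  by (simp add: TH.ip_def)

lemma fourier_coeff_eq: "fourier_coeff u n = TH.ip u (TH.E (- n))"
  by (simp add: fourier_coeff_def TH_ip_eq TH.E_def)

text \<open>\<Lambda> in the real basis, as an ordered series instead of an unordered sum over the
  integers; \<open>Lambda_op_eq_La\<close> identifies the two on smooth functions.\<close>

definition La :: "(real \<Rightarrow> complex) \<Rightarrow> real \<Rightarrow> complex" where
  "La u = TH.ser (\<lambda>k. of_real (dd k) * TH.co u k)"

text \<open>The periodic Hilbert transform, so that \<open>La\<close> is \<open>Hi\<close> followed by the derivative.\<close>

definition Hi :: "(real \<Rightarrow> complex) \<Rightarrow> real \<Rightarrow> complex" where
  "Hi u = TH.ser (\<lambda>k. of_real (- sg k) * TH.co u (partner k))"

lemma La_rapid: "smooth_circle u \<Longrightarrow> rapid (\<lambda>k. of_real (dd k) * TH.co u k)"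
  by (rule rapid_dd[where B = 1]) (auto intro: TH.co_rapid simp: less_imp_le)

lemma Hi_rapid: "smooth_circle u \<Longrightarrow> rapid (\<lambda>k. of_real (- sg k) * TH.co u (partner k))"
  by (rule rapid_partner_dd[where B = 1]) (auto intro: TH.co_rapid simp: dd_ge1)

text \<open>The nonzero frequencies are listed as 1, -1, 2, -2, ..., so that places 2 m and 2 m + 1
  match the cosine and sine of frequency m + 1.\<close>

lemma int_of_nat_bij: "bij_betw (\<lambda>k::nat. if even k then int (k div 2 + 1) else - int (k div 2 + 1)) UNIV (- {0})"
proof (rule bij_betw_byWitness[where f' = "\<lambda>n::int. if n > 0 then 2 * nat (n - 1) else 2 * nat (- n - 1) + 1"])
  show "\<forall>k\<in>UNIV. (if (if even k then int (k div 2 + 1) else - int (k div 2 + 1)) > 0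
      then 2 * nat ((if even k then int (k div 2 + 1) else - int (k div 2 + 1)) - 1)
      else 2 * nat (- (if even k then int (k div 2 + 1) else - int (k div 2 + 1)) - 1) + 1) = k"
    by (auto elim!: evenE oddE)
  show "\<forall>n\<in>- {0::int}. (if even (if n > 0 then 2 * nat (n - 1) else 2 * nat (- n - 1) + 1)
      then int ((if n > 0 then 2 * nat (n - 1) else 2 * nat (- n - 1) + 1) div 2 + 1)
      else - int ((if n > 0 then 2 * nat (n - 1) else 2 * nat (- n - 1) + 1) div 2 + 1)) = n"
    by auto
qed auto

text \<open>Absolute summability turns the unordered sum into a series along this enumeration, which
  agrees with \<open>La\<close> pair by pair.\<close>

lemma Lambda_op_eq_La:
  assumes u: "smooth_circle u"
  shows "Lambda_op u = La u"
proof
  fix x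
  have uc: "continuous_on UNIV u" by (rule smooth_circle_continuous[OF u])
  define \<iota> where "\<iota> k = (if even k then int (k div 2 + 1) else - int (k div 2 + 1))" for k :: nat
  define f where "f n = of_int \<bar>n\<bar> * fourier_coeff u n * exp (\<i> * of_int n * of_real x)" for n :: int
  have fE: "f n = of_int \<bar>n\<bar> * TH.ip u (TH.E (- n)) * TH.E n x" for n by (simp add: f_def fourier_coeff_eq TH.E_def)
  have s: "complex_of_real (sqrt 2) * complex_of_real (sqrt 2) = 2" by (metis of_real_mult of_real_numeral real_sqrt_mult_self abs_numeral)
  define g where "g k = of_real (dd k) * TH.co u k * TH.eb k x" for k
  have pair: "f (\<iota> (2 * m)) + f (\<iota> (2 * m + 1)) = g (2 * m) + g (2 * m + 1)" for m
  proof -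
    define n where "n = int m + 1"
    have i: "\<iota> (2 * m) = n" "\<iota> (2 * m + 1) = - n" by (auto simp: \<iota>_def n_def)
    have d: "TH.di (2 * m) = n" "TH.di (2 * m + 1) = n" "complex_of_real (dd (2 * m)) = of_int n"
      "complex_of_real (dd (2 * m + 1)) = of_int n" by (auto simp: n_def dd_def)
    have n: "of_int \<bar>n\<bar> = (of_int n :: complex)" "of_int \<bar>- n\<bar> = (of_int n :: complex)" by (auto simp: n_def)
    show ?thesis
      unfolding i fE g_def TH.co_def TH.ip_E_eb[OF uc] TH.eb_E d n minus_minus
      using s by (simp add: field_simps)
  qed
  \<comment> \<open>Each exponential coefficient is bounded by the two real ones of the same
    frequency; this transfers their rapid decay.\<close>
  have ipb: "norm (TH.ip u (TH.E n)) \<le> 2 * (norm (TH.co u k) + norm (TH.co u (partner k)))" if "n = TH.di k \<or> n = - TH.di k" for n k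
  proof -
    define z w where "z = TH.ip u (TH.E (TH.di k))" and "w = TH.ip u (TH.E (- TH.di k))"
    have dp: "TH.di (partner k) = TH.di k" using partner_simps(2)[of k] by (simp add: dd_def)
    have ev: "even (partner k) \<longleftrightarrow> odd k" by (auto simp: partner_def)
    have s2: "norm (complex_of_real (sqrt 2)) \<le> 2" by (simp add: real_le_lsqrt)
    have "(z + w) / sqrt 2 = TH.co u k \<and> (z - w) / (sqrt 2 * \<i>) = TH.co u (partner k) \<or>
        (z + w) / sqrt 2 = TH.co u (partner k) \<and> (z - w) / (sqrt 2 * \<i>) = TH.co u k"
      unfolding TH.co_def TH.ip_E_eb[OF uc] dp ev z_def w_def by auto
    then obtain p q where pq: "(z + w) / sqrt 2 = p" "(z - w) / (sqrt 2 * \<i>) = q"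
      "norm p + norm q = norm (TH.co u k) + norm (TH.co u (partner k))" by fastforce
    have zw: "z + w = sqrt 2 * p" "z - w = sqrt 2 * \<i> * q" using pq(1,2) by (auto simp: field_simps)
    have "2 * z = (z + w) + (z - w)" "2 * w = (z + w) - (z - w)" by auto
    then have "norm (2 * z) \<le> norm (z + w) + norm (z - w)" "norm (2 * w) \<le> norm (z + w) + norm (z - w)"
      by (metis norm_triangle_ineq, metis norm_triangle_ineq4)
    moreover have "norm (z + w) \<le> 2 * norm p" "norm (z - w) \<le> 2 * norm q"
      unfolding zw norm_mult using s2 by (auto intro!: mult_right_mono)
    ultimately have "2 * norm z \<le> 2 * norm p + 2 * norm q" "2 * norm w \<le> 2 * norm p + 2 * norm q"
      by (auto simp: norm_mult)
    then show ?thesis using that pq(3) norm_ge_zero[of p] norm_ge_zero[of q] unfolding z_def w_def by (smt (verit))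
  qed
  have r1: "rapid (\<lambda>k. of_real (dd k) * TH.co u k)" by (rule La_rapid[OF u])
  have r2: "rapid (\<lambda>k. of_real (dd k) * TH.co u (partner k))"
    by (rule rapid_partner_dd[where B = 1]) (auto intro: TH.co_rapid u simp: less_imp_le)
  have fs: "summable (\<lambda>k. norm (f (\<iota> k)))"
  proof (rule summable_comparison_test'[OF summable_mult[OF summable_add[OF rapid_summable[OF r1] rapid_summable[OF r2]], of 2]])
    fix k
    have "- \<iota> k = TH.di k \<or> - \<iota> k = - TH.di k" by (auto simp: \<iota>_def)
    then have "norm (TH.ip u (TH.E (- \<iota> k))) \<le> 2 * (norm (TH.co u k) + norm (TH.co u (partner k)))" by (rule ipb)
    moreover have "norm (of_int \<bar>\<iota> k\<bar> :: complex) = dd k" by (auto simp: \<iota>_def dd_def)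
    ultimately have "norm (f (\<iota> k)) \<le> dd k * (2 * (norm (TH.co u k) + norm (TH.co u (partner k))))"
      unfolding fE norm_mult TH.norm_E by (simp add: mult_left_mono less_imp_le)
    then show "norm (norm (f (\<iota> k))) \<le> 2 * (norm (of_real (dd k) * TH.co u k) + norm (of_real (dd k) * TH.co u (partner k)))"
      by (simp add: norm_mult less_imp_le algebra_simps)
  qed
  have "Lambda_op u x = infsum f UNIV" unfolding Lambda_op_def f_def[abs_def] ..
  also have "\<dots> = infsum f (- {0})" by (rule infsum_cong_neutral) (auto simp: f_def)
  also have "\<dots> = infsum (\<lambda>k. f (\<iota> k)) UNIV"
    using infsum_reindex_bij_betw[OF int_of_nat_bij, of f] by (simp add: \<iota>_def)
  also have "\<dots> = (\<Sum>k. f (\<iota> k))"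
    by (rule infsumI[OF norm_summable_imp_has_sum[OF fs summable_sums[OF summable_norm_cancel[OF fs]]]])
  also have "\<dots> = (\<Sum>k. g k)"
  proof (rule suminf_pairs)
    show "summable (\<lambda>k. f (\<iota> k))" by (rule summable_norm_cancel[OF fs])
    show "summable g" unfolding g_def by (rule summable_norm_cancel[OF TH.ser_summable[OF r1]])
  qed (rule pair)
  finally show "Lambda_op u x = La u x" by (simp add: La_def TH.ser_def g_def)
qed

context
  fixes u :: "real \<Rightarrow> complex"
  assumes u: "smooth_circle u"
begin

lemma La_smooth: "smooth_circle (La u)"
  unfolding La_def by (rule TH.ser_smooth[OF La_rapid[OF u]])

lemma Hi_smooth: "smooth_circle (Hi u)"
  unfolding Hi_def by (rule TH.ser_smooth[OF Hi_rapid[OF u]])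

lemma co_La: "TH.co (La u) k = of_real (dd k) * TH.co u k" and mn_La: "TH.mn (La u) = 0"
  unfolding La_def by (rule TH.co_ser[OF La_rapid[OF u]])+

lemma co_Hi: "TH.co (Hi u) k = of_real (- sg k) * TH.co u (partner k)"
  unfolding Hi_def by (rule TH.co_ser(1)[OF Hi_rapid[OF u]])

lemma Hi_deriv: "(Hi u has_vector_derivative La u x) (at x)"
proof -
  have "TH.dcoef (\<lambda>k. of_real (- sg k) * TH.co u (partner k)) = (\<lambda>k. of_real (dd k) * TH.co u k)"
  proof
    fix k
    have "complex_of_real (sg k) * complex_of_real (sg k) = 1" by (metis of_real_1 of_real_mult partner_simps(4))
    then show "TH.dcoef (\<lambda>k. of_real (- sg k) * TH.co u (partner k)) k = of_real (dd k) * TH.co u k"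
      by (simp add: TH.dcoef_def)
  qed
  then show ?thesis using TH.ser_deriv[OF Hi_rapid[OF u], of x] by (simp add: Hi_def La_def)
qed

lemma smooth_deriv: "(u has_vector_derivative TH.ser (TH.dcoef (TH.co u)) x) (at x)"
proof -
  have "u = (\<lambda>x. TH.mn u + TH.ser (TH.co u) x)" using TH.fourier_expansion[OF u] by blast
  moreover have "((\<lambda>x. TH.mn u + TH.ser (TH.co u) x) has_vector_derivative 0 + TH.ser (TH.dcoef (TH.co u)) x) (at x)"
    using TH.ser_deriv[OF TH.co_rapid[OF u], of x]
    by (intro has_vector_derivative_add has_vector_derivative_const) simp
  ultimately show ?thesis by simp
qed

text \<open>The relation H^2 = -1 in differentiated form, where constants disappear.\<close>

lemma La_Hi: "(u has_vector_derivative - La (Hi u) x) (at x)"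
proof -
  have "La (Hi u) x = TH.ser (\<lambda>k. (- 1) * TH.dcoef (TH.co u) k) x"
    unfolding La_def co_Hi TH.dcoef_def by (simp add: mult_ac)
  also have "\<dots> = - TH.ser (TH.dcoef (TH.co u)) x"
    unfolding TH.ser_def
    using suminf_minus[OF summable_norm_cancel[OF TH.ser_summable[OF TH.rapid_dcoef[OF TH.co_rapid[OF u]], of x]]] by simp
  finally show ?thesis using smooth_deriv[of x] by simp
qed

lemma La_cnj: "La (\<lambda>x. cnj (u x)) x = cnj (La u x)"
proof -
  have "La (\<lambda>x. cnj (u x)) x = (\<Sum>k. cnj (of_real (dd k) * TH.co u k * TH.eb k x))"
    by (simp add: La_def TH.ser_def TH.co_cnj TH.cnj_eb)
  also have "\<dots> = cnj (La u x)"
    unfolding La_def TH.ser_def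
    by (rule bounded_linear.suminf[OF bounded_linear_cnj summable_norm_cancel[OF TH.ser_summable[OF La_rapid[OF u]]], symmetric])
  finally show ?thesis .
qed

lemma La_form:
  assumes v: "continuous_on UNIV v"
  shows "(\<lambda>k. of_real (dd k) * TH.co u k * TH.co v k) sums TH.ip (La u) v"
  using TH.parseval[OF La_smooth v] by (simp add: co_La mn_La)

end

lemma La_sym:
  assumes "smooth_circle u" "smooth_circle v"
  shows "TH.ip (La u) v = TH.ip (La v) u"
  using sums_unique2[OF La_form[OF assms(1) smooth_circle_continuous[OF assms(2)]]]
    La_form[OF assms(2) smooth_circle_continuous[OF assms(1)]] by (simp add: mult_ac)

lemma La_add:
  assumes "smooth_circle u" "smooth_circle v"
  shows "La (\<lambda>x. u x + c * v x) x = La u x + c * La v x"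
proof -
  have c: "TH.co (\<lambda>x. u x + c * v x) k = TH.co u k + c * TH.co v k" for k
    using assms[THEN smooth_circle_continuous, of UNIV]
    by (subst TH.co_lincomb(1)) (auto intro!: continuous_intros simp: TH.co_lincomb(3))
  have s: "summable (\<lambda>k. of_real (dd k) * TH.co w k * TH.eb k x)" if "smooth_circle w" for w
    by (rule summable_norm_cancel[OF TH.ser_summable[OF La_rapid[OF that]]])
  have "La (\<lambda>x. u x + c * v x) x = (\<Sum>k. of_real (dd k) * TH.co u k * TH.eb k x + c * (of_real (dd k) * TH.co v k * TH.eb k x))"
    unfolding La_def TH.ser_def c by (simp add: algebra_simps)
  also have "\<dots> = La u x + c * La v x"
    unfolding La_def TH.ser_def using s[OF assms(1)] s[OF assms(2)]
    by (simp add: suminf_add[symmetric] summable_mult suminf_mult)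
  finally show ?thesis .
qed

text \<open>\<open>\<Lambda> + \<i> d/d\<theta>\<close> kills the nonnegative frequencies, so only the negative ones need to be small.\<close>

lemma La_minus_D:
  assumes u: "smooth_circle u" and u': "\<And>x. (u has_vector_derivative u' x) (at x)"
    and bound: "\<And>m. real (Suc m) * norm (TH.ip u (TH.E (int m + 1))) \<le> C / real (Suc m) ^ 2"
  shows "norm (La u x + \<i> * u' x) \<le> 16 * C * (\<Sum>k. (1 / real (Suc k))\<^sup>2)"
proof -
  have uc: "continuous_on UNIV u" by (rule smooth_circle_continuous[OF u])
  have d: "u' x = TH.ser (TH.dcoef (TH.co u)) x" using u' smooth_deriv[OF u] vector_derivative_unique_at by blast
  define e where "e k = of_real (dd k) * TH.co u k + \<i> * TH.dcoef (TH.co u) k" for k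
  have s1: "summable (\<lambda>k. of_real (dd k) * TH.co u k * TH.eb k x)"
    by (rule summable_norm_cancel[OF TH.ser_summable[OF La_rapid[OF u]]])
  have s2: "summable (\<lambda>k. TH.dcoef (TH.co u) k * TH.eb k x)"
    by (rule summable_norm_cancel[OF TH.ser_summable[OF TH.rapid_dcoef[OF TH.co_rapid[OF u]]]])
  have eq: "La u x + \<i> * u' x = (\<Sum>k. e k * TH.eb k x)"
    unfolding d La_def TH.ser_def e_def using s1 s2
    by (simp add: suminf_add[symmetric] suminf_mult[symmetric] summable_mult algebra_simps)
  have C0: "C \<ge> 0" using order_trans[OF _ bound[of 0]] by simp
  \<comment> \<open>The constant 8 is 2, as a bound for \<open>sqrt 2\<close>, times 4 for passing
    from m + 1 to k + 1. The bound on \<open>TH.eb\<close> later doubles it to 16.\<close>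
  have ne: "norm (e k) \<le> 8 * C * (1 / real (Suc k))\<^sup>2" for k
  proof -
    define m where "m = k div 2"
    have k: "k = 2 * m \<or> k = 2 * m + 1" unfolding m_def by presburger
    have s: "complex_of_real (sqrt 2) * complex_of_real (sqrt 2) = 2" by (metis of_real_mult of_real_numeral real_sqrt_mult_self abs_numeral)
    \<comment> \<open>Without conjugation, the product with \<open>TH.E (int m + 1)\<close> is the
      coefficient at frequency -(m + 1).\<close>
    have key: "TH.co u (2 * m) + \<i> * TH.co u (2 * m + 1) = sqrt 2 * TH.ip u (TH.E (int m + 1))"
      unfolding TH.co_def TH.ip_E_eb[OF uc] using s by (simp add: field_simps)
    have "norm (e k) = real (Suc m) * norm (TH.co u (2 * m) + \<i> * TH.co u (2 * m + 1))"
      using k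
    proof
      assume k: "k = 2 * m"
      have "e k = of_nat (Suc m) * (TH.co u (2 * m) + \<i> * TH.co u (2 * m + 1))"
        unfolding k e_def TH.dcoef_def by (simp add: sg_def dd_def partner_def algebra_simps)
      then show ?thesis by (simp add: norm_mult del: of_nat_Suc)
    next
      assume k: "k = 2 * m + 1"
      have "e k = - \<i> * of_nat (Suc m) * (TH.co u (2 * m) + \<i> * TH.co u (2 * m + 1))"
        unfolding k e_def TH.dcoef_def by (simp add: sg_def dd_def partner_def algebra_simps)
      then show ?thesis by (simp add: norm_mult del: of_nat_Suc)
    qed
    also have "\<dots> = sqrt 2 * (real (Suc m) * norm (TH.ip u (TH.E (int m + 1))))" unfolding key by (simp add: norm_mult)
    also have "\<dots> \<le> 2 * (C / real (Suc m) ^ 2)" using bound[of m] by (intro mult_mono) (auto simp: real_le_lsqrt)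
    also have "\<dots> \<le> 2 * (C * (4 * (1 / real (Suc k))\<^sup>2))"
    proof -
      have "real (Suc k) \<le> 2 * real (Suc m)" using k by auto
      then have "real (Suc k) ^ 2 \<le> (2 * real (Suc m)) ^ 2" by (intro power_mono) auto
      then have "real (Suc k) ^ 2 \<le> 4 * real (Suc m) ^ 2" by (simp only: power_mult_distrib) simp
      then have "C * real (Suc k) ^ 2 \<le> C * (4 * real (Suc m) ^ 2)" by (intro mult_left_mono C0)
      then show ?thesis by (simp add: field_simps power_divide del: of_nat_Suc)
    qed
    finally show ?thesis by simp
  qed
  have neb: "norm (e k * TH.eb k x) \<le> 16 * C * (1 / real (Suc k))\<^sup>2" for k
    using TH.ser_bound[of e k x] ne[of k] by simp
  have sn: "summable (\<lambda>k. norm (e k * TH.eb k x))"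
    by (rule summable_comparison_test'[OF summable_mult[OF summable_inverse_squares, of "16 * C"]]) (use neb in simp)
  have "norm (\<Sum>k. e k * TH.eb k x) \<le> (\<Sum>k. norm (e k * TH.eb k x))" by (rule summable_norm[OF sn])
  also have "\<dots> \<le> (\<Sum>k. 16 * C * (1 / real (Suc k))\<^sup>2)"
    by (intro suminf_le neb sn summable_mult summable_inverse_squares)
  finally show ?thesis unfolding eq by (simp only: suminf_mult[OF summable_inverse_squares])
qed

section \<open>The Steklov matrix of a weight\<close>

lemma smooth_circle_Re: "smooth_circle (u :: real \<Rightarrow> complex) \<Longrightarrow> smooth_circle (\<lambda>x. Re (u x))"
proof -
  assume u: "smooth_circle u"
  obtain D where D: "D 0 = u" "\<And>n x. (D n has_vector_derivative D (Suc n) x) (at x)"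
    using u by (auto simp: smooth_circle_def smooth_fun_def)
  have "smooth_fun (\<lambda>x. Re (u x))"
    unfolding smooth_fun_def
    by (intro exI[of _ "\<lambda>n x. Re (D n x)"])
      (auto simp: D(1) intro!: bounded_linear.has_vector_derivative[OF bounded_linear_Re] D(2))
  then show ?thesis using u by (auto simp: smooth_circle_def periodic2pi_def)
qed

lemma TH_ip_norm_le:
  assumes "continuous_on UNIV f" "continuous_on UNIV g" "\<And>x. norm (f x) \<le> B" "\<And>x. norm (g x) \<le> B'"
  shows "norm (TH.ip f g) \<le> B * B'"
proof -
  have "norm (integral {0..2 * pi} (\<lambda>x. f x * g x)) \<le> B * B' * (2 * pi - 0)"
  proof (rule integral_bound)
    show "continuous_on {0..2 * pi} (\<lambda>x. f x * g x)"
      using assms(1,2) by (intro continuous_on_mult) (auto intro: continuous_on_subset)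
    show "norm (f t * g t) \<le> B * B'" for t
      unfolding norm_mult using assms(3,4) order_trans[OF norm_ge_zero assms(3)] by (intro mult_mono) auto
  qed auto
  then show ?thesis by (simp add: TH_ip_eq norm_divide norm_mult field_simps)
qed

locale steklov_weight =
  fixes a :: "real \<Rightarrow> real"
  assumes a_smooth: "smooth_circle a" and a_pos: "a x > 0"
    and a_int: "integral {0..2*pi} (\<lambda>\<theta>. 1 / a \<theta>) / (2 * pi) = 1"
begin

abbreviation ac :: "real \<Rightarrow> complex" where "ac x \<equiv> complex_of_real (a x)"

definition b :: "real \<Rightarrow> real" where "b x = 1 / a x"

lemma b_pos: "b x > 0" using a_pos by (simp add: b_def)

lemma ac_smooth: "smooth_circle ac" by (rule smooth_circle_of_real[OF a_smooth])

lemma a_lower: obtains c where "c > 0" "\<And>x. c \<le> norm (ac x)"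
proof -
  have "continuous_on {0..2 * pi} a" using smooth_circle_continuous[OF ac_smooth, of "{0..2 * pi}"] continuous_on_Re[of _ ac] by simp
  then obtain x0 where x0: "x0 \<in> {0..2 * pi}" "\<And>y. y \<in> {0..2 * pi} \<Longrightarrow> a x0 \<le> a y"
    using continuous_attains_inf[of "{0..2 * pi}" a] by auto
  have "a x0 \<le> a x" for x
    using periodic2pi_reduce[OF smooth_circle_periodic[OF a_smooth], of x] x0(2) by metis
  then show thesis using that[of "a x0"] a_pos by (simp add: abs_of_pos)
qed

lemma inverse_ac_smooth: "smooth_circle (\<lambda>x. inverse (ac x))"
  using a_lower smooth_circle_inverse[OF ac_smooth] by metis

lemma b_smooth: "smooth_circle b"
proof -
  have "Re (inverse (ac x)) = b x" for x by (simp add: b_def inverse_eq_divide Re_divide_of_real)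
  then show ?thesis using smooth_circle_Re[OF inverse_ac_smooth] by simp
qed

abbreviation bb :: "real \<Rightarrow> complex" where "bb x \<equiv> complex_of_real (b x)"

lemma bb_smooth: "smooth_circle bb" by (rule smooth_circle_of_real[OF b_smooth])

lemma ab: "ac x * bb x = 1"
  using a_pos[of x] by (simp add: b_def flip: of_real_mult)

lemma mn_bb: "TH.mn bb = 1"
proof -
  have bcont: "continuous_on {0..2 * pi} b"
    using smooth_circle_continuous[OF bb_smooth, of "{0..2 * pi}"] continuous_on_Re[of _ bb] by simp
  have "integral {0..2 * pi} (\<lambda>x. bb x * 1 * complex_of_real 1) = of_real (integral {0..2 * pi} b)"
    using integral_linear[OF integrable_continuous_interval[OF bcont] bounded_linear_of_real[where 'a = complex]] by (simp add: o_def)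
  moreover have "integral {0..2 * pi} b = 2 * pi" using a_int by (simp add: b_def[abs_def])
  ultimately show ?thesis by (simp add: TH.mn_def TH.ip_def)
qed

text \<open>The arc-length parameter of the weight, with the antiderivative of \<open>b\<close> taken termwise.\<close>

definition phi_coef :: "nat \<Rightarrow> complex" where
  "phi_coef k = of_real (- sg k / dd k) * TH.co bb (partner k)"

lemma phi_coef_rapid: "rapid phi_coef"
  unfolding phi_coef_def[abs_def]
proof (rule rapid_partner_dd[OF TH.co_rapid[OF bb_smooth], of _ 1])
  fix k
  have "1 / dd k \<le> 1" using dd_ge1[of k] by simp
  then have "1 / dd k \<le> dd k" using dd_ge1[of k] by linarith
  then show "norm (complex_of_real (- sg k / dd k)) \<le> 1 * dd k" by (simp add: norm_divide less_imp_le)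
qed

definition phi :: "real \<Rightarrow> real" where "phi x = x + Re (TH.ser phi_coef x) - Re (TH.ser phi_coef 0)"

lemma phi_deriv: "(phi has_real_derivative b x) (at x)"
proof -
  have sgk: "complex_of_real (sg k) * complex_of_real (sg k) = 1" for k by (metis of_real_1 of_real_mult partner_simps(4))
  have "TH.dcoef phi_coef = TH.co bb"
    by (rule ext) (use sgk in \<open>simp add: TH.dcoef_def phi_coef_def\<close>)
  then have "(TH.ser phi_coef has_vector_derivative TH.ser (TH.co bb) x) (at x)"
    using TH.ser_deriv[OF phi_coef_rapid, of x] by simp
  moreover have "TH.ser (TH.co bb) x = bb x - 1" using TH.fourier_expansion[OF bb_smooth, of x] mn_bb by simp
  ultimately have "((\<lambda>x. Re (TH.ser phi_coef x)) has_vector_derivative Re (bb x - 1)) (at x)"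
    using bounded_linear.has_vector_derivative[OF bounded_linear_Re] by metis
  then have "((\<lambda>x. Re (TH.ser phi_coef x)) has_real_derivative b x - 1) (at x)"
    by (simp add: has_real_derivative_iff_has_vector_derivative)
  from DERIV_diff[OF DERIV_add[OF DERIV_ident this] DERIV_const] show ?thesis by (simp add: phi_def[abs_def])
qed

sublocale PH: circle_param b phi
proof
  show "phi (x + 2 * pi) = phi x + 2 * pi" for x
    using smooth_circle_periodic[OF TH.ser_smooth[OF phi_coef_rapid]] by (simp add: phi_def periodic2pi_def)
qed (use b_smooth b_pos phi_deriv in auto)

text \<open>The weight a cancels the density b = 1 / a of d\<phi>.\<close>

lemma PH_ip_a: "PH.ip (\<lambda>x. ac x * f x) g = TH.ip f g"
proof -
  have eq: "ac x * f x * g x * bb x = f x * g x" for x using ab[of x] by (metis mult.assoc mult.commute mult_1)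
  show ?thesis unfolding PH.ip_def TH_ip_eq eq ..
qed

lemma TH_ip_b: "TH.ip (\<lambda>x. bb x * f x) g = PH.ip f g"
  by (simp add: PH.ip_def TH_ip_eq mult_ac)

lemmas eb_smooth = PH.eb_smooth
lemmas eb_cont = PH.eb_cont

text \<open>The matrix of a \<Lambda> in the \<phi>-basis: by \<open>PH_ip_a\<close> its entries are
  values of the form of \<Lambda> in d\<theta>, which makes it symmetric.\<close>

definition Amat :: "nat \<Rightarrow> nat \<Rightarrow> real" where "Amat k l = Re (TH.ip (La (PH.eb l)) (PH.eb k))"

lemma TH_co_real: "TH.co (PH.eb l) j = of_real (Re (TH.co (PH.eb l) j))"
  using TH.co_cnj[of "PH.eb l" j] by (simp add: PH.cnj_eb complex_eq_iff)

lemma Amat_sums: "(\<lambda>j. dd j * Re (TH.co (PH.eb l) j) * Re (TH.co (PH.eb k) j)) sums Amat k l"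
proof -
  have s: "(\<lambda>j. Re (of_real (dd j) * TH.co (PH.eb l) j * TH.co (PH.eb k) j)) sums Amat k l"
    unfolding Amat_def by (rule sums_Re[OF La_form[OF eb_smooth eb_cont]])
  have eq: "Re (of_real (dd j) * TH.co (PH.eb l) j * TH.co (PH.eb k) j) = dd j * Re (TH.co (PH.eb l) j) * Re (TH.co (PH.eb k) j)" for j
    by (subst TH_co_real[of l], subst TH_co_real[of k]) simp
  show ?thesis using s unfolding eq .
qed

lemma Amat_complex: "TH.ip (La (PH.eb l)) (PH.eb k) = of_real (Amat k l)"
proof -
  have "cnj (TH.ip (La (PH.eb l)) (PH.eb k)) = TH.ip (La (PH.eb l)) (PH.eb k)"
    unfolding TH.ip_cnj[symmetric] La_cnj[OF eb_smooth, symmetric] by (simp add: PH.cnj_eb)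
  then show ?thesis by (simp add: Amat_def complex_eq_iff)
qed

lemma Amat_sym: "Amat k l = Amat l k"
  using sums_unique2[OF Amat_sums[of l k]] Amat_sums[of k l] by (simp add: mult_ac)

text \<open>The form is a series of squares with the weights d_j.\<close>

lemma Amat_psd: "0 \<le> (\<Sum>k<n. \<Sum>l<n. Amat k l * x k * x l)"
proof -
  define c where "c l j = Re (TH.co (PH.eb l) j)" for l j
  have "(\<lambda>j. \<Sum>k<n. \<Sum>l<n. dd j * c l j * c k j * (x k * x l)) sums (\<Sum>k<n. \<Sum>l<n. Amat k l * (x k * x l))"
    unfolding c_def by (intro sums_sum sums_mult2 Amat_sums)
  moreover have "(\<Sum>k<n. \<Sum>l<n. dd j * c l j * c k j * (x k * x l)) = dd j * (\<Sum>k<n. x k * c k j)\<^sup>2" for j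
    by (simp add: power2_eq_square sum_product sum_distrib_left mult_ac)
  ultimately have "(\<lambda>j. dd j * (\<Sum>k<n. x k * c k j)\<^sup>2) sums (\<Sum>k<n. \<Sum>l<n. Amat k l * (x k * x l))" by simp
  from sums_le[OF _ sums_zero this] show ?thesis by (simp add: mult.assoc less_imp_le)
qed

text \<open>The matrix acts on \<open>\<phi>\<close>-Fourier coefficients as the operator \<open>a \<Lambda>\<close>.\<close>

lemma co_aLa:
  assumes v: "smooth_circle v"
  shows "(\<lambda>j. of_real (Amat k j) * PH.co v j) sums PH.co (\<lambda>x. ac x * La v x) k"
proof -
  have ce: "continuous_on UNIV (\<lambda>x. ac x * La (PH.eb k) x)"
    by (intro smooth_circle_continuous smooth_circle_mult ac_smooth La_smooth eb_smooth)
  have "(\<lambda>j. PH.co v j * PH.co (\<lambda>x. ac x * La (PH.eb k) x) j) sums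
      (PH.ip v (\<lambda>x. ac x * La (PH.eb k) x) - PH.mn v * PH.mn (\<lambda>x. ac x * La (PH.eb k) x))"
    by (rule PH.parseval[OF v ce])
  moreover have "PH.co (\<lambda>x. ac x * La (PH.eb k) x) j = of_real (Amat k j)" for j
    unfolding PH.co_def PH_ip_a Amat_complex by (simp add: Amat_sym)
  moreover have "PH.mn (\<lambda>x. ac x * La (PH.eb k) x) = 0"
    using mn_La[OF eb_smooth, of k] by (simp add: PH.mn_def PH_ip_a TH.mn_def)
  moreover have "PH.ip v (\<lambda>x. ac x * La (PH.eb k) x) = PH.co (\<lambda>x. ac x * La v x) k"
    unfolding PH.ip_commute[of v] PH_ip_a PH.co_def by (rule La_sym[OF eb_smooth v])
  ultimately show ?thesis by (simp add: mult.commute)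
qed

text \<open>The equation a \<Lambda> g = \<open>eb l\<close> is solved by an antiderivative and a
  Hilbert transform. The coefficients of g are again values of the form of \<Lambda>, and this is
  the symmetry.\<close>

lemma Amat_inverse:
  "(\<lambda>j. Amat m j * (sg j * sg l * Amat (partner j) (partner l) / (dd j * dd l))) sums (if m = l then 1 else 0)"
proof -
  have sgk: "complex_of_real (sg k) * complex_of_real (sg k) = 1" for k by (metis of_real_1 of_real_mult partner_simps(4))
  \<comment> \<open>The antiderivative of b \<open>eb j\<close>, that is, of \<open>eb j\<close>
    with respect to \<phi>.\<close>
  define F where "F j x = of_real (sg j / dd j) * PH.eb (partner j) x" for j x
  have Fs: "smooth_circle (F j)" for j unfolding F_def by (intro smooth_circle_cmult eb_smooth)
  have Fd: "(F j has_vector_derivative bb x * PH.eb j x) (at x)" for j x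
  proof -
    have d: "(F j has_vector_derivative of_real (sg j / dd j) * (bb x * of_real (- sg (partner j) * dd (partner j)) * PH.eb (partner (partner j)) x)) (at x)"
      unfolding F_def[abs_def] by (intro has_vector_derivative_mult_right PH.eb_deriv)
    have eq: "of_real (sg j / dd j) * (bb x * of_real (- sg (partner j) * dd (partner j)) * PH.eb (partner (partner j)) x) = bb x * PH.eb j x"
      using sgk[of j] by (simp add: field_simps)
    show ?thesis using d unfolding eq .
  qed
  \<comment> \<open>By \<open>La_Hi\<close>, \<Lambda> H F = - F'; hence \<Lambda> g = b
    \<open>eb l\<close>.\<close>
  define g where "g x = (- 1) * Hi (F l) x" for x
  have gs: "smooth_circle g" unfolding g_def by (intro smooth_circle_cmult Hi_smooth Fs)
  have gd: "(g has_vector_derivative (- 1) * La (F l) x) (at x)" for x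
    unfolding g_def[abs_def] by (intro has_vector_derivative_mult_right Hi_deriv Fs)
  have LaF: "La (F j) x = of_real (sg j / dd j) * La (PH.eb (partner j)) x" for j x
  proof -
    have "La (\<lambda>x. 0) x = 0" by (simp add: La_def TH.co_def TH.ip_def TH.ser_def)
    then show ?thesis
      using La_add[OF smooth_circle_const[of 0] eb_smooth[of "partner j"], of "of_real (sg j / dd j)" x]
      by (simp add: F_def[abs_def])
  qed
  have cog: "PH.co g j = of_real (sg j * sg l * Amat (partner j) (partner l) / (dd j * dd l))" for j
  proof -
    \<comment> \<open>Integration by parts replaces the coefficient of g by the pairing of \<Lambda>
      F_l with F_j.\<close>
    have "((\<lambda>x. g x * (bb x * PH.eb j x) + ((- 1) * La (F l) x) * F j x) has_integral 0) {0..2 * pi}"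
    proof (rule integral_periodic_derivative[of "\<lambda>x. g x * F j x"])
      show "periodic2pi (\<lambda>x. g x * F j x)" by (rule smooth_circle_periodic[OF smooth_circle_mult[OF gs Fs]])
    qed (intro has_vector_derivative_mult gd Fd)
    then have "0 = integral {0..2 * pi} (\<lambda>x. g x * (bb x * PH.eb j x) - La (F l) x * F j x)"
      by (simp add: integral_unique)
    also have "\<dots> = integral {0..2 * pi} (\<lambda>x. g x * (bb x * PH.eb j x)) - integral {0..2 * pi} (\<lambda>x. La (F l) x * F j x)"
      by (intro integral_diff integrable_continuous_interval smooth_circle_continuous smooth_circle_mult
          gs bb_smooth eb_smooth La_smooth Fs)
    finally have "PH.co g j = TH.ip (La (F l)) (F j)"
      by (simp add: PH.co_def PH.ip_def TH_ip_eq mult_ac)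
    also have "\<dots> = TH.ip (\<lambda>x. of_real (sg l / dd l) * La (PH.eb (partner l)) x) (\<lambda>x. of_real (sg j / dd j) * PH.eb (partner j) x)"
    proof -
      have "La (F l) = (\<lambda>x. of_real (sg l / dd l) * La (PH.eb (partner l)) x)" by (intro ext LaF)
      then show ?thesis by (simp add: F_def[abs_def])
    qed
    also have "\<dots> = of_real (sg l / dd l) * (of_real (sg j / dd j) * TH.ip (La (PH.eb (partner l))) (PH.eb (partner j)))"
      unfolding TH.ip_cmult_left TH.ip_cmult_right ..
    finally show ?thesis unfolding Amat_complex by (simp add: mult_ac)
  qed
  have sm: "(\<lambda>j. of_real (Amat m j) * PH.co g j) sums PH.co (\<lambda>x. ac x * La g x) m" by (rule co_aLa[OF gs])
  have Lag: "La g x = bb x * PH.eb l x" for x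
  proof -
    have "La g x = - La (Hi (F l)) x"
    proof -
      have "La (\<lambda>x. 0) x = 0" by (simp add: La_def TH.co_def TH.ip_def TH.ser_def)
      then show ?thesis
        using La_add[OF smooth_circle_const[of 0] Hi_smooth[OF Fs], of "- 1" l x] by (simp add: g_def[abs_def])
    qed
    then show ?thesis using vector_derivative_unique_at[OF La_Hi[OF Fs, of l x] Fd[of l x]] by simp
  qed
  have "(\<lambda>x. ac x * La g x) = PH.eb l" by (rule ext) (metis Lag ab mult.assoc mult_1)
  then have "PH.co (\<lambda>x. ac x * La g x) m = (if m = l then 1 else 0)" by (simp add: PH.co_eb)
  then have "(\<lambda>j. of_real (Amat m j) * PH.co g j) sums (if m = l then 1 else 0)" using sm by simp
  then have "(\<lambda>j. complex_of_real (Amat m j * (sg j * sg l * Amat (partner j) (partner l) / (dd j * dd l)))) sums complex_of_real (if m = l then 1 else 0)"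
    unfolding cog by (cases "m = l") (simp_all)
  then show ?thesis unfolding sums_of_real_iff .
qed

text \<open>The phase (n + 1) \<phi> + (m + 1) \<theta> has positive frequencies in both variables,
  both increasing; so its derivative is at least a multiple of n + m + 2.\<close>

lemma mixed_coefficients:
  "\<exists>C. \<forall>n m. norm (TH.ip (PH.E (int n + 1)) (TH.E (int m + 1))) \<le> C / real (n + m + 2) ^ q"
proof -
  obtain B c0 where B: "\<And>x. b x \<le> B" "c0 > 0" "\<And>x. c0 \<le> b x" by (rule PH.b_bounds) blast
  define N where "N p = real (fst p + snd p + 2)" for p :: "nat \<times> nat"
  \<comment> \<open>The phase derivative divided by n + m + 2: a convex combination of b and 1,
    hence at least \<open>min c0 1\<close>.\<close>
  define \<rho> where "\<rho> p x = of_real (real (fst p + 1) / N p) * bb x + of_real (real (snd p + 1) / N p)" for p x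
  define EE where "EE p x = PH.E (int (fst p) + 1) x * TH.E (int (snd p) + 1) x" for p x
  have N0: "N p > 0" for p by (simp add: N_def)
  have le1: "norm (complex_of_real (real (fst p + 1) / N p)) \<le> 1" "norm (complex_of_real (real (snd p + 1) / N p)) \<le> 1" for p
    unfolding norm_of_real by (auto simp: N_def)
  have "\<exists>C. \<forall>p. norm (integral {0..2 * pi} (\<lambda>x. 1 * EE p x)) \<le> C / N p ^ q"
  proof (rule nonstationary_phase[where \<rho> = \<rho> and c = "min c0 1"])
    show "periodic2pi (EE p)" for p
      unfolding EE_def by (rule smooth_circle_periodic[OF smooth_circle_mult[OF PH.E_smooth TH.E_smooth]])
    show "norm (EE p x) \<le> 1" for p x by (simp add: EE_def norm_mult PH.norm_E TH.norm_E)
    show "(EE p has_vector_derivative \<i> * complex_of_real (N p) * \<rho> p x * EE p x) (at x)" for p x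
    proof -
      have "(EE p has_vector_derivative PH.E (int (fst p) + 1) x * (\<i> * of_int (int (snd p) + 1) * of_real 1 * TH.E (int (snd p) + 1) x) +
         (\<i> * of_int (int (fst p) + 1) * bb x * PH.E (int (fst p) + 1) x) * TH.E (int (snd p) + 1) x) (at x)"
        unfolding EE_def[abs_def] by (intro has_vector_derivative_mult PH.E_deriv TH.E_deriv)
      moreover have "complex_of_real (N p) * \<rho> p x = of_int (int (fst p) + 1) * bb x + of_int (int (snd p) + 1)"
      proof -
        have "N p * (real (fst p + 1) / N p) = real (fst p + 1)" "N p * (real (snd p + 1) / N p) = real (snd p + 1)"
          using N0[of p] by auto
        then have "complex_of_real (N p) * \<rho> p x = of_real (real (fst p + 1)) * bb x + of_real (real (snd p + 1))"
          unfolding \<rho>_def distrib_left mult.assoc[symmetric] of_real_mult[symmetric] by simp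
        then show ?thesis by simp
      qed
      then have "\<i> * complex_of_real (N p) * \<rho> p x * EE p x = PH.E (int (fst p) + 1) x * (\<i> * of_int (int (snd p) + 1) * of_real 1 * TH.E (int (snd p) + 1) x) +
         (\<i> * of_int (int (fst p) + 1) * bb x * PH.E (int (fst p) + 1) x) * TH.E (int (snd p) + 1) x"
        unfolding EE_def mult.assoc[of \<i>] by (simp add: algebra_simps)
      ultimately show ?thesis by simp
    qed
    show "Cb k \<rho>" for k
      unfolding \<rho>_def
    proof (intro Cb_add Cb_mult smooth_circle_imp_Cb bb_smooth)
      show "Cb k (\<lambda>p x. complex_of_real (real (fst p + 1) / N p))" "Cb k (\<lambda>p x. complex_of_real (real (snd p + 1) / N p))"
        by (rule Cb_const[OF le1(1)], rule Cb_const[OF le1(2)])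
    qed
    show "min c0 1 \<le> norm (\<rho> p x)" for p x
    proof -
      define \<mu> where "\<mu> = min c0 1"
      have "\<mu> = (real (fst p + 1) / N p) * \<mu> + (real (snd p + 1) / N p) * \<mu>"
      proof -
        have "real (fst p + 1) / N p + real (snd p + 1) / N p = 1"
          unfolding add_divide_distrib[symmetric] by (simp add: N_def)
        then show ?thesis unfolding distrib_right[symmetric] by simp
      qed
      also have "\<dots> \<le> (real (fst p + 1) / N p) * b x + (real (snd p + 1) / N p) * 1"
        using B(3)[of x] N0[of p] by (intro add_mono mult_left_mono) (auto simp: \<mu>_def)
      also have "\<dots> = Re (\<rho> p x)" by (simp add: \<rho>_def)
      also have "\<dots> \<le> norm (\<rho> p x)" by (rule complex_Re_le_cmod)
      finally show ?thesis by (simp add: \<mu>_def)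
    qed
    show "Cb k (\<lambda>(p::nat \<times> nat) (x::real). 1)" for k by (rule Cb_const[of _ 1]) simp
  qed (use N0 B in auto)
  then obtain C where C: "\<And>p. norm (integral {0..2 * pi} (\<lambda>x. 1 * EE p x)) \<le> C / N p ^ q" by blast
  have "norm (TH.ip (PH.E (int n + 1)) (TH.E (int m + 1))) \<le> C / real (n + m + 2) ^ q" for n m
  proof -
    have "norm (complex_of_real (2 * pi)) \<ge> 1" using pi_ge_two by (simp add: norm_mult)
    from norm_divide_le[OF this, of "integral {0..2 * pi} (EE (n, m))"]
    have "norm (TH.ip (PH.E (int n + 1)) (TH.E (int m + 1))) \<le> norm (integral {0..2 * pi} (EE (n, m)))"
      by (simp add: TH_ip_eq EE_def[abs_def])
    also have "\<dots> \<le> C / real (n + m + 2) ^ q" using C[of "(n, m)"] by (simp add: N_def)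
    finally show ?thesis .
  qed
  then show ?thesis by blast
qed

text \<open>\<Lambda> equals -i d/d\<theta> up to negative frequencies, and -i d/d\<theta>
  multiplies this exponential of \<phi> by (n + 1) b.\<close>

lemma La_E_defect:
  assumes "\<And>m. real (Suc m) * norm (TH.ip (PH.E (int n + 1)) (TH.E (int m + 1))) \<le> C / real (Suc m) ^ 2"
  shows "norm (La (PH.E (int n + 1)) x - of_nat (n + 1) * bb x * PH.E (int n + 1) x) \<le> 16 * C * (\<Sum>k. (1 / real (Suc k))\<^sup>2)"
proof -
  have "\<i> * (\<i> * of_int (int n + 1) * bb x * PH.E (int n + 1) x) = - (of_nat (n + 1) * bb x * PH.E (int n + 1) x)"
    by (simp add: algebra_simps)
  then show ?thesis using La_minus_D[OF PH.E_smooth PH.E_deriv assms, of x] by simp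
qed

text \<open>Multiplied by a, this is the error of \<open>eb l\<close> as an eigenfunction of a
  \<Lambda> for the eigenvalue d_l.\<close>

definition defect :: "nat \<Rightarrow> real \<Rightarrow> complex" where
  "defect l x = La (PH.eb l) x - of_real (dd l) * bb x * PH.eb l x"

text \<open>Since \<Lambda> is real, the exponential of frequency -n has the conjugate error, and
  \<open>eb l\<close> combines both exponentials with coefficients of modulus at most 1.\<close>

lemma defect_le:
  assumes "\<And>x. norm (La (PH.E (int (l div 2) + 1)) x - of_nat (l div 2 + 1) * bb x * PH.E (int (l div 2) + 1) x) \<le> D"
  shows "norm (defect l x) \<le> 2 * D"
proof -
  define n where "n = int (l div 2) + 1"
  define w where "w x = La (PH.E n) x - of_real (dd l) * bb x * PH.E n x" for x
  have wD: "norm (w x) \<le> D" using assms[of x] by (simp add: w_def n_def dd_def)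
  have Lm: "La (PH.E (- n)) x = cnj (La (PH.E n) x)"
    using La_cnj[OF PH.E_smooth[of n], of x] by (simp add: PH.cnj_E)
  have cw: "La (PH.E (- n)) x - of_real (dd l) * bb x * PH.E (- n) x = cnj (w x)"
    by (simp add: w_def Lm PH.cnj_E)
  have La0: "La (\<lambda>x. 0) x = 0" by (simp add: La_def TH.co_def TH.ip_def TH.ser_def)
  have Lc: "La (\<lambda>x. c * (PH.E n x + d * PH.E (- n) x)) x = c * (La (PH.E n) x + d * La (PH.E (- n)) x)" for c d
    using La_add[OF smooth_circle_const[of 0] smooth_circle_add[OF PH.E_smooth smooth_circle_cmult[OF PH.E_smooth]], of c n d "- n" x]
      La_add[OF PH.E_smooth PH.E_smooth, of n d "- n" x] by (simp add: La0)
  have s2: "norm (1 / complex_of_real (sqrt 2)) \<le> 1" "norm (1 / (complex_of_real (sqrt 2) * \<i>)) \<le> 1"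
    by (auto simp: norm_divide norm_mult)
  have "\<exists>c d. norm c \<le> 1 \<and> norm d = 1 \<and> defect l x = c * (w x + d * cnj (w x))"
  proof (cases "even l")
    case True
    then have e: "PH.eb l = (\<lambda>x. (1 / sqrt 2) * (PH.E n x + 1 * PH.E (- n) x))" by (intro ext) (simp add: PH.eb_E n_def algebra_simps add_divide_distrib diff_divide_distrib)
    have "defect l x = (1 / sqrt 2) * (w x + 1 * cnj (w x))"
      unfolding defect_def e Lc cw[symmetric] unfolding w_def by (simp add: algebra_simps add_divide_distrib diff_divide_distrib)
    then show ?thesis using s2(1) by (intro exI[of _ "1 / complex_of_real (sqrt 2)"] exI[of _ 1]) auto
  next
    case False
    then have e: "PH.eb l = (\<lambda>x. (1 / (sqrt 2 * \<i>)) * (PH.E n x + (- 1) * PH.E (- n) x))" by (intro ext) (simp add: PH.eb_E n_def algebra_simps add_divide_distrib diff_divide_distrib)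
    have "defect l x = (1 / (sqrt 2 * \<i>)) * (w x + (- 1) * cnj (w x))"
      unfolding defect_def e Lc cw[symmetric] unfolding w_def by (simp add: algebra_simps add_divide_distrib diff_divide_distrib)
    then show ?thesis using s2(2) by (intro exI[of _ "1 / (complex_of_real (sqrt 2) * \<i>)"] exI[of _ "- 1"]) auto
  qed
  then obtain c d where cd: "norm c \<le> 1" "norm d = 1" "defect l x = c * (w x + d * cnj (w x))" by blast
  have "norm (defect l x) \<le> 1 * (norm (w x) + norm (d * cnj (w x)))"
    unfolding cd(3) norm_mult[of c] using cd(1) by (intro mult_mono norm_triangle_ineq) auto
  then show ?thesis using wD cd(2) by (simp add: norm_mult)
qed

lemma Amat_defect: "of_real (Amat k l - (if k = l then dd k else 0)) = TH.ip (defect l) (PH.eb k)"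
proof -
  have "TH.ip (defect l) (PH.eb k) = TH.ip (La (PH.eb l)) (PH.eb k) - TH.ip (\<lambda>x. of_real (dd l) * (bb x * PH.eb l x)) (PH.eb k)"
    unfolding defect_def[abs_def] mult.assoc
    by (intro TH.ip_diff_left smooth_circle_continuous La_smooth eb_smooth smooth_circle_cmult smooth_circle_mult bb_smooth)
  also have "TH.ip (\<lambda>x. of_real (dd l) * (bb x * PH.eb l x)) (PH.eb k) = of_real (if k = l then dd k else 0)"
    unfolding TH.ip_cmult_left TH_ip_b using PH.co_eb[of l k] by (auto simp: PH.co_def)
  finally show ?thesis by (simp add: Amat_complex)
qed

lemma defect_cont: "continuous_on UNIV (defect l)"
  unfolding defect_def[abs_def]
  by (intro smooth_circle_continuous smooth_circle_diff La_smooth eb_smooth smooth_circle_mult smooth_circle_const bb_smooth)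

lemma Amat_decay: "\<exists>C. \<forall>k l. \<bar>Amat k l - (if k = l then dd k else 0)\<bar> \<le> C / real (Suc l) ^ p"
proof -
  \<comment> \<open>Of the p + 3 powers, p go to l, one absorbs the factor m + 1, and two make the
    sum over m converge.\<close>
  obtain C where C: "\<And>n m. norm (TH.ip (PH.E (int n + 1)) (TH.E (int m + 1))) \<le> C / real (n + m + 2) ^ (p + 3)"
    using mixed_coefficients[of "p + 3"] by blast
  have C0: "C \<ge> 0" using order_trans[OF norm_ge_zero C[of 0 0]] by (simp add: zero_le_divide_iff power_le_zero_eq)
  define Z where "Z = (\<Sum>k. (1 / real (Suc k))\<^sup>2)"
  have Z0: "Z \<ge> 0" unfolding Z_def by (intro suminf_nonneg summable_inverse_squares) auto
  have "\<bar>Amat k l - (if k = l then dd k else 0)\<bar> \<le> (64 * C * Z * 2 ^ p) / real (Suc l) ^ p" for k l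
  proof -
    define n where "n = l div 2"
    have bnd: "real (Suc m) * norm (TH.ip (PH.E (int n + 1)) (TH.E (int m + 1))) \<le> (C / real (Suc n) ^ p) / real (Suc m) ^ 2" for m
    proof -
      have "real (Suc n) ^ p * real (Suc m) ^ 3 \<le> real (n + m + 2) ^ p * real (n + m + 2) ^ 3"
        by (intro mult_mono power_mono) auto
      then have "C / real (n + m + 2) ^ (p + 3) \<le> C / (real (Suc n) ^ p * real (Suc m) ^ 3)"
        using C0 unfolding power_add by (intro divide_left_mono) (auto intro!: mult_pos_pos)
      then have "real (Suc m) * norm (TH.ip (PH.E (int n + 1)) (TH.E (int m + 1))) \<le> real (Suc m) * (C / (real (Suc n) ^ p * real (Suc m) ^ 3))"
        using C[of n m] by (intro mult_left_mono) auto
      also have "\<dots> = (C / real (Suc n) ^ p) / real (Suc m) ^ 2" by (simp add: power3_eq_cube power2_eq_square del: of_nat_Suc)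
      finally show ?thesis .
    qed
    have "norm (defect l x) \<le> 2 * (16 * (C / real (Suc n) ^ p) * Z)" for x
      by (rule defect_le) (use La_E_defect[OF bnd] in \<open>simp add: n_def Z_def\<close>)
    from TH_ip_norm_le[OF defect_cont eb_cont this PH.norm_eb]
    have "norm (complex_of_real (Amat k l - (if k = l then dd k else 0))) \<le> 2 * (16 * (C / real (Suc n) ^ p) * Z) * 2"
      unfolding Amat_defect .
    then have "\<bar>Amat k l - (if k = l then dd k else 0)\<bar> \<le> 2 * (16 * (C / real (Suc n) ^ p) * Z) * 2"
      by (simp only: norm_of_real)
    also have "\<dots> = 64 * C * Z / real (Suc n) ^ p" by simp
    also have "\<dots> \<le> (64 * C * Z * 2 ^ p) / real (Suc l) ^ p"
    proof -
      have "real (Suc l) \<le> 2 * real (Suc n)" using dd_lower[of l] by (simp add: dd_def n_def)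
      then have "real (Suc l) ^ p \<le> 2 ^ p * real (Suc n) ^ p" by (metis power_mono power_mult_distrib of_nat_0_le_iff)
      then have "64 * C * Z * real (Suc l) ^ p \<le> 64 * C * Z * (2 ^ p * real (Suc n) ^ p)"
        using C0 Z0 by (intro mult_left_mono) auto
      then show ?thesis by (simp add: divide_simps mult_ac del: of_nat_Suc)
    qed
    finally show ?thesis .
  qed
  then show ?thesis by blast
qed

sublocale SM: steklov_matrix Amat
  by standard (rule Amat_sym Amat_decay Amat_inverse Amat_psd)+

end

section \<open>Steklov eigenfunctions\<close>

interpretation FV: vector_space "\<lambda>(c::complex) (f::real \<Rightarrow> complex). (\<lambda>x. c * f x)"
  by standard (auto simp: fun_eq_iff algebra_simps)

context steklov_weight
begin

abbreviation qc :: "real \<Rightarrow> complex" where "qc x \<equiv> complex_of_real (sqrt (a x))"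

lemma qc_nz: "qc x \<noteq> 0" using a_pos[of x] by simp

lemma qc_sq: "qc x * qc x = ac x"
  using a_pos[of x] by (simp flip: of_real_mult)

lemma qc_smooth: "smooth_circle qc"
proof -
  obtain D where D: "D 0 = a" "\<And>n x. (D n has_vector_derivative D (Suc n) x) (at x)"
    using a_smooth by (auto simp: smooth_circle_def smooth_fun_def)
  have ad: "(a has_vector_derivative D 1 x) (at x)" for x using D(2)[of 0 x] D(1) by simp
  have "smooth_fun (D 1)" unfolding smooth_fun_def by (intro exI[of _ "\<lambda>n. D (Suc n)"]) (auto simp: D(2))
  moreover have "periodic2pi (D 1)"
    by (rule periodic_derivative[OF smooth_circle_periodic[OF a_smooth] ad])
  ultimately have D1: "smooth_circle (\<lambda>x. complex_of_real (D 1 x))"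
    by (intro smooth_circle_of_real) (simp add: smooth_circle_def)
  \<comment> \<open>The logarithmic derivative of \<open>sqrt a\<close>, which puts the square root
    into the form of \<open>smooth_circle_ode\<close>.\<close>
  define v where "v x = (1/2) * (complex_of_real (D 1 x) * inverse (ac x))" for x
  show ?thesis
  proof (rule smooth_circle_ode[of _ v])
    show "periodic2pi qc" using smooth_circle_periodic[OF a_smooth] by (simp add: periodic2pi_def)
    show "smooth_circle v" unfolding v_def by (intro smooth_circle_cmult smooth_circle_mult D1 inverse_ac_smooth)
    show "(qc has_vector_derivative v x * qc x) (at x)" for x
    proof -
      have "((\<lambda>x. sqrt (a x)) has_real_derivative D 1 x * (inverse (sqrt (a x)) / 2)) (at x)"
        using DERIV_chain2[where f = sqrt and g = a, OF DERIV_real_sqrt[OF a_pos[of x]],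
            OF ad[of x, folded has_real_derivative_iff_has_vector_derivative]]
        by (simp add: mult.commute)
      then have "(qc has_vector_derivative complex_of_real (D 1 x * (inverse (sqrt (a x)) / 2))) (at x)"
        by (intro bounded_linear.has_vector_derivative[OF bounded_linear_of_real])
          (simp add: has_real_derivative_iff_has_vector_derivative)
      moreover have "complex_of_real (D 1 x * (inverse (sqrt (a x)) / 2)) = v x * qc x"
        using qc_nz[of x] unfolding v_def qc_sq[symmetric] by (simp add: field_simps)
      ultimately show ?thesis by metis
    qed
  qed
qed

lemma inverse_qc_smooth: "smooth_circle (\<lambda>x. inverse (qc x))"
proof -
  obtain c where c: "c > 0" "\<And>x. c \<le> norm (ac x)" by (rule a_lower) blast
  have "sqrt c \<le> norm (qc x)" for x using c(2)[of x] a_pos[of x] by (simp add: abs_of_pos)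
  then show ?thesis using c(1) by (intro smooth_circle_inverse[OF qc_smooth, of "sqrt c"]) auto
qed

text \<open>Multiplication by \<open>sqrt a\<close> intertwines the symmetric operator with a
  \<Lambda>.\<close>

lemma eigenspace_iff:
  "u \<in> steklov_eigenspace a \<mu> \<longleftrightarrow> smooth_circle u \<and>
     (\<forall>x. ac x * La (\<lambda>x. qc x * u x) x = of_real \<mu> * (qc x * u x))"
proof (cases "smooth_circle u")
  case True
  have s: "smooth_circle (\<lambda>x. qc x * u x)" by (intro smooth_circle_mult qc_smooth True)
  have "Lambda_a a u x = of_real \<mu> * u x \<longleftrightarrow> ac x * La (\<lambda>x. qc x * u x) x = of_real \<mu> * (qc x * u x)" for x
  proof -
    have "Lambda_a a u x = of_real \<mu> * u x \<longleftrightarrow> qc x * (qc x * La (\<lambda>x. qc x * u x) x) = qc x * (of_real \<mu> * u x)"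
      unfolding Lambda_a_def Lambda_op_eq_La[OF s] using qc_nz[of x] by simp
    then show ?thesis unfolding qc_sq[symmetric] by (simp add: mult_ac)
  qed
  then show ?thesis using True by (simp add: steklov_eigenspace_def)
qed (simp add: steklov_eigenspace_def)

section \<open>From eigenvectors of the matrix to Steklov eigenfunctions\<close>

definition vv :: "nat \<Rightarrow> real \<Rightarrow> complex" where "vv i = PH.ser (\<lambda>k. of_real (crd (SM.ev i) k))"

definition uu :: "nat \<Rightarrow> real \<Rightarrow> complex" where "uu i x = inverse (qc x) * vv i x"

lemma ev_rapid: "rapid (\<lambda>k. complex_of_real (crd (SM.ev i) k))"
  unfolding rapid_def norm_of_real using SM.ev_decay by metis

lemma vv_smooth: "smooth_circle (vv i)"
  unfolding vv_def by (rule PH.ser_smooth[OF ev_rapid])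

lemma co_vv: "PH.co (vv i) k = of_real (crd (SM.ev i) k)" and mn_vv: "PH.mn (vv i) = 0"
  unfolding vv_def by (rule PH.co_ser[OF ev_rapid])+

lemma uu_smooth: "smooth_circle (uu i)"
  unfolding uu_def by (intro smooth_circle_mult inverse_qc_smooth vv_smooth)

lemma qc_uu: "(\<lambda>x. qc x * uu i x) = vv i"
  using qc_nz by (auto simp: uu_def fun_eq_iff mult.assoc[symmetric])

lemma mn_aLa: "smooth_circle v \<Longrightarrow> PH.mn (\<lambda>x. ac x * La v x) = 0"
  using mn_La[of v] by (simp add: PH.mn_def PH_ip_a TH.mn_def)

lemma Amat_crd_sums: "(\<lambda>j. Amat k j * crd x j) sums (dd k * crd x k + crd (mat_op SM.Rm x) k)"
proof -
  have "(\<lambda>j. (if j = k then dd k * crd x j else 0) + SM.Rm k j * crd x j) sums (dd k * crd x k + crd (mat_op SM.Rm x) k)"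
    by (intro sums_add mat_op_sums[OF SM.hs_Rm]) (use sums_If_finite_set[of "{k}" "\<lambda>j. dd k * crd x j"] in simp)
  moreover have "(\<lambda>j. (if j = k then dd k * crd x j else 0) + SM.Rm k j * crd x j) = (\<lambda>j. Amat k j * crd x j)"
    by (auto simp: SM.Rm_def fun_eq_iff algebra_simps)
  ultimately show ?thesis by simp
qed

text \<open>Both sides have mean 0 in \<phi> and, by \<open>co_aLa\<close> and the eigenvector
  equation, the same coefficients.\<close>

lemma vv_eigen: "ac x * La (vv i) x = of_real (SM.lam i) * vv i x"
proof -
  define g where "g x = ac x * La (vv i) x - of_real (SM.lam i) * vv i x" for x
  have s1: "smooth_circle (\<lambda>x. ac x * La (vv i) x)" by (intro smooth_circle_mult ac_smooth La_smooth vv_smooth)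
  have s2: "smooth_circle (\<lambda>x. of_real (SM.lam i) * vv i x)" by (intro smooth_circle_cmult vv_smooth)
  have gs: "smooth_circle g" unfolding g_def by (rule smooth_circle_diff[OF s1 s2])
  have c: "continuous_on UNIV (\<lambda>x. ac x * La (vv i) x)" "continuous_on UNIV (\<lambda>x. of_real (SM.lam i) * vv i x)"
    by (rule smooth_circle_continuous[OF s1], rule smooth_circle_continuous[OF s2])
  have "PH.co g k = 0" for k
  proof -
    have "(\<lambda>j. complex_of_real (Amat k j * crd (SM.ev i) j)) sums PH.co (\<lambda>x. ac x * La (vv i) x) k"
      using co_aLa[OF vv_smooth, of k i] by (simp add: co_vv)
    moreover have "(\<lambda>j. complex_of_real (Amat k j * crd (SM.ev i) j)) sums of_real (SM.lam i * crd (SM.ev i) k)"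
      unfolding sums_of_real_iff SM.ev_eigen[of i k] by (rule Amat_crd_sums)
    ultimately have "PH.co (\<lambda>x. ac x * La (vv i) x) k = of_real (SM.lam i * crd (SM.ev i) k)" using sums_unique2 by blast
    then show ?thesis unfolding g_def PH.co_lincomb(2)[OF c] by (simp add: PH.co_def PH.ip_cmult_left) (simp add: PH.co_def[symmetric] co_vv)
  qed
  moreover have "PH.mn g = 0"
    unfolding g_def PH.co_lincomb(4)[OF c] mn_aLa[OF vv_smooth] using mn_vv[of i] by (simp add: PH.mn_def PH.ip_cmult_left)
  ultimately have "g x = 0"
    using PH.fourier_unique_co[OF smooth_circle_continuous[OF gs] smooth_circle_periodic[OF gs]] by blast
  then show ?thesis by (simp add: g_def)
qed

lemma uu_in_eigenspace: "uu i \<in> steklov_eigenspace a (SM.lam i)"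
  unfolding eigenspace_iff qc_uu using uu_smooth vv_eigen qc_uu by (metis (no_types, lifting))

lemma finite_lam: "finite {i. SM.lam i = \<mu>}"
proof -
  have "\<forall>\<^sub>F i in sequentially. \<mu> < SM.lam i" using SM.lam_at_top by (simp add: filterlim_at_top_dense)
  then obtain N where N: "\<And>i. i \<ge> N \<Longrightarrow> \<mu> < SM.lam i" unfolding eventually_sequentially by blast
  have "{i. SM.lam i = \<mu>} \<subseteq> {..<N}" using N by (auto simp: not_less[symmetric])
  then show ?thesis using finite_subset by blast
qed

text \<open>Self-adjointness makes x orthogonal to the eigenvectors of all other eigenvalues, and
  completeness removes the remainder.\<close>

lemma eigenvector_expansion:
  assumes x: "SM.A_graph x (\<mu> *\<^sub>R x)"
  shows "x = (\<Sum>i\<in>{i. SM.lam i = \<mu>}. inner x (SM.ev i) *\<^sub>R SM.ev i)"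
proof -
  have xT: "x = \<mu> *\<^sub>R SM.Top x" using x by (simp add: SM.A_graph_iff linear_scale[OF SM.Top_linear])
  have orth: "inner x (SM.ev i) = 0" if "SM.lam i \<noteq> \<mu>" for i
  proof -
    have "inner x (SM.ev i) = \<mu> * inner (SM.Top x) (SM.ev i)" by (subst xT) simp
    also have "\<dots> = \<mu> * (SM.tau i * inner x (SM.ev i))" by (simp add: SM.Top_selfadjoint SM.Top_ev)
    finally have "inner x (SM.ev i) * (SM.lam i - \<mu>) = 0"
      using SM.tau_pos[of i] by (simp add: SM.lam_def field_simps)
    then show ?thesis using that by simp
  qed
  define y where "y = x - (\<Sum>i\<in>{i. SM.lam i = \<mu>}. inner x (SM.ev i) *\<^sub>R SM.ev i)"
  have "inner y (SM.ev j) = 0" for j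
  proof -
    have "(\<Sum>i\<in>{i. SM.lam i = \<mu>}. inner x (SM.ev i) * inner (SM.ev i) (SM.ev j)) =
        (\<Sum>i\<in>{i. SM.lam i = \<mu>}. if i = j then inner x (SM.ev j) else 0)"
      by (intro sum.cong) (auto simp: SM.ev_orthonormal)
    also have "\<dots> = inner x (SM.ev j)" using orth[of j] finite_lam by (simp add: sum.delta)
    finally show ?thesis by (simp add: y_def inner_diff_left inner_sum_left)
  qed
  then have "y = 0" by (rule SM.ev_complete)
  then show ?thesis by (simp add: y_def)
qed

text \<open>\<open>ell2\<close> is real, so the real and imaginary parts of the coefficients are
  expanded separately and recombined in \<zeta>.\<close>

lemma eigenfunction_expansion:
  assumes u: "u \<in> steklov_eigenspace a \<mu>" and mu: "\<mu> > 0"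
  shows "\<exists>\<zeta>. u = (\<lambda>x. \<Sum>i\<in>{i. SM.lam i = \<mu>}. \<zeta> i * uu i x)"
proof -
  define I where "I = {i. SM.lam i = \<mu>}"
  define v where "v x = qc x * u x" for x
  have us: "smooth_circle u" and ve: "\<And>x. ac x * La v x = of_real \<mu> * v x"
    using u unfolding eigenspace_iff v_def by auto
  have vs: "smooth_circle v" unfolding v_def by (intro smooth_circle_mult qc_smooth us)
  define c where "c = PH.co v"
  have cr: "rapid c" unfolding c_def by (rule PH.co_rapid[OF vs])
  have eq: "(\<lambda>x. ac x * La v x) = (\<lambda>x. of_real \<mu> * v x)" using ve by blast
  have cs: "(\<lambda>j. of_real (Amat k j) * c j) sums (of_real \<mu> * c k)" for k
    using co_aLa[OF vs, of k] unfolding eq by (simp add: c_def PH.co_def PH.ip_cmult_left)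
  \<comment> \<open>A positive eigenvalue forces mean 0 in \<phi>, so that the coefficients
    determine v.\<close>
  have "of_real \<mu> * PH.mn v = 0" using mn_aLa[OF vs] unfolding eq by (simp add: PH.mn_def PH.ip_cmult_left)
  then have mv: "PH.mn v = 0" using mu by simp
  have sq: "summable (\<lambda>k. (f k)\<^sup>2)" if f: "\<And>k. \<bar>f k\<bar> \<le> norm (c k)" for f :: "nat \<Rightarrow> real"
  proof -
    obtain C where C: "C \<ge> 0" "\<And>k. norm (c k) \<le> C / real (Suc k) ^ 1" using rapidD[OF cr] by metis
    show ?thesis
    proof (rule summable_comparison_test'[OF summable_mult[OF summable_inverse_squares, of "C\<^sup>2"]])
      fix k :: nat
      have "\<bar>f k\<bar> \<le> C * (1 / real (Suc k))" using f[of k] C(2)[of k] by simp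
      then have "\<bar>f k\<bar>\<^sup>2 \<le> (C * (1 / real (Suc k)))\<^sup>2" by (intro power_mono) auto
      then show "norm ((f k)\<^sup>2) \<le> C\<^sup>2 * (1 / real (Suc k))\<^sup>2" unfolding power_mult_distrib by simp
    qed
  qed
  define xr where "xr = of_seq (\<lambda>k. Re (c k))"
  define xi where "xi = of_seq (\<lambda>k. Im (c k))"
  have crx: "crd xr k = Re (c k)" "crd xi k = Im (c k)" for k
    unfolding xr_def xi_def by (auto simp: crd_of_seq sq abs_Re_le_cmod abs_Im_le_cmod)
  have gr: "SM.A_graph x (\<mu> *\<^sub>R x)" if "\<And>k. (\<lambda>j. Amat k j * crd x j) sums (\<mu> * crd x k)" for x
    unfolding SM.A_graph_def crd_simps using sums_unique2[OF that Amat_crd_sums] by blast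
  have "SM.A_graph xr (\<mu> *\<^sub>R xr)" "SM.A_graph xi (\<mu> *\<^sub>R xi)"
    by (rule gr, use sums_Re[OF cs] sums_Im[OF cs] in \<open>simp add: crx\<close>)+
  then have exp: "xr = (\<Sum>i\<in>I. inner xr (SM.ev i) *\<^sub>R SM.ev i)" "xi = (\<Sum>i\<in>I. inner xi (SM.ev i) *\<^sub>R SM.ev i)"
    unfolding I_def by (auto intro: eigenvector_expansion)
  define \<zeta> where "\<zeta> i = Complex (inner xr (SM.ev i)) (inner xi (SM.ev i))" for i
  have ck: "c k = (\<Sum>i\<in>I. \<zeta> i * of_real (crd (SM.ev i) k))" for k
  proof (rule complex_eqI)
    show "Re (c k) = Re (\<Sum>i\<in>I. \<zeta> i * of_real (crd (SM.ev i) k))"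
      unfolding crx(1)[symmetric] by (subst exp(1)) (simp add: crd_sum crd_simps \<zeta>_def)
    show "Im (c k) = Im (\<Sum>i\<in>I. \<zeta> i * of_real (crd (SM.ev i) k))"
      unfolding crx(2)[symmetric] by (subst exp(2)) (simp add: crd_sum crd_simps \<zeta>_def)
  qed
  have vx: "v x = (\<Sum>i\<in>I. \<zeta> i * vv i x)" for x
  proof -
    have sm: "summable (\<lambda>k. of_real (crd (SM.ev i) k) * PH.eb k x)" for i
      by (rule summable_norm_cancel[OF PH.ser_summable[OF ev_rapid]])
    have "v x = PH.ser c x" using PH.fourier_expansion[OF vs, of x] mv by (simp add: c_def)
    also have "\<dots> = (\<Sum>k. \<Sum>i\<in>I. \<zeta> i * (of_real (crd (SM.ev i) k) * PH.eb k x))"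
      unfolding PH.ser_def ck by (simp add: sum_distrib_right mult.assoc)
    also have "\<dots> = (\<Sum>i\<in>I. \<Sum>k. \<zeta> i * (of_real (crd (SM.ev i) k) * PH.eb k x))"
      by (rule suminf_sum) (intro summable_mult sm)
    also have "\<dots> = (\<Sum>i\<in>I. \<zeta> i * vv i x)"
      unfolding vv_def PH.ser_def using sm by (intro sum.cong refl suminf_mult)
    finally show ?thesis .
  qed
  have "u x = (\<Sum>i\<in>I. \<zeta> i * uu i x)" for x
  proof -
    have "u x = inverse (qc x) * v x" using qc_nz[of x] by (simp add: v_def)
    then show ?thesis by (simp add: vx uu_def sum_distrib_left mult_ac)
  qed
  then show ?thesis unfolding I_def by blast
qed

text \<open>Passing to \<phi>-coefficients reduces complex independence to the orthonormality of the
  real eigenvectors.\<close>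

lemma uu_independent:
  assumes I: "finite I" and z: "\<And>x. (\<Sum>i\<in>I. \<zeta> i * uu i x) = 0" and j: "j \<in> I"
  shows "\<zeta> j = 0"
proof -
  have vz: "(\<Sum>i\<in>I. \<zeta> i * vv i x) = 0" for x
  proof -
    have "(\<Sum>i\<in>I. \<zeta> i * vv i x) = qc x * (\<Sum>i\<in>I. \<zeta> i * uu i x)"
      unfolding qc_uu[symmetric] by (simp add: sum_distrib_left mult_ac)
    then show ?thesis using z by simp
  qed
  have co_sum: "PH.co (\<lambda>x. \<Sum>i\<in>J. \<zeta> i * vv i x) k = (\<Sum>i\<in>J. \<zeta> i * of_real (crd (SM.ev i) k))" if "finite J" for J k
    using that
  proof (induction J)
    case empty
    then show ?case by (simp add: PH.co_def PH.ip_def)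
  next
    case (insert i J)
    have c: "continuous_on UNIV (\<lambda>x. \<zeta> i * vv i x)" "continuous_on UNIV (\<lambda>x. \<Sum>i\<in>J. \<zeta> i * vv i x)"
      by (intro continuous_intros smooth_circle_continuous vv_smooth)+
    show ?case using insert PH.co_lincomb(1)[OF c, of k]
      by (simp add: PH.co_def PH.ip_cmult_left) (simp add: PH.co_def[symmetric] co_vv)
  qed
  have cz: "(\<Sum>i\<in>I. \<zeta> i * of_real (crd (SM.ev i) k)) = 0" for k
    using co_sum[OF I, of k] unfolding vz by (simp add: PH.co_def PH.ip_def)
  have "(\<Sum>i\<in>I. Re (\<zeta> i) *\<^sub>R SM.ev i) = 0" "(\<Sum>i\<in>I. Im (\<zeta> i) *\<^sub>R SM.ev i) = 0"
    by (rule ell2_eqI, use arg_cong[OF cz, of Re] arg_cong[OF cz, of Im] in \<open>simp add: crd_sum crd_simps\<close>)+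
  then have "inner (\<Sum>i\<in>I. Re (\<zeta> i) *\<^sub>R SM.ev i) (SM.ev j) = 0" "inner (\<Sum>i\<in>I. Im (\<zeta> i) *\<^sub>R SM.ev i) (SM.ev j) = 0" by auto
  moreover have "inner (\<Sum>i\<in>I. r i *\<^sub>R SM.ev i) (SM.ev j) = r j" for r
  proof -
    have "inner (\<Sum>i\<in>I. r i *\<^sub>R SM.ev i) (SM.ev j) = (\<Sum>i\<in>I. if i = j then r j else 0)"
      unfolding inner_sum_left by (intro sum.cong) (auto simp: SM.ev_orthonormal)
    then show ?thesis using I j by simp
  qed
  ultimately show ?thesis by (simp add: complex_eq_iff)
qed

lemma uu_inj: "inj uu"
proof (rule injI, rule ccontr)
  fix i j assume e: "uu i = uu j" and ne: "i \<noteq> j"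
  have "(\<Sum>k\<in>{i, j}. (if k = i then 1 else - 1) * uu k x) = 0" for x using ne e by simp
  from uu_independent[of "{i, j}" "\<lambda>k. if k = i then 1 else - 1" i, OF _ this] show False by simp
qed

lemma uu_nonzero: "uu i \<noteq> (\<lambda>_. 0)"
  using uu_independent[of "{i}" "\<lambda>_. 1" i] by auto

lemma fun_sum_apply: "sum f S x = (\<Sum>i\<in>S. f i (x::real) :: complex)"
  by (induction S rule: infinite_finite_induct) auto

lemma steklov_mult_eq:
  assumes "\<mu> > 0"
  shows "steklov_mult a \<mu> = card {i. SM.lam i = \<mu>}"
proof -
  define I where "I = {i. SM.lam i = \<mu>}"
  have fI: "finite I" unfolding I_def by (rule finite_lam)
  have "FV.dim (steklov_eigenspace a \<mu>) = card I"
  proof (rule FV.dim_unique)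
    show "uu ` I \<subseteq> steklov_eigenspace a \<mu>" using uu_in_eigenspace by (auto simp: I_def)
    show "steklov_eigenspace a \<mu> \<subseteq> FV.span (uu ` I)"
    proof
      fix u assume "u \<in> steklov_eigenspace a \<mu>"
      then obtain \<zeta> where z: "u = (\<lambda>x. \<Sum>i\<in>I. \<zeta> i * uu i x)"
        using eigenfunction_expansion[OF _ assms] unfolding I_def by blast
      have "u = (\<Sum>i\<in>I. (\<lambda>x. \<zeta> i * uu i x))" unfolding z by (rule ext) (simp add: fun_sum_apply)
      also have "\<dots> \<in> FV.span (uu ` I)"
        by (intro FV.span_sum FV.span_scale FV.span_base) auto
      finally show "u \<in> FV.span (uu ` I)" .
    qed
    show "FV.independent (uu ` I)"
    proof (rule FV.independent_if_scalars_zero)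
      show "finite (uu ` I)" using fI by simp
      fix f u assume 0: "(\<Sum>w\<in>uu ` I. (\<lambda>x. f w * w x)) = 0" and u: "u \<in> uu ` I"
      obtain j where j: "j \<in> I" "u = uu j" using u by blast
      have "(\<Sum>i\<in>I. f (uu i) * uu i x) = 0" for x
      proof -
        have "(\<Sum>w\<in>uu ` I. (\<lambda>x. f w * w x)) x = (\<Sum>i\<in>I. f (uu i) * uu i x)"
          unfolding fun_sum_apply by (subst sum.reindex) (auto intro: inj_on_subset[OF uu_inj])
        then show ?thesis using 0 by simp
      qed
      from uu_independent[OF fI this j(1)] show "f u = 0" using j(2) by simp
    qed
    show "card (uu ` I) = card I" by (rule card_image[OF inj_on_subset[OF uu_inj]]) auto
  qed
  then show ?thesis by (simp add: steklov_mult_def I_def)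
qed

lemma steklov_pos_eigs_eq: "steklov_pos_eigs a = range SM.lam"
proof (intro subset_antisym subsetI)
  fix \<mu> assume "\<mu> \<in> steklov_pos_eigs a"
  then obtain u where mu: "\<mu> > 0" and u: "u \<in> steklov_eigenspace a \<mu>" "u \<noteq> (\<lambda>_. 0)"
    unfolding steklov_pos_eigs_def by blast
  obtain \<zeta> where z: "u = (\<lambda>x. \<Sum>i\<in>{i. SM.lam i = \<mu>}. \<zeta> i * uu i x)"
    using eigenfunction_expansion[OF u(1) mu] by blast
  show "\<mu> \<in> range SM.lam"
  proof (rule ccontr)
    assume "\<mu> \<notin> range SM.lam"
    then have "{i. SM.lam i = \<mu>} = {}" by auto
    then show False using z u(2) by simp
  qed
next
  fix \<mu> assume "\<mu> \<in> range SM.lam"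
  then obtain i where "\<mu> = SM.lam i" by blast
  then show "\<mu> \<in> steklov_pos_eigs a"
    using uu_in_eigenspace[of i] uu_nonzero[of i] SM.lam_pos[of i] unfolding steklov_pos_eigs_def by blast
qed

text \<open>The sequence is grouped into the finite fibers of \<open>SM.lam\<close>, whose sizes are
  the multiplicities; absolute convergence permits the regrouping.\<close>

lemma zeta_a_series_eq:
  assumes s: "Re s > 1"
  shows "zeta_a_series a s = (\<Sum>k. of_real (SM.lam k) powr (- s))"
proof -
  define f where "f k = complex_of_real (SM.lam k) powr (- s)" for k
  define I where "I \<mu> = {i. SM.lam i = \<mu>}" for \<mu>
  have fs: "summable (\<lambda>k. norm (f k))" unfolding f_def by (rule SM.lam_powr_summable[OF s])
  have hs: "(f has_sum suminf f) UNIV"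
    by (rule norm_summable_imp_has_sum[OF fs summable_sums[OF summable_norm_cancel[OF fs]]])
  have bij: "bij_betw snd (SIGMA \<mu>:range SM.lam. I \<mu>) UNIV"
    by (rule bij_betw_byWitness[where f' = "\<lambda>k. (SM.lam k, k)"]) (auto simp: I_def)
  have hsS: "((\<lambda>p. f (snd p)) has_sum suminf f) (SIGMA \<mu>:range SM.lam. I \<mu>)"
    using has_sum_reindex_bij_betw[OF bij, of f "suminf f"] hs by simp
  have "((\<lambda>\<mu>. \<Sum>k\<in>I \<mu>. f k) has_sum suminf f) (range SM.lam)"
  proof (rule has_sum_SigmaD[OF hsS])
    show "((\<lambda>k. f (snd (\<mu>, k))) has_sum (\<Sum>k\<in>I \<mu>. f k)) (I \<mu>)" for \<mu>
      unfolding snd_conv using finite_lam by (intro has_sum_finite) (simp add: I_def)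
  qed
  moreover have "(\<Sum>k\<in>I \<mu>. f k) = of_nat (steklov_mult a \<mu>) * of_real \<mu> powr (- s)" if "\<mu> \<in> range SM.lam" for \<mu>
  proof -
    have "\<mu> > 0" using that SM.lam_pos by auto
    moreover have "(\<Sum>k\<in>I \<mu>. f k) = (\<Sum>k\<in>I \<mu>. of_real \<mu> powr (- s))"
      by (intro sum.cong) (auto simp: I_def f_def)
    ultimately show ?thesis by (simp add: steklov_mult_eq I_def)
  qed
  ultimately have "((\<lambda>\<mu>. of_nat (steklov_mult a \<mu>) * of_real \<mu> powr (- s)) has_sum suminf f) (range SM.lam)"
    by (subst has_sum_cong[where g = "\<lambda>\<mu>. \<Sum>k\<in>I \<mu>. f k"]) auto
  then show ?thesis unfolding zeta_a_series_def steklov_pos_eigs_eq f_def[abs_def] by (rule infsumI)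
qed

end

section \<open>The Riemann part and the analytic continuation\<close>

lemma zeta_R_series_eq:
  assumes s: "Re s > 1"
  shows "2 * zeta_R_series s = (\<Sum>k. of_real (dd k) powr (- s))"
proof -
  define f where "f n = complex_of_nat n powr (- s)" for n
  have nf: "norm (f n) = real n powr (- Re s)" if "n > 0" for n
    using that norm_powr_real_powr[of "complex_of_nat n" "- s"] by (simp add: f_def)
  have fs: "summable (\<lambda>m. norm (f (Suc m)))"
  proof -
    have "summable (\<lambda>m. real (Suc m) powr (- Re s))"
      using s by (subst summable_Suc_iff[of "\<lambda>k. real k powr (- Re s)"]) (simp add: summable_real_powr_iff)
    then show ?thesis by (simp add: nf del: of_nat_Suc)
  qed
  have "bij_betw Suc UNIV {1::nat..}"
    by (rule bij_betw_byWitness[where f' = "\<lambda>n. n - 1"]) auto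
  from infsum_reindex_bij_betw[OF this, of f] have "zeta_R_series s = infsum (\<lambda>m. f (Suc m)) UNIV"
    unfolding zeta_R_series_def f_def[abs_def, symmetric] by simp
  also have "\<dots> = (\<Sum>m. f (Suc m))"
    by (rule infsumI[OF norm_summable_imp_has_sum[OF fs summable_sums[OF summable_norm_cancel[OF fs]]]])
  finally have z: "zeta_R_series s = (\<Sum>m. f (Suc m))" .
  have g: "complex_of_real (dd k) powr (- s) = f (Suc (k div 2))" for k by (simp add: dd_def f_def)
  have part: "(\<Sum>k<2*M. f (Suc (k div 2))) = 2 * (\<Sum>m<M. f (Suc m))" for M
    by (induction M) (simp_all add: algebra_simps)
  have "summable (\<lambda>k. f (Suc (k div 2)))"
    using summable_norm_cancel[OF dd_powr_summable[OF s]] unfolding g .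
  then have "(\<lambda>n. \<Sum>k<n. f (Suc (k div 2))) \<longlonglongrightarrow> (\<Sum>k. f (Suc (k div 2)))" by (rule summable_LIMSEQ)
  then have "(\<lambda>M. \<Sum>k<2*M. f (Suc (k div 2))) \<longlonglongrightarrow> (\<Sum>k. f (Suc (k div 2)))"
    by (rule LIMSEQ_subseq_LIMSEQ[of "\<lambda>n. \<Sum>k<n. f (Suc (k div 2))" _ "\<lambda>M. 2 * M", unfolded o_def]) (simp add: strict_mono_def)
  moreover have "(\<lambda>M. 2 * (\<Sum>m<M. f (Suc m))) \<longlonglongrightarrow> 2 * (\<Sum>m. f (Suc m))"
    by (intro tendsto_mult tendsto_const summable_LIMSEQ summable_norm_cancel[OF fs])
  ultimately show ?thesis unfolding g z part using LIMSEQ_unique by blast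
qed

context steklov_weight
begin

text \<open>Entire functions that agree on the half-plane Re s > 1 are equal, so the description
  determines \<open>SM.zdiff\<close>.\<close>

lemma zeta_diff_eq: "zeta_diff a = SM.zdiff"
  unfolding zeta_diff_def
proof (rule the_equality)
  have eq: "SM.zdiff s = zeta_a_series a s - 2 * zeta_R_series s" if "Re s > 1" for s
    by (simp add: SM.zdiff_eq that zeta_a_series_eq zeta_R_series_eq)
  show "SM.zdiff holomorphic_on UNIV \<and> (\<forall>s. Re s > 1 \<longrightarrow> SM.zdiff s = zeta_a_series a s - 2 * zeta_R_series s)"
    using SM.zdiff_holomorphic eq by blast
  fix f assume f: "f holomorphic_on UNIV \<and> (\<forall>s. Re s > 1 \<longrightarrow> f s = zeta_a_series a s - 2 * zeta_R_series s)"
  show "f = SM.zdiff"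
  proof
    fix z
    show "f z = SM.zdiff z"
    proof (rule analytic_continuation_open[of "{s. Re s > 1}" UNIV f SM.zdiff])
      show "open {s. 1 < Re s}" by (rule open_halfspace_Re_gt)
      show "{s. 1 < Re s} \<noteq> {}" by (auto intro!: exI[of _ 2])
    qed (use f eq SM.zdiff_holomorphic in auto)
  qed
qed

end

section \<open>Conformal equivalence\<close>

text \<open>Cauchy's formula at the center, on the unit circle itself because X is continuous up to
  the boundary.\<close>

lemma disc_mean:
  assumes c: "continuous_on (cball 0 1) X" and h: "X holomorphic_on ball 0 1"
  shows "TH.mn (\<lambda>t. X (TH.E 1 t)) = X 0"
proof -
  have "((\<lambda>u. X u / (u - 0)) has_contour_integral (2 * of_real pi * \<i> * X 0)) (part_circlepath 0 1 0 (2 * pi))"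
    using Cauchy_integral_circlepath[OF c h, of 0] unfolding circlepath_def by simp
  then have "((\<lambda>t. X (0 + 1 * cis t) / (0 + 1 * cis t - 0) * 1 * \<i> * cis t) has_integral (2 * of_real pi * \<i> * X 0)) {0..2 * pi}"
    by (subst (asm) has_contour_integral_part_circlepath_iff) auto
  then have "((\<lambda>t. \<i> * X (cis t)) has_integral (2 * of_real pi * \<i> * X 0)) {0..2 * pi}"
    by (simp add: mult.commute)
  from has_integral_mult_right[OF this, of "- \<i>"]
  have "((\<lambda>t. X (cis t)) has_integral (2 * of_real pi * X 0)) {0..2 * pi}" by (simp add: mult_ac)
  then have "integral {0..2 * pi} (\<lambda>t. X (cis t)) = 2 * of_real pi * X 0" by (rule integral_unique)
  then show ?thesis by (simp add: TH.mn_def TH_ip_eq TH.E_def cis_conv_exp)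
qed

lemma TH_E_power: "TH.E (int n) t = TH.E 1 t ^ n"
  by (simp add: TH.E_def exp_of_nat_mult[symmetric] mult_ac)

lemma norm_TH_E: "TH.E 1 t \<in> cball 0 1" by (simp add: TH.norm_E)

text \<open>X times z^(n+1) vanishes at 0, hence so does its boundary mean: boundary values have no
  negative frequencies.\<close>

lemma disc_coefficients:
  assumes c: "continuous_on (cball 0 1) X" and h: "X holomorphic_on ball 0 1"
  shows "TH.ip (\<lambda>t. X (TH.E 1 t)) (TH.E (int n + 1)) = 0"
proof -
  have "TH.mn (\<lambda>t. (\<lambda>z. X z * z ^ (n + 1)) (TH.E 1 t)) = (\<lambda>z. X z * z ^ (n + 1)) 0"
    by (rule disc_mean) (intro continuous_intros holomorphic_intros c h)+
  moreover have "TH.E (int n + 1) t = TH.E 1 t ^ (n + 1)" for t using TH_E_power[of "n + 1" t] by (simp add: add.commute)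
  ultimately show ?thesis by (simp add: TH.mn_def TH_ip_eq)
qed

section \<open>Moebius transformations of the disk\<close>

lemma moebius_norm_identity:
  "(norm (1 - cnj p * z))\<^sup>2 - (norm (z - p))\<^sup>2 = (1 - (norm p)\<^sup>2) * (1 - (norm z)\<^sup>2)"
  unfolding cmod_power2 by (simp add: power2_eq_square algebra_simps)

lemma moebius_denominator:
  assumes "norm p < 1" "norm z \<le> 1"
  shows "1 - norm p \<le> norm (1 - cnj p * z)" "1 - cnj p * z \<noteq> 0"
proof -
  have "norm (cnj p * z) \<le> norm p" using assms by (simp add: norm_mult mult_left_le)
  then show 1: "1 - norm p \<le> norm (1 - cnj p * z)"
    using norm_triangle_ineq2[of 1 "cnj p * z"] by simp
  then show "1 - cnj p * z \<noteq> 0" using assms(1) by auto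
qed

lemma moebius_norm_le:
  assumes "norm p < 1" "norm z \<le> 1"
  shows "norm ((z - p) / (1 - cnj p * z)) \<le> 1"
proof -
  have "0 \<le> (1 - (norm p)\<^sup>2) * (1 - (norm z)\<^sup>2)" using assms by (simp add: abs_square_le_1)
  then have "(norm (z - p))\<^sup>2 \<le> (norm (1 - cnj p * z))\<^sup>2" unfolding moebius_norm_identity[symmetric] by simp
  then have "norm (z - p) \<le> norm (1 - cnj p * z)" by (rule power2_le_imp_le) simp
  then show ?thesis using moebius_denominator(2)[OF assms] by (simp add: norm_divide divide_le_eq)
qed

lemma moebius_conformal_aut:
  assumes p: "norm p < 1" and k: "norm \<kappa> = 1"
  shows "conformal_aut_disk (\<lambda>z. cnj \<kappa> * ((z - p) / (1 - cnj p * z)))"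
proof -
  define \<Psi> where "\<Psi> z = cnj \<kappa> * ((z - p) / (1 - cnj p * z))" for z
  have kk: "cnj \<kappa> * \<kappa> = 1" using k complex_norm_square[of \<kappa>] by (simp add: mult.commute)
  have p1: "1 - cnj p * p \<noteq> 0" using moebius_denominator(2)[OF p, of p] p by simp
  have im: "\<Psi> z \<in> cball 0 1" if "z \<in> cball 0 1" for z
    using moebius_norm_le[OF p, of z] that k by (simp add: \<Psi>_def norm_mult norm_divide)
  have surj: "\<exists>z\<in>cball 0 1. \<Psi> z = w" if w: "w \<in> cball 0 1" for w
  proof -
    \<comment> \<open>The inverse map: the Moebius transformation with -p, applied after the
      rotation by \<kappa>.\<close>
    define z where "z = (\<kappa> * w - (- p)) / (1 - cnj (- p) * (\<kappa> * w))"
    have kw: "norm (\<kappa> * w) \<le> 1" using w k by (simp add: norm_mult)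
    have d: "1 + cnj p * (\<kappa> * w) \<noteq> 0" using moebius_denominator(2)[of "- p", OF _ kw] p by simp
    have "norm z \<le> 1" unfolding z_def by (rule moebius_norm_le) (use p kw in auto)
    moreover have "z - p = (\<kappa> * w) * (1 - cnj p * p) / (1 + cnj p * (\<kappa> * w))" "1 - cnj p * z = (1 - cnj p * p) / (1 + cnj p * (\<kappa> * w))"
      using d by (auto simp: z_def field_simps)
    then have "\<Psi> z = cnj \<kappa> * (\<kappa> * w)" using p1 d by (simp add: \<Psi>_def)
    then have "\<Psi> z = w" using kk by (metis mult.assoc mult_1)
    ultimately show ?thesis by auto
  qed
  have "\<Psi> ` cball 0 1 = cball 0 1" using im surj by (auto simp: image_iff) metis+
  moreover have "inj_on \<Psi> (cball 0 1)"
  proof (rule inj_onI)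
    fix z w assume z: "z \<in> cball 0 1" and w: "w \<in> cball 0 1" and e: "\<Psi> z = \<Psi> w"
    have "cnj \<kappa> \<noteq> 0" using k by auto
    then have "(z - p) / (1 - cnj p * z) = (w - p) / (1 - cnj p * w)" using e unfolding \<Psi>_def mult_cancel_left by blast
    then have "(z - p) * (1 - cnj p * w) = (w - p) * (1 - cnj p * z)"
      using moebius_denominator(2)[OF p, of z] moebius_denominator(2)[OF p, of w] z w by (simp add: frac_eq_eq)
    then have "(z - w) * (1 - cnj p * p) = 0" by (simp add: algebra_simps)
    then show "z = w" using p1 by simp
  qed
  moreover have "continuous_on (cball 0 1) \<Psi>"
    unfolding \<Psi>_def by (intro continuous_intros) (use moebius_denominator(2)[OF p] in auto)
  moreover have "\<Psi> holomorphic_on ball 0 1"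
    unfolding \<Psi>_def by (intro holomorphic_intros) (use moebius_denominator(2)[OF p] in \<open>auto simp: less_imp_le\<close>)
  ultimately show ?thesis unfolding conformal_aut_disk_def \<Psi>_def by blast
qed

lemma isometry_real:
  fixes g :: "real \<Rightarrow> real"
  assumes "\<And>x y. \<bar>g x - g y\<bar> = \<bar>x - y\<bar>"
  obtains \<epsilon> where "\<epsilon> = 1 \<or> \<epsilon> = - 1" "\<And>t. g t = g 0 + \<epsilon> * t"
proof -
  define \<epsilon> where "\<epsilon> = g 1 - g 0"
  have e: "\<epsilon> = 1 \<or> \<epsilon> = - 1" using assms[of 1 0] by (auto simp: \<epsilon>_def)
  have "g t = g 0 + \<epsilon> * t" for t
    using e
  proof
    assume e: "\<epsilon> = 1"
    then show ?thesis using assms[of t 0] assms[of t 1] by (auto simp: \<epsilon>_def abs_if split: if_splits)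
  next
    assume e: "\<epsilon> = - 1"
    then show ?thesis using assms[of t 0] assms[of t 1] by (auto simp: \<epsilon>_def abs_if split: if_splits)
  qed
  then show thesis using that e by blast
qed

lemma sums_pairs_zero:
  fixes f :: "nat \<Rightarrow> real"
  assumes "f sums S" "S \<le> 0" "\<And>m. 0 \<le> f (2 * m) + f (2 * m + 1)"
  shows "f (2 * m) + f (2 * m + 1) = 0"
proof -
  define P where "P m = f (2 * m) + f (2 * m + 1)" for m
  have "(\<lambda>M. \<Sum>k<2*M. f k) \<longlonglongrightarrow> S"
    using assms(1) unfolding sums_def
    by (rule LIMSEQ_subseq_LIMSEQ[of "\<lambda>n. \<Sum>k<n. f k" _ "\<lambda>M. 2 * M", unfolded o_def]) (simp add: strict_mono_def)
  moreover have "(\<Sum>k<2*M. f k) = (\<Sum>m<M. P m)" for M by (induction M) (auto simp: P_def)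
  ultimately have lim: "(\<lambda>M. \<Sum>m<M. P m) \<longlonglongrightarrow> S" by simp
  have "P m \<le> (\<Sum>m<M. P m)" if "M \<ge> Suc m" for M
    using that assms(3) by (intro member_le_sum) (auto simp: P_def)
  then have "P m \<le> S" by (intro LIMSEQ_le_const[OF lim]) blast
  then show ?thesis using assms(2) assms(3)[of m] by (simp add: P_def)
qed

section \<open>Conformal equivalence to the constant weight and equality of the spectra\<close>

context steklov_weight
begin

lemma phi_0: "phi 0 = 0" by (simp add: phi_def)

lemma phi_inj: "phi x = phi y \<Longrightarrow> x = y"
  using PH.\<Phi>_strict_mono by (metis linorder_neqE_linordered_idom order_less_irrefl)

lemma phi_surj: "\<exists>x. phi x = t"
proof -
  define n where "n = \<lfloor>t / (2 * pi)\<rfloor>"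
  have p: "0 < 2 * pi" by simp
  have "of_int n \<le> t / (2 * pi)" "t / (2 * pi) < of_int n + 1" unfolding n_def by linarith+
  then have n: "of_int n * (2 * pi) \<le> t" "t < (of_int n + 1) * (2 * pi)"
    unfolding pos_le_divide_eq[OF p] pos_divide_less_eq[OF p] by blast+
  have ph: "phi (2 * pi * of_int k) = 2 * pi * of_int k" for k using PH.\<Phi>_per_int[of 0 k] by (simp add: phi_0)
  have "\<exists>x\<ge>2 * pi * of_int n. x \<le> 2 * pi * of_int (n + 1) \<and> phi x = t"
  proof (rule IVT)
    show "phi (2 * pi * of_int n) \<le> t" unfolding ph using n(1) by (simp add: mult.commute)
    show "t \<le> phi (2 * pi * of_int (n + 1))" unfolding ph using n(2) by (simp add: mult.commute)
  qed (use phi_deriv DERIV_isCont in auto)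
  then show ?thesis by blast
qed

text \<open>Without mixed coefficients the defects vanish, and with them the whole
  perturbation.\<close>

lemma mixed_zero_imp_lam:
  assumes "\<And>n m. TH.ip (PH.E (int n + 1)) (TH.E (int m + 1)) = 0"
  shows "SM.lam k = dd k"
proof (rule SM.lam_eq_of_Rm_zero)
  fix k l
  have "norm (La (PH.E (int n + 1)) x - of_nat (n + 1) * bb x * PH.E (int n + 1) x) \<le> 0" for n x
    using La_E_defect[of n 0 x] assms by simp
  then have "norm (defect l x) \<le> 2 * 0" for x by (intro defect_le)
  then have "defect l = (\<lambda>x. 0)" by auto
  then have "complex_of_real (Amat k l - (if k = l then dd k else 0)) = 0"
    unfolding Amat_defect by (simp add: TH.ip_def)
  then show "SM.Rm k l = 0" unfolding of_real_eq_0_iff SM.Rm_def .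
qed

text \<open>If exp (i \<phi>) had no positive \<theta>-frequencies, \<Lambda> would act on its
  conjugate as -i d/d\<theta>, and the energy would be -1, against positivity. This excludes the
  wrong orientation.\<close>

lemma negative_coefficients_impossible:
  assumes "\<And>m. TH.ip (PH.E 1) (TH.E (- (int m + 1))) = 0"
  shows False
proof -
  have z: "TH.ip (PH.E (- 1)) (TH.E (int m + 1)) = 0" for m
    using TH.ip_cnj[of "PH.E 1" "TH.E (- (int m + 1))"] assms[of m] by (simp add: PH.cnj_E TH.cnj_E add.commute)
  have "norm (La (PH.E (- 1)) x + \<i> * (\<i> * of_int (- 1) * bb x * PH.E (- 1) x)) \<le> 16 * 0 * (\<Sum>k. (1 / real (Suc k))\<^sup>2)" for x
    by (rule La_minus_D[OF PH.E_smooth PH.E_deriv]) (simp add: z)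
  then have L: "La (PH.E (- 1)) = (\<lambda>x. (- 1) * (bb x * PH.E (- 1) x))"
    by (auto simp: fun_eq_iff mult.assoc[symmetric] eq_neg_iff_add_eq_0)
  have "TH.ip (La (PH.E (- 1))) (PH.E 1) = - 1"
    unfolding L TH.ip_cmult_left TH_ip_b PH.ip_E by simp
  moreover have "(\<lambda>k. of_real (dd k) * TH.co (PH.E (- 1)) k * TH.co (PH.E 1) k) sums TH.ip (La (PH.E (- 1))) (PH.E 1)"
    by (rule La_form[OF PH.E_smooth PH.E_cont])
  ultimately have "(\<lambda>k. of_real (dd k) * TH.co (PH.E (- 1)) k * TH.co (PH.E 1) k) sums (- 1)" by simp
  from sums_Re[OF this] have s: "(\<lambda>k. Re (of_real (dd k) * TH.co (PH.E (- 1)) k * TH.co (PH.E 1) k)) sums (- 1)" by simp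
  have "TH.co (PH.E (- 1)) k = cnj (TH.co (PH.E 1) k)" for k
    using TH.co_cnj[of "PH.E 1" k] by (simp add: PH.cnj_E)
  then have "0 \<le> Re (of_real (dd k) * TH.co (PH.E (- 1)) k * TH.co (PH.E 1) k)" for k
    by (simp add: mult.assoc less_imp_le mult_nonneg_nonneg)
  from sums_le[OF this sums_zero s] show False by simp
qed

text \<open>Up to an isometry of the line \<psi> is the inverse of \<open>phi\<close>, so exp (i
  times that inverse), or its conjugate, is the boundary value of a holomorphic function. In the
  variable \<phi> the mixed coefficients are then negative frequencies of such boundary
  values.\<close>

lemma conf_equiv_one_imp_mixed_zero:
  assumes "conf_equiv a (\<lambda>_. 1)"
  shows "TH.ip (PH.E (int n + 1)) (TH.E (int m + 1)) = 0"
proof -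
  obtain \<Psi> \<psi> \<psi>' where conf: "conformal_aut_disk \<Psi> \<or> conformal_aut_disk (cnj \<circ> \<Psi>)"
    and bd: "\<And>\<theta>. exp (\<i> * of_real (\<psi> \<theta>)) = \<Psi> (exp (\<i> * of_real \<theta>))"
    and der: "\<And>\<theta>. (\<psi> has_real_derivative \<psi>' \<theta>) (at \<theta>)"
    and one: "\<And>\<theta>. 1 = a (\<psi> \<theta>) / \<bar>\<psi>' \<theta>\<bar>"
    using assms unfolding conf_equiv_def by blast
  have abs: "\<bar>\<psi>' t\<bar> = a (\<psi> t)" for t
  proof -
    have "\<bar>\<psi>' t\<bar> \<noteq> 0" using one[of t] by auto
    then show ?thesis using one[of t] by (simp add: field_simps)
  qed
  \<comment> \<open>The hypothesis says |\<psi>'| = a along \<psi>, and \<open>phi\<close> has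
    derivative 1 / a; so g is an isometry of the line.\<close>
  define g where "g t = phi (\<psi> t)" for t
  have gd: "(g has_real_derivative b (\<psi> t) * \<psi>' t) (at t)" for t
    unfolding g_def[abs_def] by (rule DERIV_chain2[OF phi_deriv der])
  have gd1: "\<bar>b (\<psi> t) * \<psi>' t\<bar> = 1" for t
    using a_pos[of "\<psi> t"] by (simp add: abs_mult abs b_def)
  have iso1: "\<bar>g y - g x\<bar> = \<bar>y - x\<bar>" if xy: "x < y" for x y
  proof -
    obtain z where "g y - g x = (y - x) * (b (\<psi> z) * \<psi>' z)" using MVT2[OF xy, of g "\<lambda>t. b (\<psi> t) * \<psi>' t"] gd by blast
    then show ?thesis using gd1[of z] by (simp add: abs_mult)
  qed
  have "\<bar>g x - g y\<bar> = \<bar>x - y\<bar>" for x y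
    using iso1[of x y] iso1[of y x] by (cases x y rule: linorder_cases) (auto simp: abs_minus_commute)
  then obtain \<epsilon> where eps: "\<epsilon> = 1 \<or> \<epsilon> = - 1" and gt: "\<And>t. g t = g 0 + \<epsilon> * t"
    by (rule isometry_real) blast
  have ee: "\<epsilon> * \<epsilon> = 1" using eps by auto
  \<comment> \<open>The shift that, together with the reflection \<epsilon>, undoes the isometry g
    and makes \<xi> the inverse of \<open>phi\<close>.\<close>
  define t0 where "t0 = - \<epsilon> * g 0"
  define \<xi> where "\<xi> t = \<psi> (t0 + \<epsilon> * t)" for t
  have phichi: "phi (\<xi> t) = t" for t
  proof -
    have "phi (\<xi> t) = g 0 + \<epsilon> * (t0 + \<epsilon> * t)" unfolding \<xi>_def g_def[symmetric] by (rule gt)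
    also have "\<dots> = t" unfolding t0_def using eps by (auto simp: algebra_simps)
    finally show ?thesis .
  qed
  define \<xi>' where "\<xi>' t = \<psi>' (t0 + \<epsilon> * t) * \<epsilon>" for t
  have chid: "(\<xi> has_real_derivative \<xi>' t) (at t)" for t
    unfolding \<xi>_def[abs_def] \<xi>'_def by (rule DERIV_chain2[OF der]) (auto intro!: derivative_eq_intros)
  have phi2pi: "phi (2 * pi) = 2 * pi" using PH.\<Phi>_per[of 0] by (simp add: phi_0)
  have chi0: "\<xi> 0 = 0" and chi2: "\<xi> (2 * pi) = 2 * pi"
    by (rule phi_inj, simp add: phichi phi_0 phi2pi)+
  have chi_range: "\<xi> ` {0..2 * pi} \<subseteq> {0..2 * pi}"
  proof
    fix y assume "y \<in> \<xi> ` {0..2 * pi}"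
    then obtain t where t: "t \<in> {0..2 * pi}" "y = \<xi> t" by blast
    have "\<not> y < 0" "\<not> 2 * pi < y"
      using PH.\<Phi>_strict_mono[of y 0] PH.\<Phi>_strict_mono[of "2 * pi" y] t phichi[of t] phi_0 phi2pi by auto
    then show "y \<in> {0..2 * pi}" by simp
  qed
  \<comment> \<open>The conformal and the anticonformal case are merged: K is holomorphic, and the
    sign \<sigma> records the conjugation.\<close>
  obtain K \<sigma> where K: "conformal_aut_disk K" "\<sigma> = 1 \<or> \<sigma> = (- 1 :: int)"
    "\<And>\<theta>. K (exp (\<i> * of_real \<theta>)) = exp (\<i> * of_int \<sigma> * of_real (\<psi> \<theta>))"
  proof -
    from conf show thesis
    proof
      assume "conformal_aut_disk \<Psi>"
      then show thesis by (rule that[of \<Psi> 1]) (auto simp: bd)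
    next
      assume "conformal_aut_disk (cnj \<circ> \<Psi>)"
      then show thesis by (rule that[of "cnj \<circ> \<Psi>" "- 1"]) (auto simp: bd[symmetric] exp_cnj)
    qed
  qed
  have Kc: "continuous_on (cball 0 1) K" and Kh: "K holomorphic_on ball 0 1"
    using K(1) by (auto simp: conformal_aut_disk_def)
  define w0 where "w0 = exp (\<i> * of_real t0)"
  have w0: "norm w0 = 1" by (simp add: w0_def)
  define K2 where "K2 z = K (w0 * z)" for z
  have K2c: "continuous_on (cball 0 1) K2"
    unfolding K2_def by (rule continuous_on_compose2[OF Kc]) (auto intro!: continuous_intros simp: norm_mult w0)
  have K2h: "K2 holomorphic_on ball 0 1"
  proof -
    have "(\<lambda>z. w0 * z) ` ball 0 1 \<subseteq> ball 0 1" by (auto simp: norm_mult w0)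
    then have "K \<circ> (\<lambda>z. w0 * z) holomorphic_on ball 0 1"
      by (intro holomorphic_on_compose_gen[OF _ Kh] holomorphic_intros)
    then show ?thesis by (simp add: o_def K2_def[abs_def])
  qed
  \<comment> \<open>A reflection of the parameter is matched by conjugating before and after, which
    preserves holomorphy and flips the sign.\<close>
  obtain X \<sigma>' where X: "continuous_on (cball 0 1) X" "X holomorphic_on ball 0 1" "\<sigma>' = 1 \<or> \<sigma>' = (- 1 :: int)"
    "\<And>t. X (TH.E 1 t) = exp (\<i> * of_int \<sigma>' * of_real (\<xi> t))"
  proof -
    from eps show thesis
    proof
      assume e: "\<epsilon> = 1"
      have "K2 (TH.E 1 t) = exp (\<i> * of_int \<sigma> * of_real (\<xi> t))" for t
        using K(3)[of "t0 + t"] by (simp add: K2_def w0_def TH.E_def \<xi>_def e exp_add[symmetric] algebra_simps)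
      then show thesis by (rule that[OF K2c K2h K(2)])
    next
      assume e: "\<epsilon> = - 1"
      have "(cnj \<circ> K2 \<circ> cnj) (TH.E 1 t) = exp (\<i> * of_int (- \<sigma>) * of_real (\<xi> t))" for t
      proof -
        have "cnj (TH.E 1 t) = exp (\<i> * of_real (- t))" by (simp add: TH.E_def exp_cnj)
        then have "K2 (cnj (TH.E 1 t)) = K (exp (\<i> * of_real (t0 - t)))"
          by (simp add: K2_def w0_def exp_add[symmetric] algebra_simps)
        also have "\<dots> = exp (\<i> * of_int \<sigma> * of_real (\<xi> t))" unfolding K(3) \<xi>_def e by simp
        finally show ?thesis by (simp add: exp_cnj)
      qed
      moreover have "continuous_on (cball 0 1) (cnj \<circ> K2 \<circ> cnj)"
        by (intro continuous_on_compose continuous_intros continuous_on_subset[OF K2c]) auto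
      moreover have "cnj \<circ> K2 \<circ> cnj holomorphic_on ball 0 1"
      proof (rule holomorphic_on_compose_cnj_cnj)
        have "cnj ` ball 0 1 = ball 0 1" 
        proof (rule equalityI; rule subsetI)
          fix z :: complex assume "z \<in> ball 0 1"
          then show "z \<in> cnj ` ball 0 1" by (intro image_eqI[of _ _ "cnj z"]) auto
        qed auto
        then show "K2 holomorphic_on cnj ` ball 0 1" using K2h by simp
      qed auto
      ultimately show thesis using that[of "cnj \<circ> K2 \<circ> cnj" "- \<sigma>"] K(2) by auto
    qed
  qed
  \<comment> \<open>The substitution \<theta> = \<xi> t turns the coefficient into an integral of
    exp (i N t) against the derivative of \<open>ek\<close>. By parts it reduces to that of exp (i N
    t) \<open>ek t\<close>, which is 0 because \<open>ek\<close> extends holomorphically.\<close>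
  have zero: "TH.ip (PH.E (int n + 1)) (TH.E (\<sigma>' * (int m + 1))) = 0" for n m
  proof -
    define k where "k = \<sigma>' * (int m + 1)"
    have k0: "k \<noteq> 0" using X(3) by (auto simp: k_def)
    define ek where "ek t = exp (\<i> * of_int k * of_real (\<xi> t))" for t
    have ekX: "ek t = (\<lambda>z. X z ^ (m + 1)) (TH.E 1 t)" for t
      by (simp add: ek_def X(4) k_def exp_of_nat_mult[symmetric] algebra_simps del: power_Suc)
    have ekd: "(ek has_vector_derivative \<i> * of_int k * of_real (\<xi>' t) * ek t) (at t)" for t
    proof -
      have "(\<xi> has_vector_derivative \<xi>' t) (at t)" using chid[of t] by (simp add: has_real_derivative_iff_has_vector_derivative)
      from has_vector_derivative_mult_right[OF bounded_linear.has_vector_derivative[OF bounded_linear_of_real this], of "\<i> * of_int k"]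
      have "((\<lambda>t. \<i> * of_int k * complex_of_real (\<xi> t)) has_vector_derivative \<i> * of_int k * of_real (\<xi>' t)) (at t)" .
      from field_vector_diff_chain_at[OF this DERIV_exp] show ?thesis by (simp add: o_def ek_def[abs_def])
    qed
    define N where "N = int n + 1"
    have 1: "((\<lambda>t. TH.E N t * (\<i> * of_int k * of_real (\<xi>' t) * ek t) + (\<i> * of_int N * of_real 1 * TH.E N t) * ek t) has_integral
        (TH.E N (2 * pi) * ek (2 * pi) - TH.E N 0 * ek 0)) {0..2 * pi}"
      by (rule fundamental_theorem_of_calculus, simp, rule has_vector_derivative_at_within, rule has_vector_derivative_mult[OF TH.E_deriv ekd])
    have ends: "TH.E N (2 * pi) = 1" "TH.E N 0 = 1" "ek (2 * pi) = 1" "ek 0 = 1"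
    proof -
      have e: "exp (\<i> * of_int j * complex_of_real (2 * pi)) = 1" for j
        using exp_integer_2pi[of "of_int j"] by (simp add: mult_ac)
      show "TH.E N (2 * pi) = 1" "TH.E N 0 = 1" "ek (2 * pi) = 1" "ek 0 = 1"
        unfolding TH.E_def ek_def chi0 chi2 e by simp_all
    qed
    have "TH.ip ek (TH.E N) = 0"
      unfolding ekX[abs_def] N_def by (rule disc_coefficients) (intro continuous_intros holomorphic_intros X)+
    moreover have ekc: "continuous_on {0..2 * pi} ek"
      using ekd by (meson continuous_at_imp_continuous_on has_vector_derivative_continuous)
    then have "(\<lambda>t. ek t * TH.E N t) integrable_on {0..2 * pi}"
      by (intro integrable_continuous_interval continuous_on_mult TH.E_cont)
    ultimately have "((\<lambda>t. ek t * TH.E N t) has_integral 0) {0..2 * pi}"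
      by (simp add: TH_ip_eq has_integral_iff)
    moreover have "(\<lambda>t. (\<i> * of_int N * of_real 1 * TH.E N t) * ek t) = (\<lambda>t. \<i> * of_int N * (ek t * TH.E N t))"
      by (rule ext) (simp add: mult_ac)
    ultimately have 2: "((\<lambda>t. (\<i> * of_int N * of_real 1 * TH.E N t) * ek t) has_integral 0) {0..2 * pi}"
      using has_integral_mult_right[of "\<lambda>t. ek t * TH.E N t" 0 _ "\<i> * of_int N"] unfolding mult_zero_right by metis
    from has_integral_diff[OF 1 2] have 3: "((\<lambda>t. TH.E N t * (\<i> * of_int k * of_real (\<xi>' t) * ek t)) has_integral 0) {0..2 * pi}"
      by (simp add: ends)
    have 4: "((\<lambda>t. \<xi>' t *\<^sub>R (PH.E N (\<xi> t) * TH.E k (\<xi> t))) has_integral integral {\<xi> 0..\<xi> (2 * pi)} (\<lambda>\<theta>. PH.E N \<theta> * TH.E k \<theta>)) {0..2 * pi}"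
      by (rule has_integral_substitution[where c = 0 and d = "2 * pi" and f = "\<lambda>\<theta>. PH.E N \<theta> * TH.E k \<theta>"])
        (use chi_range in \<open>auto simp: chi0 chi2 intro!: continuous_on_mult PH.E_cont TH.E_cont has_field_derivative_at_within chid\<close>)
    have "PH.E N (\<xi> t) = TH.E N t" "TH.E k (\<xi> t) = ek t" for t by (auto simp: PH.E_def TH.E_def phichi ek_def)
    then have "((\<lambda>t. of_real (\<xi>' t) * (TH.E N t * ek t)) has_integral integral {0..2 * pi} (\<lambda>\<theta>. PH.E N \<theta> * TH.E k \<theta>)) {0..2 * pi}"
      using 4 by (simp add: chi0 chi2 scaleR_conv_of_real)
    note has_integral_mult_right[OF this, of "\<i> * of_int k"]
    moreover have "(\<lambda>t. TH.E N t * (\<i> * of_int k * of_real (\<xi>' t) * ek t)) = (\<lambda>t. \<i> * of_int k * (of_real (\<xi>' t) * (TH.E N t * ek t)))"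
      by (rule ext) (simp add: mult_ac)
    ultimately have "((\<lambda>t. TH.E N t * (\<i> * of_int k * of_real (\<xi>' t) * ek t)) has_integral \<i> * of_int k * integral {0..2 * pi} (\<lambda>\<theta>. PH.E N \<theta> * TH.E k \<theta>)) {0..2 * pi}"
      by (simp only:)
    then have "\<i> * of_int k * integral {0..2 * pi} (\<lambda>\<theta>. PH.E N \<theta> * TH.E k \<theta>) = 0" using 3 has_integral_unique by blast
    then show ?thesis unfolding TH_ip_eq N_def[symmetric] k_def[symmetric] using k0 by simp
  qed
  show ?thesis
  proof (cases "\<sigma>' = 1")
    case True
    then show ?thesis using zero[of n m] by simp
  next
    case False
    then have "\<sigma>' = - 1" using X(3) by simp
    then have "TH.ip (PH.E 1) (TH.E (- (int m + 1))) = 0" for m using zero[of 0 m] by simp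
    then have False by (rule negative_coefficients_impossible)
    then show ?thesis ..
  qed
qed

text \<open>Energy against area: \<open>eb 0\<close> and \<open>eb 1\<close> have energy at most 1
  each, and the area term is fixed. Equality between energy and area amounts to Cauchy--Riemann
  relations for the coefficients, which remove the negative frequencies of exp (i \<phi>).\<close>

lemma lam_one_imp_nonnegative_spectrum:
  assumes "SM.lam 0 = 1"
  shows "TH.ip (PH.E 1) (TH.E (int m + 1)) = 0"
proof -
  define \<alpha> where "\<alpha> j = Re (TH.co (PH.eb 0) j)" for j
  define \<beta> where "\<beta> j = Re (TH.co (PH.eb 1) j)" for j
  have al: "TH.co (PH.eb 0) j = of_real (\<alpha> j)" and be: "TH.co (PH.eb 1) j = of_real (\<beta> j)" for j
    unfolding \<alpha>_def \<beta>_def by (rule TH_co_real)+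
  have A0: "(\<lambda>j. dd j * \<alpha> j * \<alpha> j) sums Amat 0 0" and A1: "(\<lambda>j. dd j * \<beta> j * \<beta> j) sums Amat 1 1"
    unfolding \<alpha>_def \<beta>_def by (rule Amat_sums)+
  have AA: "Amat 0 0 \<le> 1" "Amat 1 1 \<le> 1" using SM.A_diag_le by (simp_all add: assms)
  \<comment> \<open>Coefficients of the derivative of \<open>eb 0\<close>. Paired with
    \<open>eb 1\<close> they give -1, the normalized signed area of the circle traced by the two
    functions.\<close>
  define \<gamma> where "\<gamma> j = sg j * dd j * \<alpha> (partner j)" for j
  have "TH.ser (TH.dcoef (TH.co (PH.eb 0))) x = (- 1) * (bb x * PH.eb 1 x)" for x
    using vector_derivative_unique_at[OF smooth_deriv[OF eb_smooth, of 0 x] PH.eb_deriv[of 0 x]]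
    by (simp add: sg_def dd_def partner_def)
  then have D: "TH.ser (TH.dcoef (TH.co (PH.eb 0))) = (\<lambda>x. (- 1) * (bb x * PH.eb 1 x))" by (rule ext)
  have "TH.ip (PH.eb 1) (TH.ser (TH.dcoef (TH.co (PH.eb 0)))) = - PH.ip (PH.eb 1) (PH.eb 1)"
    unfolding TH.ip_commute[of "PH.eb 1"] D TH.ip_cmult_left TH_ip_b by simp
  then have "TH.ip (PH.eb 1) (TH.ser (TH.dcoef (TH.co (PH.eb 0)))) = - 1"
    using PH.co_eb[of 1 1] by (simp add: PH.co_def)
  then have "(\<lambda>k. TH.dcoef (TH.co (PH.eb 0)) k * TH.co (PH.eb 1) k) sums (- 1)"
    using TH.ip_ser[OF eb_cont TH.rapid_dcoef[OF TH.co_rapid[OF eb_smooth]], of 0 1] by simp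
  then have "(\<lambda>k. complex_of_real (\<gamma> k * \<beta> k)) sums of_real (- 1)"
    unfolding TH.dcoef_def al be \<gamma>_def by simp
  then have G: "(\<lambda>k. \<gamma> k * \<beta> k) sums (- 1)" unfolding sums_of_real_iff .
  \<comment> \<open>Energies plus twice the area term: the total is at most 0, while each pair of
    terms is a sum of squares.\<close>
  define f where "f j = dd j * \<alpha> j * \<alpha> j + dd j * \<beta> j * \<beta> j + 2 * (\<gamma> j * \<beta> j)" for j
  have fs: "f sums (Amat 0 0 + Amat 1 1 + 2 * (- 1))" unfolding f_def by (intro sums_add sums_mult A0 A1 G)
  have pair: "f (2 * m) + f (2 * m + 1) = real (Suc m) * ((\<alpha> (2 * m) - \<beta> (2 * m + 1))\<^sup>2 + (\<beta> (2 * m) + \<alpha> (2 * m + 1))\<^sup>2)" for m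
    by (simp add: f_def \<gamma>_def sg_def dd_def partner_def power2_eq_square algebra_simps)
  have "f (2 * m) + f (2 * m + 1) = 0"
    by (rule sums_pairs_zero[OF fs]) (use AA pair in auto)
  then have "(\<alpha> (2 * m) - \<beta> (2 * m + 1))\<^sup>2 + (\<beta> (2 * m) + \<alpha> (2 * m + 1))\<^sup>2 = 0" unfolding pair by simp
  then have e: "\<alpha> (2 * m) = \<beta> (2 * m + 1)" "\<beta> (2 * m) = - \<alpha> (2 * m + 1)" by (auto simp: sum_power2_eq_zero_iff)
  have s: "complex_of_real (sqrt 2) * complex_of_real (sqrt 2) = 2" by (metis of_real_mult of_real_numeral real_sqrt_mult_self abs_numeral)
  have E1: "PH.E 1 = (\<lambda>x. (1 / sqrt 2) * PH.eb 0 x + (\<i> / sqrt 2) * PH.eb 1 x)"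
    using s by (auto simp: fun_eq_iff PH.eb_E field_simps)
  have c: "continuous_on UNIV (\<lambda>x. (1 / sqrt 2) * PH.eb 0 x)" "continuous_on UNIV (\<lambda>x. (\<i> / sqrt 2) * PH.eb 1 x)"
    by (intro continuous_intros eb_cont)+
  have co1: "TH.co (PH.E 1) k = (of_real (\<alpha> k) + \<i> * of_real (\<beta> k)) / sqrt 2" for k
    unfolding E1 TH.co_lincomb(1)[OF c] TH.co_lincomb(3)[OF eb_cont eb_cont] al be by (simp add: add_divide_distrib)
  have "TH.co (PH.E 1) (2 * m) + \<i> * TH.co (PH.E 1) (2 * m + 1) = 0"
    unfolding co1 e by (simp add: field_simps)
  moreover have "TH.co (PH.E 1) (2 * m) + \<i> * TH.co (PH.E 1) (2 * m + 1) = sqrt 2 * TH.ip (PH.E 1) (TH.E (int m + 1))"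
    unfolding TH.co_def TH.ip_E_eb[OF PH.E_cont] using s by (simp add: field_simps)
  ultimately show ?thesis by simp
qed

text \<open>Change of variables t = \<open>phi x\<close>, with dt = b dx.\<close>

lemma PH_mn_subst:
  assumes "continuous_on (sphere 0 1) h"
  shows "PH.mn (\<lambda>x. h (PH.E 1 x)) = TH.mn (\<lambda>t. h (TH.E 1 t))"
proof -
  have phi2pi: "phi (2 * pi) = 2 * pi" using PH.\<Phi>_per[of 0] by (simp add: phi_0)
  have "((\<lambda>x. b x *\<^sub>R h (TH.E 1 (phi x))) has_integral integral {phi 0..phi (2 * pi)} (\<lambda>t. h (TH.E 1 t))) {0..2 * pi}"
  proof (rule has_integral_substitution[where c = 0 and d = "2 * pi"])
    show "phi ` {0..2 * pi} \<subseteq> {0..2 * pi}"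
    proof
      fix y assume "y \<in> phi ` {0..2 * pi}"
      then obtain x where x: "0 \<le> x" "x \<le> 2 * pi" "y = phi x" by auto
      have "phi 0 \<le> phi x" "phi x \<le> phi (2 * pi)"
        using PH.\<Phi>_strict_mono[of 0 x] PH.\<Phi>_strict_mono[of x "2 * pi"] x by (metis less_eq_real_def)+
      then show "y \<in> {0..2 * pi}" using x by (simp add: phi_0 phi2pi)
    qed
    show "continuous_on {0..2 * pi} (\<lambda>t. h (TH.E 1 t))"
      by (rule continuous_on_compose2[OF assms TH.E_cont]) (auto simp: TH.norm_E)
  qed (auto simp: phi_0 phi2pi intro!: has_field_derivative_at_within phi_deriv)
  then have "integral {0..2 * pi} (\<lambda>x. bb x * h (TH.E 1 (phi x))) = integral {0..2 * pi} (\<lambda>t. h (TH.E 1 t))"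
    by (simp add: phi_0 phi2pi has_integral_iff scaleR_conv_of_real)
  then show ?thesis by (simp add: PH.mn_def TH.mn_def PH.ip_def TH_ip_eq PH.E_def TH.E_def mult_ac)
qed

text \<open>The Fourier series is a power series in exp (i \<theta>), and its rapidly decreasing
  coefficients make it converge uniformly on the closed disk.\<close>

lemma nonnegative_spectrum_extension:
  assumes H: "\<And>m. TH.ip (PH.E 1) (TH.E (int m + 1)) = 0"
  obtains F where "continuous_on (cball 0 1) F" "F holomorphic_on ball 0 1"
    "\<And>x. F (TH.E 1 x) = PH.E 1 x" "F 0 = TH.mn (PH.E 1)" "norm (TH.mn (PH.E 1)) < 1"
proof -
  define u where "u = PH.E 1"
  have us: "smooth_circle u" unfolding u_def by (rule PH.E_smooth)
  have uc: "continuous_on UNIV u" by (rule smooth_circle_continuous[OF us])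
  define c where "c = TH.co u"
  define p where "p = TH.mn u"
  \<comment> \<open>When c (2 m + 1) = i c (2 m), the pair of cosine and sine terms is a single
    power of exp (i \<theta>) with this coefficient.\<close>
  define q where "q m = sqrt 2 * c (2 * m)" for m
  have s: "complex_of_real (sqrt 2) * complex_of_real (sqrt 2) = 2" by (metis of_real_mult of_real_numeral real_sqrt_mult_self abs_numeral)
  have c1: "c (2 * m + 1) = \<i> * c (2 * m)" for m
  proof -
    have "c (2 * m) + \<i> * c (2 * m + 1) = sqrt 2 * TH.ip u (TH.E (int m + 1))"
      unfolding c_def TH.co_def TH.ip_E_eb[OF uc] using s by (simp add: field_simps)
    then have "c (2 * m) + \<i> * c (2 * m + 1) = 0" using H by (simp add: u_def)
    then have "\<i> * (c (2 * m) + \<i> * c (2 * m + 1)) = 0" by simp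
    then show ?thesis by (simp add: distrib_left)
  qed
  have cr: "rapid c" unfolding c_def by (rule TH.co_rapid[OF us])
  obtain C where C: "C \<ge> 0" "\<And>k. norm (c k) \<le> C / real (Suc k) ^ 2" using rapidD[OF cr] by metis
  have qb: "norm (q m) \<le> 2 * C * (1 / real (Suc m))\<^sup>2" for m
  proof -
    have "norm (q m) = sqrt 2 * norm (c (2 * m))" by (simp add: q_def norm_mult)
    also have "\<dots> \<le> 2 * (C / real (Suc (2 * m)) ^ 2)" by (rule mult_mono[OF _ C(2)]) (auto simp: real_le_lsqrt)
    also have "\<dots> \<le> 2 * (C / real (Suc m) ^ 2)"
      using C(1) by (intro mult_left_mono divide_left_mono power_mono) auto
    finally show ?thesis by (simp add: power_divide)
  qed
  define F where "F z = p + (\<Sum>m. q m * z ^ (m + 1))" for z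
  define FN where "FN n z = p + (\<Sum>m<n. q m * z ^ (m + 1))" for n z
  have ul: "uniform_limit (cball 0 1) FN F sequentially"
    unfolding F_def[abs_def] FN_def[abs_def]
  proof (intro uniform_limit_intros Weierstrass_m_test[OF _ summable_mult[OF summable_inverse_squares, of "2 * C"]])
    fix m and z :: complex assume "z \<in> cball 0 1"
    then have "norm z ^ (m + 1) \<le> 1" by (intro power_le_one) auto
    then have "norm (q m) * norm z ^ (m + 1) \<le> norm (q m) * 1" by (intro mult_left_mono) auto
    then show "norm (q m * z ^ (m + 1)) \<le> 2 * C * (1 / real (Suc m))\<^sup>2"
      using qb[of m] by (simp add: norm_mult norm_power)
  qed
  have Fc: "continuous_on (cball 0 1) F"
    by (rule uniform_limit_theorem[OF _ ul]) (auto simp: FN_def[abs_def] intro!: always_eventually continuous_intros)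
  have Fh: "F holomorphic_on ball 0 1"
  proof (rule holomorphic_uniform_sequence[of _ FN])
    show "FN n holomorphic_on ball 0 1" for n unfolding FN_def[abs_def] by (intro holomorphic_intros)
    fix z :: complex assume z: "z \<in> ball 0 1"
    then obtain d where d: "d > 0" "cball z d \<subseteq> ball 0 1" using open_contains_cball[of "ball (0::complex) 1"] by (metis open_ball)
    then show "\<exists>d>0. cball z d \<subseteq> ball 0 1 \<and> uniform_limit (cball z d) FN F sequentially"
      using uniform_limit_on_subset[OF ul, of "cball z d"] ball_subset_cball by (intro exI[of _ d]) blast
  qed auto
  have sc: "summable (\<lambda>k. c k * TH.eb k x)" for x
    by (rule summable_norm_cancel[OF TH.ser_summable[OF cr]])
  have FE: "F (TH.E 1 x) = PH.E 1 x" for x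
  proof -
    have part: "(\<Sum>k<2*M. c k * TH.eb k x) = (\<Sum>m<M. q m * TH.E 1 x ^ (m + 1))" for M
    proof (induction M)
      case (Suc M)
      have "c (2 * M) * TH.eb (2 * M) x + c (2 * M + 1) * TH.eb (2 * M + 1) x = q M * TH.E (int (M + 1)) x"
        unfolding c1 TH.eb_E q_def using s by (simp add: field_simps)
      then show ?case using Suc unfolding TH_E_power by (simp add: add.assoc)
    qed simp
    have "(\<lambda>n. \<Sum>k<n. c k * TH.eb k x) \<longlonglongrightarrow> TH.ser c x" unfolding TH.ser_def by (rule summable_LIMSEQ[OF sc])
    then have "(\<lambda>M. \<Sum>k<2*M. c k * TH.eb k x) \<longlonglongrightarrow> TH.ser c x"
      by (rule LIMSEQ_subseq_LIMSEQ[of "\<lambda>n. \<Sum>k<n. c k * TH.eb k x" _ "\<lambda>M. 2 * M", unfolded o_def]) (simp add: strict_mono_def)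
    then have "(\<lambda>M. p + (\<Sum>m<M. q m * TH.E 1 x ^ (m + 1))) \<longlonglongrightarrow> p + TH.ser c x" unfolding part by (intro tendsto_intros)
    moreover have "(\<lambda>M. FN M (TH.E 1 x)) \<longlonglongrightarrow> F (TH.E 1 x)" by (rule tendsto_uniform_limitI[OF ul norm_TH_E])
    ultimately have "F (TH.E 1 x) = p + TH.ser c x" unfolding FN_def using LIMSEQ_unique by blast
    then show ?thesis using TH.fourier_expansion[OF us, of x] by (simp add: u_def p_def c_def)
  qed
  have pars: "(\<lambda>k. c k * cnj (c k)) sums (1 - p * cnj p)"
  proof -
    have uu1: "u x * cnj (u x) = 1" for x
      using complex_norm_square[of "u x"] by (simp add: u_def PH.norm_E)
    have "TH.ip u (\<lambda>x. cnj (u x)) = 1" unfolding TH_ip_eq uu1 by (simp add: scaleR_conv_of_real)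
    moreover have "TH.mn (\<lambda>x. cnj (u x)) = cnj p" using TH.ip_cnj[of u "\<lambda>_. 1"] by (simp add: p_def TH.mn_def)
    moreover have "(\<lambda>k. TH.co u k * TH.co (\<lambda>x. cnj (u x)) k) sums (TH.ip u (\<lambda>x. cnj (u x)) - TH.mn u * TH.mn (\<lambda>x. cnj (u x)))"
      by (rule TH.parseval[OF us]) (intro continuous_intros uc)
    ultimately show ?thesis by (simp add: TH.co_cnj c_def p_def)
  qed
  \<comment> \<open>Otherwise Parseval leaves no coefficients besides the mean, and exp (i \<phi>)
    would be constant.\<close>
  have "norm p < 1"
  proof (rule ccontr)
    assume np: "\<not> norm p < 1"
    have cc: "z * cnj z = of_real ((norm z)\<^sup>2)" for z using complex_norm_square[of z] by simp
    have "(\<lambda>k. complex_of_real ((norm (c k))\<^sup>2)) sums of_real (1 - (norm p)\<^sup>2)"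
      using pars unfolding cc by simp
    then have ps: "(\<lambda>k. (norm (c k))\<^sup>2) sums (1 - (norm p)\<^sup>2)" unfolding sums_of_real_iff .
    have "1 \<le> (norm p)\<^sup>2" using np by (simp add: one_le_power)
    then have "suminf (\<lambda>k. (norm (c k))\<^sup>2) \<le> 0" using ps by (simp add: sums_iff)
    moreover have "0 \<le> suminf (\<lambda>k. (norm (c k))\<^sup>2)" by (intro suminf_nonneg sums_summable[OF ps]) auto
    ultimately have "suminf (\<lambda>k. (norm (c k))\<^sup>2) = 0" by simp
    then have "(norm (c k))\<^sup>2 = 0" for k using suminf_eq_zero_iff[OF sums_summable[OF ps]] by simp
    then have "c k = 0" for k by simp
    then have "u = (\<lambda>x. p)" using TH.fourier_expansion[OF us] by (auto simp: c_def[symmetric] p_def TH.ser_def)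
    then have "(u has_vector_derivative 0) (at 0)" by simp
    from vector_derivative_unique_at[OF this PH.E_deriv[of 1 0, folded u_def]]
    show False using b_pos[of 0] PH.norm_E[of 1 0] by (auto simp: u_def)
  qed
  then show thesis using that[OF Fc Fh FE] by (simp add: F_def p_def u_def)
qed

text \<open>The energy of the normalized function can be computed exactly: its angular speed
  relative to \<phi> is the Poisson kernel of p, whose mean is 1.\<close>

lemma moebius_of_extension:
  assumes F: "continuous_on (cball 0 1) F" "F holomorphic_on ball 0 1"
    "\<And>x. F (TH.E 1 x) = PH.E 1 x" "F 0 = p" "norm p < 1"
  obtains \<kappa> where "norm \<kappa> = 1" "\<And>x. (PH.E 1 x - p) / (1 - cnj p * PH.E 1 x) = \<kappa> * TH.E 1 x"
proof -
  define u where "u = PH.E 1"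
  have nu: "norm (u x) = 1" for x by (simp add: u_def PH.norm_E)
  have us: "smooth_circle u" unfolding u_def by (rule PH.E_smooth)
  have Fle: "norm (F z) \<le> 1" if z: "z \<in> cball 0 1" for z
  proof (rule maximum_modulus_frontier[of F "cball 0 1"])
    show "norm (F w) \<le> 1" if "w \<in> frontier (cball 0 1)" for w
    proof -
      have "w \<in> TH.E 1 ` {0..2 * pi}" using that by (simp add: TH.E_one_surj)
      then show ?thesis using F(3) PH.norm_E by auto
    qed
  qed (use F z in auto)
  define X where "X z = (F z - p) / (1 - cnj p * F z)" for z
  have Xc: "continuous_on (cball 0 1) X"
    unfolding X_def by (intro continuous_intros F) (use moebius_denominator(2)[OF F(5)] Fle in auto)
  have Xh: "X holomorphic_on ball 0 1"
    unfolding X_def by (intro holomorphic_intros F) (use moebius_denominator(2)[OF F(5)] Fle in \<open>auto simp: less_imp_le\<close>)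
  define G where "G x = (u x - p) * inverse (1 - cnj p * u x)" for x
  have GX: "G x = X (TH.E 1 x)" for x by (simp add: G_def X_def F(3) u_def divide_inverse)
  have dn: "1 - norm p \<le> norm (1 - cnj p * u x)" "1 - cnj p * u x \<noteq> 0" for x
    using moebius_denominator[OF F(5), of "u x"] by (auto simp: nu)
  have Gs: "smooth_circle G" unfolding G_def
    by (intro smooth_circle_mult smooth_circle_diff smooth_circle_const us
        smooth_circle_inverse[of _ "1 - norm p"] smooth_circle_cmult) (use dn F(5) in auto)
  have Gc: "continuous_on UNIV G" by (rule smooth_circle_continuous[OF Gs])
  have mG: "TH.mn G = 0" using disc_mean[OF Xc Xh] unfolding GX[symmetric] by (simp add: X_def F(4))
  have zG: "TH.ip G (TH.E (int m + 1)) = 0" for m using disc_coefficients[OF Xc Xh, of m] unfolding GX[symmetric] .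
  have uu1: "u x * cnj (u x) = 1" for x using complex_norm_square[of "u x"] by (simp add: nu)
  have u0: "u x \<noteq> 0" for x using nu[of x] by auto
  have cu: "cnj (u x) = inverse (u x)" for x using uu1[of x] u0[of x] by (simp add: field_simps)
  have up: "u x - p \<noteq> 0" for x using nu[of x] F(5) by auto
  have cG: "cnj (G x) = (1 - cnj p * u x) / (u x - p)" for x
    using u0[of x] up[of x] dn(2)[of x] by (simp add: G_def cu field_simps)
  have GG: "G x * cnj (G x) = 1" for x
    unfolding cG using up[of x] dn(2)[of x] by (simp add: G_def)
  \<comment> \<open>On the unit circle h + conj h - 1 is the Poisson kernel of p; the mean of h is h
    0 = 1 by \<open>disc_mean\<close>.\<close>
  define h where "h z = 1 / (1 - cnj p * z)" for z
  have hc: "continuous_on (cball 0 1) h" and hh: "h holomorphic_on ball 0 1"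
    unfolding h_def by (intro continuous_intros holomorphic_intros; use moebius_denominator(2)[OF F(5)] in \<open>auto simp: less_imp_le\<close>)+
  have mh: "PH.mn (\<lambda>x. h (u x)) = 1"
    using PH_mn_subst[OF continuous_on_subset[OF hc]] disc_mean[OF hc hh] by (auto simp: u_def h_def)
  define G' where "G' x = \<i> * (bb x * ((h (u x) + cnj (h (u x)) - 1) * G x))" for x
  have Gd: "(G has_vector_derivative G' x) (at x)" for x
  proof -
    have ud: "(u has_vector_derivative \<i> * of_int 1 * bb x * u x) (at x)" unfolding u_def by (rule PH.E_deriv)
    have "((\<lambda>w. (w - p) / (1 - cnj p * w)) has_field_derivative
        ((1 - cnj p * u x) + (u x - p) * cnj p) / ((1 - cnj p * u x) * (1 - cnj p * u x))) (at (u x))"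
      using dn(2)[of x] by (auto intro!: derivative_eq_intros)
    from field_vector_diff_chain_at[OF ud this]
    have "(G has_vector_derivative \<i> * of_int 1 * bb x * u x * (((1 - cnj p * u x) + (u x - p) * cnj p) / ((1 - cnj p * u x) * (1 - cnj p * u x)))) (at x)"
      by (simp add: o_def G_def[abs_def] divide_inverse)
    moreover have "cnj (h (u x)) - 1 = p / (u x - p)"
      using u0[of x] up[of x] by (simp add: h_def cu field_simps)
    then have hh1: "h (u x) + cnj (h (u x)) - 1 = 1 / (1 - cnj p * u x) + p / (u x - p)" by (simp add: h_def algebra_simps)
    have "\<i> * of_int 1 * bb x * u x * (((1 - cnj p * u x) + (u x - p) * cnj p) / ((1 - cnj p * u x) * (1 - cnj p * u x))) = G' x"
      unfolding G'_def hh1 G_def using up[of x] dn(2)[of x] by (simp add: divide_simps) (simp add: algebra_simps)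
    ultimately show ?thesis by metis
  qed
  define g where "g = TH.co G"
  have s: "complex_of_real (sqrt 2) * complex_of_real (sqrt 2) = 2" by (metis of_real_mult of_real_numeral real_sqrt_mult_self abs_numeral)
  have g1: "g (2 * m + 1) = \<i> * g (2 * m)" for m
  proof -
    have "g (2 * m) + \<i> * g (2 * m + 1) = sqrt 2 * TH.ip G (TH.E (int m + 1))"
      unfolding g_def TH.co_def TH.ip_E_eb[OF Gc] using s by (simp add: field_simps)
    then have "\<i> * (g (2 * m) + \<i> * g (2 * m + 1)) = 0" using zG by simp
    then show ?thesis by (simp add: distrib_left)
  qed
  have dg: "TH.dcoef g k = \<i> * of_real (dd k) * g k" for k
  proof -
    have "k = 2 * (k div 2) \<or> k = 2 * (k div 2) + 1" by presburger
    then show ?thesis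
    proof
      assume k: "k = 2 * (k div 2)"
      show ?thesis by (subst (1 2 3) k) (simp add: TH.dcoef_def sg_def partner_def dd_def g1[of "k div 2", simplified])
    next
      assume k: "k = 2 * (k div 2) + 1"
      show ?thesis by (subst (1 2 3) k) (simp add: TH.dcoef_def sg_def partner_def dd_def g1[of "k div 2", simplified] algebra_simps)
    qed
  qed
  have cc: "z * cnj z = of_real ((norm z)\<^sup>2)" for z using complex_norm_square[of z] by simp
  have "(\<lambda>k. TH.dcoef g k * TH.co (\<lambda>x. cnj (G x)) k) sums TH.ip (\<lambda>x. cnj (G x)) (TH.ser (TH.dcoef g))"
    unfolding g_def by (rule TH.ip_ser) (intro continuous_intros Gc TH.rapid_dcoef TH.co_rapid Gs)+
  moreover have "TH.ser (TH.dcoef g) = G'"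
    unfolding g_def using vector_derivative_unique_at[OF smooth_deriv[OF Gs] Gd] by (auto simp: fun_eq_iff)
  moreover have "TH.ip (\<lambda>x. cnj (G x)) G' = \<i>"
  proof -
    have "TH.ip (\<lambda>x. cnj (G x)) G' = \<i> * PH.ip (\<lambda>x. h (u x) + cnj (h (u x)) - 1) (\<lambda>_. 1)"
    proof -
      have "cnj (G x) * G' x = \<i> * ((h (u x) + cnj (h (u x)) - 1) * 1 * bb x)" for x
        unfolding G'_def using GG[of x] by (simp add: mult_ac)
      then show ?thesis unfolding TH_ip_eq PH.ip_def by simp
    qed
    also have "PH.ip (\<lambda>x. h (u x) + cnj (h (u x)) - 1) (\<lambda>_. 1) = 1"
    proof -
      have huc: "continuous_on UNIV (\<lambda>x. h (u x))"
        by (rule continuous_on_compose2[OF hc smooth_circle_continuous[OF us]]) (auto simp: nu)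
      have "PH.ip (\<lambda>x. h (u x) + cnj (h (u x)) - 1) (\<lambda>_. 1) = PH.ip (\<lambda>x. h (u x)) (\<lambda>_. 1) + PH.ip (\<lambda>x. cnj (h (u x))) (\<lambda>_. 1) - PH.ip (\<lambda>_. 1) (\<lambda>_. 1)"
        by (subst PH.ip_diff_left, (intro continuous_intros huc)+, subst PH.ip_add_left, (intro continuous_intros huc)+) simp
      moreover have "PH.ip (\<lambda>_. 1) (\<lambda>_. 1) = 1" using PH.ip_E_one[of 0] by (simp add: PH.E_0[abs_def])
      moreover have "PH.ip (\<lambda>x. cnj (h (u x))) (\<lambda>_. 1) = 1"
        using PH.ip_cnj[of "\<lambda>x. h (u x)" "\<lambda>_. 1"] mh by (simp add: PH.mn_def)
      ultimately show ?thesis using mh by (simp add: PH.mn_def)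
    qed
    finally show ?thesis by simp
  qed
  ultimately have "(\<lambda>k. TH.dcoef g k * cnj (g k)) sums \<i>" by (simp add: TH.co_cnj g_def)
  then have "(\<lambda>k. (- \<i>) * (TH.dcoef g k * cnj (g k))) sums ((- \<i>) * \<i>)" by (rule sums_mult)
  moreover have "(- \<i>) * (TH.dcoef g k * cnj (g k)) = of_real (dd k * (norm (g k))\<^sup>2)" for k
    unfolding dg of_real_mult cc[symmetric] by (simp add: mult_ac)
  ultimately have "(\<lambda>k. complex_of_real (dd k * (norm (g k))\<^sup>2)) sums of_real 1" by simp
  then have s1: "(\<lambda>k. dd k * (norm (g k))\<^sup>2) sums 1" unfolding sums_of_real_iff .
  have "(\<lambda>k. g k * TH.co (\<lambda>x. cnj (G x)) k) sums (TH.ip G (\<lambda>x. cnj (G x)) - TH.mn G * TH.mn (\<lambda>x. cnj (G x)))"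
    unfolding g_def by (rule TH.parseval[OF Gs]) (intro continuous_intros Gc)
  moreover have "TH.ip G (\<lambda>x. cnj (G x)) = 1" unfolding TH_ip_eq GG by (simp add: scaleR_conv_of_real)
  ultimately have "(\<lambda>k. complex_of_real ((norm (g k))\<^sup>2)) sums of_real 1"
    unfolding cc[symmetric] by (simp add: mG TH.co_cnj g_def)
  then have s2: "(\<lambda>k. (norm (g k))\<^sup>2) sums 1" unfolding sums_of_real_iff .
  \<comment> \<open>Energy and mean square are both 1, so the terms with d_k > 1 must
    vanish.\<close>
  have "(\<lambda>k. dd k * (norm (g k))\<^sup>2 - (norm (g k))\<^sup>2) sums (1 - 1)" by (rule sums_diff[OF s1 s2])
  then have s3: "(\<lambda>k. (dd k - 1) * (norm (g k))\<^sup>2) sums 0" by (simp add: left_diff_distrib)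
  have "(dd k - 1) * (norm (g k))\<^sup>2 = 0" for k
    using suminf_eq_zero_iff[OF sums_summable[OF s3]] s3 dd_ge1 by (simp add: sums_iff)
  then have gk: "g k = 0" if "k \<ge> 2" for k
  proof -
    have "k div 2 \<ge> 1" using that by presburger
    then have "dd k \<noteq> 1" by (simp add: dd_def)
    then show ?thesis using \<open>\<And>k. (dd k - 1) * (norm (g k))\<^sup>2 = 0\<close>[of k] by simp
  qed
  define \<kappa> where "\<kappa> = sqrt 2 * g 0"
  have GE: "G x = \<kappa> * TH.E 1 x" for x
  proof -
    have "TH.ser g x = (\<Sum>k\<in>{0, 1}. g k * TH.eb k x)"
      unfolding TH.ser_def by (rule suminf_finite) (auto simp: gk)
    also have "\<dots> = \<kappa> * TH.E 1 x"
      using g1[of 0] s by (simp add: TH.eb_E \<kappa>_def field_simps)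
    finally show ?thesis using TH.fourier_expansion[OF Gs, of x] by (simp add: mG g_def)
  qed
  have "norm (G 0) = 1"
  proof -
    have "complex_of_real ((norm (G 0))\<^sup>2) = of_real 1" unfolding cc[symmetric] GG by simp
    then show ?thesis unfolding of_real_eq_iff by (simp add: power2_eq_1_iff) (smt (verit) norm_ge_zero)
  qed
  then have "norm \<kappa> = 1" unfolding GE by (simp add: norm_mult TH.norm_E)
  then show thesis using that[of \<kappa>] GE by (simp add: G_def u_def divide_inverse)
qed

lemma conf_equiv_of_lam_one:
  assumes "SM.lam 0 = 1"
  shows "conf_equiv a (\<lambda>_. 1)"
proof -
  define p where "p = TH.mn (PH.E 1)"
  obtain F where F: "continuous_on (cball 0 1) F" "F holomorphic_on ball 0 1"
    "\<And>x. F (TH.E 1 x) = PH.E 1 x" "F 0 = p" "norm p < 1"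
    unfolding p_def by (rule nonnegative_spectrum_extension[OF lam_one_imp_nonnegative_spectrum[OF assms]]) blast
  obtain \<kappa> where k: "norm \<kappa> = 1" "\<And>x. (PH.E 1 x - p) / (1 - cnj p * PH.E 1 x) = \<kappa> * TH.E 1 x"
    by (rule moebius_of_extension[OF F]) blast
  have kk: "cnj \<kappa> * \<kappa> = 1" using k(1) complex_norm_square[of \<kappa>] by (simp add: mult.commute)
  define \<Psi> where "\<Psi> z = cnj \<kappa> * ((z - p) / (1 - cnj p * z))" for z
  \<comment> \<open>The inverse of \<open>phi\<close>. Its derivative is 1 / b = a along \<psi>,
    which is exactly the conformal factor required for the constant weight.\<close>
  obtain \<psi> where psi: "\<And>t. phi (\<psi> t) = t" using phi_surj by metis
  have psi': "\<psi> (phi x) = x" for x by (rule phi_inj) (simp add: psi)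
  have cont: "isCont \<psi> t" for t
    using isCont_inverse_function[where d = 1 and x = "\<psi> t" and g = \<psi> and f = phi] psi' DERIV_isCont[OF phi_deriv] by (simp add: psi)
  have der: "(\<psi> has_real_derivative inverse (b (\<psi> t))) (at t)" for t
    by (rule DERIV_inverse_function[where f = phi and a = "t - 1" and b = "t + 1"])
      (use phi_deriv b_pos[of "\<psi> t"] psi cont in auto)
  have "exp (\<i> * of_real (\<psi> t)) = \<Psi> (exp (\<i> * of_real t))" for t
  proof -
    have "PH.E 1 (\<psi> t) = exp (\<i> * of_real t)" by (simp add: PH.E_def psi)
    then have "\<Psi> (exp (\<i> * of_real t)) = cnj \<kappa> * (\<kappa> * TH.E 1 (\<psi> t))" using k(2)[of "\<psi> t"] by (simp add: \<Psi>_def)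
    also have "\<dots> = TH.E 1 (\<psi> t)" using kk by (metis mult.assoc mult_1)
    finally show ?thesis by (simp add: TH.E_def)
  qed
  moreover have "conformal_aut_disk \<Psi>" unfolding \<Psi>_def by (rule moebius_conformal_aut[OF F(5) k(1)])
  moreover have "1 = a (\<psi> t) / \<bar>inverse (b (\<psi> t))\<bar>" for t
    using a_pos[of "\<psi> t"] by (simp add: b_def)
  ultimately show ?thesis unfolding conf_equiv_def using der
    by (intro exI[of _ \<Psi>] exI[of _ \<psi>] exI[of _ "\<lambda>t. inverse (b (\<psi> t))"]) blast
qed

end

theorem theorem1p2:
  fixes a :: "real \<Rightarrow> real"
  assumes "smooth_circle a"
    and "\<forall>\<theta>. a \<theta> > 0"
    and "integral {0..2*pi} (\<lambda>\<theta>. 1 / a \<theta>) / (2 * pi) = 1"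
  shows "(\<forall>s::real. Im (zeta_diff a (of_real s)) = 0 \<and> Re (zeta_diff a (of_real s)) \<ge> 0) \<and>
         ((\<exists>s::real. s \<noteq> 0 \<and> zeta_diff a (of_real s) = 0) \<longleftrightarrow> conf_equiv a (\<lambda>_. 1))"
proof -
  interpret steklov_weight a
    by standard (use assms in auto)
  show ?thesis
    unfolding zeta_diff_eq
  proof (intro conjI allI iffI)
    show "Im (SM.zdiff (of_real s)) = 0" "Re (SM.zdiff (of_real s)) \<ge> 0" for s by (rule SM.zdiff_nonneg)+
  next
    assume "\<exists>s::real. s \<noteq> 0 \<and> SM.zdiff (of_real s) = 0"
    then obtain s :: real where "s \<noteq> 0" "SM.zdiff (of_real s) = 0" by blast
    \<comment> \<open>The first eigenvalue carries the whole rigidity argument.\<close>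
    then have "SM.lam 0 = dd 0" using SM.zdiff_zero_imp by blast
    then show "conf_equiv a (\<lambda>_. 1)" by (intro conf_equiv_of_lam_one) (simp add: dd_def)
  next
    assume "conf_equiv a (\<lambda>_. 1)"
    then have "SM.lam k = dd k" for k by (rule mixed_zero_imp_lam[OF conf_equiv_one_imp_mixed_zero])
    then have "SM.zdiff (of_real 1) = 0" by (rule SM.zdiff_zero)
    then show "\<exists>s::real. s \<noteq> 0 \<and> SM.zdiff (of_real s) = 0" by (intro exI[of _ 1]) auto
  qed
qed

end
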